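(* Let $\tau=e^{2i\pi/3}$, $\gamma^2=2\pi/\sqrt3$, and let $v$ be a solution of the linearized problem around the Abrikosov lattice $$i\partial_tv+\lambda v=\Pi\big[2|\Psi_0|^2v+\Psi_0^2\,\overline v\big].$$ Expand $v(t)=\sum_{n\in\mathbb Z}c_n(t)\psi_n$ and set $f(t,\xi)=\sum_{n\in\mathbb Z}c_n(t)e^{-2\pi in\xi}$, $g(t,\xi)=\overline{f}(t,-\xi)$, $f_0=f(0,\cdot)$, $g_0=g(0,\cdot)$. Let $\mu$ be the function defined in the context; it is a smooth $1$-periodic function with $\mu(\xi)\sim c\,\xi^2$ as $\xi\to0$ for some nonzero constant $c$. Then $L^2$ stability holds in the following form: for all $t\ge 0$, $$\Big\|\frac{f+g}{\mu}\Big\|_{L^2([0,1])}+\|f\|_{L^2([0,1])}\lesssim\Big\|\frac{f_0+g_0}{\mu}\Big\|_{L^2([0,1])}+\|f_0\|_{L^2([0,1])},$$ where $f,g$ on the left are evaluated at time $t$, and $L^\infty$ decay holds: for all $t>0$, $$\|v(t)\|_{L^\infty(\mathbb C)}\lesssim\frac1{t^{1/3}}\left(\Big\|\frac{f_0+g_0}{\mu}\Big\|_{H^1([0,1])}+\|f_0\|_{H^1([0,1])}\right).$$ The implicit constants do not depend on $t$ or on the solution.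
   Context: $L$ is Lebesgue measure on $\mathbb C$. For a function $u$ on $\mathbb C$ of at most polynomial growth, $[\Pi u](z)=\frac1\pi e^{-|z|^2/2}\int_{\mathbb C}e^{\overline w z-|w|^2/2}u(w)\,dL(w)$. $\widetilde{\mathcal E}$ is the set of functions $u(z)=e^{-|z|^2/2}F(z)$ with $F$ entire such that $|u(z)|\lesssim\langle z\rangle^M$ for some $M$; $R_\alpha u(z)=e^{(\alpha\overline z-\overline\alpha z)/2}u(z+\alpha)$; $\mathcal F_\gamma=\{u\in\widetilde{\mathcal E}:R_\gamma u=u\}$; $S_\gamma=\{z:-\gamma/2<\mathrm{Re}\,z\le\gamma/2\}$. With $\tau=e^{2i\pi/3}$ and $\gamma^2=2\pi/\sqrt3$, the Hilbert basis of $L^2(S_\gamma)\cap\mathcal F_\gamma$ used is $$\psi_k(z)=\Big(\frac2{\pi\gamma^2}\Big)^{1/4}\exp\Big(\frac{2ik\pi z}\gamma+i\pi\tau k^2+\frac{z^2}2-\frac{|z|^2}2\Big),\quad k\in\mathbb Z,$$ and the Abrikosov lattice is $\Psi_0=\sum_{n\in\mathbb Z}\psi_n$. Define $$\ell(\xi)=1+2\sum_{k\ge1}e^{-\pi^2k^2/\gamma^2}\cos(2\pi k\xi),\qquad h(\xi)=2\sum_{k\ge0}e^{-\pi^2(2k+1)^2/\gamma^2}\cos(2(2k+1)\pi\xi),$$ $$\lambda=\frac1{\gamma\sqrt\pi}\big(\ell^2(0)-2h^2(0)\big),\quad a(\xi)=\frac2{\gamma\sqrt\pi}\big(\ell(\xi)\ell(0)-2h(\xi)h(0)\big)-\lambda,\quad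 b(\xi)=\frac1{\gamma\sqrt\pi}\big(\ell^2(\xi)-2h^2(\xi)\big),$$ $$\mu(\xi)=\big(a^2(\xi)-b^2(\xi)\big)^{1/2}.$$ The function $e^{-i\lambda t}\Psi_0$ solves $i\partial_tu=\Pi(|u|^2u)$, and the linearized problem above is its linearization (after multiplying the perturbation by $e^{i\lambda t}$). The estimates are understood for initial data $v_0\in L^2(S_\gamma)\cap\mathcal F_\gamma$ for which the right-hand side is finite. *)

theory Defs
  imports
    "HOL-Analysis.Analysis"
    "HOL-Probability.Essential_Supremum"
    "HOL-Library.Landau_Symbols"
begin

section \<open>Norms and modes of convergence\<close>

definition ennsqrt :: "ennreal \<Rightarrow> ennreal" where
  "ennsqrt x = (if x = \<infinity> then \<infinity> else ennreal (sqrt (enn2real x)))"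

text \<open>The norms are extended nonnegative reals, so that membership in the corresponding space
  is finiteness of the norm.\<close>

definition L2_norm :: "'a measure \<Rightarrow> ('a \<Rightarrow> complex) \<Rightarrow> ennreal" where
  "L2_norm M u = ennsqrt (\<integral>\<^sup>+x. ennreal ((cmod (u x))\<^sup>2) \<partial>M)"

definition Linf_norm :: "'a measure \<Rightarrow> ('a \<Rightarrow> complex) \<Rightarrow> ennreal" where
  "Linf_norm M u = esssup M (\<lambda>x. ennreal (cmod (u x)))"

definition sums_in_L2 :: "'a measure \<Rightarrow> (int \<Rightarrow> 'a \<Rightarrow> complex) \<Rightarrow> ('a \<Rightarrow> complex) \<Rightarrow> bool" where
  "sums_in_L2 M s u \<longleftrightarrow> u \<in> borel_measurable M \<and>
     (\<lambda>N. L2_norm M (\<lambda>x. u x - (\<Sum>n\<in>{- int N..int N}. s n x))) \<longlonglongrightarrow> 0"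

definition smooth :: "(real \<Rightarrow> real) \<Rightarrow> bool" where
  "smooth \<phi> \<longleftrightarrow> (\<forall>n x. (deriv ^^ n) \<phi> differentiable (at x))"

definition periodic1 :: "(real \<Rightarrow> 'a) \<Rightarrow> bool" where
  "periodic1 \<phi> \<longleftrightarrow> (\<forall>x. \<phi> (x + 1) = \<phi> x)"

abbreviation unit_interval :: "real measure" where
  "unit_interval \<equiv> lebesgue_on {0..1}"

definition test_function :: "(real \<Rightarrow> real) \<Rightarrow> bool" where
  "test_function \<phi> \<longleftrightarrow> smooth \<phi> \<and>
     (\<exists>p q. 0 < p \<and> q < 1 \<and> (\<forall>x. x \<notin> {p..q} \<longrightarrow> \<phi> x = 0))"

definition weak_deriv :: "(real \<Rightarrow> complex) \<Rightarrow> (real \<Rightarrow> complex) \<Rightarrow> bool" where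
  "weak_deriv u w \<longleftrightarrow>
     u \<in> borel_measurable unit_interval \<and> w \<in> borel_measurable unit_interval \<and>
     (\<forall>\<phi>. test_function \<phi> \<longrightarrow>
        (\<integral>x. deriv \<phi> x *\<^sub>R u x \<partial>unit_interval) = - (\<integral>x. \<phi> x *\<^sub>R w x \<partial>unit_interval))"

text \<open>The \<open>H\<^sup>1([0,1])\<close> norm.  The square-integrable weak derivative, when it exists, is unique
  almost everywhere, so the infimum only selects it; when there is none, every term is infinite
  and the norm is \<open>\<infinity>\<close> (which is also the infimum of the empty set).\<close>

definition H1_norm :: "(real \<Rightarrow> complex) \<Rightarrow> ennreal" where
  "H1_norm u = (INF w\<in>{w. weak_deriv u w}.
     ennsqrt ((L2_norm unit_interval u)\<^sup>2 + (L2_norm unit_interval w)\<^sup>2))"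

section \<open>The function spaces\<close>

definition Pi_op :: "(complex \<Rightarrow> complex) \<Rightarrow> complex \<Rightarrow> complex" where
  "Pi_op u z = complex_of_real (1 / pi * exp (- (cmod z)\<^sup>2 / 2)) *
     (\<integral>w. exp (cnj w * z - complex_of_real ((cmod w)\<^sup>2 / 2)) * u w \<partial>lebesgue)"

definition jbracket :: "complex \<Rightarrow> real" where
  "jbracket z = sqrt (1 + (cmod z)\<^sup>2)"

definition Etilde :: "(complex \<Rightarrow> complex) set" where
  "Etilde = {u.
     (\<exists>F. F holomorphic_on UNIV \<and> (\<forall>z. u z = complex_of_real (exp (- (cmod z)\<^sup>2 / 2)) * F z)) \<and>
     (\<exists>C M. \<forall>z. cmod (u z) \<le> C * jbracket z powr M)}"

definition R_op :: "complex \<Rightarrow> (complex \<Rightarrow> complex) \<Rightarrow> complex \<Rightarrow> complex" where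
  "R_op \<alpha> u z = exp ((\<alpha> * cnj z - cnj \<alpha> * z) / 2) * u (z + \<alpha>)"

definition F_space :: "real \<Rightarrow> (complex \<Rightarrow> complex) set" where
  "F_space \<gamma> = {u \<in> Etilde. R_op (complex_of_real \<gamma>) u = u}"

definition strip :: "real \<Rightarrow> complex set" where
  "strip \<gamma> = {z. - \<gamma> / 2 < Re z \<and> Re z \<le> \<gamma> / 2}"

definition L2F :: "real \<Rightarrow> (complex \<Rightarrow> complex) set" where
  "L2F \<gamma> = {u \<in> F_space \<gamma>. L2_norm (lebesgue_on (strip \<gamma>)) u < \<infinity>}"

section \<open>The Abrikosov lattice\<close>

definition gam :: real where
  "gam = sqrt (2 * pi / sqrt 3)"

definition tau :: complex where
  "tau = exp (2 * \<i> * complex_of_real pi / 3)"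

definition psi :: "int \<Rightarrow> complex \<Rightarrow> complex" where
  "psi k z = complex_of_real ((2 / (pi * gam\<^sup>2)) powr (1/4)) *
     exp (2 * \<i> * of_int k * complex_of_real pi * z / complex_of_real gam
          + \<i> * complex_of_real pi * tau * (of_int k)\<^sup>2
          + z\<^sup>2 / 2 - complex_of_real ((cmod z)\<^sup>2 / 2))"

definition Psi0 :: "complex \<Rightarrow> complex" where
  "Psi0 z = (\<Sum>\<^sub>\<infinity>n\<in>UNIV. psi n z)"

text \<open>The sum over \<open>k \<ge> 1\<close> is indexed by \<open>k + 1\<close> with \<open>k \<ge> 0\<close>.\<close>

definition ell_fun :: "real \<Rightarrow> real" where
  "ell_fun \<xi> = 1 + 2 * (\<Sum>k. exp (- pi\<^sup>2 * (real (k + 1))\<^sup>2 / gam\<^sup>2) * cos (2 * pi * real (k + 1) * \<xi>))"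

definition h_fun :: "real \<Rightarrow> real" where
  "h_fun \<xi> = 2 * (\<Sum>k. exp (- pi\<^sup>2 * (real (2 * k + 1))\<^sup>2 / gam\<^sup>2)
                        * cos (2 * real (2 * k + 1) * pi * \<xi>))"

definition lam :: real where
  "lam = 1 / (gam * sqrt pi) * ((ell_fun 0)\<^sup>2 - 2 * (h_fun 0)\<^sup>2)"

definition a_fun :: "real \<Rightarrow> real" where
  "a_fun \<xi> = 2 / (gam * sqrt pi) * (ell_fun \<xi> * ell_fun 0 - 2 * h_fun \<xi> * h_fun 0) - lam"

definition b_fun :: "real \<Rightarrow> real" where
  "b_fun \<xi> = 1 / (gam * sqrt pi) * ((ell_fun \<xi>)\<^sup>2 - 2 * (h_fun \<xi>)\<^sup>2)"

definition mu :: "real \<Rightarrow> real" where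
  "mu \<xi> = sqrt ((a_fun \<xi>)\<^sup>2 - (b_fun \<xi>)\<^sup>2)"

section \<open>The linearized problem\<close>

text \<open>\<open>w\<close> is the derivative at time \<open>t\<close> of the curve \<open>v\<close> on \<open>[0,\<infinity>)\<close> with values in
  \<open>L\<^sup>2(S\<^sub>\<gamma>)\<close> (one-sided at \<open>t = 0\<close>).\<close>

definition has_L2_time_derivative ::
    "(real \<Rightarrow> complex \<Rightarrow> complex) \<Rightarrow> (complex \<Rightarrow> complex) \<Rightarrow> real \<Rightarrow> bool" where
  "has_L2_time_derivative v w t \<longleftrightarrow>
     ((\<lambda>s. L2_norm (lebesgue_on (strip gam))
             (\<lambda>z. (v s z - v t z) / complex_of_real (s - t) - w z)) \<longlongrightarrow> 0) (at t within {0..})"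

definition linearized_solution :: "(real \<Rightarrow> complex \<Rightarrow> complex) \<Rightarrow> bool" where
  "linearized_solution v \<longleftrightarrow>
     (\<forall>t\<ge>0. v t \<in> L2F gam \<and>
        (\<exists>w\<in>L2F gam. has_L2_time_derivative v w t \<and>
           (\<forall>z. \<i> * w z + complex_of_real lam * v t z =
              Pi_op (\<lambda>y. 2 * complex_of_real ((cmod (Psi0 y))\<^sup>2) * v t y
                          + (Psi0 y)\<^sup>2 * cnj (v t y)) z)))"

definition lattice_expansion ::
    "(real \<Rightarrow> complex \<Rightarrow> complex) \<Rightarrow> (real \<Rightarrow> int \<Rightarrow> complex) \<Rightarrow> bool" where
  "lattice_expansion v c \<longleftrightarrow>
     (\<forall>t\<ge>0. sums_in_L2 (lebesgue_on (strip gam)) (\<lambda>n z. c t n * psi n z) (v t))"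

text \<open>For square-summable coefficients the Fourier series need not converge at a given point
  in an elementary sense, so \<open>f t\<close> is any periodic representative of its \<open>L\<^sup>2\<close> sum.\<close>

definition fourier_function ::
    "(real \<Rightarrow> int \<Rightarrow> complex) \<Rightarrow> (real \<Rightarrow> real \<Rightarrow> complex) \<Rightarrow> bool" where
  "fourier_function c f \<longleftrightarrow>
     (\<forall>t\<ge>0. periodic1 (f t) \<and>
        sums_in_L2 unit_interval
          (\<lambda>n \<xi>. c t n * exp (- 2 * complex_of_real pi * \<i> * of_int n * complex_of_real \<xi>)) (f t))"

end

theory Submission
  imports Defs "HOL-Probability.Characteristic_Functions" "HOL-Complex_Analysis.Complex_Analysis" "HOL-Real_Asymp.Real_Asymp"
begin

text \<open>The projection maps a product \<open>\<psi>\<^sub>a \<psi>\<^sub>b\<^sup>* \<psi>\<^sub>c\<close> to a Gaussian multiple of \<open>\<psi>\<^sub>k\<close> with \<open>k = a - b + c\<close>, so that in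
  Fourier variables the linearized problem becomes, for each \<open>\<xi>\<close>, the linear system \<open>i f' = a f + b g\<close>,
  \<open>- i g' = a g + b f\<close> with frequency \<open>\<mu>\<close>. Its propagator is a combination of \<open>cos (\<mu> t)\<close> and \<open>sin (\<mu> t)\<close>
  whose coefficients are bounded in the variables \<open>f\<close> and \<open>(f + g) / \<mu>\<close>, since \<open>\<mu>\<^sup>2 = (a - b) (a + b)\<close> with
  \<open>a + b > 0\<close>; this gives the \<open>L\<^sup>2\<close> stability.

  For the decay, \<open>\<mu>\<close> is written as \<open>1 - cos (2 \<pi> \<xi>)\<close> times the square root of an explicit perturbation of a
  quadratic polynomial in \<open>cos (2 \<pi> \<xi>)\<close>. Hence its second and third derivatives have no common zero, and van der Corput's
  lemma bounds all coefficients \<open>c\<^sub>n(t)\<close> by \<open>t powr (- 1 / 3)\<close> times the \<open>H\<^sup>1\<close> norms. A lattice sum with bounded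
  coefficients is bounded because the basis functions are Gaussians concentrated on equally spaced lines.\<close>

section \<open>Square-integrable functions\<close>

text \<open>Nothing is pointwise: \<open>f t\<close> is an L2 class whose time derivative exists
  only in L2. The system at each \<xi> is therefore integrated in weak form: \<open>f t\<close> is
  paired with the propagator running from time t to a final time, and this pairing has zero
  derivative in t. The quotient (f + g) / \<mu> enters because sin (\<mu> t) / \<mu> grows like t
  where \<mu> vanishes: in a f + b g = (a - b) f + b (f + g) the factor a - b compensates for this,
  but b does not.

  The value of \<gamma> makes the nome exp (- pi sqrt 3 / 2) smaller than 1/15. The tails of the
  theta series are then tiny fractions of their first terms, and the nondegeneracy of \<mu> becomes
  rational arithmetic with some margin. The disc of radius 3 is a compromise: it leaves room for
  Cauchy estimates of radius 1.9 around [-1, 1], and the tails are still below 0.0027 on it.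

  Weak derivatives are tested only against functions supported inside (0, 1), whereas the
  oscillating factors do not vanish at the ends. Integration by parts is therefore extended to
  smooth functions vanishing at 0 and 1, and a linear correction handles the rest.\<close>

definition sq_int :: "'a measure \<Rightarrow> ('a \<Rightarrow> complex) \<Rightarrow> bool" where
  "sq_int M u \<longleftrightarrow> u \<in> borel_measurable M \<and> integrable M (\<lambda>x. (cmod (u x))\<^sup>2)"

text \<open>The extended-valued \<open>L2_norm\<close> is awkward under subtraction and in limits.
  On functions satisfying \<open>sq_int\<close> it equals this real number; on other measurable
  functions it is infinite.\<close>

definition L2n :: "'a measure \<Rightarrow> ('a \<Rightarrow> complex) \<Rightarrow> real" where
  "L2n M u = sqrt (\<integral>x. (cmod (u x))\<^sup>2 \<partial>M)"

definition L2ip :: "'a measure \<Rightarrow> ('a \<Rightarrow> complex) \<Rightarrow> ('a \<Rightarrow> complex) \<Rightarrow> complex" where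
  "L2ip M u v = (\<integral>x. u x * cnj (v x) \<partial>M)"

lemma L2n_nonneg [simp]: "0 \<le> L2n M u"
  by (simp add: L2n_def)

lemma L2n_sq: "(L2n M u)\<^sup>2 = (\<integral>x. (cmod (u x))\<^sup>2 \<partial>M)"
  by (simp add: L2n_def)

lemma ennsqrt_ennreal: "0 \<le> x \<Longrightarrow> ennsqrt (ennreal x) = ennreal (sqrt x)"
  by (simp add: ennsqrt_def)

lemma L2_norm_eq: "sq_int M u \<Longrightarrow> L2_norm M u = ennreal (L2n M u)"
  unfolding L2_norm_def sq_int_def L2n_def
  by (subst nn_integral_eq_integral) (auto simp: ennsqrt_ennreal)

lemma L2_norm_finite_iff:
  assumes "u \<in> borel_measurable M"
  shows "L2_norm M u < \<infinity> \<longleftrightarrow> sq_int M u"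
proof
  assume "sq_int M u"
  then show "L2_norm M u < \<infinity>" by (simp add: L2_norm_eq)
next
  assume "L2_norm M u < \<infinity>"
  then have "(\<integral>\<^sup>+x. ennreal ((cmod (u x))\<^sup>2) \<partial>M) < \<infinity>"
    unfolding L2_norm_def ennsqrt_def by (auto split: if_splits simp: top.not_eq_extremum)
  then show "sq_int M u"
    using assms unfolding sq_int_def by (auto intro!: integrableI_bounded)
qed

lemma sq_int_measurable [measurable_dest]: "sq_int M u \<Longrightarrow> u \<in> borel_measurable M"
  by (simp add: sq_int_def)

lemma sq_int_bound:
  assumes "sq_int M u" "v \<in> borel_measurable M" "AE x in M. cmod (v x) \<le> B * cmod (u x)"
  shows "sq_int M v"
proof -
  have "integrable M (\<lambda>x. (cmod (v x))\<^sup>2)"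
  proof (rule Bochner_Integration.integrable_bound[of _ "\<lambda>x. B\<^sup>2 * (cmod (u x))\<^sup>2"])
    show "integrable M (\<lambda>x. B\<^sup>2 * (cmod (u x))\<^sup>2)" using assms(1) by (simp add: sq_int_def)
    show "(\<lambda>x. (cmod (v x))\<^sup>2) \<in> borel_measurable M" using assms(2) by measurable
    show "AE x in M. norm ((cmod (v x))\<^sup>2) \<le> norm (B\<^sup>2 * (cmod (u x))\<^sup>2)"
      using assms(3)
    proof eventually_elim
      case (elim x)
      then have "(cmod (v x))\<^sup>2 \<le> (B * cmod (u x))\<^sup>2" by (intro power_mono) auto
      then show ?case by (simp add: power_mult_distrib)
    qed
  qed
  then show ?thesis using assms(2) by (simp add: sq_int_def)
qed

lemma sq_int_mult_bounded:
  assumes "sq_int M u" "m \<in> borel_measurable M" "AE x in M. cmod (m x) \<le> B"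
  shows "sq_int M (\<lambda>x. m x * u x)"
proof (rule sq_int_bound[OF assms(1), of _ B])
  show "(\<lambda>x. m x * u x) \<in> borel_measurable M" using assms by measurable
  show "AE x in M. cmod (m x * u x) \<le> B * cmod (u x)"
    using assms(3) by eventually_elim (auto simp: norm_mult intro: mult_right_mono)
qed

lemma sq_int_cmult: "sq_int M u \<Longrightarrow> sq_int M (\<lambda>x. c * u x)"
  by (rule sq_int_mult_bounded[of _ _ _ "cmod c"]) auto

lemma measurable_cnj [measurable]: "cnj \<in> borel_measurable borel"
  by (intro borel_measurable_continuous_onI continuous_intros)

lemma sq_int_cnj: "sq_int M u \<Longrightarrow> sq_int M (\<lambda>x. cnj (u x))"
  by (rule sq_int_bound[of _ u _ 1]) (auto intro: measurable_compose[OF sq_int_measurable measurable_cnj])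

lemma sq_int_add:
  assumes "sq_int M u" "sq_int M v"
  shows "sq_int M (\<lambda>x. u x + v x)"
proof -
  have [measurable]: "u \<in> borel_measurable M" "v \<in> borel_measurable M" using assms by (auto simp: sq_int_def)
  have "integrable M (\<lambda>x. (cmod (u x + v x))\<^sup>2)"
  proof (rule Bochner_Integration.integrable_bound[of _ "\<lambda>x. 2 * (cmod (u x))\<^sup>2 + 2 * (cmod (v x))\<^sup>2"])
    show "integrable M (\<lambda>x. 2 * (cmod (u x))\<^sup>2 + 2 * (cmod (v x))\<^sup>2)" using assms by (simp add: sq_int_def)
    show "AE x in M. norm ((cmod (u x + v x))\<^sup>2) \<le> norm (2 * (cmod (u x))\<^sup>2 + 2 * (cmod (v x))\<^sup>2)"
    proof (rule AE_I2)
      fix x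
      have "(cmod (u x + v x))\<^sup>2 \<le> (cmod (u x) + cmod (v x))\<^sup>2"
        by (intro power_mono norm_triangle_ineq) auto
      also have "\<dots> \<le> 2 * (cmod (u x))\<^sup>2 + 2 * (cmod (v x))\<^sup>2"
        using sum_squares_bound[of "cmod (u x)" "cmod (v x)"] by (simp add: power2_sum)
      finally show "norm ((cmod (u x + v x))\<^sup>2) \<le> norm (2 * (cmod (u x))\<^sup>2 + 2 * (cmod (v x))\<^sup>2)" by simp
    qed
  qed measurable
  then show ?thesis by (simp add: sq_int_def)
qed

lemma sq_int_diff: "sq_int M u \<Longrightarrow> sq_int M v \<Longrightarrow> sq_int M (\<lambda>x. u x - v x)"
  using sq_int_add[of M u "\<lambda>x. (-1) * v x"] sq_int_cmult[of M v "-1"] by simp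

lemma sq_int_zero [simp]: "sq_int M (\<lambda>x. 0)"
  by (simp add: sq_int_def)

lemma sq_int_sum: "(\<And>i. i \<in> I \<Longrightarrow> sq_int M (u i)) \<Longrightarrow> sq_int M (\<lambda>x. \<Sum>i\<in>I. u i x)"
  by (induction I rule: infinite_finite_induct) (auto intro: sq_int_add)

lemma sq_int_bounded:
  assumes "finite_measure M" "u \<in> borel_measurable M" "AE x in M. cmod (u x) \<le> B"
  shows "sq_int M u"
proof -
  interpret finite_measure M by fact
  have "sq_int M (\<lambda>x. u x * 1)"
    using assms by (intro sq_int_mult_bounded[of _ _ _ B]) (auto simp: sq_int_def)
  then show ?thesis by simp
qed

lemma sq_int_mult_integrable:
  assumes "sq_int M u" "sq_int M v"
  shows "integrable M (\<lambda>x. u x * v x)"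
proof (rule Bochner_Integration.integrable_bound[of _ "\<lambda>x. (cmod (u x))\<^sup>2 + (cmod (v x))\<^sup>2"])
  show "integrable M (\<lambda>x. (cmod (u x))\<^sup>2 + (cmod (v x))\<^sup>2)" using assms by (simp add: sq_int_def)
  show "(\<lambda>x. u x * v x) \<in> borel_measurable M" using assms by measurable
  show "AE x in M. norm (u x * v x) \<le> norm ((cmod (u x))\<^sup>2 + (cmod (v x))\<^sup>2)"
  proof (rule AE_I2)
    fix x
    have "2 * (cmod (u x) * cmod (v x)) \<le> (cmod (u x))\<^sup>2 + (cmod (v x))\<^sup>2"
      using sum_squares_bound[of "cmod (u x)" "cmod (v x)"] by simp
    moreover have "0 \<le> cmod (u x) * cmod (v x)" by simp
    ultimately have "cmod (u x) * cmod (v x) \<le> (cmod (u x))\<^sup>2 + (cmod (v x))\<^sup>2" by linarith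
    then show "norm (u x * v x) \<le> norm ((cmod (u x))\<^sup>2 + (cmod (v x))\<^sup>2)" by (simp add: norm_mult)
  qed
qed

lemma L2ip_integrable: "sq_int M u \<Longrightarrow> sq_int M v \<Longrightarrow> integrable M (\<lambda>x. u x * cnj (v x))"
  by (rule sq_int_mult_integrable[OF _ sq_int_cnj])

lemma sq_int_imp_integrable:
  assumes "finite_measure M" "sq_int M u"
  shows "integrable M u"
  using sq_int_mult_integrable[OF assms(2) sq_int_bounded[OF assms(1), of "\<lambda>_. 1" 1]] by simp

text \<open>Stated for the moduli because both uses need them: the bound of the inner product and
  the cross term of the triangle inequality.\<close>

lemma L2_cauchy_schwarz_norm:
  assumes "sq_int M u" "sq_int M v"
  shows "(\<integral>x. cmod (u x) * cmod (v x) \<partial>M) \<le> L2n M u * L2n M v"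
proof -
  have [measurable]: "u \<in> borel_measurable M" "v \<in> borel_measurable M" using assms by (auto simp: sq_int_def)
  have int: "integrable M (\<lambda>x. cmod (u x) * cmod (v x))"
    using sq_int_mult_integrable[OF assms, THEN integrable_norm] by (simp add: norm_mult)
  have "(\<integral>\<^sup>+x. ennreal (cmod (u x)) * ennreal (cmod (v x)) \<partial>M)\<^sup>2 \<le>
     (\<integral>\<^sup>+x. (ennreal (cmod (u x)))\<^sup>2 \<partial>M) * (\<integral>\<^sup>+x. (ennreal (cmod (v x)))\<^sup>2 \<partial>M)"
    by (rule Cauchy_Schwarz_nn_integral) measurable
  also have "(\<integral>\<^sup>+x. (ennreal (cmod (u x)))\<^sup>2 \<partial>M) = ennreal (\<integral>x. (cmod (u x))\<^sup>2 \<partial>M)"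
    using assms by (subst nn_integral_eq_integral[symmetric]) (auto simp: sq_int_def ennreal_power)
  also have "(\<integral>\<^sup>+x. (ennreal (cmod (v x)))\<^sup>2 \<partial>M) = ennreal (\<integral>x. (cmod (v x))\<^sup>2 \<partial>M)"
    using assms by (subst nn_integral_eq_integral[symmetric]) (auto simp: sq_int_def ennreal_power)
  also have "(\<integral>\<^sup>+x. ennreal (cmod (u x)) * ennreal (cmod (v x)) \<partial>M) = ennreal (\<integral>x. cmod (u x) * cmod (v x) \<partial>M)"
    using int by (subst nn_integral_eq_integral[symmetric]) (auto simp: ennreal_mult)
  finally have "(\<integral>x. cmod (u x) * cmod (v x) \<partial>M)\<^sup>2 \<le> (\<integral>x. (cmod (u x))\<^sup>2 \<partial>M) * (\<integral>x. (cmod (v x))\<^sup>2 \<partial>M)"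
    by (simp add: ennreal_power flip: ennreal_mult)
  also have "\<dots> = (L2n M u * L2n M v)\<^sup>2"
    by (simp add: power_mult_distrib L2n_sq)
  finally show ?thesis
    by (rule power2_le_imp_le) simp
qed

lemma L2ip_bound:
  assumes "sq_int M u" "sq_int M v"
  shows "cmod (L2ip M u v) \<le> L2n M u * L2n M v"
proof -
  have "cmod (L2ip M u v) \<le> (\<integral>x. cmod (u x * cnj (v x)) \<partial>M)"
    unfolding L2ip_def by (rule integral_norm_bound)
  also have "\<dots> \<le> L2n M u * L2n M v"
    using L2_cauchy_schwarz_norm[OF assms] by (simp add: norm_mult)
  finally show ?thesis .
qed

lemma L2n_mono:
  assumes "sq_int M u" "v \<in> borel_measurable M" "AE x in M. cmod (v x) \<le> cmod (u x)"
  shows "L2n M v \<le> L2n M u"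
proof -
  have "sq_int M v" using sq_int_bound[OF assms(1,2), of 1] assms(3) by simp
  then show ?thesis unfolding L2n_def using assms
    by (intro real_sqrt_le_mono integral_mono_AE) (auto simp: sq_int_def elim!: eventually_mono intro!: power_mono)
qed

lemma L2n_triangle:
  assumes "sq_int M u" "sq_int M v"
  shows "L2n M (\<lambda>x. u x + v x) \<le> L2n M u + L2n M v"
proof (rule power2_le_imp_le)
  have i: "integrable M (\<lambda>x. cmod (u x) * cmod (v x))"
    using sq_int_mult_integrable[OF assms, THEN integrable_norm] by (simp add: norm_mult)
  have "(L2n M (\<lambda>x. u x + v x))\<^sup>2 = (\<integral>x. (cmod (u x + v x))\<^sup>2 \<partial>M)" by (rule L2n_sq)
  also have "\<dots> \<le> (\<integral>x. (cmod (u x))\<^sup>2 + 2 * (cmod (u x) * cmod (v x)) + (cmod (v x))\<^sup>2 \<partial>M)"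
  proof (rule integral_mono)
    show "integrable M (\<lambda>x. (cmod (u x + v x))\<^sup>2)" using sq_int_add[OF assms] by (simp add: sq_int_def)
    show "integrable M (\<lambda>x. (cmod (u x))\<^sup>2 + 2 * (cmod (u x) * cmod (v x)) + (cmod (v x))\<^sup>2)"
      using assms i by (auto simp: sq_int_def)
    fix x
    have "(cmod (u x + v x))\<^sup>2 \<le> (cmod (u x) + cmod (v x))\<^sup>2"
      by (intro power_mono norm_triangle_ineq) auto
    then show "(cmod (u x + v x))\<^sup>2 \<le> (cmod (u x))\<^sup>2 + 2 * (cmod (u x) * cmod (v x)) + (cmod (v x))\<^sup>2"
      by (simp add: power2_sum algebra_simps)
  qed
  also have "\<dots> = (L2n M u)\<^sup>2 + 2 * (\<integral>x. cmod (u x) * cmod (v x) \<partial>M) + (L2n M v)\<^sup>2"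
    using assms i by (simp add: sq_int_def L2n_sq)
  also have "\<dots> \<le> (L2n M u)\<^sup>2 + 2 * (L2n M u * L2n M v) + (L2n M v)\<^sup>2"
    using L2_cauchy_schwarz_norm[OF assms] by simp
  also have "\<dots> = (L2n M u + L2n M v)\<^sup>2" by (simp add: power2_sum algebra_simps)
  finally show "(L2n M (\<lambda>x. u x + v x))\<^sup>2 \<le> (L2n M u + L2n M v)\<^sup>2" .
qed simp

lemma L2n_cmult: "L2n M (\<lambda>x. c * u x) = cmod c * L2n M u"
  by (simp add: L2n_def norm_mult power_mult_distrib real_sqrt_mult)

lemma L2n_mult_bounded:
  assumes "sq_int M u" "m \<in> borel_measurable M" "AE x in M. cmod (m x) \<le> B" "0 \<le> B"
  shows "L2n M (\<lambda>x. m x * u x) \<le> B * L2n M u"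
proof -
  have "L2n M (\<lambda>x. m x * u x) \<le> L2n M (\<lambda>x. of_real B * u x)"
  proof (rule L2n_mono)
    show "sq_int M (\<lambda>x. of_real B * u x)" by (rule sq_int_cmult[OF assms(1)])
    show "(\<lambda>x. m x * u x) \<in> borel_measurable M" using assms by measurable
    show "AE x in M. cmod (m x * u x) \<le> cmod (of_real B * u x)"
      using assms(3) by eventually_elim (use assms(4) in \<open>auto simp: norm_mult intro: mult_right_mono\<close>)
  qed
  then show ?thesis using assms(4) by (simp add: L2n_cmult)
qed

lemma L2ip_diff: "sq_int M u \<Longrightarrow> sq_int M v \<Longrightarrow> sq_int M e \<Longrightarrow> L2ip M (\<lambda>x. u x - v x) e = L2ip M u e - L2ip M v e"
  unfolding L2ip_def by (subst Bochner_Integration.integral_diff[symmetric]) (auto intro!: L2ip_integrable simp: algebra_simps)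

lemma L2ip_add: "sq_int M u \<Longrightarrow> sq_int M v \<Longrightarrow> sq_int M e \<Longrightarrow> L2ip M (\<lambda>x. u x + v x) e = L2ip M u e + L2ip M v e"
  unfolding L2ip_def by (subst Bochner_Integration.integral_add[symmetric]) (auto intro!: L2ip_integrable simp: algebra_simps)

lemma L2ip_cmult: "L2ip M (\<lambda>x. c * u x) e = c * L2ip M u e"
  unfolding L2ip_def by (subst integral_mult_right_zero[symmetric]) (simp add: mult.assoc)

lemma L2ip_sum:
  assumes "\<And>i. i \<in> I \<Longrightarrow> sq_int M (u i)" "sq_int M e"
  shows "L2ip M (\<lambda>x. \<Sum>i\<in>I. u i x) e = (\<Sum>i\<in>I. L2ip M (u i) e)"
  unfolding L2ip_def sum_distrib_right
  by (intro Bochner_Integration.integral_sum L2ip_integrable assms)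

lemma L2ip_cnj: "L2ip M u v = cnj (L2ip M v u)"
  unfolding L2ip_def using Bochner_Integration.integral_cnj[of M "\<lambda>x. v x * cnj (u x)"] by (simp add: mult.commute)

lemma L2ip_self: "sq_int M u \<Longrightarrow> L2ip M u u = of_real ((L2n M u)\<^sup>2)"
  unfolding L2ip_def L2n_sq by (subst integral_complex_of_real[symmetric]) (simp only: complex_norm_square)

section \<open>Orthonormal systems indexed by the integers\<close>

definition ibox :: "nat \<Rightarrow> int set" where
  "ibox N = {- int N..int N}"

lemma finite_ibox [simp]: "finite (ibox N)"
  by (simp add: ibox_def)

lemma ibox_mono: "N \<le> N' \<Longrightarrow> ibox N \<subseteq> ibox N'"
  by (auto simp: ibox_def)

lemma eventually_ibox: "\<forall>\<^sub>F N in sequentially. n \<in> ibox N"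
  unfolding eventually_sequentially by (rule exI[of _ "nat \<bar>n\<bar>"]) (auto simp: ibox_def)

lemma sums_in_L2_ibox:
  "sums_in_L2 M s u \<longleftrightarrow> u \<in> borel_measurable M \<and> (\<lambda>N. L2_norm M (\<lambda>x. u x - (\<Sum>n\<in>ibox N. s n x))) \<longlonglongrightarrow> 0"
  by (simp add: sums_in_L2_def ibox_def)

text \<open>There are two instances, the lattice functions on the strip and the exponentials on the
  unit interval. Indexing both by the integers, with the same symmetric boxes, lets coefficients be
  carried from one to the other.\<close>

locale orthonormal_system =
  fixes M :: "'a measure" and e :: "int \<Rightarrow> 'a \<Rightarrow> complex"
  assumes e_sq: "\<And>n. sq_int M (e n)"
    and e_ip: "\<And>m n. L2ip M (e m) (e n) = (if m = n then 1 else 0)"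
begin

text \<open>Membership in the closed span takes the place of completeness of the system. The
  approximating coefficients are arbitrary rather than the Fourier coefficients of \<open>u\<close>,
  which makes closure under sums, shifts and limits easy.\<close>

definition in_span :: "('a \<Rightarrow> complex) \<Rightarrow> bool" where
  "in_span u \<longleftrightarrow> sq_int M u \<and> (\<forall>\<epsilon>>0. \<exists>N a. L2n M (\<lambda>x. u x - (\<Sum>n\<in>ibox N. a n * e n x)) < \<epsilon>)"

lemma sq_int_comb: "sq_int M (\<lambda>x. \<Sum>n\<in>I. a n * e n x)"
  by (intro sq_int_sum sq_int_cmult e_sq)

lemma L2ip_comb: "finite I \<Longrightarrow> L2ip M (\<lambda>x. \<Sum>n\<in>I. a n * e n x) (e m) = (if m \<in> I then a m else 0)"
  by (subst L2ip_sum) (auto simp: L2ip_cmult e_ip e_sq sq_int_cmult if_distrib cong: if_cong)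

lemma L2n_e [simp]: "L2n M (e n) = 1"
proof -
  have "complex_of_real ((L2n M (e n))\<^sup>2) = 1" using L2ip_self[OF e_sq[of n]] e_ip[of n n] by simp
  then have "(L2n M (e n))\<^sup>2 = 1" by (simp only: of_real_eq_1_iff)
  then show ?thesis using L2n_nonneg[of M "e n"] by (simp add: power2_eq_1_iff)
qed

lemma coeff_bound: "sq_int M u \<Longrightarrow> cmod (L2ip M u (e n)) \<le> L2n M u"
  using L2ip_bound[OF _ e_sq[of n], of u] by simp

text \<open>A single remainder of extended norm below 1 is square integrable, hence so is
  \<open>u\<close>. After that all norms are real, and the coefficients follow from continuity of
  the inner product.\<close>

lemma sums_in_L2_D:
  assumes "sums_in_L2 M (\<lambda>n x. c n * e n x) u"
  shows "sq_int M u" "(\<lambda>N. L2n M (\<lambda>x. u x - (\<Sum>n\<in>ibox N. c n * e n x))) \<longlonglongrightarrow> 0"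
    "L2ip M u (e n) = c n" "in_span u"
proof -
  have um [measurable]: "u \<in> borel_measurable M" and lim: "(\<lambda>N. L2_norm M (\<lambda>x. u x - (\<Sum>n\<in>ibox N. c n * e n x))) \<longlonglongrightarrow> 0"
    using assms by (auto simp: sums_in_L2_ibox)
  have S: "sq_int M (\<lambda>x. \<Sum>n\<in>ibox N. c n * e n x)" for N by (rule sq_int_comb)
  from order_tendstoD(2)[OF lim, of 1] have "eventually (\<lambda>N. L2_norm M (\<lambda>x. u x - (\<Sum>n\<in>ibox N. c n * e n x)) < 1) sequentially"
    by simp
  then obtain N where N: "L2_norm M (\<lambda>x. u x - (\<Sum>n\<in>ibox N. c n * e n x)) < 1"
    by (auto simp: eventually_sequentially)
  have "sq_int M (\<lambda>x. u x - (\<Sum>n\<in>ibox N. c n * e n x))"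
  proof (subst L2_norm_finite_iff[symmetric])
    show "(\<lambda>x. u x - (\<Sum>n\<in>ibox N. c n * e n x)) \<in> borel_measurable M" using um sq_int_measurable[OF S[of N]] by measurable
    show "L2_norm M (\<lambda>x. u x - (\<Sum>n\<in>ibox N. c n * e n x)) < \<infinity>" using N by (metis ennreal_one_less_top infinity_ennreal_def less_trans)
  qed
  from sq_int_add[OF this S[of N]] show u: "sq_int M u" by simp
  have D: "sq_int M (\<lambda>x. u x - (\<Sum>n\<in>ibox N. c n * e n x))" for N
    by (rule sq_int_diff[OF u S])
  show lim': "(\<lambda>N. L2n M (\<lambda>x. u x - (\<Sum>n\<in>ibox N. c n * e n x))) \<longlonglongrightarrow> 0"
    using lim by (simp add: L2_norm_eq[OF D] flip: ennreal_0)
  have "(\<lambda>N. L2ip M u (e n) - c n) \<longlonglongrightarrow> 0"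
  proof (rule Lim_null_comparison[OF _ lim'])
    show "\<forall>\<^sub>F N in sequentially. norm (L2ip M u (e n) - c n) \<le> L2n M (\<lambda>x. u x - (\<Sum>n\<in>ibox N. c n * e n x))"
      using eventually_ibox[of n]
    proof eventually_elim
      case (elim N)
      have "L2ip M u (e n) - c n = L2ip M (\<lambda>x. u x - (\<Sum>n\<in>ibox N. c n * e n x)) (e n)"
        using elim by (subst L2ip_diff[OF u S e_sq]) (simp add: L2ip_comb)
      then show ?case using coeff_bound[OF D] by simp
    qed
  qed
  then show "L2ip M u (e n) = c n" by (simp add: LIMSEQ_const_iff)
  show "in_span u" unfolding in_span_def
  proof (intro conjI allI impI u)
    fix \<epsilon> :: real assume "\<epsilon> > 0"
    from order_tendstoD(2)[OF lim' this] show "\<exists>N a. L2n M (\<lambda>x. u x - (\<Sum>n\<in>ibox N. a n * e n x)) < \<epsilon>"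
      by (auto simp: eventually_sequentially)
  qed
qed

text \<open>Completing the square in each coefficient: the excess over the best approximation is the
  squared distance of \<open>a\<close> from the Fourier coefficients. Bessel's inequality is the
  case of zero excess.\<close>

lemma pythagoras:
  assumes u: "sq_int M u"
  shows "(L2n M (\<lambda>x. u x - (\<Sum>n\<in>ibox N. a n * e n x)))\<^sup>2 =
    (L2n M u)\<^sup>2 - (\<Sum>n\<in>ibox N. (cmod (L2ip M u (e n)))\<^sup>2) + (\<Sum>n\<in>ibox N. (cmod (L2ip M u (e n) - a n))\<^sup>2)"
proof -
  define S where "S = (\<lambda>x. \<Sum>n\<in>ibox N. a n * e n x)"
  define k where "k n = L2ip M u (e n)" for n
  have S: "sq_int M S" unfolding S_def by (rule sq_int_comb)
  have SS: "L2ip M w S = (\<Sum>n\<in>ibox N. cnj (a n) * L2ip M w (e n))" if w: "sq_int M w" for w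
    unfolding S_def
    by (subst L2ip_cnj, subst L2ip_sum) (auto simp: w L2ip_cmult intro!: sq_int_cmult e_sq sum.cong L2ip_cnj[symmetric])
  have kS: "L2ip M S (e n) = a n" if "n \<in> ibox N" for n
    using that by (simp add: S_def L2ip_comb)
  have "complex_of_real ((L2n M (\<lambda>x. u x - S x))\<^sup>2) = L2ip M (\<lambda>x. u x - S x) (\<lambda>x. u x - S x)"
    by (rule L2ip_self[symmetric, OF sq_int_diff[OF u S]])
  also have "\<dots> = L2ip M u (\<lambda>x. u x - S x) - L2ip M S (\<lambda>x. u x - S x)"
    by (rule L2ip_diff[OF u S sq_int_diff[OF u S]])
  also have "L2ip M u (\<lambda>x. u x - S x) = L2ip M u u - L2ip M u S"
    by (subst L2ip_cnj, subst L2ip_diff[OF u S u]) (simp add: L2ip_cnj[of M u u, symmetric] L2ip_cnj[of M S u, symmetric] flip: L2ip_cnj)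
  also have "L2ip M S (\<lambda>x. u x - S x) = L2ip M S u - L2ip M S S"
    by (subst L2ip_cnj, subst L2ip_diff[OF u S S]) (simp flip: L2ip_cnj)
  also have "L2ip M S u = cnj (L2ip M u S)" by (rule L2ip_cnj)
  finally have "complex_of_real ((L2n M (\<lambda>x. u x - S x))\<^sup>2) =
     of_real ((L2n M u)\<^sup>2) - (\<Sum>n\<in>ibox N. cnj (a n) * k n) - (\<Sum>n\<in>ibox N. a n * cnj (k n)) + (\<Sum>n\<in>ibox N. cnj (a n) * a n)"
    by (simp add: L2ip_self[OF u] SS[OF u] SS[OF S] kS k_def cong: sum.cong)
  also have "\<dots> = of_real ((L2n M u)\<^sup>2 - (\<Sum>n\<in>ibox N. (cmod (k n))\<^sup>2) + (\<Sum>n\<in>ibox N. (cmod (k n - a n))\<^sup>2))"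
    by (simp add: complex_norm_square sum_subtractf sum.distrib algebra_simps del: of_real_power)
  finally have "(L2n M (\<lambda>x. u x - S x))\<^sup>2 = (L2n M u)\<^sup>2 - (\<Sum>n\<in>ibox N. (cmod (k n))\<^sup>2) + (\<Sum>n\<in>ibox N. (cmod (k n - a n))\<^sup>2)"
    by (simp only: of_real_eq_iff)
  then show ?thesis by (simp add: S_def k_def)
qed

lemma bessel:
  assumes "sq_int M u"
  shows "(\<Sum>n\<in>ibox N. (cmod (L2ip M u (e n)))\<^sup>2) \<le> (L2n M u)\<^sup>2"
  using pythagoras[OF assms, where N = N and a = "\<lambda>n. L2ip M u (e n)"] zero_le_power2[of "L2n M (\<lambda>x. u x - (\<Sum>n\<in>ibox N. L2ip M u (e n) * e n x))"]
  by simp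

text \<open>The half of Parseval's identity that needs approximability: the squared error of any
  approximation dominates the squared norm minus the sum of squared coefficients. This turns
  coefficient bounds on the strip into norm bounds on the circle.\<close>

lemma in_span_norm_bound:
  assumes u: "in_span u" and B: "0 \<le> B" "\<And>N. (\<Sum>n\<in>ibox N. (cmod (L2ip M u (e n)))\<^sup>2) \<le> B\<^sup>2"
  shows "L2n M u \<le> B"
proof -
  have u': "sq_int M u" using u by (simp add: in_span_def)
  have "(L2n M u)\<^sup>2 \<le> B\<^sup>2 + \<epsilon>" if "\<epsilon> > 0" for \<epsilon>
  proof -
    from u that obtain N a where Na: "L2n M (\<lambda>x. u x - (\<Sum>n\<in>ibox N. a n * e n x)) < sqrt \<epsilon>"
      unfolding in_span_def by (meson real_sqrt_gt_zero)
    then have "(L2n M (\<lambda>x. u x - (\<Sum>n\<in>ibox N. a n * e n x)))\<^sup>2 \<le> (sqrt \<epsilon>)\<^sup>2"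
      by (intro power_mono) auto
    then have "(L2n M u)\<^sup>2 - (\<Sum>n\<in>ibox N. (cmod (L2ip M u (e n)))\<^sup>2) + (\<Sum>n\<in>ibox N. (cmod (L2ip M u (e n) - a n))\<^sup>2) \<le> \<epsilon>"
      using that by (simp add: pythagoras[OF u'])
    moreover have "0 \<le> (\<Sum>n\<in>ibox N. (cmod (L2ip M u (e n) - a n))\<^sup>2)" by (intro sum_nonneg) auto
    ultimately show ?thesis using B(2)[of N] by linarith
  qed
  then have "(L2n M u)\<^sup>2 \<le> B\<^sup>2" by (rule field_le_epsilon)
  then show ?thesis using B(1) by (rule power2_le_imp_le)
qed

lemma comb_extend:
  "N \<le> N' \<Longrightarrow> (\<Sum>n\<in>ibox N. a n * e n x) = (\<Sum>n\<in>ibox N'. (if n \<in> ibox N then a n else 0) * e n x)"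
  using ibox_mono[of N N'] by (intro sum.mono_neutral_cong_left) auto

lemma in_span_add:
  assumes "in_span u" "in_span v"
  shows "in_span (\<lambda>x. u x + v x)"
  unfolding in_span_def
proof (intro conjI allI impI)
  have u: "sq_int M u" and v: "sq_int M v" using assms by (auto simp: in_span_def)
  then show "sq_int M (\<lambda>x. u x + v x)" by (rule sq_int_add)
  fix \<epsilon> :: real assume "\<epsilon> > 0"
  then have "\<epsilon> / 2 > 0" by simp
  from assms this obtain N a N' a' where
    N: "L2n M (\<lambda>x. u x - (\<Sum>n\<in>ibox N. a n * e n x)) < \<epsilon> / 2"
    and N': "L2n M (\<lambda>x. v x - (\<Sum>n\<in>ibox N'. a' n * e n x)) < \<epsilon> / 2"
    unfolding in_span_def by meson
  define K where "K = max N N'"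
  define b where "b n = (if n \<in> ibox N then a n else 0) + (if n \<in> ibox N' then a' n else 0)" for n
  have "(\<lambda>x. u x + v x - (\<Sum>n\<in>ibox K. b n * e n x)) =
     (\<lambda>x. (u x - (\<Sum>n\<in>ibox N. a n * e n x)) + (v x - (\<Sum>n\<in>ibox N'. a' n * e n x)))"
    by (subst comb_extend[of N K], simp add: K_def, subst comb_extend[of N' K], simp add: K_def)
       (simp add: b_def sum.distrib distrib_right fun_eq_iff)
  then have "L2n M (\<lambda>x. u x + v x - (\<Sum>n\<in>ibox K. b n * e n x)) < \<epsilon>"
    using L2n_triangle[OF sq_int_diff[OF u sq_int_comb] sq_int_diff[OF v sq_int_comb], of a "ibox N" a' "ibox N'"] N N' by simp
  then show "\<exists>N a. L2n M (\<lambda>x. u x + v x - (\<Sum>n\<in>ibox N. a n * e n x)) < \<epsilon>" by blast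
qed

lemma in_span_comb: "in_span (\<lambda>x. \<Sum>n\<in>ibox N. a n * e n x)"
  unfolding in_span_def
proof (intro conjI allI impI sq_int_comb)
  fix \<epsilon> :: real assume "\<epsilon> > 0"
  then show "\<exists>N' b. L2n M (\<lambda>x. (\<Sum>n\<in>ibox N. a n * e n x) - (\<Sum>n\<in>ibox N'. b n * e n x)) < \<epsilon>"
    by (intro exI[of _ N] exI[of _ a]) (simp add: L2n_def)
qed

lemma in_span_limit:
  assumes u: "sq_int M u" and a: "\<And>\<epsilon>. \<epsilon> > 0 \<Longrightarrow> \<exists>v. in_span v \<and> L2n M (\<lambda>x. u x - v x) < \<epsilon>"
  shows "in_span u"
  unfolding in_span_def
proof (intro conjI allI impI u)
  fix \<epsilon> :: real assume "\<epsilon> > 0"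
  then have "\<epsilon> / 2 > 0" by simp
  from a[OF this] obtain v where v: "in_span v" "L2n M (\<lambda>x. u x - v x) < \<epsilon> / 2" by blast
  from v(1) \<open>\<epsilon> / 2 > 0\<close> obtain N b where N: "L2n M (\<lambda>x. v x - (\<Sum>n\<in>ibox N. b n * e n x)) < \<epsilon> / 2"
    unfolding in_span_def by meson
  have v': "sq_int M v" using v by (simp add: in_span_def)
  have "L2n M (\<lambda>x. u x - (\<Sum>n\<in>ibox N. b n * e n x)) < \<epsilon>"
    using L2n_triangle[OF sq_int_diff[OF u v'] sq_int_diff[OF v' sq_int_comb], of b "ibox N"] v N by simp
  then show "\<exists>N a. L2n M (\<lambda>x. u x - (\<Sum>n\<in>ibox N. a n * e n x)) < \<epsilon>" by blast
qed

lemma in_span_cmult: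
  assumes "in_span u"
  shows "in_span (\<lambda>x. c * u x)"
proof (rule in_span_limit)
  have u: "sq_int M u" using assms by (auto simp: in_span_def)
  then show "sq_int M (\<lambda>x. c * u x)" by (rule sq_int_cmult)
  fix \<epsilon> :: real assume "\<epsilon> > 0"
  then have "\<epsilon> / (cmod c + 1) > 0" by (intro divide_pos_pos add_nonneg_pos) auto
  then obtain N a where N: "L2n M (\<lambda>x. u x - (\<Sum>n\<in>ibox N. a n * e n x)) < \<epsilon> / (cmod c + 1)"
    using assms unfolding in_span_def by meson
  have "L2n M (\<lambda>x. c * u x - (\<Sum>n\<in>ibox N. (c * a n) * e n x)) = cmod c * L2n M (\<lambda>x. u x - (\<Sum>n\<in>ibox N. a n * e n x))"
    by (subst L2n_cmult[symmetric]) (simp add: right_diff_distrib sum_distrib_left mult.assoc)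
  also have "\<dots> \<le> (cmod c + 1) * L2n M (\<lambda>x. u x - (\<Sum>n\<in>ibox N. a n * e n x))"
    by (intro mult_right_mono) auto
  also have "\<dots> < \<epsilon>"
    using N by (simp add: pos_less_divide_eq add_nonneg_pos mult.commute)
  finally show "\<exists>v. in_span v \<and> L2n M (\<lambda>x. c * u x - v x) < \<epsilon>"
    using in_span_comb[where a = "\<lambda>n. c * a n" and N = N] by (intro exI conjI)
qed

end

section \<open>Van der Corput estimates\<close>

lemma has_vector_derivative_cis:
  assumes "(\<phi> has_real_derivative d) (at x within S)"
  shows "((\<lambda>x. cis (\<phi> x)) has_vector_derivative \<i> * of_real d * cis (\<phi> x)) (at x within S)"
proof -
  have "((\<lambda>x. cos (\<phi> x)) has_real_derivative (- sin (\<phi> x) * d)) (at x within S)"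
    "((\<lambda>x. sin (\<phi> x)) has_real_derivative (cos (\<phi> x) * d)) (at x within S)"
    using assms by (auto intro!: derivative_eq_intros)
  then have "((\<lambda>x. of_real (cos (\<phi> x)) + \<i> * of_real (sin (\<phi> x))) has_vector_derivative
       of_real (- sin (\<phi> x) * d) + \<i> * of_real (cos (\<phi> x) * d)) (at x within S)"
    by (intro has_vector_derivative_add has_vector_derivative_mult_right has_vector_derivative_of_real)
  moreover have "of_real (cos t) + \<i> * of_real (sin t) = cis t" for t
    by (simp add: complex_eq_iff)
  moreover have "of_real (- sin (\<phi> x) * d) + \<i> * of_real (cos (\<phi> x) * d) = \<i> * of_real d * cis (\<phi> x)"
    by (simp add: complex_eq_iff)
  ultimately show ?thesis by simp
qed

lemma integrable_cis_continuous:
  fixes \<phi> :: "real \<Rightarrow> real"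
  assumes "continuous_on UNIV \<phi>"
  shows "(\<lambda>x. cis (\<phi> x)) integrable_on {a..b}"
  by (intro integrable_continuous_interval continuous_intros continuous_on_subset[OF assms]) auto

lemma integral_unimodular_bound:
  fixes f :: "real \<Rightarrow> complex"
  assumes "f integrable_on {a..b}" "a \<le> b" "\<And>x. norm (f x) \<le> 1"
  shows "norm (integral {a..b} f) \<le> b - a"
  using integral_norm_bound_integral[of f "{a..b}" "\<lambda>_. 1"] assms by (simp add: integrable_on_const)

lemma integral_cis_uminus:
  "norm (integral {a..b} (\<lambda>x. cis (- \<phi> x))) = norm (integral {a..b} (\<lambda>x. cis (\<phi> x)))"
proof -
  have "integral {a..b} (\<lambda>x. cis (- \<phi> x)) = cnj (integral {a..b} (\<lambda>x. cis (\<phi> x)))"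
    by (simp add: integral_cnj cis_cnj)
  then show ?thesis by simp
qed

text \<open>Integration by parts, cis \<phi> = (cis \<phi> / (i \<phi>'))' - R. The remainder has
  modulus \<phi>'' / \<phi>'^2, which by the sign of \<phi>'' is the exact derivative of - 1 /
  \<phi>'; so its integral is at most 2 / L without any bound on \<phi>''. The boundary terms give
  the other 2 / L.\<close>

lemma van_der_corput_first:
  assumes d0: "\<And>x. (\<phi> has_real_derivative \<phi>' x) (at x)"
    and d1: "\<And>x. (\<phi>' has_real_derivative \<phi>'' x) (at x)"
    and c2: "continuous_on UNIV \<phi>''"
    and ab: "a \<le> b" and L: "0 < L"
    and low: "\<And>x. x \<in> {a..b} \<Longrightarrow> L \<le> \<bar>\<phi>' x\<bar>"
    and pos: "\<And>x. x \<in> {a..b} \<Longrightarrow> 0 \<le> \<phi>'' x"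
  shows "norm (integral {a..b} (\<lambda>x. cis (\<phi> x))) \<le> 4 / L"
proof -
  have c0: "continuous_on S \<phi>" and c1: "continuous_on S \<phi>'" for S
    using d0 d1 by (meson DERIV_isCont continuous_at_imp_continuous_on)+
  have c2': "continuous_on S \<phi>''" for S using c2 continuous_on_subset by blast
  have nz: "\<phi>' x \<noteq> 0" if "x \<in> {a..b}" for x using low[OF that] L by auto
  have inv: "((\<lambda>x. inverse (\<phi>' x)) has_real_derivative - (\<phi>'' x / (\<phi>' x)\<^sup>2)) (at x within {a..b})" if "x \<in> {a..b}" for x
    using DERIV_inverse_fun[OF has_field_derivative_at_within[OF d1[of x], of "{a..b}"] nz[OF that]]
    by (simp add: divide_inverse numeral_2_eq_2)
  define F where "F x = - \<i> * (cis (\<phi> x) * of_real (inverse (\<phi>' x)))" for x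
  define R where "R x = \<i> * (cis (\<phi> x) * of_real (\<phi>'' x / (\<phi>' x)\<^sup>2))" for x
  have "(F has_vector_derivative cis (\<phi> x) + R x) (at x within {a..b})" if x: "x \<in> {a..b}" for x
  proof -
    have "(F has_vector_derivative - \<i> * (cis (\<phi> x) * of_real (- (\<phi>'' x / (\<phi>' x)\<^sup>2)) + (\<i> * of_real (\<phi>' x) * cis (\<phi> x)) * of_real (inverse (\<phi>' x))))
      (at x within {a..b})"
      unfolding F_def
      by (intro has_vector_derivative_mult_right has_vector_derivative_mult has_vector_derivative_cis
          has_vector_derivative_of_real has_field_derivative_at_within[OF d0]
          inv[OF x])
    moreover have "- \<i> * (cis (\<phi> x) * of_real (- (\<phi>'' x / (\<phi>' x)\<^sup>2)) + (\<i> * of_real (\<phi>' x) * cis (\<phi> x)) * of_real (inverse (\<phi>' x))) = cis (\<phi> x) + R x"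
      using nz[OF x] by (simp add: R_def field_simps)
    ultimately show ?thesis by simp
  qed
  then have I: "((\<lambda>x. cis (\<phi> x) + R x) has_integral F b - F a) {a..b}"
    by (rule fundamental_theorem_of_calculus[OF ab])
  have J: "((\<lambda>x. - (\<phi>'' x / (\<phi>' x)\<^sup>2)) has_integral inverse (\<phi>' b) - inverse (\<phi>' a)) {a..b}"
    by (rule fundamental_theorem_of_calculus[OF ab]) (use inv in \<open>simp add: has_real_derivative_iff_has_vector_derivative\<close>)
  then have J': "((\<lambda>x. \<phi>'' x / (\<phi>' x)\<^sup>2) has_integral inverse (\<phi>' a) - inverse (\<phi>' b)) {a..b}"
    using has_integral_neg[OF J] by simp
  have Ri: "R integrable_on {a..b}"
    unfolding R_def by (intro integrable_continuous_interval continuous_intros c0 c1 c2') (use nz in auto)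
  have "norm (integral {a..b} R) \<le> integral {a..b} (\<lambda>x. \<phi>'' x / (\<phi>' x)\<^sup>2)"
    by (rule integral_norm_bound_integral[OF Ri]) (use J' pos in \<open>auto simp: R_def norm_mult norm_divide norm_power has_integral_iff\<close>)
  also have "\<dots> = inverse (\<phi>' a) - inverse (\<phi>' b)" using J' by (rule integral_unique)
  finally have R: "norm (integral {a..b} R) \<le> inverse (\<phi>' a) - inverse (\<phi>' b)" .
  have ia: "\<bar>inverse (\<phi>' x)\<bar> \<le> 1 / L" if "x \<in> {a..b}" for x
    using low[OF that] L by (simp add: divide_inverse)
  have "integral {a..b} (\<lambda>x. cis (\<phi> x)) = integral {a..b} (\<lambda>x. cis (\<phi> x) + R x) - integral {a..b} R"
    using Henstock_Kurzweil_Integration.integral_add[OF integrable_cis_continuous[OF c0] Ri] by simp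
  also have "\<dots> = F b - F a - integral {a..b} R" using I by (simp add: integral_unique)
  finally have "norm (integral {a..b} (\<lambda>x. cis (\<phi> x))) \<le> norm (F b) + norm (F a) + norm (integral {a..b} R)"
    by (metis norm_triangle_ineq4 add_mono_thms_linordered_semiring(3) order_trans)
  also have "\<dots> \<le> 1 / L + 1 / L + 2 / L"
  proof -
    have nF: "norm (F x) \<le> 1 / L" if "x \<in> {a..b}" for x
      using ia[OF that] by (simp add: F_def norm_mult norm_inverse)
    have "inverse (\<phi>' a) \<le> 1 / L" "- inverse (\<phi>' b) \<le> 1 / L"
      using ia[of a] ia[of b] ab by (simp_all only: abs_le_iff atLeastAtMost_iff order.refl)
    then have "norm (integral {a..b} R) \<le> 1 / L + 1 / L" using R by linarith
    then show ?thesis using nF[of a] nF[of b] ab by simp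
  qed
  finally show ?thesis by simp
qed

text \<open>A function of slope at least L moves away from its zero at rate L. Without a sign change
  an endpoint of the interval takes the place of the zero, and one of the two alternatives becomes
  vacuous.\<close>

lemma derivative_ge_root_split:
  assumes d: "\<And>x. (\<psi> has_real_derivative \<psi>' x) (at x)"
    and ab: "a \<le> b" and L: "0 < L" and low: "\<And>x. x \<in> {a..b} \<Longrightarrow> L \<le> \<psi>' x"
  shows "\<exists>c\<in>{a..b}. \<forall>x\<in>{a..b}. \<forall>\<delta>>0. (c + \<delta> \<le> x \<longrightarrow> L * \<delta> \<le> \<psi> x) \<and> (x \<le> c - \<delta> \<longrightarrow> \<psi> x \<le> - (L * \<delta>))"
proof -
  have grow: "L * (y - x) \<le> \<psi> y - \<psi> x" if "a \<le> x" "x \<le> y" "y \<le> b" for x y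
  proof (cases "x = y")
    case False
    then have "x < y" using that by simp
    from MVT2[OF this, of \<psi> \<psi>'] d obtain z where "x < z" "z < y" "\<psi> y - \<psi> x = (y - x) * \<psi>' z" by auto
    with low[of z] that show ?thesis by (simp add: mult.commute mult_left_mono)
  qed simp
  have mul: "L * \<delta> \<le> L * s" if "\<delta> \<le> s" for \<delta> s using L that by simp
  consider "0 \<le> \<psi> a" | "\<psi> b \<le> 0" | "\<psi> a < 0" "0 < \<psi> b" by linarith
  then show ?thesis
  proof cases
    case 1
    show ?thesis
    proof (rule bexI[of _ a], intro ballI allI impI conjI)
      fix x \<delta> :: real assume "x \<in> {a..b}" "0 < \<delta>" 
      { assume "a + \<delta> \<le> x" then show "L * \<delta> \<le> \<psi> x" using grow[of a x] mul[of \<delta> "x - a"] 1 \<open>x \<in> {a..b}\<close> by simp }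
      { assume "x \<le> a - \<delta>" then show "\<psi> x \<le> - (L * \<delta>)" using \<open>0 < \<delta>\<close> \<open>x \<in> {a..b}\<close> by simp }
    qed (use ab in auto)
  next
    case 2
    show ?thesis
    proof (rule bexI[of _ b], intro ballI allI impI conjI)
      fix x \<delta> :: real assume "x \<in> {a..b}" "0 < \<delta>" 
      { assume "b + \<delta> \<le> x" then show "L * \<delta> \<le> \<psi> x" using \<open>0 < \<delta>\<close> \<open>x \<in> {a..b}\<close> by simp }
      { assume "x \<le> b - \<delta>" then show "\<psi> x \<le> - (L * \<delta>)" using grow[of x b] mul[of \<delta> "b - x"] 2 \<open>x \<in> {a..b}\<close> by simp }
    qed (use ab in auto)
  next
    case 3
    have "continuous_on {a..b} \<psi>" using d by (meson DERIV_isCont continuous_at_imp_continuous_on)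
    then obtain c where c: "a \<le> c" "c \<le> b" "\<psi> c = 0" using IVT'[of \<psi> a 0 b] 3 ab by auto
    show ?thesis
    proof (rule bexI[of _ c], intro ballI allI impI conjI)
      fix x \<delta> :: real assume "x \<in> {a..b}" "0 < \<delta>" 
      { assume "c + \<delta> \<le> x" then show "L * \<delta> \<le> \<psi> x" using grow[of c x] mul[of \<delta> "x - c"] c \<open>0 < \<delta>\<close> \<open>x \<in> {a..b}\<close> by simp }
      { assume "x \<le> c - \<delta>" then show "\<psi> x \<le> - (L * \<delta>)" using grow[of x c] mul[of \<delta> "c - x"] c \<open>0 < \<delta>\<close> \<open>x \<in> {a..b}\<close> by simp }
    qed (use c in auto)
  qed
qed

text \<open>The middle piece, of length at most 2 \<delta>, is estimated trivially and the outer
  ones by \<open>B\<close>. The same cut serves the passage from first to second and from second to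
  third derivatives.\<close>

lemma integral_bound_away_from_point:
  fixes f :: "real \<Rightarrow> complex"
  assumes f: "continuous_on UNIV f" "\<And>x. norm (f x) \<le> 1"
    and ab: "a \<le> b" and "0 < \<delta>" and B: "0 \<le> B"
    and piece: "\<And>u v. a \<le> u \<Longrightarrow> u \<le> v \<Longrightarrow> v \<le> b \<Longrightarrow> c + \<delta> \<le> u \<or> v \<le> c - \<delta> \<Longrightarrow> norm (integral {u..v} f) \<le> B"
  shows "norm (integral {a..b} f) \<le> 2 * \<delta> + 2 * B"
proof -
  have int: "f integrable_on {u..v}" for u v
    using f(1) continuous_on_subset by (intro integrable_continuous_interval) blast
  \<comment> \<open>Clamping the cut points to the interval covers a point \<open>c\<close> near or
    outside the ends. A piece that collapses has integral 0, and \<open>piece\<close> is not invoked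
    for it.\<close>
  define p where "p = max a (min b (c - \<delta>))"
  define q where "q = min b (max a (c + \<delta>))"
  have o: "a \<le> p" "p \<le> q" "q \<le> b" "q - p \<le> 2 * \<delta>" using ab \<open>0 < \<delta>\<close> by (auto simp: p_def q_def)
  have 1: "norm (integral {a..p} f) \<le> B"
  proof (cases "p = a")
    case False
    then have "p \<le> c - \<delta>" by (auto simp: p_def max_def min_def split: if_splits)
    then show ?thesis using o by (intro piece) auto
  qed (use B in simp)
  have 2: "norm (integral {q..b} f) \<le> B"
  proof (cases "q = b")
    case False
    then have "c + \<delta> \<le> q" by (auto simp: q_def max_def min_def split: if_splits)
    then show ?thesis using o by (intro piece) auto
  qed (use B in simp)
  have 3: "norm (integral {p..q} f) \<le> q - p"
    using o f(2) by (intro integral_unimodular_bound int) auto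
  have "integral {a..b} f = integral {a..p} f + integral {p..q} f + integral {q..b} f"
    using Henstock_Kurzweil_Integration.integral_combine[of a q b f] Henstock_Kurzweil_Integration.integral_combine[of a p q f] o int by simp
  also have "norm \<dots> \<le> norm (integral {a..p} f) + norm (integral {p..q} f) + norm (integral {q..b} f)"
    by (meson add_right_mono norm_triangle_ineq order_trans)
  finally show ?thesis using 1 2 3 o by linarith
qed

lemma continuous_cis_of_DERIV:
  assumes "\<And>x. (\<phi> has_real_derivative \<phi>' x) (at x)"
  shows "continuous_on UNIV (\<lambda>x. cis (\<phi> x))"
proof -
  have "continuous_on UNIV \<phi>" using assms by (meson DERIV_isCont continuous_at_imp_continuous_on)
  then show ?thesis by (intro continuous_intros)
qed

text \<open>Outside the \<delta>-neighbourhood of the point given by the split, \<phi>' is at least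
  L \<delta> in modulus and the first-derivative bound applies. The radius \<delta> stays free,
  since one choice has to serve second and third derivatives.\<close>

lemma van_der_corput_second_pos:
  assumes d0: "\<And>x. (\<phi> has_real_derivative \<phi>' x) (at x)"
    and d1: "\<And>x. (\<phi>' has_real_derivative \<phi>'' x) (at x)"
    and c2: "continuous_on UNIV \<phi>''"
    and ab: "a \<le> b" and L: "0 < L" and \<delta>: "0 < \<delta>"
    and low: "\<And>x. x \<in> {a..b} \<Longrightarrow> L \<le> \<phi>'' x"
  shows "norm (integral {a..b} (\<lambda>x. cis (\<phi> x))) \<le> 2 * \<delta> + 8 / (L * \<delta>)"
proof -
  from derivative_ge_root_split[of \<phi>' \<phi>'', OF d1 ab L low] obtain c where
    c: "\<And>x. x \<in> {a..b} \<Longrightarrow> (c + \<delta> \<le> x \<longrightarrow> L * \<delta> \<le> \<phi>' x) \<and> (x \<le> c - \<delta> \<longrightarrow> \<phi>' x \<le> - (L * \<delta>))"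
    using \<delta> by blast
  have "norm (integral {a..b} (\<lambda>x. cis (\<phi> x))) \<le> 2 * \<delta> + 2 * (4 / (L * \<delta>))"
  proof (rule integral_bound_away_from_point[of _ a b \<delta> _ c])
    show "continuous_on UNIV (\<lambda>x. cis (\<phi> x))" by (rule continuous_cis_of_DERIV[OF d0])
    fix u v assume uv: "a \<le> u" "u \<le> v" "v \<le> b" "c + \<delta> \<le> u \<or> v \<le> c - \<delta>"
    have "L * \<delta> > 0" using L \<delta> by simp
    then have low1: "L * \<delta> \<le> \<bar>\<phi>' x\<bar>" if "x \<in> {u..v}" for x
      using c[of x] that uv by force
    have pos2: "0 \<le> \<phi>'' x" if "x \<in> {u..v}" for x using low[of x] that uv L by simp
    show "norm (integral {u..v} (\<lambda>x. cis (\<phi> x))) \<le> 4 / (L * \<delta>)"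
      using van_der_corput_first[OF d0 d1 c2 uv(2) \<open>L * \<delta> > 0\<close> low1 pos2] .
  qed (use ab L \<delta> in auto)
  then show ?thesis by simp
qed

text \<open>A negative second derivative is reduced to the positive case by complex conjugation,
  which changes the sign of the phase.\<close>

lemma van_der_corput_second:
  assumes d0: "\<And>x. (\<phi> has_real_derivative \<phi>' x) (at x)"
    and d1: "\<And>x. (\<phi>' has_real_derivative \<phi>'' x) (at x)"
    and c2: "continuous_on UNIV \<phi>''"
    and ab: "a \<le> b" and L: "0 < L" and \<delta>: "0 < \<delta>"
    and low: "(\<forall>x\<in>{a..b}. L \<le> \<phi>'' x) \<or> (\<forall>x\<in>{a..b}. \<phi>'' x \<le> - L)"
  shows "norm (integral {a..b} (\<lambda>x. cis (\<phi> x))) \<le> 2 * \<delta> + 8 / (L * \<delta>)"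
  using low
proof
  assume "\<forall>x\<in>{a..b}. L \<le> \<phi>'' x"
  then show ?thesis by (intro van_der_corput_second_pos[OF d0 d1 c2 ab L \<delta>]) auto
next
  assume neg: "\<forall>x\<in>{a..b}. \<phi>'' x \<le> - L"
  have "norm (integral {a..b} (\<lambda>x. cis (- \<phi> x))) \<le> 2 * \<delta> + 8 / (L * \<delta>)"
    by (rule van_der_corput_second_pos[where \<phi> = "\<lambda>x. - \<phi> x" and \<phi>' = "\<lambda>x. - \<phi>' x" and \<phi>'' = "\<lambda>x. - \<phi>'' x"])
      (use neg ab L \<delta> c2 in \<open>auto simp: le_minus_iff intro!: DERIV_minus d0 d1 continuous_intros\<close>)
  then show ?thesis by (simp add: integral_cis_uminus)
qed

text \<open>The same cut one order higher: away from the point where \<phi>'' may vanish, the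
  second-derivative bound applies with constant L \<delta> and the same \<delta>.\<close>

lemma van_der_corput_third_pos:
  assumes d0: "\<And>x. (\<phi> has_real_derivative \<phi>' x) (at x)"
    and d1: "\<And>x. (\<phi>' has_real_derivative \<phi>'' x) (at x)"
    and d2: "\<And>x. (\<phi>'' has_real_derivative \<phi>''' x) (at x)"
    and ab: "a \<le> b" and L: "0 < L" and \<delta>: "0 < \<delta>"
    and low: "\<And>x. x \<in> {a..b} \<Longrightarrow> L \<le> \<phi>''' x"
  shows "norm (integral {a..b} (\<lambda>x. cis (\<phi> x))) \<le> 6 * \<delta> + 16 / (L * \<delta>\<^sup>2)"
proof -
  have c2: "continuous_on UNIV \<phi>''" using d2 by (meson DERIV_isCont continuous_at_imp_continuous_on)
  from derivative_ge_root_split[of \<phi>'' \<phi>''', OF d2 ab L low] obtain c where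
    c: "\<And>x. x \<in> {a..b} \<Longrightarrow> (c + \<delta> \<le> x \<longrightarrow> L * \<delta> \<le> \<phi>'' x) \<and> (x \<le> c - \<delta> \<longrightarrow> \<phi>'' x \<le> - (L * \<delta>))"
    using \<delta> by blast
  have "norm (integral {a..b} (\<lambda>x. cis (\<phi> x))) \<le> 2 * \<delta> + 2 * (2 * \<delta> + 8 / (L * \<delta> * \<delta>))"
  proof (rule integral_bound_away_from_point[of _ a b \<delta> _ c])
    show "continuous_on UNIV (\<lambda>x. cis (\<phi> x))" by (rule continuous_cis_of_DERIV[OF d0])
    fix u v assume uv: "a \<le> u" "u \<le> v" "v \<le> b" "c + \<delta> \<le> u \<or> v \<le> c - \<delta>"
    have "L * \<delta> > 0" using L \<delta> by simp
    have "(\<forall>x\<in>{u..v}. L * \<delta> \<le> \<phi>'' x) \<or> (\<forall>x\<in>{u..v}. \<phi>'' x \<le> - (L * \<delta>))"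
      using c uv by force
    then show "norm (integral {u..v} (\<lambda>x. cis (\<phi> x))) \<le> 2 * \<delta> + 8 / (L * \<delta> * \<delta>)"
      by (rule van_der_corput_second[OF d0 d1 c2 uv(2) \<open>L * \<delta> > 0\<close> \<delta>])
  qed (use ab L \<delta> in auto)
  then show ?thesis by (simp add: power2_eq_square mult.assoc)
qed

lemma van_der_corput_third:
  assumes d0: "\<And>x. (\<phi> has_real_derivative \<phi>' x) (at x)"
    and d1: "\<And>x. (\<phi>' has_real_derivative \<phi>'' x) (at x)"
    and d2: "\<And>x. (\<phi>'' has_real_derivative \<phi>''' x) (at x)"
    and ab: "a \<le> b" and L: "0 < L" and \<delta>: "0 < \<delta>"
    and low: "(\<forall>x\<in>{a..b}. L \<le> \<phi>''' x) \<or> (\<forall>x\<in>{a..b}. \<phi>''' x \<le> - L)"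
  shows "norm (integral {a..b} (\<lambda>x. cis (\<phi> x))) \<le> 6 * \<delta> + 16 / (L * \<delta>\<^sup>2)"
  using low
proof
  assume "\<forall>x\<in>{a..b}. L \<le> \<phi>''' x"
  then show ?thesis by (intro van_der_corput_third_pos[OF d0 d1 d2 ab L \<delta>]) auto
next
  assume neg: "\<forall>x\<in>{a..b}. \<phi>''' x \<le> - L"
  have "norm (integral {a..b} (\<lambda>x. cis (- \<phi> x))) \<le> 6 * \<delta> + 16 / (L * \<delta>\<^sup>2)"
    by (rule van_der_corput_third_pos[where \<phi> = "\<lambda>x. - \<phi> x" and \<phi>' = "\<lambda>x. - \<phi>' x" and \<phi>'' = "\<lambda>x. - \<phi>'' x" and \<phi>''' = "\<lambda>x. - \<phi>''' x"])
      (use neg ab L \<delta> in \<open>auto simp: le_minus_iff intro!: DERIV_minus d0 d1 d2\<close>)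
  then show ?thesis by (simp add: integral_cis_uminus)
qed

lemma continuous_nonzero_local_sign:
  fixes f :: "real \<Rightarrow> real"
  assumes "continuous_on UNIV f" "f x \<noteq> 0"
  shows "\<exists>d>0. \<exists>c>0. (\<forall>y. \<bar>y - x\<bar> < d \<longrightarrow> c \<le> f y) \<or> (\<forall>y. \<bar>y - x\<bar> < d \<longrightarrow> f y \<le> - c)"
proof -
  have "\<bar>f x\<bar> / 2 > 0" using assms(2) by simp
  then obtain d where d: "d > 0" "\<And>y. dist y x < d \<Longrightarrow> dist (f y) (f x) < \<bar>f x\<bar> / 2"
    using assms(1) unfolding continuous_on_iff by (meson UNIV_I)
  have *: "\<bar>f y - f x\<bar> < \<bar>f x\<bar> / 2" if "\<bar>y - x\<bar> < d" for y
    using d(2)[of y] that by (simp add: dist_real_def)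
  show ?thesis
  proof (cases "f x > 0")
    case True
    have "f x / 2 \<le> f y" if "\<bar>y - x\<bar> < d" for y using *[OF that] True by linarith
    then show ?thesis using d(1) True half_gt_zero by blast
  next
    case False
    then have neg: "f x < 0" using assms(2) by simp
    have "f y \<le> - (- f x / 2)" if "\<bar>y - x\<bar> < d" for y using *[OF that] neg by linarith
    moreover have "- f x / 2 > 0" using neg by simp
    ultimately show ?thesis using d(1) by blast
  qed
qed

text \<open>The linear term \<nu> x disappears from the second and third derivatives of the phase,
  so the bound is uniform in \<nu>; this gives all Fourier coefficients the same rate. Near each
  point one of the two derivatives is bounded away from 0, and the bisection principle on the
  compact interval glues the local bounds by adding constants.\<close>

lemma oscillatory_decay:
  assumes d0: "\<And>x. (m0 has_real_derivative m1 x) (at x)"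
    and d1: "\<And>x. (m1 has_real_derivative m2 x) (at x)"
    and d2: "\<And>x. (m2 has_real_derivative m3 x) (at x)"
    and c3: "continuous_on UNIV m3"
    and nz: "\<And>x. m2 x \<noteq> 0 \<or> m3 x \<noteq> 0"
    and "u \<le> v"
  shows "\<exists>B\<ge>0. \<forall>t \<nu> a b. t \<noteq> 0 \<and> u \<le> a \<and> a \<le> b \<and> b \<le> v \<longrightarrow>
    norm (integral {a..b} (\<lambda>x. cis (t * m0 x + \<nu> * x))) \<le> B * \<bar>t\<bar> powr (-1/3)"
  using \<open>u \<le> v\<close>
proof (induction rule: Bolzano)
  case (trans p q r)
  obtain B where B: "B \<ge> 0" "\<forall>t \<nu> a b. t \<noteq> 0 \<and> p \<le> a \<and> a \<le> b \<and> b \<le> q \<longrightarrow> norm (integral {a..b} (\<lambda>x. cis (t * m0 x + \<nu> * x))) \<le> B * \<bar>t\<bar> powr (-1/3)"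
    using trans(1) by (elim exE conjE)
  obtain B' where B': "B' \<ge> 0" "\<forall>t \<nu> a b. t \<noteq> 0 \<and> q \<le> a \<and> a \<le> b \<and> b \<le> r \<longrightarrow> norm (integral {a..b} (\<lambda>x. cis (t * m0 x + \<nu> * x))) \<le> B' * \<bar>t\<bar> powr (-1/3)"
    using trans(2) by (elim exE conjE)
  show ?case
  proof (intro exI[of _ "B + B'"] conjI allI impI)
    show "0 \<le> B + B'" using B B' by simp
    fix t \<nu> a b :: real assume *: "t \<noteq> 0 \<and> p \<le> a \<and> a \<le> b \<and> b \<le> r"
    let ?f = "\<lambda>x. cis (t * m0 x + \<nu> * x)"
    have "continuous_on UNIV m0" using d0 by (meson DERIV_isCont continuous_at_imp_continuous_on)
    then have int: "?f integrable_on {x..y}" for x y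
      by (intro integrable_cis_continuous continuous_intros)
    have e: "B * \<bar>t\<bar> powr (-1/3) \<ge> 0" "B' * \<bar>t\<bar> powr (-1/3) \<ge> 0" using B B' by auto
    consider "b \<le> q" | "q \<le> a" | "a \<le> q" "q \<le> b" by linarith
    then show "norm (integral {a..b} ?f) \<le> (B + B') * \<bar>t\<bar> powr (-1/3)"
    proof cases
      case 1 then show ?thesis using B(2)[rule_format, of t a b \<nu>] * e by (simp add: distrib_right)
    next
      case 2 then show ?thesis using B'(2)[rule_format, of t a b \<nu>] * e by (simp add: distrib_right)
    next
      case 3
      have "norm (integral {a..b} ?f) \<le> norm (integral {a..q} ?f) + norm (integral {q..b} ?f)"
        unfolding Henstock_Kurzweil_Integration.integral_combine[OF 3 int, symmetric] by (rule norm_triangle_ineq)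
      also have "\<dots> \<le> B * \<bar>t\<bar> powr (-1/3) + B' * \<bar>t\<bar> powr (-1/3)"
        by (rule add_mono[OF B(2)[rule_format] B'(2)[rule_format]]) (use * 3 in auto)
      finally show ?thesis by (simp only: distrib_right)
    qed
  qed
next
  case (local x)
  have cont2: "continuous_on UNIV m2" using d2 by (meson DERIV_isCont continuous_at_imp_continuous_on)
  obtain d c where dc: "d > 0" "c > 0"
    "((\<forall>y. \<bar>y - x\<bar> < d \<longrightarrow> c \<le> m2 y) \<or> (\<forall>y. \<bar>y - x\<bar> < d \<longrightarrow> m2 y \<le> - c)) \<or>
     ((\<forall>y. \<bar>y - x\<bar> < d \<longrightarrow> c \<le> m3 y) \<or> (\<forall>y. \<bar>y - x\<bar> < d \<longrightarrow> m3 y \<le> - c))"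
    using nz[of x] continuous_nonzero_local_sign[OF cont2, of x] continuous_nonzero_local_sign[OF c3, of x] by metis
  show ?case
  \<comment> \<open>Length below 1 is used when \<delta> > 1: there the length of the interval is
    itself the bound and must stay below a multiple of \<delta>.\<close>
  proof (rule exI[of _ "min d 1"], rule conjI, goal_cases)
    case 1
    show "0 < min d 1" using dc by simp
  next
    case 2
    show ?case
    proof (intro allI impI)
    fix p q assume pq: "p \<le> x \<and> x \<le> q \<and> q - p < min d 1"
    have near: "\<bar>y - x\<bar> < d" if "p \<le> y" "y \<le> q" for y using that pq by auto
    show "\<exists>B\<ge>0. \<forall>t \<nu> a b. t \<noteq> 0 \<and> p \<le> a \<and> a \<le> b \<and> b \<le> q \<longrightarrow>
      norm (integral {a..b} (\<lambda>x. cis (t * m0 x + \<nu> * x))) \<le> B * \<bar>t\<bar> powr (-1/3)"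
    proof (intro exI[of _ "22 * c powr (-1/3)"] conjI allI impI)
      fix t \<nu> a b :: real assume *: "t \<noteq> 0 \<and> p \<le> a \<and> a \<le> b \<and> b \<le> q"
      define L where "L = \<bar>t\<bar> * c"
      \<comment> \<open>This choice balances the third-derivative bound: L \<delta>^3 = 1 turns 16 /
        (L \<delta>^2) into 16 \<delta>, hence the factor 22 = 6 + 16.\<close>
      define \<delta> where "\<delta> = L powr (-1/3)"
      have L: "L > 0" using * dc by (simp add: L_def)
      then have \<delta>: "\<delta> > 0" by (simp add: \<delta>_def)
      have LD: "22 * c powr (-1/3) * \<bar>t\<bar> powr (-1/3) = 22 * \<delta>"
        using dc by (simp add: \<delta>_def L_def powr_mult)
      have "\<delta> ^ 3 = \<delta> powr 3" using \<delta> by (simp add: powr_numeral)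
      also have "\<dots> = L powr (-1)" by (simp add: \<delta>_def powr_powr)
      finally have "\<delta> ^ 3 = L powr (-1)" .
      then have L\<delta>: "L * \<delta> ^ 3 = 1" using L by (simp add: powr_minus)
      let ?\<phi> = "\<lambda>x. t * m0 x + \<nu> * x" and ?\<phi>' = "\<lambda>x. t * m1 x + \<nu>" and ?\<phi>'' = "\<lambda>x. t * m2 x" and ?\<phi>''' = "\<lambda>x. t * m3 x"
      have D0: "(?\<phi> has_real_derivative ?\<phi>' y) (at y)" and D1: "(?\<phi>' has_real_derivative ?\<phi>'' y) (at y)"
        and D2: "(?\<phi>'' has_real_derivative ?\<phi>''' y) (at y)" for y
        by (auto intro!: derivative_eq_intros d0 d1 d2)
      have scale: "(\<forall>y\<in>{a..b}. L \<le> t * g y) \<or> (\<forall>y\<in>{a..b}. t * g y \<le> - L)"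
        if g: "(\<forall>y. \<bar>y - x\<bar> < d \<longrightarrow> c \<le> g y) \<or> (\<forall>y. \<bar>y - x\<bar> < d \<longrightarrow> g y \<le> - c)" for g :: "real \<Rightarrow> real"
      proof -
        have g': "(\<forall>y\<in>{a..b}. c \<le> g y) \<or> (\<forall>y\<in>{a..b}. c \<le> - g y)"
          using g near * by (smt (verit) atLeastAtMost_iff)
        have ts: "t * g y = \<bar>t\<bar> * g y \<or> t * g y = - (\<bar>t\<bar> * g y)" "(t > 0 \<longrightarrow> t * g y = \<bar>t\<bar> * g y)" "(t < 0 \<longrightarrow> t * g y = - (\<bar>t\<bar> * g y))" for y by auto
        have m: "L \<le> \<bar>t\<bar> * s" if "c \<le> s" for s using that by (simp add: L_def mult_left_mono)
        consider "t > 0" | "t < 0" using * by linarith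
        then show ?thesis
        proof cases
          case 1 with g' show ?thesis using m ts by (metis mult_minus_right le_minus_iff)
        next
          case 2 with g' show ?thesis using m ts by (metis mult_minus_right le_minus_iff minus_minus)
        qed
      qed
      have "norm (integral {a..b} (\<lambda>x. cis (t * m0 x + \<nu> * x))) \<le> 22 * \<delta>"
        using dc(3)
      proof
        assume g: "(\<forall>y. \<bar>y - x\<bar> < d \<longrightarrow> c \<le> m3 y) \<or> (\<forall>y. \<bar>y - x\<bar> < d \<longrightarrow> m3 y \<le> - c)"
        have "norm (integral {a..b} (\<lambda>x. cis (?\<phi> x))) \<le> 6 * \<delta> + 16 / (L * \<delta>\<^sup>2)"
          using * by (intro van_der_corput_third[OF D0 D1 D2 _ L \<delta> scale[OF g]]) auto
        also have "1 / (L * \<delta>\<^sup>2) = \<delta>" using L\<delta> L \<delta> by (simp add: field_simps power3_eq_cube power2_eq_square)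
        then have "16 / (L * \<delta>\<^sup>2) = 16 * \<delta>" by simp
        finally show ?thesis by simp
      next
        assume g: "(\<forall>y. \<bar>y - x\<bar> < d \<longrightarrow> c \<le> m2 y) \<or> (\<forall>y. \<bar>y - x\<bar> < d \<longrightarrow> m2 y \<le> - c)"
        show ?thesis
        \<comment> \<open>A nonvanishing second derivative gives 8 \<delta>^2 in place of 16
          \<delta>, which is better for small \<delta>, that is for large |t|. For \<delta> > 1 the
          length of the interval suffices.\<close>
        proof (cases "\<delta> \<le> 1")
          case True
          have "norm (integral {a..b} (\<lambda>x. cis (?\<phi> x))) \<le> 2 * \<delta> + 8 / (L * \<delta>)"
            using * by (intro van_der_corput_second[OF D0 D1 _ _ L \<delta> scale[OF g]] continuous_intros cont2) auto
          also have "1 / (L * \<delta>) = \<delta>\<^sup>2" using L\<delta> L \<delta> by (simp add: field_simps power3_eq_cube power2_eq_square)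
          then have "8 / (L * \<delta>) = 8 * \<delta>\<^sup>2" by simp
          also have "\<delta>\<^sup>2 \<le> \<delta>" using True \<delta> by (simp add: power2_eq_square mult_left_le)
          finally show ?thesis using \<delta> by simp
        next
          case False
          have "norm (integral {a..b} (\<lambda>x. cis (?\<phi> x))) \<le> b - a"
            using * D0 by (intro integral_unimodular_bound integrable_continuous_interval continuous_on_subset[OF continuous_cis_of_DERIV[OF D0]]) auto
          also have "\<dots> \<le> 22 * \<delta>" using pq * False by auto
          finally show ?thesis .
        qed
      qed
      then show "norm (integral {a..b} (\<lambda>x. cis (t * m0 x + \<nu> * x))) \<le> 22 * c powr (-1/3) * \<bar>t\<bar> powr (-1/3)"
        by (simp only: LD)
    qed (use dc in auto)
    qed
  qed
qed

text \<open>Integration by parts against the primitive of the oscillating factor that vanishes at 0.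
  The oscillation sits entirely in this primitive, so the amplitude enters only through bounds of
  \<open>A\<close> and \<open>A'\<close> on [0, 1].\<close>

lemma oscillatory_decay_amplitude:
  fixes A A' :: "real \<Rightarrow> complex"
  assumes osc: "\<And>t \<nu> b. t \<noteq> 0 \<Longrightarrow> 0 \<le> b \<Longrightarrow> b \<le> 1 \<Longrightarrow>
      norm (integral {0..b} (\<lambda>x. cis (t * m0 x + \<nu> * x))) \<le> B * \<bar>t\<bar> powr (-1/3)"
    and B: "0 \<le> B" and m0: "continuous_on UNIV m0"
    and A: "\<And>x. (A has_vector_derivative A' x) (at x)" and A': "continuous_on UNIV A'"
  shows "\<exists>C\<ge>0. \<forall>t \<nu> b. t \<noteq> 0 \<and> 0 \<le> b \<and> b \<le> 1 \<longrightarrow>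
    norm (integral {0..b} (\<lambda>x. A x * cis (t * m0 x + \<nu> * x))) \<le> C * \<bar>t\<bar> powr (-1/3)"
proof -
  have cA: "continuous_on S A" for S
    using A by (meson continuous_at_imp_continuous_on has_vector_derivative_continuous)
  have "bounded (A ` {0..1})" "bounded (A' ` {0..1})"
    using cA continuous_on_subset[OF A'] by (auto intro!: compact_imp_bounded compact_continuous_image)
  then obtain K1 K2 where "\<forall>y\<in>A ` {0..1}. norm y \<le> K1" "\<forall>y\<in>A' ` {0..1}. norm y \<le> K2"
    by (meson bounded_iff)
  then have K: "\<And>x. x \<in> {0..1} \<Longrightarrow> norm (A x) \<le> K1" "\<And>x. x \<in> {0..1} \<Longrightarrow> norm (A' x) \<le> K2"
    by simp_all
  have "0 \<le> K1" "0 \<le> K2" using K[of 0] by (auto intro: order_trans[OF norm_ge_zero])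
  show ?thesis
  proof (intro exI[of _ "K1 * B + K2 * B"] conjI allI impI)
    show "0 \<le> K1 * B + K2 * B" using B \<open>0 \<le> K1\<close> \<open>0 \<le> K2\<close> by simp
    fix t \<nu> b :: real assume *: "t \<noteq> 0 \<and> 0 \<le> b \<and> b \<le> 1"
    let ?f = "\<lambda>x. cis (t * m0 x + \<nu> * x)"
    define J where "J x = integral {0..x} ?f" for x
    define E where "E = B * \<bar>t\<bar> powr (-1/3)"
    have E: "0 \<le> E" using B by (simp add: E_def)
    have cf: "continuous_on S ?f" for S by (intro continuous_intros continuous_on_subset[OF m0]) auto
    have J: "(J has_vector_derivative ?f x) (at x within {0..b})" if "x \<in> {0..b}" for x
      unfolding J_def using that by (intro integral_has_vector_derivative cf)
    have cJ: "continuous_on {0..b} J" 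
      using J by (meson continuous_on_eq_continuous_within has_vector_derivative_continuous)
    have JB: "norm (J x) \<le> E" if "x \<in> {0..b}" for x
      unfolding J_def E_def using osc[of t x \<nu>] that * by auto
    have "((\<lambda>x. A x * J x) has_vector_derivative A x * ?f x + A' x * J x) (at x within {0..b})" if "x \<in> {0..b}" for x
      by (intro has_vector_derivative_mult J that has_vector_derivative_at_within[OF A])
    then have "((\<lambda>x. A x * ?f x + A' x * J x) has_integral A b * J b - A 0 * J 0) {0..b}"
      using * by (intro fundamental_theorem_of_calculus) auto
    then have I: "integral {0..b} (\<lambda>x. A x * ?f x + A' x * J x) = A b * J b"
      by (simp add: integral_unique J_def)
    have i1: "(\<lambda>x. A x * ?f x) integrable_on {0..b}" 
      by (intro integrable_continuous_interval continuous_on_mult cA cf)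
    have i2: "(\<lambda>x. A' x * J x) integrable_on {0..b}"
      using continuous_on_subset[OF A'] by (intro integrable_continuous_interval continuous_on_mult cJ) auto
    have "norm (integral {0..b} (\<lambda>x. A' x * J x)) \<le> integral {0..b} (\<lambda>x. K2 * E)"
      using K(2) JB * \<open>0 \<le> K2\<close> by (intro integral_norm_bound_integral i2) (auto simp: norm_mult intro!: mult_mono integrable_on_const)
    also have "\<dots> = b * (K2 * E)" using * by (simp add: mult_ac)
    also have "\<dots> \<le> K2 * E" using * E \<open>0 \<le> K2\<close> by (intro mult_left_le_one_le) auto
    finally have 2: "norm (integral {0..b} (\<lambda>x. A' x * J x)) \<le> K2 * E" .
    have 1: "norm (A b * J b) \<le> K1 * E"
      using K(1)[of b] JB[of b] * \<open>0 \<le> K1\<close> by (auto simp: norm_mult intro!: mult_mono)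
    have "integral {0..b} (\<lambda>x. A x * ?f x) = A b * J b - integral {0..b} (\<lambda>x. A' x * J x)"
      using I Henstock_Kurzweil_Integration.integral_add[OF i1 i2] by (simp add: algebra_simps)
    also have "norm \<dots> \<le> K1 * E + K2 * E" using norm_triangle_ineq4 1 2 by (meson add_mono order_trans)
    finally show "norm (integral {0..b} (\<lambda>x. A x * ?f x)) \<le> (K1 * B + K2 * B) * \<bar>t\<bar> powr (-1/3)"
      by (simp add: E_def algebra_simps)
  qed
qed

section \<open>The theta functions as functions of the cosine\<close>

definition nome :: real where
  "nome = exp (- pi\<^sup>2 / gam\<^sup>2)"

lemma gam_pos: "gam > 0"
  by (simp add: gam_def)

lemma gam_sq: "gam\<^sup>2 = 2 * pi / sqrt 3"
  by (simp add: gam_def)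

lemma nome_alt: "nome = exp (- (pi * sqrt 3 / 2))"
  unfolding nome_def gam_sq by (simp add: power2_eq_square field_simps)

lemma nome_pos: "0 < nome"
  by (simp add: nome_def)

text \<open>pi sqrt 3 / 2 is about 2.7207 and exp 2.72 about 15.18, so 1/15 is close to the true
  value; the margins of the later numerical estimates rest on it.\<close>

lemma nome_le: "nome \<le> 1 / 15"
proof -
  \<comment> \<open>The Taylor sum is taken at 0.34 = 2.72 / 8, where five terms are accurate
    enough, and then raised to the eighth power.\<close>
  have "(1.4049::real) \<le> (\<Sum>k<5. (34/100) ^ k /\<^sub>R fact k)"
    by (simp add: eval_nat_numeral)
  also have "\<dots> \<le> exp (34/100)"
    unfolding exp_def by (rule sum_le_suminf[OF summable_exp_generic]) auto
  finally have "1.4049 ^ 8 \<le> exp (34/100 :: real) ^ 8" by (intro power_mono) auto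
  also have "\<dots> = exp (2.72 :: real)" by (simp flip: exp_of_nat_mult)
  finally have "15 \<le> exp (2.72 :: real)" by (simp add: power_numeral_even power_numeral_odd)
  moreover have "2.72 \<le> pi * sqrt 3 / 2"
  proof -
    have "1.732 \<le> sqrt 3" by (rule real_le_rsqrt) (simp add: power2_eq_square)
    then have "3.141 * 1.732 \<le> pi * sqrt 3" using pi_approx by (intro mult_mono) auto
    then show ?thesis by simp
  qed
  ultimately have "15 \<le> exp (pi * sqrt 3 / 2)" by (meson exp_le_cancel_iff order_trans)
  then show ?thesis by (simp add: nome_alt exp_minus field_simps)
qed

lemma nome_power: "exp (- pi\<^sup>2 * (real k)\<^sup>2 / gam\<^sup>2) = nome ^ (k\<^sup>2)"
  by (simp add: nome_def flip: exp_of_nat_mult)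

text \<open>\<open>fejer n (cos t)\<close> is (1 - cos (n t)) / (1 - cos t), n times the Fejer
  kernel, as a polynomial in cos t. The recursion is Chebyshev's, with the inhomogeneity 2 stemming
  from the constant 1. The ring is left open so that one definition covers the real values and their
  holomorphic extension.\<close>

fun fejer :: "nat \<Rightarrow> 'a::comm_ring_1 \<Rightarrow> 'a" where
  "fejer 0 c = 0"
| "fejer (Suc 0) c = 1"
| "fejer (Suc (Suc n)) c = 2 * c * fejer (Suc n) c - fejer n c + 2"

lemma fejer_of_real: "fejer n (of_real c :: 'a::{real_algebra_1,comm_ring_1}) = of_real (fejer n c)"
  by (induction n c rule: fejer.induct) simp_all

lemma fejer_cos: "(1 - cos t) * fejer n (cos t) = 1 - cos (real n * t)" for t :: real
proof (induction n "cos t" rule: fejer.induct)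
  case (3 n)
  have "cos (real (Suc (Suc n)) * t) + cos (real n * t) = 2 * cos t * cos (real (Suc n) * t)"
    using cos_add[of "real (Suc n) * t" t] cos_diff[of "real (Suc n) * t" t] by (simp add: algebra_simps)
  moreover have "(1 - cos t) * fejer (Suc (Suc n)) (cos t) =
      2 * cos t * ((1 - cos t) * fejer (Suc n) (cos t)) - (1 - cos t) * fejer n (cos t) + 2 * (1 - cos t)"
    by (simp add: algebra_simps)
  ultimately show ?case unfolding 3 by (simp add: algebra_simps)
qed simp_all

text \<open>For |c| <= 3 the coefficient of the recursion has modulus at most 6, and 6 times 9 plus
  1 plus 2 is below 81. The growth rate 9 is harmless against \<open>nome ^ 3\<close>.\<close>

lemma norm_fejer_le:
  fixes c :: "'a::{real_normed_field}"
  assumes "norm c \<le> 3"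
  shows "norm (fejer (Suc n) c) \<le> 9 ^ n"
proof (induction n rule: less_induct)
  case (less n)
  consider "n = 0" | "n = 1" | m where "n = Suc (Suc m)"
    by (metis One_nat_def not0_implies_Suc)
  then show ?case
  proof cases
    case 2
    have "norm (2 * c + 2) \<le> 2 * norm c + 2"
      using norm_triangle_ineq[of "2 * c" 2] by (simp add: norm_mult)
    then show ?thesis using assms 2 by simp
  next
    case (3 m)
    have "norm (fejer (Suc n) c) \<le> norm (2 * c * fejer n c) + norm (fejer (Suc m) c) + norm (2::'a)"
      unfolding 3 fejer.simps by (intro order_trans[OF norm_triangle_ineq] add_mono norm_triangle_ineq4) auto
    also have "norm (2 * c * fejer n c) = 2 * norm c * norm (fejer n c)" by (simp add: norm_mult)
    also have "2 * norm c * norm (fejer n c) \<le> 6 * 9 ^ Suc m"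
      using assms less[of "Suc m"] 3 by (intro mult_mono) auto
    also have "norm (fejer (Suc m) c) \<le> 9 ^ m" using less[of m] 3 by simp
    also have "6 * 9 ^ Suc m + 9 ^ m + norm (2::'a) \<le> (9::real) ^ n"
    proof -
      have "1 \<le> (9::real) ^ m" "(9::real) ^ n = 81 * 9 ^ m" "(9::real) ^ Suc m = 9 * 9 ^ m" by (simp_all add: 3)
      then show ?thesis unfolding norm_numeral by linarith
    qed
    finally show ?thesis by simp
  qed simp
qed

lemma fejer_holomorphic [holomorphic_intros]: "(\<lambda>c::complex. fejer n c) holomorphic_on S"
proof (induction n rule: induct_nat_012)
  case (ge2 n)
  then show ?case unfolding fejer.simps by (intro holomorphic_intros)
qed (simp_all only: fejer.simps holomorphic_on_const)

text \<open>The terms k >= 2 of \<open>theta s 0 - theta s \<xi>\<close>, divided by the factor 2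
  nome (1 - c) that is the term k = 1, with c = cos (2 pi \<xi>). The division lowers the exponent
  k^2 of the nome by one.\<close>

definition tail :: "(nat \<Rightarrow> real) \<Rightarrow> 'a::{banach,real_normed_field} \<Rightarrow> 'a" where
  "tail s c = (\<Sum>k. of_real (s (Suc (Suc k)) * nome ^ ((Suc (Suc k))\<^sup>2 - 1)) * fejer (Suc (Suc k)) c)"

text \<open>(k + 2)^2 - 1 = (k + 1) (k + 3) is at least 3 (k + 1), which replaces the Gaussian decay
  by a geometric one that still beats the growth 9^(k + 1) of the kernels.\<close>

lemma tail_term_bound:
  fixes c :: "'a::{real_normed_field}"
  assumes s: "\<And>k. \<bar>s k\<bar> \<le> 1" and c: "norm c \<le> 3"
  shows "norm (of_real (s (Suc (Suc k)) * nome ^ ((Suc (Suc k))\<^sup>2 - 1)) * fejer (Suc (Suc k)) c) \<le> (9 * nome ^ 3) ^ Suc k"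
proof -
  have "(Suc (Suc k))\<^sup>2 - 1 \<ge> 3 * Suc k" by (simp add: power2_eq_square)
  then have "nome ^ ((Suc (Suc k))\<^sup>2 - 1) \<le> nome ^ (3 * Suc k)"
    using nome_pos nome_le by (intro power_decreasing) auto
  also have "\<dots> = (nome ^ 3) ^ Suc k" by (simp only: power_mult)
  finally have 1: "\<bar>s (Suc (Suc k))\<bar> * nome ^ ((Suc (Suc k))\<^sup>2 - 1) \<le> 1 * (nome ^ 3) ^ Suc k"
    using s nome_pos by (intro mult_mono) auto
  have "norm (of_real (s (Suc (Suc k)) * nome ^ ((Suc (Suc k))\<^sup>2 - 1)) * fejer (Suc (Suc k)) c) =
      (\<bar>s (Suc (Suc k))\<bar> * nome ^ ((Suc (Suc k))\<^sup>2 - 1)) * norm (fejer (Suc (Suc k)) c)"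
    using nome_pos by (simp add: norm_mult norm_power abs_mult del: fejer.simps)
  also have "\<dots> \<le> (nome ^ 3) ^ Suc k * 9 ^ Suc k"
    using 1 norm_fejer_le[OF c, of "Suc k"] nome_pos by (intro mult_mono) auto
  also have "\<dots> = (9 * nome ^ 3) ^ Suc k" by (simp only: power_mult_distrib mult.commute)
  finally show ?thesis .
qed

lemma ratio_bound: "0 < 9 * nome ^ 3" "9 * nome ^ 3 \<le> 0.00267"
proof -
  show "0 < 9 * nome ^ 3" using nome_pos by simp
  have "nome ^ 3 \<le> (1/15) ^ 3" using nome_pos nome_le by (intro power_mono) auto
  then show "9 * nome ^ 3 \<le> 0.00267" by (simp add: power3_eq_cube)
qed

lemma summable_ratio: "summable (\<lambda>k. (9 * nome ^ 3) ^ Suc k)"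
  using ratio_bound by (intro summable_mult summable_ignore_initial_segment[of _ 1, simplified] summable_geometric) auto

lemma suminf_ratio_le: "(\<Sum>k. (9 * nome ^ 3) ^ Suc k) \<le> 0.0027"
proof -
  have "(\<lambda>k. (9 * nome ^ 3) * (9 * nome ^ 3) ^ k) sums ((9 * nome ^ 3) * (1 / (1 - 9 * nome ^ 3)))"
    using ratio_bound by (intro sums_mult geometric_sums) auto
  then have "(\<Sum>k. (9 * nome ^ 3) ^ Suc k) = (9 * nome ^ 3) / (1 - 9 * nome ^ 3)"
    by (simp add: sums_iff)
  also have "\<dots> \<le> 0.0027"
    using ratio_bound by (subst pos_divide_le_eq) auto
  finally show ?thesis .
qed

lemma tail_summable:
  fixes c :: "'a::{banach,real_normed_field}"
  assumes "\<And>k. \<bar>s k\<bar> \<le> 1" "norm c \<le> 3"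
  shows "summable (\<lambda>k. of_real (s (Suc (Suc k)) * nome ^ ((Suc (Suc k))\<^sup>2 - 1)) * fejer (Suc (Suc k)) c)"
  by (rule summable_comparison_test'[OF summable_ratio, of 0]) (rule tail_term_bound[OF assms])

lemma norm_tail_le:
  fixes c :: "'a::{banach,real_normed_field}"
  assumes "\<And>k. \<bar>s k\<bar> \<le> 1" "norm c \<le> 3"
  shows "norm (tail s c) \<le> 0.0027"
proof -
  have "norm (tail s c) \<le> (\<Sum>k. (9 * nome ^ 3) ^ Suc k)"
    unfolding tail_def by (rule norm_suminf_le[OF tail_term_bound[OF assms] summable_ratio])
  then show ?thesis using suminf_ratio_le by linarith
qed

lemma tail_of_real:
  assumes "\<And>k. \<bar>s k\<bar> \<le> 1" "\<bar>c\<bar> \<le> 3"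
  shows "tail s (complex_of_real c) = of_real (tail s c)"
proof -
  have "summable (\<lambda>k. s (Suc (Suc k)) * nome ^ ((Suc (Suc k))\<^sup>2 - 1) * fejer (Suc (Suc k)) c)"
    using tail_summable[of s c] assms by simp
  from suminf_of_real[OF this, where 'a = complex] show ?thesis
    unfolding tail_def by (simp only: fejer_of_real of_real_mult of_real_eq_id id_apply)
qed

text \<open>Weierstrass' test: the geometric majorant is the same at all points of the disc, so the
  partial sums, which are polynomials, converge uniformly.\<close>

lemma tail_holomorphic:
  assumes "\<And>k. \<bar>s k\<bar> \<le> 1"
  shows "(tail s :: complex \<Rightarrow> complex) holomorphic_on ball 0 3"
proof (rule holomorphic_uniform_sequence)
  let ?f = "\<lambda>k (c::complex). of_real (s (Suc (Suc k)) * nome ^ ((Suc (Suc k))\<^sup>2 - 1)) * fejer (Suc (Suc k)) c"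
  show "(\<lambda>c. \<Sum>k<n. ?f k c) holomorphic_on ball 0 3" for n
    by (intro holomorphic_intros)
  fix x :: complex assume "x \<in> ball 0 3"
  then obtain d where d: "d > 0" "cball x d \<subseteq> ball 0 3" using open_contains_cball by blast
  have "uniform_limit (cball x d) (\<lambda>n c. \<Sum>k<n. ?f k c) (\<lambda>c. suminf (\<lambda>k. ?f k c)) sequentially"
  proof (rule Weierstrass_m_test[OF _ summable_ratio])
    fix n c assume "c \<in> cball x d"
    then have "norm c \<le> 3" using d by auto
    then show "norm (?f n c) \<le> (9 * nome ^ 3) ^ Suc n" by (rule tail_term_bound[OF assms])
  qed
  then show "\<exists>d>0. cball x d \<subseteq> ball 0 3 \<and> uniform_limit (cball x d) (\<lambda>n c. \<Sum>k<n. ?f k c) (tail s) sequentially"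
    using d unfolding tail_def by blast
qed simp

text \<open>Both theta functions have the shape \<open>\<Sum> 2 s\<^sub>k nome^(k\<^sup>2) cos (2 \<pi> k \<xi>)\<close>, with \<open>s\<close> the
  indicator of the positive, respectively of the odd integers.\<close>

definition theta :: "(nat \<Rightarrow> real) \<Rightarrow> real \<Rightarrow> real" where
  "theta s \<xi> = (\<Sum>k. 2 * s k * nome ^ (k\<^sup>2) * cos (2 * pi * real k * \<xi>))"

definition ind_pos :: "nat \<Rightarrow> real" where "ind_pos k = (if k = 0 then 0 else 1)"

definition ind_odd :: "nat \<Rightarrow> real" where "ind_odd k = (if odd k then 1 else 0)"

lemma ind_simps [simp]: "\<bar>ind_pos k\<bar> \<le> 1" "\<bar>ind_odd k\<bar> \<le> 1" "0 \<le> ind_pos k" "0 \<le> ind_odd k"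
  "ind_pos 0 = 0" "ind_odd 0 = 0" "ind_pos (Suc 0) = 1" "ind_odd (Suc 0) = 1"
  by (auto simp: ind_pos_def ind_odd_def)

lemma summable_nome: "summable (\<lambda>k. nome ^ (k\<^sup>2))"
proof (rule summable_comparison_test'[of "\<lambda>k. nome ^ k" 0])
  show "summable (\<lambda>k. nome ^ k)" using nome_pos nome_le by (intro summable_geometric) auto
  fix k :: nat
  have "k \<le> k\<^sup>2" by (simp add: power2_nat_le_imp_le power2_eq_square)
  then show "norm (nome ^ k\<^sup>2) \<le> nome ^ k" using nome_pos nome_le by (auto intro!: power_decreasing)
qed

lemma theta_summable:
  assumes "\<And>k. \<bar>s k\<bar> \<le> 1"
  shows "summable (\<lambda>k. 2 * s k * nome ^ (k\<^sup>2) * cos (2 * pi * real k * \<xi>))"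
proof (rule summable_comparison_test'[of "\<lambda>k. 2 * nome ^ (k\<^sup>2)" 0])
  show "summable (\<lambda>k. 2 * nome ^ (k\<^sup>2))" by (intro summable_mult summable_nome)
  fix k
  have "\<bar>s k\<bar> * nome ^ (k\<^sup>2) * \<bar>cos (2 * pi * real k * \<xi>)\<bar> \<le> 1 * nome ^ (k\<^sup>2) * 1"
    using assms nome_pos by (intro mult_mono) auto
  then show "norm (2 * s k * nome ^ (k\<^sup>2) * cos (2 * pi * real k * \<xi>)) \<le> 2 * nome ^ (k\<^sup>2)"
    using nome_pos by (simp add: abs_mult mult.assoc)
qed

lemma ell_fun_theta: "ell_fun \<xi> = 1 + theta ind_pos \<xi>"
proof -
  have "theta ind_pos \<xi> = (\<Sum>k. 2 * ind_pos (Suc k) * nome ^ ((Suc k)\<^sup>2) * cos (2 * pi * real (Suc k) * \<xi>))"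
    unfolding theta_def by (rule suminf_mono_reindex[symmetric]) (auto simp: strict_mono_def image_iff gr0_conv_Suc ind_pos_def)
  also have "\<dots> = (\<Sum>k. 2 * (nome ^ ((Suc k)\<^sup>2) * cos (2 * pi * real (Suc k) * \<xi>)))"
    by (simp add: ind_pos_def mult.assoc)
  also have "\<dots> = 2 * (\<Sum>k. nome ^ ((Suc k)\<^sup>2) * cos (2 * pi * real (Suc k) * \<xi>))"
  proof (rule suminf_mult)
    have "summable (\<lambda>k. 2 * ind_pos (Suc k) * nome ^ ((Suc k)\<^sup>2) * cos (2 * pi * real (Suc k) * \<xi>))"
      by (rule iffD2[OF summable_Suc_iff theta_summable[OF ind_simps(1)]])
    then have "summable (\<lambda>k. 2 * (nome ^ ((Suc k)\<^sup>2) * cos (2 * pi * real (Suc k) * \<xi>)))"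
      by (simp add: ind_pos_def mult.assoc)
    then show "summable (\<lambda>k. nome ^ ((Suc k)\<^sup>2) * cos (2 * pi * real (Suc k) * \<xi>))"
      by (subst (asm) summable_cmult_iff) simp
  qed
  finally show ?thesis unfolding ell_fun_def nome_power by simp
qed

lemma h_fun_theta: "h_fun \<xi> = theta ind_odd \<xi>"
proof -
  have sm: "strict_mono (\<lambda>k::nat. 2 * k + 1)" by (auto simp: strict_mono_def)
  have nr: "2 * ind_odd n * nome ^ (n\<^sup>2) * cos (2 * pi * real n * \<xi>) = 0" if "n \<notin> range (\<lambda>k. 2 * k + 1)" for n
    using that by (auto simp: ind_odd_def elim!: oddE)
  have "theta ind_odd \<xi> = (\<Sum>k. 2 * ind_odd (2 * k + 1) * nome ^ ((2 * k + 1)\<^sup>2) * cos (2 * pi * real (2 * k + 1) * \<xi>))"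
    unfolding theta_def by (rule suminf_mono_reindex[OF sm nr, symmetric])
  also have "\<dots> = (\<Sum>k. 2 * (nome ^ ((2 * k + 1)\<^sup>2) * cos (2 * real (2 * k + 1) * pi * \<xi>)))"
    by (simp add: ind_odd_def mult_ac)
  also have "\<dots> = 2 * (\<Sum>k. nome ^ ((2 * k + 1)\<^sup>2) * cos (2 * real (2 * k + 1) * pi * \<xi>))"
  proof (rule suminf_mult)
    have "summable (\<lambda>k. 2 * ind_odd (2 * k + 1) * nome ^ ((2 * k + 1)\<^sup>2) * cos (2 * pi * real (2 * k + 1) * \<xi>))"
      by (rule iffD2[OF summable_mono_reindex[OF sm, of "\<lambda>k. 2 * ind_odd k * nome ^ (k\<^sup>2) * cos (2 * pi * real k * \<xi>)"]])
        (rule nr, assumption, rule theta_summable, rule ind_simps)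
    then have "summable (\<lambda>k. 2 * (nome ^ ((2 * k + 1)\<^sup>2) * cos (2 * real (2 * k + 1) * pi * \<xi>)))"
      by (simp add: ind_odd_def mult_ac)
    then show "summable (\<lambda>k. nome ^ ((2 * k + 1)\<^sup>2) * cos (2 * real (2 * k + 1) * pi * \<xi>))"
      by (subst (asm) summable_cmult_iff) simp
  qed
  finally show ?thesis unfolding h_fun_def nome_power by simp
qed

text \<open>The term k = 0 vanishes, k = 1 is the prefactor itself, and every k >= 2 contains 1 - c
  by \<open>fejer_cos\<close>. This common double zero at \<xi> = 0 of the two theta increments is
  the origin of the double zero of \<mu>.\<close>

lemma theta_zero_minus_theta:
  assumes s: "\<And>k. \<bar>s k\<bar> \<le> 1" "s 0 = 0" "s 1 = 1"
  shows "theta s 0 - theta s \<xi> = 2 * nome * (1 - cos (2 * pi * \<xi>)) * (1 + tail s (cos (2 * pi * \<xi>)))"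
proof -
  define c where "c = cos (2 * pi * \<xi>)"
  have c: "norm c \<le> 3" by (simp add: c_def order_trans[OF abs_cos_le_one])
  let ?g = "\<lambda>k. 2 * s k * nome ^ (k\<^sup>2) * ((1 - c) * fejer k c)"
  have eq: "2 * s k * nome ^ (k\<^sup>2) * cos (2 * pi * real k * 0) - 2 * s k * nome ^ (k\<^sup>2) * cos (2 * pi * real k * \<xi>) = ?g k" for k
  proof -
    have "2 * s k * nome ^ (k\<^sup>2) * cos (2 * pi * real k * 0) - 2 * s k * nome ^ (k\<^sup>2) * cos (2 * pi * real k * \<xi>) =
        2 * s k * nome ^ (k\<^sup>2) * (1 - cos (real k * (2 * pi * \<xi>)))"
      by (simp add: algebra_simps)
    then show ?thesis unfolding fejer_cos[of "2 * pi * \<xi>" k, symmetric] c_def .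
  qed
  have ts: "summable (\<lambda>k. 2 * s k * nome ^ (k\<^sup>2) * cos (2 * pi * real k * x))" for x
    by (rule theta_summable) (rule s)
  have sm: "summable ?g"
    using summable_diff[OF ts[of 0] ts[of \<xi>]] unfolding eq .
  have "theta s 0 - theta s \<xi> = (\<Sum>k. ?g k)"
    unfolding theta_def by (subst suminf_diff[OF ts ts]) (simp only: eq)
  also have "\<dots> = (\<Sum>k. ?g (k + 2)) + (\<Sum>k<2. ?g k)"
    by (rule suminf_split_initial_segment[OF sm])
  also have "(\<Sum>k<2. ?g k) = 2 * nome * (1 - c)"
    using s by (simp add: eval_nat_numeral)
  also have "(\<Sum>k. ?g (k + 2)) = (\<Sum>k. 2 * nome * (1 - c) * (of_real (s (Suc (Suc k)) * nome ^ ((Suc (Suc k))\<^sup>2 - 1)) * fejer (Suc (Suc k)) c))"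
  proof (rule suminf_cong)
    fix k
    have "nome ^ ((k + 2)\<^sup>2) = nome * nome ^ ((Suc (Suc k))\<^sup>2 - 1)"
      by (simp add: power2_eq_square flip: power_Suc)
    then show "?g (k + 2) = 2 * nome * (1 - c) * (of_real (s (Suc (Suc k)) * nome ^ ((Suc (Suc k))\<^sup>2 - 1)) * fejer (Suc (Suc k)) c)"
      by (simp del: fejer.simps)
  qed
  also have "\<dots> = 2 * nome * (1 - c) * tail s c"
    unfolding tail_def by (rule suminf_mult[OF tail_summable[OF s(1) c]])
  finally show ?thesis by (simp add: c_def algebra_simps)
qed

text \<open>Two-sided, because the lower bound serves to keep the symbol positive and the upper one
  to control errors. The terms k >= 2 are at most 0.0027 of the first.\<close>

lemma theta_zero_bounds:
  assumes s: "\<And>k. \<bar>s k\<bar> \<le> 1" "\<And>k. 0 \<le> s k" "s 0 = 0" "s 1 = 1"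
  shows "2 * nome \<le> theta s 0" "theta s 0 \<le> 2 * nome * 1.0027"
proof -
  let ?g = "\<lambda>k. 2 * s k * nome ^ (k\<^sup>2)"
  have "summable (\<lambda>k. 2 * s k * nome ^ (k\<^sup>2) * cos (2 * pi * real k * 0))"
    by (rule theta_summable) (rule s)
  then have sm: "summable ?g" by simp
  have "theta s 0 = (\<Sum>k. ?g (k + 2)) + (\<Sum>k<2. ?g k)"
    unfolding theta_def using suminf_split_initial_segment[OF sm, of 2] by simp
  also have "(\<Sum>k<2. ?g k) = 2 * nome" using s by (simp add: eval_nat_numeral)
  finally have eq: "theta s 0 = (\<Sum>k. ?g (k + 2)) + 2 * nome" .
  have sm2: "summable (\<lambda>k. ?g (k + 2))" by (rule summable_ignore_initial_segment[OF sm])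
  have "0 \<le> (\<Sum>k. ?g (k + 2))" using s nome_pos by (intro suminf_nonneg sm2) auto
  then show "2 * nome \<le> theta s 0" using eq by simp
  have "(\<Sum>k. ?g (k + 2)) \<le> (\<Sum>k. 2 * nome * (9 * nome ^ 3) ^ Suc k)"
  proof (rule suminf_le[OF _ sm2 summable_mult[OF summable_ratio]])
    fix k
    have "(k + 2)\<^sup>2 \<ge> 1 + 3 * Suc k" by (simp add: power2_eq_square)
    then have "nome ^ ((k + 2)\<^sup>2) \<le> nome ^ (1 + 3 * Suc k)" using nome_pos nome_le by (intro power_decreasing) auto
    also have "\<dots> = nome * (nome ^ 3) ^ Suc k" by (simp only: power_add power_mult power_one_right)
    also have "\<dots> \<le> nome * (9 * nome ^ 3) ^ Suc k" using nome_pos by (intro mult_left_mono power_mono) auto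
    finally have "s (k + 2) * nome ^ ((k + 2)\<^sup>2) \<le> 1 * (nome * (9 * nome ^ 3) ^ Suc k)"
      using s(1)[of "k + 2"] s(2)[of "k + 2"] nome_pos by (intro mult_mono) auto
    then show "?g (k + 2) \<le> 2 * nome * (9 * nome ^ 3) ^ Suc k" by simp
  qed
  also have "\<dots> = 2 * nome * (\<Sum>k. (9 * nome ^ 3) ^ Suc k)" by (rule suminf_mult[OF summable_ratio])
  also have "\<dots> \<le> 2 * nome * 0.0027" using suminf_ratio_le nome_pos by (intro mult_left_mono) auto
  finally show "theta s 0 \<le> 2 * nome * 1.0027" using eq by simp
qed

section \<open>Restrictions of holomorphic functions to the real line\<close>

text \<open>A holomorphic extension to one open neighbourhood of the real line yields all
  derivatives at once. The property is stable under the operations that build the amplitudes and the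
  oscillating factors.\<close>

definition real_analytic :: "(real \<Rightarrow> complex) \<Rightarrow> bool" where
  "real_analytic \<phi> \<longleftrightarrow> (\<exists>F S. open S \<and> (\<forall>x. complex_of_real x \<in> S) \<and> F holomorphic_on S \<and>
     (\<forall>x. F (of_real x) = \<phi> x))"

lemma real_analyticI:
  "open S \<Longrightarrow> (\<And>x. complex_of_real x \<in> S) \<Longrightarrow> F holomorphic_on S \<Longrightarrow> (\<And>x. F (of_real x) = \<phi> x) \<Longrightarrow> real_analytic \<phi>"
  unfolding real_analytic_def by blast

lemma real_analytic_const: "real_analytic (\<lambda>x. c)"
  by (rule real_analyticI[of UNIV "\<lambda>_. c"]) auto

lemma real_analytic_of_real: "real_analytic of_real"
  by (rule real_analyticI[of UNIV "\<lambda>z. z"]) auto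

lemma real_analytic_binary:
  assumes "real_analytic f" "real_analytic g"
    and op: "\<And>F G S. F holomorphic_on S \<Longrightarrow> G holomorphic_on S \<Longrightarrow> (\<lambda>z. H (F z) (G z)) holomorphic_on S"
  shows "real_analytic (\<lambda>x. H (f x) (g x))"
proof -
  from assms obtain F S G T where "open S" "\<forall>x. complex_of_real x \<in> S" "F holomorphic_on S" "\<forall>x. F (of_real x) = f x"
    "open T" "\<forall>x. complex_of_real x \<in> T" "G holomorphic_on T" "\<forall>x. G (of_real x) = g x"
    unfolding real_analytic_def by metis
  then show ?thesis
    by (intro real_analyticI[of "S \<inter> T" "\<lambda>z. H (F z) (G z)"] open_Int op) (auto intro: holomorphic_on_subset)
qed

lemma real_analytic_add: "real_analytic f \<Longrightarrow> real_analytic g \<Longrightarrow> real_analytic (\<lambda>x. f x + g x)"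
  by (rule real_analytic_binary) (auto intro: holomorphic_on_add)

lemma real_analytic_mult: "real_analytic f \<Longrightarrow> real_analytic g \<Longrightarrow> real_analytic (\<lambda>x. f x * g x)"
  by (rule real_analytic_binary) (auto intro: holomorphic_on_mult)

lemma real_analytic_exp:
  assumes "real_analytic f"
  shows "real_analytic (\<lambda>x. exp (f x))"
  by (rule real_analytic_binary[OF assms assms, of "\<lambda>u v. exp u"]) (auto intro: holomorphic_intros)

lemma has_vector_derivative_of_real_restrict:
  assumes "F holomorphic_on S" "open S" "complex_of_real x \<in> S"
  shows "((\<lambda>x. (deriv ^^ j) F (of_real x)) has_vector_derivative (deriv ^^ Suc j) F (of_real x)) (at x within T)"
proof -
  have "(deriv ^^ j) F holomorphic_on S" by (rule holomorphic_higher_deriv[OF assms(1,2)])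
  then have "((deriv ^^ j) F has_field_derivative deriv ((deriv ^^ j) F) (of_real x)) (at (of_real x))"
    using assms(2,3) by (rule holomorphic_derivI)
  then show ?thesis by (simp add: has_vector_derivative_real_field)
qed

lemma DERIV_Re_restrict:
  assumes "F holomorphic_on S" "open S" "complex_of_real x \<in> S"
  shows "((\<lambda>x. Re ((deriv ^^ j) F (of_real x))) has_real_derivative Re ((deriv ^^ Suc j) F (of_real x))) (at x)"
  by (rule has_field_derivative_Re[OF has_vector_derivative_of_real_restrict[OF assms]])

lemma real_analytic_vector_derivative:
  assumes "real_analytic f"
  shows "\<exists>f'. (\<forall>x. (f has_vector_derivative f' x) (at x)) \<and> real_analytic f'"
proof -
  from assms obtain F S where F: "open S" "\<forall>x. complex_of_real x \<in> S" "F holomorphic_on S" "\<forall>x. F (of_real x) = f x"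
    unfolding real_analytic_def by metis
  have "(f has_vector_derivative (deriv ^^ Suc 0) F (of_real x)) (at x)" for x
    using has_vector_derivative_of_real_restrict[OF F(3,1), of x 0] F(2,4) by simp
  moreover have "real_analytic (\<lambda>x. (deriv ^^ Suc 0) F (of_real x))"
    by (rule real_analyticI[OF F(1) F(2)[rule_format] holomorphic_higher_deriv[OF F(3,1), of "Suc 0"] refl])
  ultimately show ?thesis by (intro exI[of _ "\<lambda>x. (deriv ^^ Suc 0) F (of_real x)"] conjI allI)
qed

lemma real_analytic_continuous: "real_analytic f \<Longrightarrow> continuous_on S f"
  using real_analytic_vector_derivative[of f]
  by (meson continuous_at_imp_continuous_on has_vector_derivative_continuous)

text \<open>Along the real line the n-th real derivative of Re f is the real part of the n-th
  complex derivative of the extension.\<close>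

lemma smooth_Re:
  assumes "real_analytic f"
  shows "smooth (\<lambda>x. Re (f x))"
proof -
  from assms obtain F S where F: "open S" "\<forall>x. complex_of_real x \<in> S" "F holomorphic_on S" "\<forall>x. F (of_real x) = f x"
    unfolding real_analytic_def by metis
  have D: "((\<lambda>x. Re ((deriv ^^ j) F (of_real x))) has_real_derivative Re ((deriv ^^ Suc j) F (of_real x))) (at x)" for x j
    using DERIV_Re_restrict[OF F(3,1)] F(2) by blast
  have eq: "(deriv ^^ n) (\<lambda>x. Re (f x)) = (\<lambda>x. Re ((deriv ^^ n) F (of_real x)))" for n
  proof (induction n)
    case 0
    then show ?case using F(4) by simp
  next
    case (Suc n)
    have "(deriv ^^ Suc n) (\<lambda>x. Re (f x)) = deriv (\<lambda>x. Re ((deriv ^^ n) F (of_real x)))"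
      by (simp only: funpow.simps o_apply Suc)
    also have "\<dots> = (\<lambda>x. Re ((deriv ^^ Suc n) F (of_real x)))"
      using DERIV_imp_deriv[OF D] by (rule ext)
    finally show ?case .
  qed
  show ?thesis unfolding smooth_def eq
    using D by (meson real_differentiable_def)
qed

lemma smooth_Im:
  assumes "real_analytic f"
  shows "smooth (\<lambda>x. Im (f x))"
  using smooth_Re[OF real_analytic_mult[OF real_analytic_const[of "-\<i>"] assms]] by simp

text \<open>All symbols are functions of cos (2 pi \<xi>), so an extension in the variable c near
  [-1, 1] is enough; the complex cosine carries a neighbourhood of the real line there.\<close>

lemma real_analytic_cos_compose:
  assumes "open S" "\<And>c. -1 \<le> c \<Longrightarrow> c \<le> 1 \<Longrightarrow> complex_of_real c \<in> S" "G holomorphic_on S"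
    and "\<And>\<xi>. \<phi> \<xi> = G (of_real (cos (2 * pi * \<xi>)))"
  shows "real_analytic \<phi>"
proof (rule real_analyticI)
  let ?c = "\<lambda>z::complex. cos (2 * of_real pi * z)"
  have c: "?c holomorphic_on T" for T by (intro holomorphic_intros)
  show "open (?c -` S)"
    by (rule open_vimage[OF assms(1)]) (intro continuous_intros)
  have cc: "?c (of_real x) = of_real (cos (2 * pi * x))" for x
    by (simp add: cos_of_real[symmetric])
  show "of_real x \<in> ?c -` S" for x
    unfolding vimage_eq cc by (intro assms(2)) auto
  show "(G \<circ> ?c) holomorphic_on ?c -` S"
    by (rule holomorphic_on_compose_gen[OF c assms(3)]) auto
  show "(G \<circ> ?c) (of_real x) = \<phi> x" for x
    unfolding o_apply cc assms(4) ..
qed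

text \<open>Allows an identity valid on an open set to be differentiated repeatedly.\<close>

lemma DERIV_eq_on_open:
  fixes f g :: "real \<Rightarrow> real"
  assumes "open I" "x \<in> I" "\<And>y. y \<in> I \<Longrightarrow> f y = g y"
    and "(f has_real_derivative a) (at x)" "(g has_real_derivative b) (at x)"
  shows "a = b"
proof -
  have "(g has_real_derivative a) (at x)"
    by (rule has_field_derivative_transform_within_open[OF assms(4,1,2)]) (rule assms(3))
  then show ?thesis using assms(5) by (rule DERIV_unique)
qed

section \<open>Factorization of the symbol\<close>

lemma ind_le_1 [simp]: "ind_pos k \<le> 1" "ind_odd k \<le> 1"
  by (auto simp: ind_pos_def ind_odd_def)

definition kap :: real where "kap = 1 / (gam * sqrt pi)"

definition xn :: real where "xn = 2 * nome"

text \<open>The cofactor in a - b after the explicit square of the zero is split off; with small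
  tails it is close to 2 - 1 = 1. This and the following functions are polymorphic because they are
  estimated for real and complex c alike.\<close>

definition symb_diff :: "'a::{banach,real_normed_field} \<Rightarrow> 'a" where
  "symb_diff c = 2 * (1 + tail ind_odd c)\<^sup>2 - (1 + tail ind_pos c)\<^sup>2"

definition theta_l :: "'a::{banach,real_normed_field} \<Rightarrow> 'a" where
  "theta_l c = of_real (ell_fun 0) - of_real xn * (1 - c) * (1 + tail ind_pos c)"

definition theta_h :: "'a::{banach,real_normed_field} \<Rightarrow> 'a" where
  "theta_h c = of_real (h_fun 0) - of_real xn * (1 - c) * (1 + tail ind_odd c)"

definition symb_sum :: "'a::{banach,real_normed_field} \<Rightarrow> 'a" where
  "symb_sum c = 2 * theta_l c * of_real (ell_fun 0) - 4 * theta_h c * of_real (h_fun 0)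
     - of_real (ell_fun 0) ^ 2 + 2 * of_real (h_fun 0) ^ 2 + theta_l c ^ 2 - 2 * theta_h c ^ 2"

definition symb_prod :: "'a::{banach,real_normed_field} \<Rightarrow> 'a" where
  "symb_prod c = symb_diff c * symb_sum c"

lemma kap_pos: "kap > 0" and xn_pos: "xn > 0" and xn_le: "xn \<le> 2 / 15"
  using gam_pos nome_pos nome_le by (auto simp: kap_def xn_def)

lemma ell_fun_cos: "ell_fun \<xi> = theta_l (cos (2 * pi * \<xi>))"
  using theta_zero_minus_theta[of ind_pos \<xi>] by (simp add: theta_l_def ell_fun_theta xn_def)

lemma h_fun_cos: "h_fun \<xi> = theta_h (cos (2 * pi * \<xi>))"
  using theta_zero_minus_theta[of ind_odd \<xi>] by (simp add: theta_h_def h_fun_theta xn_def)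

text \<open>Polarization: \<open>a - b\<close> is, up to the factor \<open>kap\<close>, the quadratic form \<open>2 H\<^sup>2 - L\<^sup>2\<close> in the increments
  of the theta functions from \<open>0\<close>, which both vanish like \<open>1 - cos (2 \<pi> \<xi>)\<close>.\<close>

lemma a_minus_b: "a_fun \<xi> - b_fun \<xi> = kap * xn\<^sup>2 * (1 - cos (2 * pi * \<xi>))\<^sup>2 * symb_diff (cos (2 * pi * \<xi>))"
proof -
  define c where "c = cos (2 * pi * \<xi>)"
  have "a_fun \<xi> - b_fun \<xi> = kap * (2 * (h_fun 0 - h_fun \<xi>)\<^sup>2 - (ell_fun 0 - ell_fun \<xi>)\<^sup>2)"
    unfolding a_fun_def b_fun_def lam_def kap_def by (simp add: power2_eq_square divide_inverse algebra_simps)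
  also have "h_fun 0 - h_fun \<xi> = xn * (1 - c) * (1 + tail ind_odd c)"
    by (simp add: h_fun_cos[of \<xi>] theta_h_def c_def)
  also have "ell_fun 0 - ell_fun \<xi> = xn * (1 - c) * (1 + tail ind_pos c)"
    by (simp add: ell_fun_cos[of \<xi>] theta_l_def c_def)
  finally show ?thesis
    unfolding symb_diff_def c_def[symmetric] power_mult_distrib by (simp only: right_diff_distrib mult_ac)
qed

lemma a_plus_b: "a_fun \<xi> + b_fun \<xi> = kap * symb_sum (cos (2 * pi * \<xi>))"
  unfolding a_fun_def b_fun_def lam_def kap_def symb_sum_def ell_fun_cos[of \<xi>] h_fun_cos[of \<xi>]
  by (simp add: power2_eq_square divide_inverse algebra_simps)

lemma sq_diff: "(a_fun \<xi>)\<^sup>2 - (b_fun \<xi>)\<^sup>2 = (kap * xn * (1 - cos (2 * pi * \<xi>)))\<^sup>2 * symb_prod (cos (2 * pi * \<xi>))"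
proof -
  have "(a_fun \<xi>)\<^sup>2 - (b_fun \<xi>)\<^sup>2 = (a_fun \<xi> - b_fun \<xi>) * (a_fun \<xi> + b_fun \<xi>)"
    by (simp add: power2_eq_square algebra_simps)
  then show ?thesis unfolding a_minus_b a_plus_b symb_prod_def by (simp add: power2_eq_square)
qed

text \<open>The root of a^2 - b^2 could fail to be smooth at its zeros. Here the zero is an explicit
  square, which leaves the root as the nonnegative factor 1 - cos (2 pi \<xi>); what remains under
  the root is shown below to be positive.\<close>

lemma mu_eq: "mu \<xi> = kap * xn * (1 - cos (2 * pi * \<xi>)) * sqrt (symb_prod (cos (2 * pi * \<xi>)))"
  unfolding mu_def sq_diff using kap_pos xn_pos by (simp add: real_sqrt_mult)

lemma symb_of_real:
  assumes "\<bar>c\<bar> \<le> 3"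
  shows "symb_diff (complex_of_real c) = of_real (symb_diff c)" "symb_sum (complex_of_real c) = of_real (symb_sum c)"
    "symb_prod (complex_of_real c) = of_real (symb_prod c)" "theta_l (complex_of_real c) = of_real (theta_l c)"
    "theta_h (complex_of_real c) = of_real (theta_h c)"
proof -
  have "tail ind_pos (complex_of_real c) = of_real (tail ind_pos c)"
    "tail ind_odd (complex_of_real c) = of_real (tail ind_odd c)"
    by (rule tail_of_real, rule ind_simps, rule assms)+
  then show "symb_diff (complex_of_real c) = of_real (symb_diff c)" "symb_sum (complex_of_real c) = of_real (symb_sum c)"
    "symb_prod (complex_of_real c) = of_real (symb_prod c)" "theta_l (complex_of_real c) = of_real (theta_l c)"
    "theta_h (complex_of_real c) = of_real (theta_h c)"
    by (simp_all add: symb_diff_def symb_sum_def symb_prod_def theta_l_def theta_h_def)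
qed

lemma symb_holomorphic:
  "(theta_l :: complex \<Rightarrow> complex) holomorphic_on ball 0 3" "(theta_h :: complex \<Rightarrow> complex) holomorphic_on ball 0 3"
  "(symb_diff :: complex \<Rightarrow> complex) holomorphic_on ball 0 3" "(symb_sum :: complex \<Rightarrow> complex) holomorphic_on ball 0 3"
  "(symb_prod :: complex \<Rightarrow> complex) holomorphic_on ball 0 3"
proof -
  have t: "(tail ind_pos :: complex \<Rightarrow> complex) holomorphic_on ball 0 3" "(tail ind_odd :: complex \<Rightarrow> complex) holomorphic_on ball 0 3"
    by (rule tail_holomorphic, rule ind_simps)+
  show 1: "(theta_l :: complex \<Rightarrow> complex) holomorphic_on ball 0 3" and 2: "(theta_h :: complex \<Rightarrow> complex) holomorphic_on ball 0 3"
    and 3: "(symb_diff :: complex \<Rightarrow> complex) holomorphic_on ball 0 3"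
    unfolding theta_l_def[abs_def] theta_h_def[abs_def] symb_diff_def[abs_def] by (intro holomorphic_intros t)+
  show 4: "(symb_sum :: complex \<Rightarrow> complex) holomorphic_on ball 0 3"
    unfolding symb_sum_def[abs_def] by (intro holomorphic_intros 1 2)
  show "(symb_prod :: complex \<Rightarrow> complex) holomorphic_on ball 0 3"
    unfolding symb_prod_def[abs_def] by (intro holomorphic_intros 3 4)
qed

section \<open>Comparison of the symbol with a quadratic polynomial\<close>

definition A0 :: real where "A0 = 2 * (ell_fun 0)\<^sup>2 - 4 * (h_fun 0)\<^sup>2"
definition A1 :: real where "A1 = xn * (4 * ell_fun 0 - 8 * h_fun 0)"

text \<open>\<open>symb_prod\<close> with both tails set to 0: \<open>symb_diff\<close> is then 1,
  and \<open>symb_sum\<close> is this quadratic in y = xn (1 - c).\<close>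

definition symb_main :: "'a::{banach,real_normed_field} \<Rightarrow> 'a" where
  "symb_main c = of_real A0 - of_real A1 * (1 - c) - of_real (xn\<^sup>2) * (1 - c)\<^sup>2"

lemma ell0_bounds: "1 + xn \<le> ell_fun 0" "ell_fun 0 \<le> 1 + 1.0027 * xn"
  using theta_zero_bounds[of ind_pos] by (simp_all add: ell_fun_theta xn_def)

lemma h0_bounds: "xn \<le> h_fun 0" "h_fun 0 \<le> 1.0027 * xn"
  using theta_zero_bounds[of ind_odd] by (simp_all add: h_fun_theta xn_def)

lemma norm_mult_le: "norm a \<le> A \<Longrightarrow> norm b \<le> B \<Longrightarrow> norm (a * b) \<le> A * B"
  for a b :: "'a::real_normed_field"
  by (simp add: norm_mult mult_mono' order_trans[OF norm_ge_zero])

lemma norm_square_tail: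
  fixes r :: "'a::real_normed_field"
  assumes "norm r \<le> 0.0027"
  shows "norm (2 * r + r\<^sup>2) \<le> 0.00541"
proof -
  have "norm (r\<^sup>2) \<le> 0.0027 * 0.0027" unfolding power2_eq_square by (rule norm_mult_le[OF assms assms])
  then show ?thesis using norm_triangle_ineq[of "2 * r" "r\<^sup>2"] assms by (simp add: norm_mult)
qed

text \<open>The deviation consists of three copies of 2 r + r^2 with |r| <= 0.0027, each below
  0.00541.\<close>

lemma symb_diff_bound:
  fixes c :: "'a::{banach,real_normed_field}"
  assumes "norm c \<le> 3"
  shows "norm (symb_diff c - 1) \<le> 0.01623"
proof -
  define r :: 'a where "r = tail ind_pos c"
  define s :: 'a where "s = tail ind_odd c"
  have r: "norm (2 * r + r\<^sup>2) \<le> 0.00541" and s: "norm (2 * s + s\<^sup>2) \<le> 0.00541"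
    unfolding r_def s_def by (intro norm_square_tail norm_tail_le ind_simps assms)+
  have "symb_diff c - 1 = 2 * (2 * s + s\<^sup>2) - (2 * r + r\<^sup>2)"
    by (simp add: symb_diff_def r_def s_def power2_eq_square algebra_simps)
  also have "norm \<dots> \<le> norm (2 * (2 * s + s\<^sup>2)) + norm (2 * r + r\<^sup>2)" by (rule norm_triangle_ineq4)
  also have "norm (2 * (2 * s + s\<^sup>2)) = 2 * norm (2 * s + s\<^sup>2)" by (simp only: norm_mult norm_numeral)
  finally show ?thesis using r s by simp
qed

lemma norm_of_real_le: "0 \<le> r \<Longrightarrow> r \<le> B \<Longrightarrow> norm (of_real r :: 'a::real_normed_field) \<le> B"
  by simp

text \<open>Every term of the difference carries a tail, of size at most 0.0027. The other factors
  are bounded through xn <= 2/15 and |1 - c| <= 4, whence |y| <= 0.53336. The product is handled as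
  (\<open>symb_diff\<close> - 1) times \<open>symb_sum\<close> plus the error of
  \<open>symb_sum\<close>.\<close>

lemma symb_main_bound:
  fixes c :: "'a::{banach,real_normed_field}"
  assumes "norm c \<le> 3"
  shows "norm (symb_prod c - symb_main c) \<le> 0.1"
proof -
  define r :: 'a where "r = tail ind_pos c"
  define s :: 'a where "s = tail ind_odd c"
  define y :: 'a where "y = of_real xn * (1 - c)"
  have r: "norm r \<le> 0.0027" and s: "norm s \<le> 0.0027"
    unfolding r_def s_def by (intro norm_tail_le ind_simps assms)+
  have r2: "norm (2 * r + r\<^sup>2) \<le> 0.00541" and s2: "norm (2 * s + s\<^sup>2) \<le> 0.00541"
    by (intro norm_square_tail r s)+
  have c: "norm (1 - c) \<le> 4" using norm_triangle_ineq4[of 1 c] assms by simp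
  have xn: "norm (of_real xn :: 'a) \<le> 0.13334" using xn_pos xn_le by simp
  have y: "norm y \<le> 0.53336" unfolding y_def using norm_mult_le[OF xn c] by simp
  have y2: "norm (y\<^sup>2) \<le> 0.28448" unfolding power2_eq_square using norm_mult_le[OF y y] by simp
  have l0: "norm (of_real (ell_fun 0) :: 'a) \<le> 1.1337" using ell0_bounds xn_le xn_pos by simp
  have h0: "norm (of_real (h_fun 0) :: 'a) \<le> 0.1337" using h0_bounds xn_le xn_pos by simp
  have main: "symb_main c = of_real A0 - (4 * of_real (ell_fun 0) - 8 * of_real (h_fun 0)) * y - y\<^sup>2"
    by (simp add: symb_main_def A1_def y_def power2_eq_square algebra_simps)
  have eq: "symb_sum c - symb_main c = 8 * (of_real (h_fun 0) * (y * s)) - 4 * (of_real (ell_fun 0) * (y * r))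
      + (y\<^sup>2 * (2 * r + r\<^sup>2) - 2 * (y\<^sup>2 * (2 * s + s\<^sup>2)))"
    unfolding main symb_sum_def theta_l_def theta_h_def A0_def r_def[symmetric] s_def[symmetric] y_def[symmetric]
    by (simp add: power2_eq_square algebra_simps)
  have d': "norm (symb_sum c - symb_main c) \<le> (8 * (0.1337 * (0.53336 * 0.0027)) + 4 * (1.1337 * (0.53336 * 0.0027)))
      + (0.28448 * 0.00541 + 2 * (0.28448 * 0.00541))"
    unfolding eq
    by (intro order_trans[OF norm_triangle_ineq] order_trans[OF norm_triangle_ineq4] add_mono norm_mult_le
        h0 l0 y2 r2 s2 y r s) auto
  have d: "norm (symb_sum c - symb_main c) \<le> 0.0128" by (rule order_trans[OF d']) simp
  have A0: "0 \<le> A0" "A0 \<le> 2.5706"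
  proof -
    have "(ell_fun 0)\<^sup>2 \<le> 1.1337\<^sup>2" "1 \<le> (ell_fun 0)\<^sup>2" "(h_fun 0)\<^sup>2 \<le> 0.1337\<^sup>2"
      using ell0_bounds h0_bounds xn_pos xn_le by (auto intro!: power_mono)
    then have "(ell_fun 0)\<^sup>2 \<le> 1285300 / 1000000" "1 \<le> (ell_fun 0)\<^sup>2" "(h_fun 0)\<^sup>2 \<le> 2 / 100"
      by (simp_all add: power2_eq_square[of "_ / _ :: real"])
    then have "0 \<le> A0" "A0 \<le> 25706 / 10000" unfolding A0_def using zero_le_power2[of "h_fun 0"] by linarith+
    then show "0 \<le> A0" "A0 \<le> 2.5706" by simp_all
  qed
  have l8: "norm (4 * of_real (ell_fun 0) - 8 * of_real (h_fun 0) :: 'a) \<le> 4.5348"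
  proof -
    have "(4 * of_real (ell_fun 0) - 8 * of_real (h_fun 0) :: 'a) = of_real (4 * ell_fun 0 - 8 * h_fun 0)" by simp
    then show ?thesis using ell0_bounds h0_bounds xn_pos xn_le by (simp only: norm_of_real) simp
  qed
  have "norm (symb_main c) \<le> 2.5706 + 4.5348 * 0.53336 + 0.28448"
    unfolding main
    by (intro order_trans[OF norm_triangle_ineq4] add_mono norm_mult_le norm_of_real_le A0 l8 y y2)
  then have m: "norm (symb_main c) \<le> 5.2738" by simp
  have sum: "norm (symb_sum c) \<le> 5.2866"
    using norm_triangle_ineq[of "symb_sum c - symb_main c" "symb_main c"] d m by simp
  have "symb_prod c - symb_main c = (symb_diff c - 1) * symb_sum c + (symb_sum c - symb_main c)"
    by (simp add: symb_prod_def algebra_simps)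
  also have "norm \<dots> \<le> 0.01623 * 5.2866 + 0.0128"
    by (intro order_trans[OF norm_triangle_ineq] add_mono norm_mult_le symb_diff_bound assms sum d)
  finally show ?thesis by simp
qed

text \<open>The gain - 3.989 xn^2 is kept because, doubled at c = -1, it outweighs the quadratic
  losses in \<open>A0\<close> and in the last term of \<open>symb_main\<close>.\<close>

lemma A1_bounds: "0 \<le> A1" "A1 \<le> 4 * xn - 3.989 * xn\<^sup>2"
proof -
  have "0 \<le> 4 * ell_fun 0 - 8 * h_fun 0" "4 * ell_fun 0 - 8 * h_fun 0 \<le> 4 - 3.989 * xn"
    using ell0_bounds h0_bounds xn_pos xn_le by simp_all
  then show "0 \<le> A1" "A1 \<le> 4 * xn - 3.989 * xn\<^sup>2"
    unfolding A1_def using xn_pos mult_left_mono[of "4 * ell_fun 0 - 8 * h_fun 0" "4 - 3.989 * xn" xn]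
    by (simp_all add: power2_eq_square algebra_simps)
qed

lemma xn_sq: "0 \<le> xn\<^sup>2" "xn\<^sup>2 \<le> 0.0178"
proof -
  have "xn\<^sup>2 \<le> (2/15)\<^sup>2" using xn_pos xn_le by (intro power_mono) auto
  then show "xn\<^sup>2 \<le> 0.0178" by (simp add: power2_eq_square)
qed simp

text \<open>The quadratic is smallest at c = -1, where the bounds of \<open>A0\<close> and
  \<open>A1\<close> leave at least 2 - 4 xn, about 1.4667. The error 0.1 of the approximation is
  then subtracted.\<close>

lemma symb_prod_lower:
  fixes c :: real
  assumes "-1 \<le> c" "c \<le> 1"
  shows "1.366 \<le> symb_prod c"
proof -
  have "2 * (1 + xn)\<^sup>2 - 4 * ((10027 / 10000) * xn)\<^sup>2 \<le> A0"
    unfolding A0_def using ell0_bounds h0_bounds xn_pos by (intro diff_mono mult_left_mono power_mono) auto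
  then have A0: "2 + 4 * xn - (2022 / 1000) * xn\<^sup>2 \<le> A0"
  proof -
    have "((10027 / 10000) * xn)\<^sup>2 = (100540729 / 100000000) * xn\<^sup>2" by (simp add: power2_eq_square)
    moreover have "(1 + xn)\<^sup>2 = 1 + 2 * xn + xn\<^sup>2" by (simp add: power2_eq_square algebra_simps)
    ultimately show ?thesis using \<open>2 * (1 + xn)\<^sup>2 - 4 * ((10027 / 10000) * xn)\<^sup>2 \<le> A0\<close> xn_sq(1) by linarith
  qed
  have 1: "A1 * (1 - c) \<le> (4 * xn - (3989 / 1000) * xn\<^sup>2) * 2"
    using assms A1_bounds by (intro mult_mono) auto
  have "(1 - c)\<^sup>2 \<le> 2\<^sup>2" using assms by (intro power_mono) auto
  then have 2: "xn\<^sup>2 * (1 - c)\<^sup>2 \<le> xn\<^sup>2 * 4" by (intro mult_left_mono) auto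
  have "symb_main c = A0 - A1 * (1 - c) - xn\<^sup>2 * (1 - c)\<^sup>2" by (simp add: symb_main_def)
  \<comment> \<open>The terms in xn^2 add up to (- 2.022 + 7.978 - 4) xn^2 >= 0 and are dropped.
    Plain variables in place of the products make the statement linear.\<close>
  moreover have "2 - 4 * x \<le> S" if "S = A - p - q" "2 + 4 * x - 2022 / 1000 * r \<le> A"
    "p \<le> (4 * x - 3989 / 1000 * r) * 2" "q \<le> r * 4" "0 \<le> r" for S A p q x r :: real
    using that by (simp add: field_simps)
  ultimately have "2 - 4 * xn \<le> symb_main c" using A0 1 2 xn_sq(1) by blast
  then have "1466 / 1000 \<le> symb_main c" using xn_le by simp
  moreover have "\<bar>symb_prod c - symb_main c\<bar> \<le> 1 / 10" using symb_main_bound[of c] assms by simp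
  ultimately have "1366 / 1000 \<le> symb_prod c" by linarith
  then show ?thesis by simp
qed

lemma symb_diff_pos:
  assumes "norm (c::real) \<le> 3"
  shows "0 < symb_diff c"
proof -
  have "\<bar>symb_diff c - 1\<bar> \<le> 1623 / 100000" using symb_diff_bound[OF assms] by simp
  then show ?thesis by linarith
qed

text \<open>Positivity is inherited from the product, because the other factor is close to
  1.\<close>

lemma symb_sum_pos:
  assumes "-1 \<le> c" "c \<le> 1"
  shows "0 < symb_sum (c::real)"
proof -
  have "0 < symb_prod c"
    using symb_prod_lower[OF assms] by (rule order.strict_trans2[rotated]) simp
  then have "0 < symb_diff c * symb_sum c" by (simp only: symb_prod_def)
  moreover have "0 < symb_diff c" by (rule symb_diff_pos) (use assms in simp)
  ultimately show ?thesis by (rule zero_less_mult_pos)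
qed

section \<open>The dispersion relation\<close>

text \<open>Where the real part is positive the principal square root is holomorphic. The region
  contains the segment [-1, 1], the range of the cosine on the real line.\<close>

definition pos_region :: "complex set" where
  "pos_region = {z \<in> ball 0 3. 0 < Re (symb_prod z)}"

lemma open_pos_region: "open pos_region"
proof -
  have "continuous_on (ball 0 3) (\<lambda>z::complex. Re (symb_prod z))"
    by (intro continuous_intros holomorphic_on_imp_continuous_on symb_holomorphic)
  then have "open (ball 0 3 \<inter> (\<lambda>z::complex. Re (symb_prod z)) -` {0<..})"
    by (intro continuous_open_preimage) auto
  moreover have "ball 0 3 \<inter> (\<lambda>z::complex. Re (symb_prod z)) -` {0<..} = pos_region"
    by (auto simp: pos_region_def)
  ultimately show ?thesis by simp
qed

lemma pos_region_subset: "pos_region \<subseteq> ball 0 3"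
  by (auto simp: pos_region_def)

lemma of_real_in_pos_region:
  assumes "-1 \<le> c" "c \<le> 1"
  shows "complex_of_real c \<in> pos_region"
proof -
  have "0 < symb_prod c" using symb_prod_lower[OF assms] by (rule order.strict_trans2[rotated]) simp
  moreover have "\<bar>c\<bar> < 3" using assms by linarith
  ultimately show ?thesis using symb_of_real(3)[of c] by (simp add: pos_region_def)
qed

lemma pos_region_real:
  assumes "complex_of_real c \<in> pos_region"
  shows "\<bar>c\<bar> \<le> 3" "0 < symb_prod c"
proof -
  show c: "\<bar>c\<bar> \<le> 3" using assms by (auto simp: pos_region_def)
  show "0 < symb_prod c" using assms symb_of_real(3)[OF c] by (simp add: pos_region_def)
qed

definition root_prod :: "complex \<Rightarrow> complex" where
  "root_prod z = csqrt (symb_prod z)"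

lemma symb_prod_hol_pos_region: "(symb_prod :: complex \<Rightarrow> complex) holomorphic_on pos_region"
  using holomorphic_on_subset[OF symb_holomorphic(5) pos_region_subset] .

lemma root_prod_holomorphic: "root_prod holomorphic_on pos_region"
  unfolding root_prod_def[abs_def]
  by (intro holomorphic_intros symb_prod_hol_pos_region) (auto simp: pos_region_def complex_nonpos_Reals_iff)

text \<open>Derivatives in c, at real points, of the root (\<open>rr\<close>) and of the radicand
  (\<open>pp\<close>). Taking real parts loses nothing, since both functions are real at the real
  points of \<open>pos_region\<close>.\<close>

definition rr :: "nat \<Rightarrow> real \<Rightarrow> real" where
  "rr j x = Re ((deriv ^^ j) root_prod (of_real x))"

definition pp :: "nat \<Rightarrow> real \<Rightarrow> real" where
  "pp j x = Re ((deriv ^^ j) symb_prod (of_real x))"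

lemma DERIV_rr: "complex_of_real x \<in> pos_region \<Longrightarrow> (rr j has_real_derivative rr (Suc j) x) (at x)"
  unfolding rr_def[abs_def] by (rule DERIV_Re_restrict[OF root_prod_holomorphic open_pos_region])

lemma DERIV_pp: "complex_of_real x \<in> pos_region \<Longrightarrow> (pp j has_real_derivative pp (Suc j) x) (at x)"
  unfolding pp_def[abs_def] by (rule DERIV_Re_restrict[OF symb_prod_hol_pos_region open_pos_region])

lemma pp_0: "complex_of_real c \<in> pos_region \<Longrightarrow> pp 0 c = symb_prod c"
  using symb_of_real(3)[OF pos_region_real(1)] by (simp add: pp_def)

lemma root_prod_of_real:
  assumes "complex_of_real c \<in> pos_region"
  shows "root_prod (of_real c) = of_real (sqrt (symb_prod c))"
  unfolding root_prod_def symb_of_real(3)[OF pos_region_real(1)[OF assms]]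
  by (rule of_real_sqrt[symmetric], rule less_imp_le, rule pos_region_real(2)[OF assms])

lemma rr_0: "complex_of_real c \<in> pos_region \<Longrightarrow> rr 0 c = sqrt (symb_prod c)"
  using root_prod_of_real by (simp add: rr_def)

text \<open>The identity root^2 = radicand is differentiated three times on the open set of real
  points of \<open>pos_region\<close>. Cauchy's estimate acts on the radicand; these relations
  transfer it to the root.\<close>

lemma rr_pp_relations:
  assumes c: "complex_of_real c \<in> pos_region"
  shows "rr 0 c * rr 0 c = pp 0 c" "2 * rr 0 c * rr 1 c = pp 1 c" "2 * (rr 1 c * rr 1 c + rr 0 c * rr 2 c) = pp 2 c"
    "2 * (3 * rr 1 c * rr 2 c + rr 0 c * rr 3 c) = pp 3 c"
proof -
  let ?I = "{x. complex_of_real x \<in> pos_region}"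
  have "?I = complex_of_real -` pos_region" by auto
  moreover have "open (complex_of_real -` pos_region)"
    by (rule open_vimage[OF open_pos_region]) (intro continuous_intros)
  ultimately have I: "open ?I" by (simp only:)
  have r0: "(rr 0 has_real_derivative rr 1 x) (at x)" "(rr 1 has_real_derivative rr 2 x) (at x)" "(rr 2 has_real_derivative rr 3 x) (at x)"
    "(pp 0 has_real_derivative pp 1 x) (at x)" "(pp 1 has_real_derivative pp 2 x) (at x)" "(pp 2 has_real_derivative pp 3 x) (at x)" if "x \<in> ?I" for x
    using DERIV_rr[of x 0] DERIV_rr[of x 1] DERIV_rr[of x 2] DERIV_pp[of x 0] DERIV_pp[of x 1] DERIV_pp[of x 2] that
    by (simp_all add: eval_nat_numeral)
  have 0: "rr 0 x * rr 0 x = pp 0 x" if "x \<in> ?I" for x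
    using that pos_region_real(2)[of x] by (simp add: rr_0 pp_0)
  have 1: "2 * rr 0 x * rr 1 x = pp 1 x" if x: "x \<in> ?I" for x
    by (rule DERIV_eq_on_open[OF I x 0]) (auto simp del: One_nat_def intro!: derivative_eq_intros r0[OF x])
  have 2: "2 * (rr 1 x * rr 1 x + rr 0 x * rr 2 x) = pp 2 x" if x: "x \<in> ?I" for x
    by (rule DERIV_eq_on_open[OF I x 1]) (auto simp del: One_nat_def intro!: derivative_eq_intros r0[OF x])
  have 3: "2 * (3 * rr 1 x * rr 2 x + rr 0 x * rr 3 x) = pp 3 x" if x: "x \<in> ?I" for x
    by (rule DERIV_eq_on_open[OF I x 2]) (auto intro!: derivative_eq_intros r0[OF x] simp: algebra_simps simp del: One_nat_def)
  show "rr 0 c * rr 0 c = pp 0 c" "2 * rr 0 c * rr 1 c = pp 1 c" "2 * (rr 1 c * rr 1 c + rr 0 c * rr 2 c) = pp 2 c"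
    "2 * (3 * rr 1 c * rr 2 c + rr 0 c * rr 3 c) = pp 3 c"
    using 0[of c] 1[of c] 2[of c] 3[of c] c by (simp_all only: mem_Collect_eq)
qed

text \<open>\<open>symb_prod\<close> is within \<open>0.1\<close> of the quadratic polynomial \<open>symb_main\<close> on the disc of radius \<open>3\<close>, so
  Cauchy's estimates with radius \<open>1.9\<close> control its derivatives on \<open>[-1, 1]\<close>.\<close>

lemma pp_bounds:
  assumes c: "-1 \<le> c" "c \<le> 1"
  shows "- 53 / 1000 \<le> pp 1 c" "pp 1 c \<le> 587 / 1000" "- 912 / 10000 \<le> pp 2 c" "pp 2 c \<le> 556 / 10000"
    "\<bar>pp 3 c\<bar> \<le> 876 / 10000"
proof -
  define e :: "complex \<Rightarrow> complex" where "e z = symb_prod z - symb_main z" for z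
  have main: "(symb_main :: complex \<Rightarrow> complex) holomorphic_on S" for S
    unfolding symb_main_def[abs_def] by (intro holomorphic_intros)
  have sub: "cball (complex_of_real c) (19/10) \<subseteq> ball 0 3"
  proof
    fix z assume "z \<in> cball (complex_of_real c) (19/10)"
    then have "norm (of_real c - z) \<le> 19/10" by (simp add: dist_norm)
    moreover have "norm z \<le> norm (complex_of_real c) + norm (of_real c - z)"
      by (metis norm_triangle_ineq3 abs_le_iff diff_le_eq norm_triangle_sub norm_minus_commute add.commute)
    moreover have "norm (complex_of_real c) \<le> 1" using c by simp
    ultimately show "z \<in> ball 0 3" by simp
  qed
  have eh: "e holomorphic_on ball 0 3" unfolding e_def[abs_def] by (intro holomorphic_intros symb_holomorphic main)
  have cauchy: "norm ((deriv ^^ n) e (of_real c)) \<le> fact n * (1/10) / (19/10) ^ n" for n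
  proof (rule Cauchy_inequality)
    show "e holomorphic_on ball (of_real c) (19/10)"
      by (rule holomorphic_on_subset[OF eh]) (use sub in auto)
    show "continuous_on (cball (of_real c) (19/10)) e"
      by (rule holomorphic_on_imp_continuous_on[OF holomorphic_on_subset[OF eh sub]])
    fix z :: complex assume "norm (of_real c - z) = 19/10"
    then have "z \<in> ball 0 3" using sub by (auto simp: dist_norm subset_iff)
    then have "norm z \<le> 3" by simp
    from symb_main_bound[OF this] show "norm (e z) \<le> 1/10" by (simp add: e_def)
  qed simp
  have diff: "(deriv ^^ n) e (of_real c) = (deriv ^^ n) symb_prod (of_real c) - (deriv ^^ n) symb_main (of_real c)" for n
    unfolding e_def[abs_def] using c by (intro higher_deriv_diff[of _ "ball 0 3"] symb_holomorphic main) auto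
  have close: "\<bar>pp n c - Re ((deriv ^^ n) symb_main (of_real c))\<bar> \<le> fact n * (1/10) / (19/10) ^ n" for n
    using abs_Re_le_cmod[of "(deriv ^^ n) e (of_real c)"] cauchy[of n] by (simp add: diff pp_def)
  have d1: "deriv symb_main = (\<lambda>z::complex. of_real A1 + 2 * of_real (xn\<^sup>2) * (1 - z))"
    by (rule ext, rule DERIV_imp_deriv) (auto simp: symb_main_def[abs_def] algebra_simps intro!: derivative_eq_intros)
  have d2: "deriv (\<lambda>z::complex. of_real A1 + 2 * of_real (xn\<^sup>2) * (1 - z)) = (\<lambda>z. - 2 * of_real (xn\<^sup>2))"
    by (rule ext, rule DERIV_imp_deriv) (auto intro!: derivative_eq_intros)
  have d3: "deriv (\<lambda>z::complex. - 2 * of_real (xn\<^sup>2)) = (\<lambda>z. 0)"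
    by (rule ext, rule DERIV_imp_deriv) (auto intro!: derivative_eq_intros)
  have f2: "(deriv ^^ 2) f = deriv (deriv f)" and f3: "(deriv ^^ 3) f = deriv (deriv (deriv f))" for f :: "complex \<Rightarrow> complex"
    by (simp_all add: eval_nat_numeral)
  have m1: "Re ((deriv ^^ 1) symb_main (of_real c)) = A1 + 2 * xn\<^sup>2 * (1 - c)" by (simp add: d1)
  have m2: "Re ((deriv ^^ 2) symb_main (of_real c)) = - 2 * xn\<^sup>2"
    unfolding f2 d1 d2 by simp
  have m3: "Re ((deriv ^^ 3) symb_main (of_real c)) = 0"
    unfolding f3 d1 d2 d3 by simp
  have "0 \<le> 2 * xn\<^sup>2 * (1 - c)" using c by simp
  moreover have "2 * xn\<^sup>2 * (1 - c) \<le> 2 * xn\<^sup>2 * 2"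
    by (rule mult_left_mono) (use c in auto)
  moreover have "A1 \<le> 4 * xn - 3989 / 1000 * xn\<^sup>2" using A1_bounds(2) by simp
  moreover have "xn\<^sup>2 \<le> 178 / 10000" using xn_sq(2) by simp
  ultimately have b1: "0 \<le> A1 + 2 * xn\<^sup>2 * (1 - c)" "A1 + 2 * xn\<^sup>2 * (1 - c) \<le> 534 / 1000"
    using A1_bounds(1) xn_le by linarith+
  \<comment> \<open>The three errors are n! times 0.1 / 1.9^n for n = 1, 2, 3, rounded up.\<close>
  have c1: "\<bar>pp 1 c - (A1 + 2 * xn\<^sup>2 * (1 - c))\<bar> \<le> 527 / 10000"
    using close[of 1] unfolding m1 by (rule order_trans) simp
  have c2: "\<bar>pp 2 c - (- 2 * xn\<^sup>2)\<bar> \<le> 555 / 10000"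
    using close[of 2] unfolding m2 by (rule order_trans) (simp add: fact_numeral power2_eq_square)
  have c3: "\<bar>pp 3 c - 0\<bar> \<le> 876 / 10000"
    using close[of 3] unfolding m3 by (rule order_trans) (simp add: fact_numeral power3_eq_cube)
  show "- 53 / 1000 \<le> pp 1 c" "pp 1 c \<le> 587 / 1000" using b1 c1 by linarith+
  show "- 912 / 10000 \<le> pp 2 c" "pp 2 c \<le> 556 / 10000"
    using c2 xn_sq(1) \<open>xn\<^sup>2 \<le> 178 / 10000\<close> by linarith+
  show "\<bar>pp 3 c\<bar> \<le> 876 / 10000" using c3 by simp
qed

lemma abs_mult_le: "\<bar>x\<bar> \<le> X \<Longrightarrow> \<bar>y\<bar> \<le> Y \<Longrightarrow> \<bar>x * y\<bar> \<le> X * Y" for x y :: real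
  by (simp add: abs_mult mult_mono' order_trans[OF abs_ge_zero])

text \<open>Here u, v, w stand for the first three derivatives of the root divided by the root.
  \<open>eq\<close> expresses that the second derivative of \<mu> vanishes; the conclusion concerns
  the cofactor of the sine in the third. Vanishing curvature forces c >= -0.15, and on that range
  the summand -1 dominates all others.\<close>

lemma curvature_nondegenerate:
  fixes c u v w :: real
  assumes c: "-1 \<le> c" "c \<le> 1" and u: "- 2 / 100 \<le> u" "u \<le> 215 / 1000"
    and v: "- 8 / 100 \<le> v" "v \<le> 21 / 1000" and w: "\<bar>w\<bar> \<le> 84 / 1000"
    and eq: "c * (1 - (1 - c) * u) = (1 - c\<^sup>2) * (2 * u - (1 - c) * v)"
  shows "3 * c * (- 2 * u + (1 - c) * v) + (- 1 + (1 - c) * u) - (1 - c\<^sup>2) * (- 3 * v + (1 - c) * w) < 0"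
proof -
  have s: "0 \<le> 1 - c\<^sup>2" "1 - c\<^sup>2 \<le> 1" using c by (auto simp: abs_square_le_1 abs_le_iff)
  have u2: "(1 - c) * u \<le> 43 / 100"
    using mult_mono[of "1 - c" 2 u "215 / 1000"] mult_nonneg_nonpos[of "1 - c" u] c u by (cases "0 \<le> u") auto
  have v2: "(1 - c) * v \<le> 42 / 1000"
    using mult_mono[of "1 - c" 2 v "21 / 1000"] mult_nonneg_nonpos[of "1 - c" v] c v by (cases "0 \<le> v") auto
  \<comment> \<open>For smaller c the left side of \<open>eq\<close> is at most -0.0855, whereas the
    right side is at least -0.082.\<close>
  have c_low: "- 15 / 100 \<le> c"
  proof (rule ccontr)
    assume "\<not> - 15 / 100 \<le> c"
    then have "c * (1 - (1 - c) * u) \<le> (- 15 / 100) * (57 / 100)"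
      using u2 mult_mono[of "15 / 100" "- c" "57 / 100" "1 - (1 - c) * u"] by simp
    moreover have "- 82 / 1000 \<le> (1 - c\<^sup>2) * (2 * u - (1 - c) * v)"
    proof -
      have "(1 - c\<^sup>2) * (- 82 / 1000) \<le> (1 - c\<^sup>2) * (2 * u - (1 - c) * v)"
        using s u v2 by (intro mult_left_mono) auto
      moreover have "- 82 / 1000 \<le> (1 - c\<^sup>2) * (- 82 / 1000)" using s by simp
      ultimately show ?thesis by linarith
    qed
    ultimately show False using eq by simp
  qed
  have t1: "(1 - c) * u \<le> 248 / 1000"
    using mult_mono[of "1 - c" "115 / 100" u "215 / 1000"] mult_nonneg_nonpos[of "1 - c" u] c c_low u by (cases "0 \<le> u") auto
  have t2: "- (c * u) \<le> 33 / 1000"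
  proof (cases "0 \<le> c")
    case True
    show ?thesis
    proof (cases "0 \<le> u")
      case u0: True
      with True have "0 \<le> c * u" by simp
      then show ?thesis by linarith
    next
      case False
      then show ?thesis using True c u mult_mono[of c 1 "- u" "2 / 100"] by simp
    qed
  next
    case False
    then have "(- c) * u \<le> (15 / 100) * (215 / 1000)"
      using c_low u mult_mono[of "- c" "15 / 100" u "215 / 1000"] mult_nonneg_nonpos[of "- c" u] by (cases "0 \<le> u") auto
    then show ?thesis by simp
  qed
  have "\<bar>c * (1 - c)\<bar> \<le> 1 / 4"
  proof -
    have "0 \<le> (c - 1/2)\<^sup>2" by simp
    then have "c * (1 - c) \<le> 1 / 4" by (simp add: power2_eq_square algebra_simps)
    moreover have "- (c * (1 - c)) \<le> (15 / 100) * (115 / 100)"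
    proof (cases "0 \<le> c")
      case True
      then have "0 \<le> c * (1 - c)" using c by simp
      then show ?thesis by simp
    next
      case False
      then show ?thesis using mult_mono[of "- c" "15 / 100" "1 - c" "115 / 100"] c_low by simp
    qed
    ultimately show ?thesis by (simp add: abs_le_iff)
  qed
  then have "\<bar>(c * (1 - c)) * v\<bar> \<le> 1 / 4 * (8 / 100)" using v by (intro abs_mult_le) (auto simp: abs_le_iff)
  then have t3: "c * (1 - c) * v \<le> 2 / 100" by (simp add: abs_le_iff)
  have t4: "(1 - c\<^sup>2) * v \<le> 21 / 1000"
    using mult_mono[of "1 - c\<^sup>2" 1 v "21 / 1000"] mult_nonneg_nonpos[of "1 - c\<^sup>2" v] s v by (cases "0 \<le> v") auto
  have "\<bar>(1 - c\<^sup>2) * ((1 - c) * w)\<bar> \<le> 1 * (115 / 100 * (84 / 1000))"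
    using s c c_low w by (intro abs_mult_le) (auto simp: abs_le_iff)
  then have t5: "- ((1 - c\<^sup>2) * ((1 - c) * w)) \<le> 97 / 1000" by (simp add: abs_le_iff)
  \<comment> \<open>With these weights the bounds \<open>t1\<close> to \<open>t5\<close> add up to
    0.666, a third below the 1 that they have to stay under.\<close>
  have "3 * c * (- 2 * u + (1 - c) * v) + (- 1 + (1 - c) * u) - (1 - c\<^sup>2) * (- 3 * v + (1 - c) * w) =
     6 * (- (c * u)) + 3 * (c * (1 - c) * v) - 1 + (1 - c) * u + 3 * ((1 - c\<^sup>2) * v) + (- ((1 - c\<^sup>2) * ((1 - c) * w)))"
    by (simp add: algebra_simps)
  also have "\<dots> < 0" using t1 t2 t3 t4 t5 by linarith
  finally show ?thesis .
qed

text \<open>With \<open>n2\<close> and \<open>n3\<close>, the first three derivatives of (1 - c)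
  times the root, which is \<mu> as a function of c up to a constant factor.\<close>

definition n1 :: "real \<Rightarrow> real" where "n1 c = - rr 0 c + (1 - c) * rr 1 c"
definition n2 :: "real \<Rightarrow> real" where "n2 c = - 2 * rr 1 c + (1 - c) * rr 2 c"
definition n3 :: "real \<Rightarrow> real" where "n3 c = - 3 * rr 2 c + (1 - c) * rr 3 c"

text \<open>Division of the differentiated identities by 2 \<open>pp 0 c\<close> >= 2.732 bounds u,
  then u^2 + v, then 3 u v + w; each is solved for its new unknown with the bounds already
  obtained.\<close>

lemma log_derivative_bounds:
  assumes c: "-1 \<le> c" "c \<le> 1"
  obtains u v w where "- 2 / 100 \<le> u" "u \<le> 215 / 1000" "- 8 / 100 \<le> v" "v \<le> 21 / 1000" "\<bar>w\<bar> \<le> 84 / 1000"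
    "rr 1 c = rr 0 c * u" "rr 2 c = rr 0 c * v" "rr 3 c = rr 0 c * w" "0 < rr 0 c"
proof -
  note cp = of_real_in_pos_region[OF c]
  have p: "1366 / 1000 \<le> pp 0 c" using symb_prod_lower[OF c] by (simp add: pp_0[OF cp])
  have r: "0 < rr 0 c" using pos_region_real(2)[OF cp] by (simp add: rr_0[OF cp])
  define u v w where "u = rr 1 c / rr 0 c" and "v = rr 2 c / rr 0 c" and "w = rr 3 c / rr 0 c"
  have e: "rr 1 c = rr 0 c * u" "rr 2 c = rr 0 c * v" "rr 3 c = rr 0 c * w" using r by (simp_all add: u_def v_def w_def)
  note rel = rr_pp_relations[OF cp]
  have r1: "2 * pp 0 c * u = pp 1 c" using rel(2) unfolding rel(1)[symmetric] e(1) by (simp add: mult_ac)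
  have r2: "2 * pp 0 c * (u * u + v) = pp 2 c" using rel(3) unfolding rel(1)[symmetric] e(1,2) by (simp add: algebra_simps)
  have r3: "2 * pp 0 c * (3 * u * v + w) = pp 3 c" using rel(4) unfolding rel(1)[symmetric] e by (simp add: algebra_simps)
  have q: "\<bar>y\<bar> \<le> B / (2732 / 1000)" if "2 * pp 0 c * y = z" "\<bar>z\<bar> \<le> B" for y z B
  proof -
    have "2732 / 1000 * \<bar>y\<bar> \<le> (2 * pp 0 c) * \<bar>y\<bar>" using p by (intro mult_right_mono) auto
    also have "\<dots> = \<bar>2 * pp 0 c * y\<bar>" using p by (simp add: abs_mult)
    finally have "2732 / 1000 * \<bar>y\<bar> \<le> \<bar>2 * pp 0 c * y\<bar>" .
    then have "2732 / 1000 * \<bar>y\<bar> \<le> B" using that by simp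
    then show ?thesis by (simp add: field_simps)
  qed
  have qu: "y \<le> B / (2732 / 1000)" if "2 * pp 0 c * y = z" "z \<le> B" "0 \<le> B" for y z B
  proof (cases "0 \<le> y")
    case True
    then have "2732 / 1000 * y \<le> 2 * pp 0 c * y" using p by (intro mult_right_mono) auto
    then show ?thesis using that by (simp add: field_simps)
  next
    case False
    moreover have "0 \<le> B / (2732 / 1000)" using that by simp
    ultimately show ?thesis by linarith
  qed
  note b = pp_bounds[OF c]
  have u1: "u \<le> 215 / 1000" using qu[OF r1 b(2)] by simp
  have "2 * pp 0 c * (- u) = - pp 1 c" using r1 by simp
  from qu[OF this, of "53 / 1000"] b(1) have u2: "- 2 / 100 \<le> u" by simp
  have "\<bar>u * u\<bar> \<le> 215 / 1000 * (215 / 1000)" using u1 u2 by (intro abs_mult_le) (auto simp: abs_le_iff)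
  then have uu: "u * u \<le> 463 / 10000" "0 \<le> u * u" by simp_all
  have "u * u + v \<le> 2036 / 100000" using qu[OF r2 b(4)] by simp
  then have v1: "v \<le> 21 / 1000" using uu(2) by linarith
  have "2 * pp 0 c * (- (u * u + v)) = - pp 2 c" unfolding r2[symmetric] by (simp add: algebra_simps)
  from qu[OF this, of "912 / 10000"] b(3) have "- (u * u + v) \<le> 3339 / 100000" by simp
  then have v2: "- 8 / 100 \<le> v" using uu(1) by linarith
  have "\<bar>3 * (u * v) + w\<bar> \<le> 3207 / 100000" using q[OF r3 b(5)] by (simp add: mult.assoc)
  moreover have "\<bar>u * v\<bar> \<le> 215 / 1000 * (8 / 100)" using u1 u2 v1 v2 by (intro abs_mult_le) (auto simp: abs_le_iff)
  then have "\<bar>u * v\<bar> \<le> 172 / 10000" by simp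
  ultimately have w: "\<bar>w\<bar> \<le> 84 / 1000" by linarith
  show ?thesis using that[OF u2 u1 v2 v1 w e r] .
qed

lemma DERIV_n:
  assumes "complex_of_real x \<in> pos_region"
  shows "((\<lambda>c. (1 - c) * rr 0 c) has_real_derivative n1 x) (at x)" "(n1 has_real_derivative n2 x) (at x)" "(n2 has_real_derivative n3 x) (at x)"
proof -
  have r: "(rr 0 has_real_derivative rr 1 x) (at x)" "(rr 1 has_real_derivative rr 2 x) (at x)" "(rr 2 has_real_derivative rr 3 x) (at x)"
    using DERIV_rr[OF assms, of 0] DERIV_rr[OF assms, of 1] DERIV_rr[OF assms, of 2] by (simp_all add: eval_nat_numeral)
  show "((\<lambda>c. (1 - c) * rr 0 c) has_real_derivative n1 x) (at x)" "(n1 has_real_derivative n2 x) (at x)" "(n2 has_real_derivative n3 x) (at x)"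
    unfolding n1_def[abs_def] n2_def[abs_def] n3_def[abs_def] by (auto intro!: derivative_eq_intros r simp: algebra_simps simp del: One_nat_def)
qed

section \<open>Derivatives of the dispersion relation in \<xi>\<close>

lemma cos_in_pos_region: "complex_of_real (cos t) \<in> pos_region"
  by (rule of_real_in_pos_region) auto

definition mu1 :: "real \<Rightarrow> real" where
  "mu1 \<xi> = kap * xn * (2 * pi) * (- sin (2 * pi * \<xi>) * n1 (cos (2 * pi * \<xi>)))"

definition mu2 :: "real \<Rightarrow> real" where
  "mu2 \<xi> = kap * xn * (2 * pi)\<^sup>2 * (sin (2 * pi * \<xi>) ^ 2 * n2 (cos (2 * pi * \<xi>)) - cos (2 * pi * \<xi>) * n1 (cos (2 * pi * \<xi>)))"

definition mu3 :: "real \<Rightarrow> real" where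
  "mu3 \<xi> = kap * xn * (2 * pi) ^ 3 * (sin (2 * pi * \<xi>) *
     (3 * cos (2 * pi * \<xi>) * n2 (cos (2 * pi * \<xi>)) + n1 (cos (2 * pi * \<xi>)) - sin (2 * pi * \<xi>) ^ 2 * n3 (cos (2 * pi * \<xi>))))"

lemma mu_rr: "mu \<xi> = kap * xn * ((1 - cos (2 * pi * \<xi>)) * rr 0 (cos (2 * pi * \<xi>)))"
  by (simp add: mu_eq rr_0[OF cos_in_pos_region])

lemma DERIV_mu:
  "(mu has_real_derivative mu1 \<xi>) (at \<xi>)" "(mu1 has_real_derivative mu2 \<xi>) (at \<xi>)" "(mu2 has_real_derivative mu3 \<xi>) (at \<xi>)"
proof -
  have C: "((\<lambda>\<xi>. cos (2 * pi * \<xi>)) has_real_derivative - (2 * pi) * sin (2 * pi * \<xi>)) (at \<xi>)"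
    and S: "((\<lambda>\<xi>. sin (2 * pi * \<xi>)) has_real_derivative (2 * pi) * cos (2 * pi * \<xi>)) (at \<xi>)"
    by (auto intro!: derivative_eq_intros)
  note ch = DERIV_chain2[OF _ C]
  note d = DERIV_n[OF cos_in_pos_region, of "2 * pi * \<xi>"]
  note n0 = ch[OF d(1)] and n1 = ch[OF d(2)] and n2 = ch[OF d(3)]
  show "(mu has_real_derivative mu1 \<xi>) (at \<xi>)"
    unfolding mu_rr[abs_def] by (rule DERIV_cong[OF DERIV_cmult[OF n0]]) (simp add: mu1_def)
  show "(mu1 has_real_derivative mu2 \<xi>) (at \<xi>)"
    unfolding mu1_def[abs_def]
    by (rule DERIV_cong[OF DERIV_cmult[OF DERIV_mult[OF DERIV_minus[OF S] n1]]])
       (simp add: mu2_def power2_eq_square algebra_simps)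
  show "(mu2 has_real_derivative mu3 \<xi>) (at \<xi>)"
    unfolding mu2_def[abs_def]
    by (rule DERIV_cong[OF DERIV_cmult[OF DERIV_diff[OF DERIV_mult[OF DERIV_power[OF S] n2] DERIV_mult[OF C n1]]]])
       (simp add: mu3_def power2_eq_square power3_eq_cube algebra_simps)
qed

lemma continuous_mu3: "continuous_on UNIV mu3"
proof -
  have rr: "continuous_on UNIV (\<lambda>\<xi>. rr j (cos (2 * pi * \<xi>)))" for j
  proof (rule continuous_on_compose2[of "{-1..1}" "rr j"])
    show "continuous_on {-1..1} (rr j)"
      using DERIV_rr[OF of_real_in_pos_region] by (meson DERIV_isCont atLeastAtMost_iff continuous_at_imp_continuous_on)
  qed (auto intro!: continuous_intros)
  show ?thesis unfolding mu3_def[abs_def] n1_def n2_def n3_def by (intro continuous_intros rr)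
qed

text \<open>The third derivative carries the factor sin (2 pi \<xi>). Where the sine is nonzero,
  \<open>curvature_nondegenerate\<close> excludes a common zero; where it vanishes, c is 1 or -1 and
  the second derivative is c times a positive number.\<close>

lemma mu_nondegenerate: "mu2 \<xi> \<noteq> 0 \<or> mu3 \<xi> \<noteq> 0"
proof (rule ccontr)
  assume "\<not> (mu2 \<xi> \<noteq> 0 \<or> mu3 \<xi> \<noteq> 0)"
  then have z: "mu2 \<xi> = 0" "mu3 \<xi> = 0" by auto
  define c s where "c = cos (2 * pi * \<xi>)" and "s = sin (2 * pi * \<xi>)"
  have c: "-1 \<le> c" "c \<le> 1" by (auto simp: c_def)
  have s2: "s\<^sup>2 = 1 - c\<^sup>2" by (simp add: c_def s_def sin_squared_eq)
  obtain u v w where b: "- 2 / 100 \<le> u" "u \<le> 215 / 1000" "- 8 / 100 \<le> v" "v \<le> 21 / 1000" "\<bar>w\<bar> \<le> 84 / 1000"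
    and e: "rr 1 c = rr 0 c * u" "rr 2 c = rr 0 c * v" "rr 3 c = rr 0 c * w" and r: "0 < rr 0 c"
    by (rule log_derivative_bounds[OF c])
  have N: "n1 c = rr 0 c * (-1 + (1 - c) * u)" "n2 c = rr 0 c * (- 2 * u + (1 - c) * v)" "n3 c = rr 0 c * (- 3 * v + (1 - c) * w)"
    unfolding n1_def n2_def n3_def e by (simp_all add: algebra_simps)
  have k: "kap * xn * (2 * pi) ^ n \<noteq> 0" for n using kap_pos xn_pos by simp
  have "s\<^sup>2 * n2 c - c * n1 c = 0" using z(1) k[of 2] unfolding mu2_def c_def[symmetric] s_def[symmetric] by simp
  then have "rr 0 c * (c * (1 - (1 - c) * u) - (1 - c\<^sup>2) * (2 * u - (1 - c) * v)) = 0"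
    unfolding N s2 by (simp add: algebra_simps)
  then have eq: "c * (1 - (1 - c) * u) = (1 - c\<^sup>2) * (2 * u - (1 - c) * v)" using r by simp
  from curvature_nondegenerate[OF c b eq] have neg: "3 * c * (- 2 * u + (1 - c) * v) + (- 1 + (1 - c) * u) - (1 - c\<^sup>2) * (- 3 * v + (1 - c) * w) \<noteq> 0"
    by simp
  have "s * (3 * c * n2 c + n1 c - s\<^sup>2 * n3 c) = 0" using z(2) k[of 3] unfolding mu3_def c_def[symmetric] s_def[symmetric] by simp
  moreover have "3 * c * n2 c + n1 c - s\<^sup>2 * n3 c = rr 0 c * (3 * c * (- 2 * u + (1 - c) * v) + (- 1 + (1 - c) * u) - (1 - c\<^sup>2) * (- 3 * v + (1 - c) * w))"
    unfolding N s2 by (simp add: algebra_simps)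
  ultimately have "s = 0" using neg r by simp
  then have "c\<^sup>2 = 1" using s2 by simp
  then have "c * (1 - (1 - c) * u) = 0" "c \<noteq> 0" using eq by auto
  moreover have "(1 - c) * u \<le> 43 / 100"
    using mult_mono[of "1 - c" 2 u "215 / 1000"] mult_nonneg_nonpos[of "1 - c" u] c b by (cases "0 \<le> u") auto
  ultimately show False by simp
qed

lemma mu_oscillatory_decay:
  "\<exists>B\<ge>0. \<forall>t \<nu> b. t \<noteq> 0 \<and> 0 \<le> b \<and> b \<le> 1 \<longrightarrow>
    norm (integral {0..b} (\<lambda>x. cis (t * mu x + \<nu> * x))) \<le> B * \<bar>t\<bar> powr (-1/3)"
  using oscillatory_decay[OF DERIV_mu continuous_mu3 mu_nondegenerate, of 0 1] by auto

section \<open>Signs, symmetries and analyticity of the symbols\<close>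

lemma mu_nonneg: "0 \<le> mu \<xi>"
  unfolding mu_eq using kap_pos xn_pos symb_prod_lower[of "cos (2 * pi * \<xi>)"]
  by (intro mult_nonneg_nonneg) (auto intro: order_trans[rotated])

lemma mu_square: "(mu \<xi>)\<^sup>2 = (a_fun \<xi> - b_fun \<xi>) * (a_fun \<xi> + b_fun \<xi>)"
proof -
  have "0 < symb_prod (cos (2 * pi * \<xi>))" using pos_region_real(2)[OF cos_in_pos_region] .
  then have "(mu \<xi>)\<^sup>2 = (a_fun \<xi>)\<^sup>2 - (b_fun \<xi>)\<^sup>2" unfolding sq_diff mu_eq by (simp add: power_mult_distrib)
  then show ?thesis by (simp add: power2_eq_square algebra_simps)
qed

lemma a_plus_b_pos: "0 < a_fun \<xi> + b_fun \<xi>"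
  unfolding a_plus_b using kap_pos symb_sum_pos[of "cos (2 * pi * \<xi>)"] by simp

lemma mu_pos:
  assumes "0 < \<xi>" "\<xi> < 1"
  shows "0 < mu \<xi>"
proof -
  have "cos (2 * pi * \<xi>) \<noteq> 1"
  proof
    assume "cos (2 * pi * \<xi>) = 1"
    then obtain n :: int where "2 * pi * \<xi> = n * 2 * pi" by (auto simp: cos_one_2pi_int)
    then have "\<xi> = of_int n" by simp
    then show False using assms by simp
  qed
  then have "cos (2 * pi * \<xi>) < 1" using cos_le_one[of "2 * pi * \<xi>"] by linarith
  then show ?thesis unfolding mu_eq using kap_pos xn_pos pos_region_real(2)[OF cos_in_pos_region, of "2 * pi * \<xi>"] by simp
qed

lemma cos_2pi_shift: "cos (2 * pi * (\<xi> + 1)) = cos (2 * pi * \<xi>)"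
  using cos_periodic[of "2 * pi * \<xi>"] by (simp add: distrib_left)

lemma symbols_cos:
  "b_fun \<xi> = kap * ((theta_l (cos (2 * pi * \<xi>)))\<^sup>2 - 2 * (theta_h (cos (2 * pi * \<xi>)))\<^sup>2)"
  "a_fun \<xi> = kap * symb_sum (cos (2 * pi * \<xi>)) - b_fun \<xi>"
  using a_plus_b[of \<xi>] by (simp_all add: b_fun_def kap_def ell_fun_cos h_fun_cos)

lemma symbols_periodic: "a_fun (\<xi> + 1) = a_fun \<xi>" "b_fun (\<xi> + 1) = b_fun \<xi>" "mu (\<xi> + 1) = mu \<xi>"
  unfolding symbols_cos mu_eq cos_2pi_shift by rule+

lemma symbols_even: "a_fun (- \<xi>) = a_fun \<xi>" "b_fun (- \<xi>) = b_fun \<xi>" "mu (- \<xi>) = mu \<xi>"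
  unfolding symbols_cos mu_eq by simp_all

lemma real_analytic_b: "real_analytic (\<lambda>\<xi>. of_real (b_fun \<xi>))"
proof (rule real_analytic_cos_compose[OF open_ball])
  show "(\<lambda>z. of_real kap * ((theta_l z)\<^sup>2 - 2 * (theta_h z)\<^sup>2)) holomorphic_on ball (0::complex) 3"
    by (intro holomorphic_intros symb_holomorphic)
  show "complex_of_real c \<in> ball 0 3" if "-1 \<le> c" "c \<le> 1" for c using that by simp
  show "of_real (b_fun \<xi>) = of_real kap * ((theta_l (complex_of_real (cos (2 * pi * \<xi>))))\<^sup>2 - 2 * (theta_h (of_real (cos (2 * pi * \<xi>))))\<^sup>2)" for \<xi>
    unfolding symbols_cos by (subst symb_of_real, rule pos_region_real[OF cos_in_pos_region])+ simp
qed

lemma real_analytic_mu: "real_analytic (\<lambda>\<xi>. of_real (mu \<xi>))"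
proof (rule real_analytic_cos_compose[OF open_pos_region of_real_in_pos_region])
  show "(\<lambda>z. of_real (kap * xn) * (1 - z) * root_prod z) holomorphic_on pos_region"
    by (intro holomorphic_intros root_prod_holomorphic)
  show "of_real (mu \<xi>) = of_real (kap * xn) * (1 - of_real (cos (2 * pi * \<xi>))) * root_prod (of_real (cos (2 * pi * \<xi>)))" for \<xi>
    unfolding mu_eq root_prod_of_real[OF cos_in_pos_region] by simp
qed

text \<open>Away from the integers this quotient equals (a - b) / \<mu>, but its denominator never
  vanishes. It replaces the singular expression as an amplitude.\<close>

lemma real_analytic_mu_ratio: "real_analytic (\<lambda>\<xi>. of_real (mu \<xi> / (a_fun \<xi> + b_fun \<xi>)))"
proof (rule real_analytic_cos_compose[OF open_pos_region of_real_in_pos_region])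
  have nz: "symb_sum z \<noteq> 0" if "z \<in> pos_region" for z :: complex
    using that by (auto simp: pos_region_def symb_prod_def)
  show "(\<lambda>z. of_real (kap * xn) * (1 - z) * root_prod z / (of_real kap * symb_sum z)) holomorphic_on pos_region"
    using kap_pos
    by (intro holomorphic_intros root_prod_holomorphic holomorphic_on_subset[OF symb_holomorphic(4) pos_region_subset])
       (simp add: nz)
  show "of_real (mu \<xi> / (a_fun \<xi> + b_fun \<xi>)) = of_real (kap * xn) * (1 - of_real (cos (2 * pi * \<xi>))) * root_prod (of_real (cos (2 * pi * \<xi>)))
      / (of_real kap * symb_sum (of_real (cos (2 * pi * \<xi>))))" for \<xi>
    unfolding mu_eq a_plus_b root_prod_of_real[OF cos_in_pos_region] symb_of_real(2)[OF pos_region_real(1)[OF cos_in_pos_region]] by simp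
qed

lemma real_analytic_a_plus_b: "real_analytic (\<lambda>\<xi>. of_real (a_fun \<xi> + b_fun \<xi>))"
proof (rule real_analytic_cos_compose[OF open_ball])
  show "(\<lambda>z. of_real kap * symb_sum z) holomorphic_on ball (0::complex) 3"
    by (intro holomorphic_intros symb_holomorphic)
  show "complex_of_real c \<in> ball 0 3" if "-1 \<le> c" "c \<le> 1" for c using that by simp
  show "of_real (a_fun \<xi> + b_fun \<xi>) = of_real kap * symb_sum (complex_of_real (cos (2 * pi * \<xi>)))" for \<xi>
    unfolding a_plus_b symb_of_real(2)[OF pos_region_real(1)[OF cos_in_pos_region]] by simp
qed

lemma mu_smooth: "smooth mu"
  using smooth_Re[OF real_analytic_mu] by simp

text \<open>The zero comes from the factor 1 - cos (2 pi \<xi>), asymptotic to 2 pi^2 \<xi>^2; the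
  root contributes its value at c = 1.\<close>

lemma mu_asymp: "\<exists>\<kappa>. \<kappa> \<noteq> 0 \<and> mu \<sim>[at 0] (\<lambda>\<xi>. \<kappa> * \<xi>\<^sup>2)"
proof (intro exI conjI)
  let ?k = "kap * xn * rr 0 1 * (2 * pi\<^sup>2)"
  have r1: "0 < rr 0 1" using pos_region_real(2)[OF of_real_in_pos_region, of 1] rr_0[OF of_real_in_pos_region, of 1] by simp
  then show "?k \<noteq> 0" using kap_pos xn_pos by simp
  have 1: "(\<lambda>\<xi>::real. 1 - cos (2 * pi * \<xi>)) \<sim>[at 0] (\<lambda>\<xi>. 2 * pi\<^sup>2 * \<xi>\<^sup>2)"
  proof (rule asymp_equivI')
    have "((\<lambda>x::real. sin x / x) \<longlongrightarrow> 1) (at 0)" by real_asymp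
    moreover have "filterlim (\<lambda>\<xi>::real. pi * \<xi>) (at 0) (at 0)"
      by (rule filterlim_atI) (auto intro!: tendsto_eq_intros eventually_neq_at_within simp: eventually_at_filter)
    ultimately have "((\<lambda>\<xi>::real. sin (pi * \<xi>) / (pi * \<xi>)) \<longlongrightarrow> 1) (at 0)"
      by (rule filterlim_compose)
    then have "((\<lambda>\<xi>::real. (sin (pi * \<xi>) / (pi * \<xi>))\<^sup>2) \<longlongrightarrow> 1\<^sup>2) (at 0)" by (rule tendsto_power)
    moreover have "(sin (pi * \<xi>) / (pi * \<xi>))\<^sup>2 = (1 - cos (2 * pi * \<xi>)) / (2 * pi\<^sup>2 * \<xi>\<^sup>2)" for \<xi> :: real
      using cos_double_sin[of "pi * \<xi>"] by (simp add: power_divide power_mult_distrib mult.assoc)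
    ultimately show "((\<lambda>\<xi>::real. (1 - cos (2 * pi * \<xi>)) / (2 * pi\<^sup>2 * \<xi>\<^sup>2)) \<longlongrightarrow> 1) (at 0)" by simp
  qed
  have "isCont (rr 0) 1" using DERIV_rr[OF of_real_in_pos_region, of 1 0] DERIV_isCont by auto
  then have r: "isCont (rr 0) (cos (2 * pi * 0))" by simp
  have "isCont (\<lambda>\<xi>::real. cos (2 * pi * \<xi>)) 0" by (intro continuous_intros)
  from isCont_o2[OF this r] have "isCont (\<lambda>\<xi>. rr 0 (cos (2 * pi * \<xi>))) 0" .
  then have "((\<lambda>\<xi>. rr 0 (cos (2 * pi * \<xi>))) \<longlongrightarrow> rr 0 1) (at 0)" by (simp add: isCont_def)
  then have 2: "(\<lambda>\<xi>. rr 0 (cos (2 * pi * \<xi>))) \<sim>[at 0] (\<lambda>_. rr 0 1)"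
    using r1 by (intro tendsto_imp_asymp_equiv_const) auto
  have "(\<lambda>\<xi>. kap * xn * ((1 - cos (2 * pi * \<xi>)) * rr 0 (cos (2 * pi * \<xi>)))) \<sim>[at 0] (\<lambda>\<xi>. kap * xn * ((2 * pi\<^sup>2 * \<xi>\<^sup>2) * rr 0 1))"
    by (intro asymp_equiv_mult asymp_equiv_refl 1 2)
  then show "mu \<sim>[at 0] (\<lambda>\<xi>. ?k * \<xi>\<^sup>2)" by (simp add: mu_rr[abs_def] mult_ac)
qed

section \<open>Integration over the complex plane\<close>

lemma lborel_complex: "(lborel :: complex measure) = distr (lborel \<Otimes>\<^sub>M lborel) borel (\<lambda>p. Complex (fst p) (snd p))"
proof (rule lborel_eqI)
  have [measurable]: "(\<lambda>p. Complex (fst p) (snd p)) \<in> borel_measurable (lborel \<Otimes>\<^sub>M lborel)"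
    unfolding Complex_eq by measurable
  fix l u :: complex assume lu: "\<And>b. b \<in> Basis \<Longrightarrow> l \<bullet> b \<le> u \<bullet> b"
  have "Re l \<le> Re u" "Im l \<le> Im u" using lu[of 1] lu[of \<i>] by (auto simp: Basis_complex_def inner_complex_def)
  moreover have "(\<lambda>p. Complex (fst p) (snd p)) -` box l u \<inter> space (lborel \<Otimes>\<^sub>M lborel) = {Re l<..<Re u} \<times> {Im l<..<Im u}"
    by (auto simp: box_def Basis_complex_def inner_complex_def space_pair_measure)
  ultimately show "emeasure (distr (lborel \<Otimes>\<^sub>M lborel) borel (\<lambda>p. Complex (fst p) (snd p))) (box l u) = ennreal (\<Prod>b\<in>Basis. (u - l) \<bullet> b)"
    by (subst emeasure_distr) (auto simp: lborel.emeasure_pair_measure_Times Basis_complex_def inner_complex_def ennreal_mult)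
qed simp

lemma measurable_Complex_pair [measurable]:
  "(\<lambda>p. Complex (fst p) (snd p)) \<in> borel_measurable (lborel \<Otimes>\<^sub>M lborel)"
  unfolding Complex_eq by measurable

lemma integrable_complex_iff:
  fixes G :: "complex \<Rightarrow> complex"
  assumes [measurable]: "G \<in> borel_measurable borel"
  shows "integrable lborel G \<longleftrightarrow> integrable (lborel \<Otimes>\<^sub>M lborel) (\<lambda>p. G (Complex (fst p) (snd p)))"
  by (subst lborel_complex, subst integrable_distr_eq) auto

lemma integral_complex_fubini:
  fixes G :: "complex \<Rightarrow> complex"
  assumes [measurable]: "G \<in> borel_measurable borel" and int: "integrable lborel G"
  shows "(\<integral>w. G w \<partial>lborel) = (\<integral>y. (\<integral>x. G (Complex x y) \<partial>lborel) \<partial>lborel)"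
proof -
  have "(\<integral>w. G w \<partial>lborel) = (\<integral>p. G (Complex (fst p) (snd p)) \<partial>(lborel \<Otimes>\<^sub>M lborel))"
    by (subst lborel_complex, subst integral_distr) auto
  also have "\<dots> = (\<integral>y. (\<integral>x. G (Complex x y) \<partial>lborel) \<partial>lborel)"
    using lborel_pair.integral_snd[of "\<lambda>x y. G (Complex x y)"] int
    by (simp add: integrable_complex_iff case_prod_unfold)
  finally show ?thesis .
qed

lemma complex_product_integral:
  fixes f g :: "real \<Rightarrow> complex"
  assumes f: "integrable lborel f" and g: "integrable lborel g"
  shows "integrable lborel (\<lambda>w. f (Re w) * g (Im w))"
    "(\<integral>w. f (Re w) * g (Im w) \<partial>lborel) = (\<integral>x. f x \<partial>lborel) * (\<integral>y. g y \<partial>lborel)"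
proof -
  have [measurable]: "f \<in> borel_measurable borel" "g \<in> borel_measurable borel" using f g by auto
  have "integrable (lborel \<Otimes>\<^sub>M lborel) (\<lambda>p. f (fst p) * g (snd p))"
    by (rule lborel_pair.Fubini_integrable) (use f g in \<open>auto simp: norm_mult\<close>)
  then show int: "integrable lborel (\<lambda>w. f (Re w) * g (Im w))"
    by (subst integrable_complex_iff) auto
  have "(\<integral>w. f (Re w) * g (Im w) \<partial>lborel) = (\<integral>y. (\<integral>x. f x * g y \<partial>lborel) \<partial>lborel)"
    using integral_complex_fubini[OF _ int] by simp
  then show "(\<integral>w. f (Re w) * g (Im w) \<partial>lborel) = (\<integral>x. f x \<partial>lborel) * (\<integral>y. g y \<partial>lborel)"
    by simp
qed

section \<open>Gaussian integrals\<close>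

lemma gaussian_real:
  assumes "0 < r"
  shows "integrable lborel (\<lambda>x. exp (- r * (x - m)\<^sup>2))" "(\<integral>x. exp (- r * (x - m)\<^sup>2) \<partial>lborel) = sqrt (pi / r)"
proof -
  define \<sigma> where "\<sigma> = sqrt (1 / (2 * r))"
  have \<sigma>: "0 < \<sigma>" "\<sigma>\<^sup>2 = 1 / (2 * r)" using assms by (auto simp: \<sigma>_def)
  have eq: "exp (- r * (x - m)\<^sup>2) = sqrt (pi / r) * normal_density m \<sigma> x" for x
    using assms by (simp add: normal_density_def \<sigma>(2) field_simps)
  show "integrable lborel (\<lambda>x. exp (- r * (x - m)\<^sup>2))"
    unfolding eq using \<sigma>(1) by (intro integrable_mult_right integrable_normal_density)
  show "(\<integral>x. exp (- r * (x - m)\<^sup>2) \<partial>lborel) = sqrt (pi / r)"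
    unfolding eq using \<sigma>(1) by simp
qed

lemma gaussian_fourier:
  "integrable lborel (\<lambda>x. complex_of_real (exp (- x\<^sup>2 / 2)) * cis (u * x))"
  "(\<integral>x. complex_of_real (exp (- x\<^sup>2 / 2)) * cis (u * x) \<partial>lborel) = of_real (sqrt (2 * pi) * exp (- u\<^sup>2 / 2))"
proof -
  have g: "integrable lborel (\<lambda>x::real. exp (- x\<^sup>2 / 2))" using gaussian_real(1)[of "1/2" 0] by simp
  show int: "integrable lborel (\<lambda>x. complex_of_real (exp (- x\<^sup>2 / 2)) * cis (u * x))"
  proof (rule Bochner_Integration.integrable_bound[OF g])
    have "continuous_on UNIV (\<lambda>x. complex_of_real (exp (- x\<^sup>2 / 2)) * cis (u * x))" by (intro continuous_intros) auto
    then show "(\<lambda>x. complex_of_real (exp (- x\<^sup>2 / 2)) * cis (u * x)) \<in> borel_measurable lborel"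
      using borel_measurable_continuous_onI by simp
  qed (simp add: norm_mult)
  have "complex_of_real (exp (- u\<^sup>2 / 2)) = char std_normal_distribution u"
    by (simp add: char_std_normal_distribution)
  also have "\<dots> = (\<integral>x. std_normal_density x *\<^sub>R iexp (u * x) \<partial>lborel)"
    unfolding char_def by (subst integral_density) (auto simp: normal_density_nonneg)
  also have "\<dots> = (\<integral>x. of_real (1 / sqrt (2 * pi)) * (complex_of_real (exp (- x\<^sup>2 / 2)) * cis (u * x)) \<partial>lborel)"
    by (simp add: std_normal_density_def cis_conv_exp scaleR_conv_of_real mult_ac)
  also have "\<dots> = of_real (1 / sqrt (2 * pi)) * (\<integral>x. complex_of_real (exp (- x\<^sup>2 / 2)) * cis (u * x) \<partial>lborel)"
    by (rule integral_mult_right_zero)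
  finally show "(\<integral>x. complex_of_real (exp (- x\<^sup>2 / 2)) * cis (u * x) \<partial>lborel) = of_real (sqrt (2 * pi) * exp (- u\<^sup>2 / 2))"
    by (simp add: field_simps flip: of_real_mult)
qed

text \<open>A shift of the real variable by Re \<zeta> completes the square in the real part and
  leaves the Fourier transform of a Gaussian, so no contour has to be moved.\<close>

lemma gaussian_complex:
  "(\<integral>x. exp (- (complex_of_real x)\<^sup>2 / 2 + of_real x * \<zeta>) \<partial>lborel) = of_real (sqrt (2 * pi)) * exp (\<zeta>\<^sup>2 / 2)"
proof -
  define s u where "s = Re \<zeta>" and "u = Im \<zeta>"
  have z: "\<zeta> = of_real s + \<i> * of_real u" by (simp add: s_def u_def complex_eq_iff)
  define K where "K = exp (complex_of_real (s\<^sup>2 / 2) + \<i> * of_real (u * s))"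
  have eq: "exp (- (complex_of_real (s + x))\<^sup>2 / 2 + of_real (s + x) * \<zeta>) = K * (complex_of_real (exp (- x\<^sup>2 / 2)) * cis (u * x))" for x
    unfolding K_def z cis_conv_exp exp_of_real[symmetric] exp_add[symmetric]
    by (rule arg_cong[of _ _ exp]) (simp add: power2_eq_square field_simps)
  have "(\<integral>x. exp (- (complex_of_real x)\<^sup>2 / 2 + of_real x * \<zeta>) \<partial>lborel) =
      (\<integral>x. exp (- (complex_of_real (s + 1 * x))\<^sup>2 / 2 + of_real (s + 1 * x) * \<zeta>) \<partial>lborel)"
    by (subst lborel_integral_real_affine[of 1 _ s]) auto
  also have "\<dots> = K * (\<integral>x. complex_of_real (exp (- x\<^sup>2 / 2)) * cis (u * x) \<partial>lborel)"
    unfolding mult_1 eq by (rule integral_mult_right_zero)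
  also have "\<dots> = of_real (sqrt (2 * pi)) * (K * exp (complex_of_real (- u\<^sup>2 / 2)))"
    unfolding gaussian_fourier(2) by (simp only: of_real_mult exp_of_real mult_ac)
  also have "K * exp (complex_of_real (- u\<^sup>2 / 2)) = exp (\<zeta>\<^sup>2 / 2)"
    unfolding K_def z exp_add[symmetric]
    by (rule arg_cong[of _ _ exp]) (simp add: power2_eq_square field_simps)
  finally show ?thesis .
qed

section \<open>The basis functions\<close>

text \<open>The distance between neighbouring horizontal lines on which the basis functions
  concentrate. Its square is pi Im \<tau> = pi sqrt 3 / 2, so the nome is exp (- dlt^2).\<close>

definition dlt :: real where "dlt = pi / gam"

definition nrm :: real where "nrm = (2 / (pi * gam\<^sup>2)) powr (1/4)"

lemma nrm_pos: "0 < nrm" using gam_pos by (simp add: nrm_def)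

lemma dlt_pos: "0 < dlt" using gam_pos by (simp add: dlt_def)

lemma nrm_sq: "nrm\<^sup>2 = sqrt (2 / (pi * gam\<^sup>2))"
proof -
  have "nrm\<^sup>2 = nrm powr 2" using nrm_pos by (simp add: powr_numeral)
  also have "\<dots> = (2 / (pi * gam\<^sup>2)) powr (1/2)" by (simp add: nrm_def powr_powr)
  also have "\<dots> = sqrt (2 / (pi * gam\<^sup>2))" using gam_pos by (simp add: powr_half_sqrt)
  finally show ?thesis .
qed

lemma dlt_sq: "dlt\<^sup>2 = pi * sqrt 3 / 2"
  unfolding dlt_def power_divide gam_sq by (simp add: power2_eq_square field_simps)

lemma nome_dlt: "nome = exp (- dlt\<^sup>2)"
  by (simp add: nome_alt dlt_sq)

lemma tau_eq: "tau = - 1 / 2 + \<i> * of_real (sqrt 3 / 2)"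
proof -
  have "tau = cis (2 * pi / 3)" unfolding tau_def cis_conv_exp by (rule arg_cong[of _ _ exp]) simp
  then show ?thesis by (simp add: complex_eq_iff cos_120 sin_120)
qed

definition gauss :: "int \<Rightarrow> real \<Rightarrow> real" where
  "gauss k y = exp (- (y + of_int k * dlt)\<^sup>2)"

text \<open>Since dlt^2 = pi Im \<tau>, the quadratic terms in k and Im z complete to one square, so
  the modulus is a Gaussian around Im z = - k dlt. The real part -1/2 of \<tau> survives as the
  phase - pi k^2 / 2, from which the signs in \<open>omega\<close> arise.\<close>

lemma psi_eq:
  "psi k z = of_real nrm * cis (2 * dlt * of_int k * Re z + Re z * Im z - pi * (of_int k)\<^sup>2 / 2) * of_real (gauss k (Im z))"
proof -
  define x y where "x = Re z" and "y = Im z"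
  have z: "z = of_real x + \<i> * of_real y" by (simp add: x_def y_def complex_eq_iff)
  have cm: "(cmod z)\<^sup>2 = x\<^sup>2 + y\<^sup>2" by (simp add: cmod_power2 x_def y_def)
  have d: "complex_of_real pi / of_real gam = of_real dlt" by (simp add: dlt_def)
  have e1: "2 * \<i> * of_int k * complex_of_real pi * z / complex_of_real gam = 2 * \<i> * of_int k * of_real dlt * z"
    unfolding d[symmetric] by simp
  have e2: "\<i> * complex_of_real pi * tau * (of_int k)\<^sup>2 = - (\<i> * of_real (pi * (of_int k)\<^sup>2 / 2)) - of_real (dlt\<^sup>2 * (of_int k)\<^sup>2)"
    unfolding tau_eq dlt_sq by (simp add: field_simps)
  have "2 * \<i> * of_int k * complex_of_real pi * z / complex_of_real gam + \<i> * complex_of_real pi * tau * (of_int k)\<^sup>2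
      + z\<^sup>2 / 2 - complex_of_real ((cmod z)\<^sup>2 / 2) =
      \<i> * of_real (2 * dlt * of_int k * x + x * y - pi * (of_int k)\<^sup>2 / 2) + of_real (- (y + of_int k * dlt)\<^sup>2)"
    unfolding e1 e2 cm by (simp add: z power2_eq_square field_simps)
  then show ?thesis
    unfolding psi_def nrm_def[symmetric] gauss_def x_def[symmetric] y_def[symmetric] cis_conv_exp
    by (simp only: exp_add exp_of_real mult.assoc)
qed

lemma norm_psi: "cmod (psi k z) = nrm * gauss k (Im z)"
  using nrm_pos by (simp add: psi_eq norm_mult gauss_def)

lemma continuous_psi: "continuous_on S (psi k)"
  unfolding psi_def[abs_def] using gam_pos by (intro continuous_intros) auto

lemma measurable_psi [measurable]: "psi k \<in> borel_measurable borel"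
  by (rule borel_measurable_continuous_onI[OF continuous_psi])

lemma gauss_nonneg [simp]: "0 \<le> gauss k y" and gauss_le_1: "gauss k y \<le> 1"
  by (auto simp: gauss_def)

lemma continuous_gauss: "continuous_on S (gauss k)"
  unfolding gauss_def[abs_def] by (intro continuous_intros)

lemma gauss_integrable: "integrable lborel (gauss k)"
  using gaussian_real(1)[of 1 "- of_int k * dlt"] by (simp add: gauss_def[abs_def])

section \<open>Orthonormality on the strip\<close>

lemma measurable_strip [measurable]: "strip \<gamma> \<in> sets borel"
proof -
  have "strip \<gamma> = Re -` {- \<gamma> / 2 <.. \<gamma> / 2} \<inter> space borel" by (auto simp: strip_def)
  moreover have "Re -` {- \<gamma> / 2 <.. \<gamma> / 2} \<inter> space borel \<in> sets borel"
    by (rule measurable_sets[OF borel_measurable_Re]) simp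
  ultimately show ?thesis by (simp only:)
qed

lemma integral_strip_conv:
  fixes f :: "complex \<Rightarrow> 'a::{banach,second_countable_topology}"
  assumes [measurable]: "f \<in> borel_measurable borel"
  shows "integrable (lebesgue_on (strip \<gamma>)) f \<longleftrightarrow> integrable lborel (\<lambda>w. indicator (strip \<gamma>) w *\<^sub>R f w)"
    "integral\<^sup>L (lebesgue_on (strip \<gamma>)) f = (\<integral>w. indicator (strip \<gamma>) w *\<^sub>R f w \<partial>lborel)"
proof -
  have s: "strip \<gamma> \<inter> space lebesgue \<in> sets lebesgue" by simp
  show "integrable (lebesgue_on (strip \<gamma>)) f \<longleftrightarrow> integrable lborel (\<lambda>w. indicator (strip \<gamma>) w *\<^sub>R f w)"
    unfolding integrable_restrict_space[OF s] by (rule integrable_completion) measurable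
  show "integral\<^sup>L (lebesgue_on (strip \<gamma>)) f = (\<integral>w. indicator (strip \<gamma>) w *\<^sub>R f w \<partial>lborel)"
    unfolding integral_restrict_space[OF s] by (rule integral_completion) measurable
qed

lemma measurable_lebesgue_on_borel:
  "f \<in> borel_measurable borel \<Longrightarrow> f \<in> borel_measurable (lebesgue_on S)"
  by (intro measurable_restrict_space1 measurable_completion) simp

text \<open>The strip is half open, but its missing left edge is a null set; on the closed interval
  the fundamental theorem of calculus can be used.\<close>

lemma strip_product_integral:
  fixes g :: "real \<Rightarrow> complex"
  assumes f: "continuous_on UNIV f" and g: "integrable lborel g"
  shows "integrable (lebesgue_on (strip gam)) (\<lambda>w. f (Re w) * g (Im w))"
    "(\<integral>w. f (Re w) * g (Im w) \<partial>lebesgue_on (strip gam)) =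
       (\<integral>x. indicator {- gam / 2..gam / 2} x *\<^sub>R f x \<partial>lborel) * (\<integral>y. g y \<partial>lborel)"
proof -
  have [measurable]: "f \<in> borel_measurable borel" "g \<in> borel_measurable borel"
    using borel_measurable_continuous_onI[OF f] borel_measurable_integrable[OF g] by simp_all
  define F where "F x = indicator {- gam / 2<..gam / 2} x *\<^sub>R f x" for x
  have "integrable lborel (\<lambda>x. indicator {- gam / 2..gam / 2} x *\<^sub>R f x)"
    using borel_integrable_compact[of "{- gam / 2..gam / 2}" f] continuous_on_subset[OF f] by auto
  then have Fi: "integrable lborel F"
    unfolding F_def by (rule Bochner_Integration.integrable_bound) (auto simp: indicator_def)
  have Feq: "(\<integral>x. F x \<partial>lborel) = (\<integral>x. indicator {- gam / 2..gam / 2} x *\<^sub>R f x \<partial>lborel)"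
    unfolding F_def by (rule integral_cong_AE)
      (use AE_lborel_singleton[of "- gam / 2"] in \<open>auto elim!: eventually_mono simp: indicator_def\<close>)
  have e: "indicator (strip gam) w *\<^sub>R (f (Re w) * g (Im w)) = F (Re w) * g (Im w)" for w
    by (auto simp: F_def indicator_def strip_def)
  have m: "(\<lambda>w. f (Re w) * g (Im w)) \<in> borel_measurable borel" by measurable
  show "integrable (lebesgue_on (strip gam)) (\<lambda>w. f (Re w) * g (Im w))"
    unfolding integral_strip_conv(1)[OF m] e by (rule complex_product_integral(1)[OF Fi g])
  show "(\<integral>w. f (Re w) * g (Im w) \<partial>lebesgue_on (strip gam)) =
       (\<integral>x. indicator {- gam / 2..gam / 2} x *\<^sub>R f x \<partial>lborel) * (\<integral>y. g y \<partial>lborel)"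
    unfolding integral_strip_conv(2)[OF m] e complex_product_integral(2)[OF Fi g] Feq ..
qed

lemma integral_cis_period:
  assumes "k \<noteq> 0" "a \<le> b" "c * (b - a) = 2 * pi * of_int k"
  shows "(\<integral>x. indicator {a..b} x *\<^sub>R cis (c * x) \<partial>lborel) = 0"
proof -
  have c: "c \<noteq> 0" using assms by auto
  have "(\<integral>x. indicator {a..b} x *\<^sub>R cis (c * x) \<partial>lborel) = cis (c * b) / (\<i> * c) - cis (c * a) / (\<i> * c)"
  proof (rule integral_FTC_Icc[OF assms(2)])
    fix x
    have "((\<lambda>x. c * x) has_real_derivative c) (at x within {a..b})" by (auto intro!: derivative_eq_intros)
    from has_vector_derivative_divide[OF has_vector_derivative_cis[OF this], of "\<i> * c"] 
    show "((\<lambda>x. cis (c * x) / (\<i> * c)) has_vector_derivative cis (c * x)) (at x within {a..b})" using c by simp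
  qed (intro continuous_intros)
  also have "cis (c * b) = cis (c * a) * cis (c * (b - a))" by (simp add: cis_mult algebra_simps)
  also have "cis (c * (b - a)) = 1" unfolding assms(3) by (metis cis_multiple_2pi Ints_of_int)
  finally show ?thesis by simp
qed

lemma psi_mult_cnj_psi:
  "psi m w * cnj (psi n w) = (of_real (nrm\<^sup>2) * cis (pi * ((of_int n)\<^sup>2 - (of_int m)\<^sup>2) / 2)) *
     (cis (2 * dlt * of_int (m - n) * Re w) * of_real (gauss m (Im w) * gauss n (Im w)))"
proof -
  have c: "cis (2 * dlt * of_int m * Re w + Re w * Im w - pi * (of_int m)\<^sup>2 / 2) * cnj (cis (2 * dlt * of_int n * Re w + Re w * Im w - pi * (of_int n)\<^sup>2 / 2))
    = cis (pi * ((of_int n)\<^sup>2 - (of_int m)\<^sup>2) / 2) * cis (2 * dlt * of_int (m - n) * Re w)"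
    unfolding cis_cnj cis_mult by (rule arg_cong[of _ _ cis]) (simp add: field_simps)
  have "psi m w * cnj (psi n w) = of_real (nrm\<^sup>2) * (cis (2 * dlt * of_int m * Re w + Re w * Im w - pi * (of_int m)\<^sup>2 / 2) * cnj (cis (2 * dlt * of_int n * Re w + Re w * Im w - pi * (of_int n)\<^sup>2 / 2))) * of_real (gauss m (Im w) * gauss n (Im w))"
    unfolding psi_eq by (simp add: power2_eq_square)
  then show ?thesis unfolding c by simp
qed

lemma gauss_mult_integrable: "integrable lborel (\<lambda>y. complex_of_real (gauss m y * gauss n y))"
proof (rule integrable_of_real, rule Bochner_Integration.integrable_bound[OF gauss_integrable[of m]])
  show "(\<lambda>y. gauss m y * gauss n y) \<in> borel_measurable lborel"
    using borel_measurable_continuous_onI[OF continuous_on_mult[OF continuous_gauss continuous_gauss]] by simp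
  show "AE y in lborel. norm (gauss m y * gauss n y) \<le> norm (gauss m y)"
    using gauss_le_1 by (intro AE_I2) (simp add: abs_mult mult_left_le)
qed

text \<open>For m different from n the product is a nontrivial character of period gam in Re z and
  integrates to 0. For m = n, \<open>nrm\<close> normalizes a Gaussian of rate 2 in Im z over a
  strip of width gam.\<close>

interpretation strip: orthonormal_system "lebesgue_on (strip gam)" psi
proof
  have int: "integrable (lebesgue_on (strip gam)) (\<lambda>w. psi m w * cnj (psi n w))" for m n
    unfolding psi_mult_cnj_psi
    by (rule integrable_mult_right, rule strip_product_integral(1)[OF _ gauss_mult_integrable]) (intro continuous_intros)
  show "sq_int (lebesgue_on (strip gam)) (psi n)" for n
  proof -
    have "integrable (lebesgue_on (strip gam)) (\<lambda>w. norm (psi n w * cnj (psi n w)))" by (rule integrable_norm[OF int])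
    then show ?thesis
      by (simp add: sq_int_def norm_mult power2_eq_square measurable_lebesgue_on_borel[OF measurable_psi])
  qed
  show "L2ip (lebesgue_on (strip gam)) (psi m) (psi n) = (if m = n then 1 else 0)" for m n
  proof -
    have "L2ip (lebesgue_on (strip gam)) (psi m) (psi n) = (of_real (nrm\<^sup>2) * cis (pi * ((of_int n)\<^sup>2 - (of_int m)\<^sup>2) / 2)) *
       ((\<integral>x. indicator {- gam / 2..gam / 2} x *\<^sub>R cis (2 * dlt * of_int (m - n) * x) \<partial>lborel) * (\<integral>y. complex_of_real (gauss m y * gauss n y) \<partial>lborel))"
      unfolding L2ip_def psi_mult_cnj_psi integral_mult_right_zero
      by (subst strip_product_integral(2)[OF _ gauss_mult_integrable]) (auto intro!: continuous_intros)
    also have "\<dots> = (if m = n then 1 else 0)"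
    proof (cases "m = n")
      case False
      have "(\<integral>x. indicator {- gam / 2..gam / 2} x *\<^sub>R cis (2 * dlt * of_int (m - n) * x) \<partial>lborel) = 0"
        by (rule integral_cis_period[of "m - n"]) (use False gam_pos in \<open>auto simp: dlt_def\<close>)
      then show ?thesis using False by simp
    next
      case True
      have "gauss n y * gauss n y = exp (- 2 * (y - (- of_int n * dlt))\<^sup>2)" for y
        unfolding gauss_def exp_add[symmetric] by simp
      then have "(\<integral>y. complex_of_real (gauss n y * gauss n y) \<partial>lborel) = of_real (sqrt (pi / 2))"
        using gaussian_real(2)[of 2 "- of_int n * dlt"] by (simp only: integral_complex_of_real)
      moreover have "(\<integral>x. indicator {- gam / 2..gam / 2} x *\<^sub>R (1::complex) \<partial>lborel) = of_real gam"
        using gam_pos by (simp add: scaleR_conv_of_real)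
      moreover have "nrm\<^sup>2 * (gam * sqrt (pi / 2)) = 1"
      proof -
        have "nrm\<^sup>2 * (gam * sqrt (pi / 2)) = sqrt (2 / (pi * gam\<^sup>2)) * sqrt (gam\<^sup>2 * (pi / 2))"
          unfolding nrm_sq real_sqrt_mult[of "gam\<^sup>2"] using gam_pos by (simp only: real_sqrt_abs abs_of_pos)
        also have "\<dots> = 1" unfolding real_sqrt_mult[symmetric] using gam_pos by simp
        finally show ?thesis .
      qed
      then have "complex_of_real (nrm\<^sup>2) * (of_real gam * of_real (sqrt (pi / 2))) = 1"
        by (simp only: of_real_mult[symmetric] of_real_1)
      ultimately show ?thesis using True by (simp del: of_real_power of_real_mult)
    qed
    finally show ?thesis .
  qed
qed

section \<open>The circle\<close>

definition ee :: "int \<Rightarrow> real \<Rightarrow> complex" where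
  "ee n \<xi> = cis (- 2 * pi * of_int n * \<xi>)"

lemma ee_exp: "exp (- 2 * complex_of_real pi * \<i> * of_int n * complex_of_real \<xi>) = ee n \<xi>"
  unfolding ee_def cis_conv_exp by (rule arg_cong[of _ _ exp]) simp

lemma finite_unit_interval: "finite_measure unit_interval"
  by (rule finite_measure_lebesgue_on) simp

lemma continuous_measurable_unit: "continuous_on UNIV f \<Longrightarrow> f \<in> borel_measurable unit_interval"
  for f :: "real \<Rightarrow> 'a::topological_space"
  using borel_measurable_continuous_onI[of f] by (intro measurable_restrict_space1 measurable_completion) simp

lemma ee_mult: "ee m \<xi> * ee n \<xi> = ee (m + n) \<xi>"
  unfolding ee_def cis_mult by (rule arg_cong[of _ _ cis]) (simp add: algebra_simps)

lemma ee_cnj: "cnj (ee n \<xi>) = ee (- n) \<xi>"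
  unfolding ee_def cis_cnj by (rule arg_cong[of _ _ cis]) simp

lemma norm_ee [simp]: "cmod (ee n \<xi>) = 1"
  by (simp add: ee_def)

lemma continuous_ee: "continuous_on S (ee n)"
  unfolding ee_def[abs_def] by (intro continuous_intros)

lemma measurable_ee [measurable]: "ee n \<in> borel_measurable unit_interval"
  by (rule continuous_measurable_unit[OF continuous_ee])

interpretation circle: orthonormal_system unit_interval ee
proof
  show "sq_int unit_interval (ee n)" for n
    by (rule sq_int_bounded[OF finite_unit_interval, of _ 1]) auto
  show "L2ip unit_interval (ee m) (ee n) = (if m = n then 1 else 0)" for m n
  proof -
    have s: "{0..1} \<inter> space lebesgue \<in> sets (lebesgue :: real measure)" by simp
    have m: "(\<lambda>x. indicator {0..1} x *\<^sub>R cis (- 2 * pi * of_int (m - n) * x)) \<in> borel_measurable borel"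
      by (intro borel_measurable_scaleR borel_measurable_indicator borel_measurable_continuous_onI continuous_intros) simp
    have "L2ip unit_interval (ee m) (ee n) = (\<integral>x. cis (- 2 * pi * of_int (m - n) * x) \<partial>unit_interval)"
      unfolding L2ip_def ee_cnj ee_mult by (simp add: ee_def)
    also have "\<dots> = (\<integral>x. indicator {0..1} x *\<^sub>R cis (- 2 * pi * of_int (m - n) * x) \<partial>lborel)"
      unfolding integral_restrict_space[OF s] using m by (intro integral_completion) simp
    also have "\<dots> = (if m = n then 1 else 0)"
    proof (cases "m = n")
      case False
      then show ?thesis
        by (simp only: if_False, intro integral_cis_period[of "n - m"]) (simp_all add: algebra_simps)
    qed (simp add: scaleR_conv_of_real)
    finally show ?thesis .
  qed
qed

section \<open>The projection of a product of three basis functions\<close>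

text \<open>The coefficient with which a product of three basis functions projects, in terms of the
  displacements p and q of the two unconjugated indices from the output index. The sign is (-1)^(p
  q) and is responsible for the terms with - 2 h in the symbols.\<close>

definition omega :: "int \<Rightarrow> int \<Rightarrow> real" where
  "omega p q = kap * (if odd p \<and> odd q then -1 else 1) * exp (- (dlt\<^sup>2 * ((of_int p)\<^sup>2 + (of_int q)\<^sup>2)))"

text \<open>Completing the square shows that the modulus is a Gaussian centred at z; hence the
  projection acts on all bounded functions, square integrable or not.\<close>

lemma norm_kernel:
  "cmod (exp (cnj w * z - complex_of_real ((cmod w)\<^sup>2 / 2))) = exp ((cmod z)\<^sup>2 / 2) * exp (- (cmod (w - z))\<^sup>2 / 2)"
proof -
  have "Re (cnj w * z - complex_of_real ((cmod w)\<^sup>2 / 2)) = (cmod z)\<^sup>2 / 2 - (cmod (w - z))\<^sup>2 / 2"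
    unfolding cmod_power2 by (simp add: power2_eq_square field_simps)
  then show ?thesis
    unfolding norm_exp_eq_Re exp_add[symmetric] by (simp only: diff_conv_add_uminus minus_divide_left)
qed

lemma heat_kernel_integral:
  "integrable lborel (\<lambda>w. exp (- (cmod (w - z))\<^sup>2 / 2))" "(\<integral>w. exp (- (cmod (w - z))\<^sup>2 / 2) \<partial>lborel) = 2 * pi"
proof -
  have g: "integrable lborel (\<lambda>x. complex_of_real (exp (- (1 / 2) * (x - m)\<^sup>2)))"
    "(\<integral>x. complex_of_real (exp (- (1 / 2) * (x - m)\<^sup>2)) \<partial>lborel) = of_real (sqrt (2 * pi))" for m
    using gaussian_real[of "1/2" m] by (simp_all add: integral_complex_of_real mult.commute del: of_real_exp)
  have e: "complex_of_real (exp (- (cmod (w - z))\<^sup>2 / 2)) =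
     complex_of_real (exp (- (1 / 2) * (Re w - Re z)\<^sup>2)) * complex_of_real (exp (- (1 / 2) * (Im w - Im z)\<^sup>2))" for w
    unfolding of_real_mult[symmetric] exp_add[symmetric] by (simp add: cmod_power2 field_simps)
  have i: "integrable lborel (\<lambda>w. complex_of_real (exp (- (cmod (w - z))\<^sup>2 / 2)))"
    unfolding e by (rule complex_product_integral(1)[OF g(1) g(1)])
  then show "integrable lborel (\<lambda>w. exp (- (cmod (w - z))\<^sup>2 / 2))"
    using integrable_Re[OF i] by simp
  have "(\<integral>w. complex_of_real (exp (- (cmod (w - z))\<^sup>2 / 2)) \<partial>lborel) = of_real (sqrt (2 * pi)) * of_real (sqrt (2 * pi))"
    unfolding e complex_product_integral(2)[OF g(1) g(1)] g(2) ..
  also have "\<dots> = of_real (2 * pi)" by (simp flip: of_real_mult)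
  finally show "(\<integral>w. exp (- (cmod (w - z))\<^sup>2 / 2) \<partial>lborel) = 2 * pi"
    unfolding integral_complex_of_real of_real_eq_iff .
qed

section \<open>The projection on bounded functions\<close>

definition kern :: "complex \<Rightarrow> complex \<Rightarrow> complex" where
  "kern z w = exp (cnj w * z - complex_of_real ((cmod w)\<^sup>2 / 2))"

lemma kern_measurable [measurable]: "kern z \<in> borel_measurable borel"
  unfolding kern_def[abs_def] by (intro borel_measurable_continuous_onI continuous_intros) simp

lemma norm_kern_le:
  assumes "cmod u \<le> B"
  shows "cmod (kern z w * u) \<le> B * exp ((cmod z)\<^sup>2 / 2) * exp (- (cmod (w - z))\<^sup>2 / 2)"
proof -
  have "cmod (kern z w * u) = exp ((cmod z)\<^sup>2 / 2) * exp (- (cmod (w - z))\<^sup>2 / 2) * cmod u"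
    unfolding norm_mult kern_def norm_kernel ..
  also have "\<dots> \<le> exp ((cmod z)\<^sup>2 / 2) * exp (- (cmod (w - z))\<^sup>2 / 2) * B"
    using assms by (intro mult_left_mono) auto
  finally show ?thesis by (simp only: mult_ac)
qed

lemma kern_integrable:
  assumes "u \<in> borel_measurable borel" "\<And>w. cmod (u w) \<le> B"
  shows "integrable lborel (\<lambda>w. kern z w * u w)"
proof (rule Bochner_Integration.integrable_bound)
  show "integrable lborel (\<lambda>w. B * exp ((cmod z)\<^sup>2 / 2) * exp (- (cmod (w - z))\<^sup>2 / 2))"
    by (intro integrable_mult_right heat_kernel_integral)
  show "(\<lambda>w. kern z w * u w) \<in> borel_measurable lborel" using assms(1) by measurable
  have "0 \<le> B" using assms(2)[of 0] norm_ge_zero order_trans by blast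
  then show "AE w in lborel. norm (kern z w * u w) \<le> norm (B * exp ((cmod z)\<^sup>2 / 2) * exp (- (cmod (w - z))\<^sup>2 / 2))"
    using norm_kern_le[OF assms(2)] by (intro AE_I2) simp
qed

lemma Pi_op_lborel:
  assumes "u \<in> borel_measurable borel"
  shows "Pi_op u z = complex_of_real (1 / pi * exp (- (cmod z)\<^sup>2 / 2)) * (\<integral>w. kern z w * u w \<partial>lborel)"
proof -
  have "(\<lambda>w. kern z w * u w) \<in> borel_measurable lborel" using assms by measurable
  from integral_completion[OF this] show ?thesis by (simp add: Pi_op_def kern_def)
qed

text \<open>The factor 2 is 1 / pi times the mass 2 pi of the Gaussian; the exponentials in z
  cancel.\<close>

lemma Pi_op_bound:
  assumes "u \<in> borel_measurable borel" "\<And>w. cmod (u w) \<le> B"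
  shows "cmod (Pi_op u z) \<le> 2 * B"
proof -
  have B: "0 \<le> B" using assms(2)[of 0] norm_ge_zero order_trans by blast
  have "cmod (\<integral>w. kern z w * u w \<partial>lborel) \<le> (\<integral>w. B * exp ((cmod z)\<^sup>2 / 2) * exp (- (cmod (w - z))\<^sup>2 / 2) \<partial>lborel)"
  proof (rule order_trans[OF integral_norm_bound integral_mono])
    show "integrable lborel (\<lambda>w. norm (kern z w * u w))" by (rule integrable_norm[OF kern_integrable[OF assms]])
    show "integrable lborel (\<lambda>w. B * exp ((cmod z)\<^sup>2 / 2) * exp (- (cmod (w - z))\<^sup>2 / 2))"
      by (intro integrable_mult_right heat_kernel_integral)
    show "norm (kern z w * u w) \<le> B * exp ((cmod z)\<^sup>2 / 2) * exp (- (cmod (w - z))\<^sup>2 / 2)" for w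
      by (rule norm_kern_le[OF assms(2)])
  qed
  also have "\<dots> = B * exp ((cmod z)\<^sup>2 / 2) * (2 * pi)"
    by (simp only: integral_mult_right_zero heat_kernel_integral)
  finally have "cmod (Pi_op u z) \<le> (1 / pi * exp (- (cmod z)\<^sup>2 / 2)) * (B * exp ((cmod z)\<^sup>2 / 2) * (2 * pi))"
  proof -
    have "cmod (complex_of_real (1 / pi * exp (- (cmod z)\<^sup>2 / 2))) = 1 / pi * exp (- (cmod z)\<^sup>2 / 2)"
      unfolding norm_of_real by (rule abs_of_nonneg) simp
    moreover assume "cmod (\<integral>w. kern z w * u w \<partial>lborel) \<le> B * exp ((cmod z)\<^sup>2 / 2) * (2 * pi)"
    ultimately show ?thesis
      unfolding Pi_op_lborel[OF assms(1)] norm_mult by (simp only:) (rule mult_left_mono, auto)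
  qed
  also have "\<dots> = 2 * B" by (simp add: exp_minus field_simps)
  finally show ?thesis .
qed

lemma Pi_op_add:
  assumes "u \<in> borel_measurable borel" "\<And>w. cmod (u w) \<le> B" "v \<in> borel_measurable borel" "\<And>w. cmod (v w) \<le> B'"
  shows "Pi_op (\<lambda>w. u w + v w) z = Pi_op u z + Pi_op v z"
proof -
  have "(\<lambda>w. u w + v w) \<in> borel_measurable borel" using assms by measurable
  then show ?thesis
    unfolding Pi_op_lborel[OF assms(1)] Pi_op_lborel[OF assms(3)]
    by (simp add: Pi_op_lborel distrib_left Bochner_Integration.integral_add[OF kern_integrable[OF assms(1,2)] kern_integrable[OF assms(3,4)]])
qed

lemma Pi_op_sum:
  assumes "finite I" "\<And>i. i \<in> I \<Longrightarrow> u i \<in> borel_measurable borel" "\<And>i w. i \<in> I \<Longrightarrow> cmod (u i w) \<le> B i"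
  shows "Pi_op (\<lambda>w. \<Sum>i\<in>I. u i w) z = (\<Sum>i\<in>I. Pi_op (u i) z)"
proof -
  have "(\<lambda>w. \<Sum>i\<in>I. u i w) \<in> borel_measurable borel" using assms by (intro borel_measurable_sum) auto
  then have "Pi_op (\<lambda>w. \<Sum>i\<in>I. u i w) z = complex_of_real (1 / pi * exp (- (cmod z)\<^sup>2 / 2)) * (\<integral>w. (\<Sum>i\<in>I. kern z w * u i w) \<partial>lborel)"
    by (simp add: Pi_op_lborel sum_distrib_left)
  also have "(\<integral>w. (\<Sum>i\<in>I. kern z w * u i w) \<partial>lborel) = (\<Sum>i\<in>I. (\<integral>w. kern z w * u i w \<partial>lborel))"
    using assms by (intro Bochner_Integration.integral_sum kern_integrable) auto
  finally show ?thesis using assms(2) by (simp add: sum_distrib_left Pi_op_lborel)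
qed

lemma Pi_op_cmult:
  assumes "u \<in> borel_measurable borel"
  shows "Pi_op (\<lambda>w. c * u w) z = c * Pi_op u z"
proof -
  have "(\<lambda>w. c * u w) \<in> borel_measurable borel" using assms by measurable
  moreover have "kern z w * (c * u w) = c * (kern z w * u w)" for w by simp
  ultimately show ?thesis using assms by (simp only: Pi_op_lborel integral_mult_right_zero) (simp add: mult_ac)
qed

text \<open>Bounded pointwise convergence passes through the projection, with the Gaussian kernel as
  majorant. This justifies truncating the lattice sums.\<close>

lemma Pi_op_dominated:
  assumes "\<And>N. u N \<in> borel_measurable borel" "\<And>N w. cmod (u N w) \<le> B" "\<And>w. (\<lambda>N. u N w) \<longlonglongrightarrow> v w"
  shows "(\<lambda>N. Pi_op (u N) z) \<longlonglongrightarrow> Pi_op v z"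
proof -
  have v: "v \<in> borel_measurable borel" by (rule borel_measurable_LIMSEQ_metric[OF assms(1,3)])
  have "(\<lambda>N. \<integral>w. kern z w * u N w \<partial>lborel) \<longlonglongrightarrow> (\<integral>w. kern z w * v w \<partial>lborel)"
  proof (rule integral_dominated_convergence)
    show "integrable lborel (\<lambda>w. B * exp ((cmod z)\<^sup>2 / 2) * exp (- (cmod (w - z))\<^sup>2 / 2))"
      by (intro integrable_mult_right heat_kernel_integral)
    show "(\<lambda>w. kern z w * v w) \<in> borel_measurable lborel" using v by measurable
    show "(\<lambda>w. kern z w * u N w) \<in> borel_measurable lborel" for N using assms(1)[of N] by measurable
    show "AE w in lborel. (\<lambda>N. kern z w * u N w) \<longlonglongrightarrow> kern z w * v w"
      by (intro AE_I2 tendsto_intros assms(3))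
    show "AE w in lborel. norm (kern z w * u N w) \<le> B * exp ((cmod z)\<^sup>2 / 2) * exp (- (cmod (w - z))\<^sup>2 / 2)" for N
      by (intro AE_I2 norm_kern_le assms(2))
  qed
  then show ?thesis unfolding Pi_op_lborel[OF assms(1)] Pi_op_lborel[OF v] by (intro tendsto_intros)
qed

section \<open>The projection of an elementary triple product\<close>

definition trip :: "int \<Rightarrow> int \<Rightarrow> int \<Rightarrow> complex \<Rightarrow> complex" where
  "trip a b c w = psi a w * cnj (psi b w) * psi c w"

lemma trip_measurable [measurable]: "trip a b c \<in> borel_measurable borel"
  unfolding trip_def[abs_def] by (intro borel_measurable_continuous_onI continuous_intros continuous_psi)

lemma norm_psi_le: "cmod (psi k w) \<le> nrm"
  unfolding norm_psi using nrm_pos gauss_le_1 by (simp add: mult_left_le)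

lemma norm_trip_le: "cmod (trip a b c w) \<le> nrm * nrm * nrm"
  unfolding trip_def norm_mult using nrm_pos by (intro mult_mono) (simp_all add: norm_psi_le)

lemma trip_eq:
  "trip a b c w = of_real (nrm ^ 3) * (cis (2 * dlt * of_int (a - b + c) * Re w + Re w * Im w - pi * ((of_int a)\<^sup>2 - (of_int b)\<^sup>2 + (of_int c)\<^sup>2) / 2)
     * of_real (gauss a (Im w) * gauss b (Im w) * gauss c (Im w)))"
proof -
  let ?t = "\<lambda>k. 2 * dlt * of_int k * Re w + Re w * Im w - pi * (of_int k)\<^sup>2 / 2"
  have "cis (?t a) * cnj (cis (?t b)) * cis (?t c) =
      cis (2 * dlt * of_int (a - b + c) * Re w + Re w * Im w - pi * ((of_int a)\<^sup>2 - (of_int b)\<^sup>2 + (of_int c)\<^sup>2) / 2)"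
    unfolding cis_cnj cis_mult by (rule arg_cong[of _ _ cis]) (simp add: field_simps)
  moreover have "trip a b c w = of_real (nrm ^ 3) * (cis (?t a) * cnj (cis (?t b)) * cis (?t c) * of_real (gauss a (Im w) * gauss b (Im w) * gauss c (Im w)))"
    unfolding trip_def psi_eq by (simp add: power3_eq_cube)
  ultimately show ?thesis by simp
qed

text \<open>The integral over \<open>x = Re w\<close> comes first: it removes the \<open>y\<close>-dependence on \<open>z\<close> altogether and leaves a
  real Gaussian in \<open>y\<close> to which the output mode contributes a fourth factor.\<close>

lemma trip_inner_integral:
  fixes a b c :: int and y :: real and z :: complex
  defines "k \<equiv> a - b + c"
  shows "(\<integral>x. kern z (Complex x y) * trip a b c (Complex x y) \<partial>lborel) =
    of_real (nrm ^ 3) * cis (- pi * ((of_int a)\<^sup>2 - (of_int b)\<^sup>2 + (of_int c)\<^sup>2) / 2) * of_real (sqrt (2 * pi))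
      * exp ((z + 2 * \<i> * of_real (of_int k * dlt))\<^sup>2 / 2 + of_real ((of_int k * dlt)\<^sup>2))
      * of_real (gauss k y * gauss a y * gauss b y * gauss c y)"
proof -
  define \<theta> where "\<theta> = pi * ((of_int a)\<^sup>2 - (of_int b)\<^sup>2 + (of_int c)\<^sup>2) / 2"
  define d where "d = of_int k * dlt"
  define \<zeta> where "\<zeta> = z + \<i> * of_real (2 * d + y)"
  define g where "g = gauss a y * gauss b y * gauss c y"
  define A where "A = of_real (nrm ^ 3) * exp (- \<i> * of_real y * z - of_real (y\<^sup>2 / 2) - \<i> * of_real \<theta>) * complex_of_real g"
  have cm: "(cmod (Complex x y))\<^sup>2 = x\<^sup>2 + y\<^sup>2" for x by (simp add: cmod_power2)
  have pt: "kern z (Complex x y) * trip a b c (Complex x y) = A * exp (- (complex_of_real x)\<^sup>2 / 2 + of_real x * \<zeta>)" for x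
  proof -
    have "kern z (Complex x y) * cis (2 * dlt * of_int k * x + x * y - \<theta>) =
       exp (- \<i> * of_real y * z - of_real (y\<^sup>2 / 2) - \<i> * of_real \<theta>) * exp (- (complex_of_real x)\<^sup>2 / 2 + of_real x * \<zeta>)"
      unfolding kern_def cm cis_conv_exp exp_add[symmetric] \<zeta>_def d_def
      by (rule arg_cong[of _ _ exp]) (simp add: Complex_eq power2_eq_square field_simps)
    moreover have "trip a b c (Complex x y) = of_real (nrm ^ 3) * (cis (2 * dlt * of_int k * x + x * y - \<theta>) * of_real g)"
      unfolding trip_eq k_def[symmetric] \<theta>_def g_def by simp
    ultimately show ?thesis unfolding A_def by (simp add: mult_ac)
  qed
  have "(\<integral>x. kern z (Complex x y) * trip a b c (Complex x y) \<partial>lborel) = A * (of_real (sqrt (2 * pi)) * exp (\<zeta>\<^sup>2 / 2))"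
    unfolding pt integral_mult_right_zero gaussian_complex ..
  also have "\<dots> = of_real (nrm ^ 3) * of_real (sqrt (2 * pi)) * of_real g *
      (exp (- \<i> * of_real y * z - of_real (y\<^sup>2 / 2) - \<i> * of_real \<theta>) * exp (\<zeta>\<^sup>2 / 2))"
    unfolding A_def by (simp add: mult_ac)
  also have "exp (- \<i> * of_real y * z - of_real (y\<^sup>2 / 2) - \<i> * of_real \<theta>) * exp (\<zeta>\<^sup>2 / 2) =
      exp (\<i> * of_real (- \<theta>)) * exp ((z + 2 * \<i> * of_real d)\<^sup>2 / 2 + of_real (d\<^sup>2)) * exp (of_real (- (y + d)\<^sup>2))"
    unfolding exp_add[symmetric] \<zeta>_def by (rule arg_cong[of _ _ exp]) (simp add: power2_eq_square field_simps)
  also have "exp (complex_of_real (- (y + d)\<^sup>2)) = of_real (gauss k y)"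
    unfolding exp_of_real gauss_def d_def ..
  finally show ?thesis unfolding cis_conv_exp \<theta>_def d_def g_def by (simp add: mult_ac)
qed

text \<open>The four centres are those of k, k + p, k + q and k + p + q. Their mean index is (a + c)
  / 2 and the squared deviations from it sum to p^2 + q^2, so the product is one Gaussian of rate 4
  times the exponential factor of \<open>omega\<close>.\<close>

lemma gauss_four_integral:
  fixes a b c :: int
  defines "k \<equiv> a - b + c"
  shows "(\<integral>y. gauss k y * gauss a y * gauss b y * gauss c y \<partial>lborel) =
    sqrt pi / 2 * exp (- (dlt\<^sup>2 * ((of_int (a - k))\<^sup>2 + (of_int (c - k))\<^sup>2)))"
proof -
  define m where "m = - (of_int (a + c) * dlt / 2)"
  have b: "b = a + c - k" by (simp add: k_def)
  have "gauss k y * gauss a y * gauss b y * gauss c y =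
      exp (- (dlt\<^sup>2 * ((of_int (a - k))\<^sup>2 + (of_int (c - k))\<^sup>2))) * exp (- 4 * (y - m)\<^sup>2)" for y
    unfolding gauss_def exp_add[symmetric] b m_def
    by (rule arg_cong[of _ _ exp]) (simp add: power2_eq_square field_simps)
  then have "(\<integral>y. gauss k y * gauss a y * gauss b y * gauss c y \<partial>lborel) =
      exp (- (dlt\<^sup>2 * ((of_int (a - k))\<^sup>2 + (of_int (c - k))\<^sup>2))) * sqrt (pi / 4)"
    using gaussian_real(2)[of 4 m] by (simp only: integral_mult_right_zero)
  then show ?thesis by (simp add: real_sqrt_divide mult.commute)
qed

text \<open>For a = k + p, c = k + q, b = k + p + q one has a^2 - b^2 + c^2 = k^2 - 2 p q, so the
  two phases differ by cis (pi p q), which is a sign.\<close>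

lemma phase_parity:
  fixes a b c :: int
  defines "k \<equiv> a - b + c"
  shows "cis (- pi * ((of_int a)\<^sup>2 - (of_int b)\<^sup>2 + (of_int c)\<^sup>2) / 2) =
    (if odd (a - k) \<and> odd (c - k) then -1 else 1) * cis (- pi * (of_int k)\<^sup>2 / 2)"
proof -
  define p q where "p = a - k" and "q = c - k"
  have abc: "a = k + p" "c = k + q" "b = k + p + q" by (auto simp: p_def q_def k_def)
  have "cis (- pi * ((of_int a)\<^sup>2 - (of_int b)\<^sup>2 + (of_int c)\<^sup>2) / 2) = cis (pi * of_int (p * q)) * cis (- pi * (of_int k)\<^sup>2 / 2)"
    unfolding cis_mult abc by (rule arg_cong[of _ _ cis]) (simp add: power2_eq_square field_simps)
  also have "cis (pi * of_int (p * q)) = (if odd p \<and> odd q then -1 else 1)"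
  proof (cases "odd (p * q)")
    case True
    then obtain n where "p * q = 2 * n + 1" by (elim oddE)
    then have "pi * of_int (p * q) = 2 * pi * of_int n + pi" by (simp add: algebra_simps)
    then have "cis (pi * of_int (p * q)) = cis (2 * pi * of_int n) * cis pi" by (simp only: cis_mult)
    then show ?thesis using True cis_multiple_2pi[of "of_int n"] by simp
  next
    case False
    then have "even (p * q)" by simp
    then obtain n where "p * q = 2 * n" by (elim evenE)
    then have "pi * of_int (p * q) = 2 * pi * of_int n" by (simp add: algebra_simps)
    then have "cis (pi * of_int (p * q)) = 1" by (simp only: cis_multiple_2pi Ints_of_int)
    moreover have "\<not> (odd p \<and> odd q)" using False by simp
    ultimately show ?thesis by (simp only: if_False)
  qed
  finally show ?thesis by (simp add: p_def q_def)
qed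

text \<open>The integral over the vertical variable is a number, so z enters only through
  \<open>E\<close>; with the prefactor of the projection and the phase it forms
  \<open>psi k\<close>. The remaining constants combine to nrm^2 sqrt (2 pi) sqrt pi / (2 pi) =
  kap.\<close>

lemma Pi_op_trip:
  fixes a b c :: int
  defines "k \<equiv> a - b + c"
  shows "Pi_op (trip a b c) z = of_real (omega (a - k) (c - k)) * psi k z"
proof -
  define d where "d = of_int k * dlt"
  define E where "E = exp ((z + 2 * \<i> * of_real d)\<^sup>2 / 2 + of_real (d\<^sup>2))"
  define P where "P = cis (- pi * ((of_int a)\<^sup>2 - (of_int b)\<^sup>2 + (of_int c)\<^sup>2) / 2)"
  define W where "W = exp (- (dlt\<^sup>2 * ((of_int (a - k))\<^sup>2 + (of_int (c - k))\<^sup>2)))"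
  define s :: real where "s = (if odd (a - k) \<and> odd (c - k) then -1 else 1)"
  have m: "(\<lambda>w. kern z w * trip a b c w) \<in> borel_measurable borel" by measurable
  have int: "integrable lborel (\<lambda>w. kern z w * trip a b c w)"
    by (rule kern_integrable[OF trip_measurable norm_trip_le])
  have "(\<integral>w. kern z w * trip a b c w \<partial>lborel) =
     (\<integral>y. (of_real (nrm ^ 3) * P * of_real (sqrt (2 * pi)) * E) * of_real (gauss k y * gauss a y * gauss b y * gauss c y) \<partial>lborel)"
    unfolding integral_complex_fubini[OF m int] trip_inner_integral k_def[symmetric] d_def[symmetric] E_def[symmetric] P_def[symmetric] ..
  also have "\<dots> = (of_real (nrm ^ 3) * P * of_real (sqrt (2 * pi)) * E) * of_real (sqrt pi / 2 * W)"
    unfolding integral_mult_right_zero integral_complex_of_real k_def gauss_four_integral unfolding k_def[symmetric] W_def[symmetric] ..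
  finally have "Pi_op (trip a b c) z = complex_of_real (1 / pi * exp (- (cmod z)\<^sup>2 / 2)) *
     ((of_real (nrm ^ 3) * P * of_real (sqrt (2 * pi)) * E) * of_real (sqrt pi / 2 * W))"
    unfolding Pi_op_lborel[OF trip_measurable] by (simp only:)
  also have "P = of_real s * cis (- pi * (of_int k)\<^sup>2 / 2)"
    unfolding P_def phase_parity k_def[symmetric] s_def
    by (cases "odd (a - k) \<and> odd (c - k)") (simp_all only: if_True if_False simp_thms of_real_1 of_real_minus)
  also have "complex_of_real (1 / pi * exp (- (cmod z)\<^sup>2 / 2)) *
     ((of_real (nrm ^ 3) * (of_real s * cis (- pi * (of_int k)\<^sup>2 / 2)) * of_real (sqrt (2 * pi)) * E) * of_real (sqrt pi / 2 * W)) =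
     of_real ((nrm\<^sup>2 * (sqrt (2 * pi) * sqrt pi / (2 * pi))) * s * W) *
     (of_real nrm * (of_real (exp (- (cmod z)\<^sup>2 / 2)) * cis (- pi * (of_int k)\<^sup>2 / 2) * E))"
    by (simp add: power2_eq_square power3_eq_cube field_simps)
  also have "nrm\<^sup>2 * (sqrt (2 * pi) * sqrt pi / (2 * pi)) = kap"
  proof -
    have "sqrt (2 * pi) * sqrt pi = sqrt 2 * pi" by (simp add: real_sqrt_mult mult.assoc)
    then have "sqrt (2 * pi) * sqrt pi / (2 * pi) = sqrt 2 / 2" by simp
    moreover have "nrm\<^sup>2 = sqrt 2 / (sqrt pi * gam)" unfolding nrm_sq using gam_pos by (simp add: real_sqrt_divide real_sqrt_mult)
    ultimately have "nrm\<^sup>2 * (sqrt (2 * pi) * sqrt pi / (2 * pi)) = sqrt 2 / (sqrt pi * gam) * (sqrt 2 / 2)" by (simp only:)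
    then show ?thesis by (simp add: kap_def mult.commute)
  qed
  also have "of_real nrm * (of_real (exp (- (cmod z)\<^sup>2 / 2)) * cis (- pi * (of_int k)\<^sup>2 / 2) * E) = psi k z"
  proof -
    define x y where "x = Re z" and "y = Im z"
    have z: "z = of_real x + \<i> * of_real y" by (simp add: x_def y_def complex_eq_iff)
    have cm: "(cmod z)\<^sup>2 = x\<^sup>2 + y\<^sup>2" by (simp add: cmod_power2 x_def y_def)
    have "of_real (exp (- (cmod z)\<^sup>2 / 2)) * cis (- pi * (of_int k)\<^sup>2 / 2) * E =
      exp (\<i> * of_real (2 * dlt * of_int k * x + x * y - pi * (of_int k)\<^sup>2 / 2)) * exp (of_real (- (y + of_int k * dlt)\<^sup>2))"
      unfolding cm E_def cis_conv_exp exp_of_real[symmetric] exp_add[symmetric] d_def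
      by (rule arg_cong[of _ _ exp]) (simp add: z power2_eq_square field_simps)
    then show ?thesis unfolding psi_eq gauss_def x_def[symmetric] y_def[symmetric] cis_conv_exp exp_of_real by (simp add: mult.assoc)
  qed
  finally show ?thesis unfolding omega_def s_def W_def by (simp add: mult_ac)
qed

section \<open>Absolutely convergent lattice sums\<close>

lemma finite_subset_ibox: "finite F \<Longrightarrow> \<exists>N. F \<subseteq> ibox N"
proof (induction F rule: finite_induct)
  case (insert x F)
  then obtain N where "F \<subseteq> ibox N" by blast
  moreover have "ibox N \<subseteq> ibox (max N (nat \<bar>x\<bar>))" by (rule ibox_mono) simp
  moreover have "x \<in> ibox (max N (nat \<bar>x\<bar>))" by (auto simp: ibox_def)
  ultimately have "insert x F \<subseteq> ibox (max N (nat \<bar>x\<bar>))" by blast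
  then show ?case by (rule exI)
qed simp

lemma filterlim_sets_at_top:
  assumes "\<And>N. finite (S N)" "\<And>x. \<forall>\<^sub>F N in sequentially. x \<in> S N"
  shows "filterlim S (finite_subsets_at_top UNIV) sequentially"
proof (rule filterlim_finite_subsets_at_top[THEN iffD2], intro allI impI)
  fix X :: "'a set" assume X: "finite X \<and> X \<subseteq> UNIV"
  then have "\<forall>\<^sub>F N in sequentially. \<forall>x\<in>X. x \<in> S N"
    using assms(2) by (intro eventually_ball_finite) auto
  then show "\<forall>\<^sub>F N in sequentially. finite (S N) \<and> X \<subseteq> S N \<and> S N \<subseteq> UNIV"
    by eventually_elim (use assms(1) in auto)
qed

lemma sum_tendsto_infsum:
  fixes f :: "'a \<Rightarrow> 'b::{topological_comm_monoid_add,t2_space}"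
  assumes "f summable_on UNIV" "\<And>N. finite (S N)" "\<And>x. \<forall>\<^sub>F N in sequentially. x \<in> S N"
  shows "(\<lambda>N. sum f (S N)) \<longlonglongrightarrow> infsum f UNIV"
  by (rule filterlim_compose[OF infsum_tendsto[OF assms(1)] filterlim_sets_at_top[OF assms(2,3)]])

lemma ibox_tendsto_infsum:
  fixes f :: "int \<Rightarrow> 'b::{topological_comm_monoid_add,t2_space}"
  assumes "f summable_on UNIV"
  shows "(\<lambda>N. sum f (ibox N)) \<longlonglongrightarrow> infsum f UNIV"
  by (rule sum_tendsto_infsum[OF assms]) (auto intro: eventually_ibox)

lemma sum_ibox_Suc: "sum f (ibox (Suc N)) = f (int (Suc N)) + f (- int (Suc N)) + sum f (ibox N)"
  for f :: "int \<Rightarrow> 'a::comm_monoid_add"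
proof -
  have "ibox (Suc N) = insert (int (Suc N)) (insert (- int (Suc N)) (ibox N))" by (auto simp: ibox_def)
  moreover have "int (Suc N) \<notin> insert (- int (Suc N)) (ibox N)" "- int (Suc N) \<notin> ibox N" by (auto simp: ibox_def)
  ultimately show ?thesis by (simp add: add.assoc del: of_nat_Suc)
qed

lemma summable_ibox_bound:
  fixes f :: "int \<Rightarrow> real"
  assumes nn: "\<And>k. 0 \<le> f k" and B: "\<And>N. sum f (ibox N) \<le> B"
  shows "f summable_on UNIV" "infsum f UNIV \<le> B"
proof -
  show s: "f summable_on UNIV"
  proof (rule nonneg_bdd_above_summable_on)
    show "bdd_above (sum f ` {F. F \<subseteq> UNIV \<and> finite F})"
    proof (rule bdd_aboveI[of _ B])
      fix v assume "v \<in> sum f ` {F. F \<subseteq> UNIV \<and> finite F}"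
      then obtain F where F: "finite F" "v = sum f F" by auto
      then obtain N where "F \<subseteq> ibox N" using finite_subset_ibox by blast
      then have "sum f F \<le> sum f (ibox N)" by (intro sum_mono2) (use nn in auto)
      then show "v \<le> B" using B[of N] F by simp
    qed
  qed (use nn in auto)
  show "infsum f UNIV \<le> B"
    by (rule LIMSEQ_le_const2[OF ibox_tendsto_infsum[OF s]]) (use B in auto)
qed

lemma geometric_ibox: "(\<Sum>j\<in>ibox N. nome ^ nat \<bar>j\<bar>) \<le> 3"
proof -
  have n1: "1 - nome \<noteq> 0" "0 < 1 - nome" using nome_le by auto
  have "(\<Sum>j\<in>ibox N. nome ^ nat \<bar>j\<bar>) = (1 + nome - 2 * nome ^ Suc N) / (1 - nome)"
  proof (induction N)
    case 0
    then show ?case using n1 by (simp add: ibox_def)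
  next
    case (Suc N)
    have "nat \<bar>int (Suc N)\<bar> = Suc N" "nat \<bar>- int (Suc N)\<bar> = Suc N" by simp_all
    then show ?case unfolding sum_ibox_Suc Suc using n1 by (simp add: field_simps)
  qed
  also have "\<dots> \<le> (1 + nome) / (1 - nome)" using n1 nome_pos by (intro divide_right_mono) auto
  also have "\<dots> \<le> 3" using n1 nome_le by (simp add: field_simps)
  finally show ?thesis .
qed

lemma geometric_int:
  "(\<lambda>j::int. nome ^ nat \<bar>j\<bar>) summable_on UNIV" "(\<Sum>\<^sub>\<infinity>j::int. nome ^ nat \<bar>j\<bar>) \<le> 3"
  using summable_ibox_bound[of "\<lambda>j. nome ^ nat \<bar>j\<bar>" 3] geometric_ibox nome_pos by auto

text \<open>A bound, uniform in y, for the sum of \<open>gauss k y\<close> over k: the lines are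
  equally spaced, so the distances from a given height grow linearly.\<close>

definition Cg :: real where "Cg = exp (dlt\<^sup>2) * 3"

text \<open>The line of index \<open>m y\<close> lies at or above height y, at distance at most dlt.
  A line |j| steps from it is at least (|j| - 1) dlt away from y, and the factor exp (dlt^2) pays
  for the lost step.\<close>

lemma gauss_le_geometric:
  defines "m y \<equiv> \<lfloor>- y / dlt\<rfloor>"
  shows "gauss k y \<le> exp (dlt\<^sup>2) * nome ^ nat \<bar>k - m y\<bar>"
proof -
  define r where "r = y + of_int (m y) * dlt"
  define j where "j = k - m y"
  have d: "0 < dlt" by (rule dlt_pos)
  have "of_int (m y) \<le> - y / dlt" "- y / dlt < of_int (m y) + 1" unfolding m_def by linarith+
  then have r: "- dlt \<le> r" "r \<le> 0" using d by (auto simp: r_def field_simps)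
  have y: "y + of_int k * dlt = r + of_int j * dlt" by (simp add: r_def j_def algebra_simps)
  show ?thesis
  proof (cases "j = 0")
    case True
    then show ?thesis using gauss_le_1[of k y] by (simp add: j_def order_trans)
  next
    case False
    define n where "n = real (nat \<bar>j\<bar>)"
    have n: "1 \<le> n" "\<bar>real_of_int j\<bar> = n" using False by (auto simp: n_def)
    have "(n - 1) * dlt \<le> \<bar>r + of_int j * dlt\<bar>"
    proof -
      have "\<bar>of_int j * dlt\<bar> = n * dlt" using n d by (simp add: abs_mult)
      moreover have "\<bar>r\<bar> \<le> dlt" using r by simp
      ultimately show ?thesis by (simp add: left_diff_distrib)
    qed
    then have "((n - 1) * dlt)\<^sup>2 \<le> (r + of_int j * dlt)\<^sup>2"
      using n d by (metis abs_ge_zero abs_le_square_iff abs_of_nonneg diff_ge_0_iff_ge mult_nonneg_nonneg less_imp_le)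
    moreover have "(n - 1) * dlt\<^sup>2 \<le> ((n - 1) * dlt)\<^sup>2"
    proof -
      \<comment> \<open>This uses that n is a positive integer; it would fail for real n between 1
        and 2.\<close>
      have "n - 1 \<le> (n - 1)\<^sup>2"
      proof -
        define k where "k = nat \<bar>j\<bar> - 1"
        have "n - 1 = real k" using False by (simp add: n_def k_def of_nat_diff)
        moreover have "k \<le> k * k" by (cases k) auto
        ultimately show ?thesis by (simp only: power2_eq_square of_nat_mult[symmetric] of_nat_le_iff)
      qed
      then show ?thesis by (simp add: power_mult_distrib mult_right_mono)
    qed
    ultimately have "- (y + of_int k * dlt)\<^sup>2 \<le> dlt\<^sup>2 + n * (- dlt\<^sup>2)"
      unfolding y by (simp add: algebra_simps)
    then have "gauss k y \<le> exp (dlt\<^sup>2 + n * (- dlt\<^sup>2))" unfolding gauss_def by simp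
    also have "\<dots> = exp (dlt\<^sup>2) * nome ^ nat \<bar>j\<bar>"
      unfolding exp_add n_def nome_dlt exp_of_nat_mult ..
    finally show ?thesis by (simp add: j_def)
  qed
qed

lemma gauss_sum_finite: 
  assumes "finite I"
  shows "(\<Sum>k\<in>I. gauss k y) \<le> Cg"
proof -
  define m where "m = \<lfloor>- y / dlt\<rfloor>"
  have "(\<Sum>k\<in>I. gauss k y) \<le> (\<Sum>k\<in>I. exp (dlt\<^sup>2) * nome ^ nat \<bar>k - m\<bar>)"
    unfolding m_def by (intro sum_mono gauss_le_geometric)
  also have "\<dots> = exp (dlt\<^sup>2) * (\<Sum>j\<in>(\<lambda>k. k - m) ` I. nome ^ nat \<bar>j\<bar>)"
    unfolding sum_distrib_left by (subst sum.reindex) (auto simp: inj_on_def)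
  also have "(\<Sum>j\<in>(\<lambda>k. k - m) ` I. nome ^ nat \<bar>j\<bar>) \<le> (\<Sum>\<^sub>\<infinity>j::int. nome ^ nat \<bar>j\<bar>)"
    using assms nome_pos by (intro finite_sum_le_infsum geometric_int) auto
  also have "\<dots> \<le> 3" by (rule geometric_int(2))
  finally show ?thesis by (simp add: Cg_def)
qed

lemma gauss_summable: "(\<lambda>k. gauss k y) summable_on UNIV"
  by (rule summable_ibox_bound(1)[of _ Cg]) (auto intro: gauss_sum_finite)

text \<open>An unordered sum, meant for all bounded coefficient sequences: the Abrikosov lattice
  itself has all coefficients 1 and no square-summability.\<close>

definition synth :: "(int \<Rightarrow> complex) \<Rightarrow> complex \<Rightarrow> complex" where
  "synth x z = (\<Sum>\<^sub>\<infinity>k. x k * psi k z)"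

lemma synth_term_bound:
  assumes "\<And>k. cmod (x k) \<le> B"
  shows "norm (x k * psi k z) \<le> (B * nrm) * gauss k (Im z)"
proof -
  have "norm (x k * psi k z) = cmod (x k) * (nrm * gauss k (Im z))" by (simp add: norm_mult norm_psi)
  also have "\<dots> \<le> B * (nrm * gauss k (Im z))" using assms nrm_pos by (intro mult_right_mono) auto
  finally show ?thesis by (simp add: mult.assoc)
qed

lemma synth_summable:
  assumes "\<And>k. cmod (x k) \<le> B"
  shows "(\<lambda>k. x k * psi k z) summable_on UNIV"
proof (rule abs_summable_summable, rule Infinite_Sum.abs_summable_on_comparison_test')
  show "(\<lambda>k. (B * nrm) * gauss k (Im z)) summable_on UNIV"
    by (intro summable_on_cmult_right gauss_summable)
  show "norm (x k * psi k z) \<le> (B * nrm) * gauss k (Im z)" for k by (rule synth_term_bound[OF assms])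
qed

lemma synth_tendsto:
  assumes "\<And>k. cmod (x k) \<le> B"
  shows "(\<lambda>N. \<Sum>k\<in>ibox N. x k * psi k z) \<longlonglongrightarrow> synth x z"
  unfolding synth_def by (rule ibox_tendsto_infsum[OF synth_summable[OF assms]])

lemma synth_partial_bound:
  assumes "\<And>k. cmod (x k) \<le> B" "finite I"
  shows "cmod (\<Sum>k\<in>I. x k * psi k z) \<le> B * nrm * Cg"
proof -
  have B: "0 \<le> B" using assms(1)[of 0] norm_ge_zero order_trans by blast
  have "cmod (\<Sum>k\<in>I. x k * psi k z) \<le> (\<Sum>k\<in>I. (B * nrm) * gauss k (Im z))"
    by (rule sum_norm_le[OF synth_term_bound[OF assms(1)]])
  also have "\<dots> \<le> B * nrm * Cg"
    unfolding sum_distrib_left[symmetric] using gauss_sum_finite[OF assms(2)] B nrm_pos by (intro mult_left_mono) auto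
  finally show ?thesis .
qed

lemma synth_bound:
  assumes "\<And>k. cmod (x k) \<le> B"
  shows "cmod (synth x z) \<le> B * nrm * Cg"
  by (rule LIMSEQ_le_const2[OF tendsto_norm[OF synth_tendsto[OF assms]]])
     (intro exI allI impI synth_partial_bound[OF assms] finite_ibox)

lemma measurable_partial_synth [measurable]: "(\<lambda>z. \<Sum>k\<in>I. x k * psi k z) \<in> borel_measurable borel"
  by measurable

lemma synth_measurable:
  assumes "\<And>k. cmod (x k) \<le> B"
  shows "synth x \<in> borel_measurable borel"
  by (rule borel_measurable_LIMSEQ_metric[OF measurable_partial_synth synth_tendsto[OF assms]])

lemma Psi0_synth: "Psi0 = synth (\<lambda>_. 1)"
  by (rule ext) (simp add: Psi0_def synth_def)

lemma gauss_mult_summable_pair: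
  "(\<lambda>(p, q). gauss p 0 * gauss q 0) summable_on UNIV"
proof (rule nonneg_bdd_above_summable_on)
  have Cg: "0 \<le> Cg" by (simp add: Cg_def)
  show "bdd_above (sum (\<lambda>(p, q). gauss p 0 * gauss q 0) ` {F. F \<subseteq> UNIV \<and> finite F})"
  proof (rule bdd_aboveI[of _ "Cg * Cg"])
    fix v assume "v \<in> sum (\<lambda>(p, q). gauss p 0 * gauss q 0) ` {F. F \<subseteq> UNIV \<and> finite F}"
    then obtain F where F: "finite F" "v = (\<Sum>(p, q)\<in>F. gauss p 0 * gauss q 0)" by auto
    have "F \<subseteq> fst ` F \<times> snd ` F" by force
    then have "v \<le> (\<Sum>(p, q)\<in>fst ` F \<times> snd ` F. gauss p 0 * gauss q 0)"
      unfolding F using F by (intro sum_mono2) auto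
    also have "\<dots> = (\<Sum>p\<in>fst ` F. gauss p 0) * (\<Sum>q\<in>snd ` F. gauss q 0)"
      by (simp add: sum_product sum.cartesian_product)
    also have "\<dots> \<le> Cg * Cg" using F Cg by (intro mult_mono gauss_sum_finite sum_nonneg) auto
    finally show "v \<le> Cg * Cg" .
  qed
qed auto

lemma norm_omega: "\<bar>omega p q\<bar> = kap * (gauss p 0 * gauss q 0)"
  using kap_pos by (simp add: omega_def gauss_def abs_mult exp_add[symmetric] power_mult_distrib algebra_simps)

text \<open>The weights |omega p q| factor into two summable Gaussians, so double series with
  bounded entries converge absolutely.\<close>

lemma omega_summable:
  fixes g :: "int \<Rightarrow> int \<Rightarrow> complex"
  assumes "\<And>p q. cmod (g p q) \<le> B"
  shows "(\<lambda>(p, q). of_real (omega p q) * g p q) summable_on UNIV"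
proof (rule abs_summable_summable, rule Infinite_Sum.abs_summable_on_comparison_test')
  show "(\<lambda>pq. (B * kap) * (case pq of (p, q) \<Rightarrow> gauss p 0 * gauss q 0)) summable_on UNIV"
    by (intro summable_on_cmult_right gauss_mult_summable_pair)
  fix pq :: "int \<times> int"
  obtain p q where pq: "pq = (p, q)" by (cases pq)
  have "cmod (of_real (omega p q) * g p q) \<le> (kap * (gauss p 0 * gauss q 0)) * B"
    unfolding norm_mult norm_of_real norm_omega using assms kap_pos by (intro mult_left_mono) auto
  then show "norm (case pq of (p, q) \<Rightarrow> of_real (omega p q) * g p q) \<le> (B * kap) * (case pq of (p, q) \<Rightarrow> gauss p 0 * gauss q 0)"
    unfolding pq by (simp add: mult_ac)
qed

section \<open>The trilinear pairing\<close>

lemma psi_strip_integrable: "integrable (lebesgue_on (strip gam)) (\<lambda>w. cmod (psi d w))"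
proof -
  have "integrable (lebesgue_on (strip gam)) (\<lambda>w. 1 * complex_of_real (gauss d (Im w)))"
    by (rule strip_product_integral(1)) (auto intro: integrable_of_real gauss_integrable)
  then have n: "integrable (lebesgue_on (strip gam)) (\<lambda>w. cmod (1 * complex_of_real (gauss d (Im w))))"
    by (rule integrable_norm)
  have "integrable (lebesgue_on (strip gam)) (\<lambda>w. nrm * cmod (1 * complex_of_real (gauss d (Im w))))"
    by (rule integrable_mult_right) (rule n)
  moreover have "cmod (psi d w) = nrm * cmod (1 * complex_of_real (gauss d (Im w)))" for w
    by (simp add: norm_psi)
  ultimately show ?thesis by (simp only:)
qed

lemma sum_triple_product:
  fixes A B C :: "'a \<Rightarrow> 'b::comm_ring_1"
  shows "sum A I * sum B J * sum C K = (\<Sum>a\<in>I. \<Sum>b\<in>J. \<Sum>c\<in>K. A a * B b * C c)"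
proof -
  have "sum A I * sum B J * sum C K = sum A I * (\<Sum>b\<in>J. \<Sum>c\<in>K. B b * C c)"
    by (simp only: mult.assoc sum_product[of B J C K])
  also have "\<dots> = (\<Sum>a\<in>I. A a * (\<Sum>b\<in>J. \<Sum>c\<in>K. B b * C c))" by (rule sum_distrib_right)
  finally show ?thesis by (simp only: sum_distrib_left mult.assoc)
qed

text \<open>All three sums are truncated to boxes, where the projection is a finite sum given by
  \<open>Pi_op_trip\<close>, and the boxes grow. Two dominated limits occur, one inside the
  projection and one in the pairing; as the projection is merely bounded, the majorant of the second
  is a multiple of |psi d|.\<close>

theorem trilinear_pairing:
  assumes x: "\<And>k. cmod (x k) \<le> B" and y: "\<And>k. cmod (y k) \<le> B" and z: "\<And>k. cmod (z k) \<le> B"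
  shows "L2ip (lebesgue_on (strip gam)) (Pi_op (\<lambda>w. synth x w * cnj (synth y w) * synth z w)) (psi d) =
    (\<Sum>\<^sub>\<infinity>(p, q). of_real (omega p q) * (x (d + p) * cnj (y (d + p + q)) * z (d + q)))"
    and "integrable (lebesgue_on (strip gam)) (\<lambda>w. Pi_op (\<lambda>w. synth x w * cnj (synth y w) * synth z w) w * cnj (psi d w))"
proof -
  define T where "T w = synth x w * cnj (synth y w) * synth z w" for w
  define X where "X N w = (\<Sum>k\<in>ibox N. x k * psi k w)" for N w
  define Y where "Y N w = (\<Sum>k\<in>ibox N. y k * psi k w)" for N w
  define Z where "Z N w = (\<Sum>k\<in>ibox N. z k * psi k w)" for N w
  define TN where "TN N w = X N w * cnj (Y N w) * Z N w" for N w
  define C where "C = B * nrm * Cg"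
  have C: "0 \<le> C" using synth_bound[OF x, where z = 0] norm_ge_zero order_trans unfolding C_def by blast
  have [measurable]: "X N \<in> borel_measurable borel" "Y N \<in> borel_measurable borel" "Z N \<in> borel_measurable borel" for N
    unfolding X_def[abs_def] Y_def[abs_def] Z_def[abs_def] by measurable
  have cY: "(\<lambda>w. cnj (Y N w)) \<in> borel_measurable borel" for N
    by (rule measurable_compose[OF _ measurable_cnj]) measurable
  have TNm: "TN N \<in> borel_measurable borel" for N
    unfolding TN_def[abs_def] using cY[of N] by measurable
  have bX: "cmod (X N w) \<le> C" "cmod (Y N w) \<le> C" "cmod (Z N w) \<le> C" for N w
    unfolding X_def Y_def Z_def C_def by (intro synth_partial_bound x y z finite_ibox)+
  have TNb: "cmod (TN N w) \<le> C * C * C" for N w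
    unfolding TN_def norm_mult complex_mod_cnj using bX C by (intro mult_mono) auto
  have Tb: "cmod (T w) \<le> C * C * C" for w
    unfolding T_def norm_mult complex_mod_cnj using synth_bound[OF x] synth_bound[OF y] synth_bound[OF z] C
    unfolding C_def[symmetric] by (intro mult_mono) auto
  have TNl: "(\<lambda>N. TN N w) \<longlonglongrightarrow> T w" for w
    unfolding TN_def T_def X_def Y_def Z_def
    by (intro tendsto_mult tendsto_cnj synth_tendsto[OF x] synth_tendsto[OF y] synth_tendsto[OF z])
  have Pl: "(\<lambda>N. Pi_op (TN N) w) \<longlonglongrightarrow> Pi_op T w" for w
    by (rule Pi_op_dominated[OF TNm TNb TNl])
  define I where "I N = ibox N \<times> ibox N \<times> ibox N" for N
  have fI: "finite (I N)" for N by (simp add: I_def)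
  define co where "co = (\<lambda>(a, b, c). x a * cnj (y b) * z c)"
  have TNs: "TN N w = (\<Sum>t\<in>I N. co t * (case t of (a, b, c) \<Rightarrow> trip a b c w))" for N w
  proof -
    have "TN N w = (\<Sum>a\<in>ibox N. \<Sum>b\<in>ibox N. \<Sum>c\<in>ibox N. (x a * psi a w) * (cnj (y b) * cnj (psi b w)) * (z c * psi c w))"
      unfolding TN_def X_def Y_def Z_def cnj_sum complex_cnj_mult by (rule sum_triple_product)
    also have "\<dots> = (\<Sum>(a, b, c)\<in>I N. (x a * psi a w) * (cnj (y b) * cnj (psi b w)) * (z c * psi c w))"
      unfolding I_def by (simp add: sum.cartesian_product)
    finally show ?thesis by (simp add: co_def trip_def mult_ac case_prod_unfold)
  qed
  define om where "om = (\<lambda>(a, b, c). complex_of_real (omega (a - (a - b + c)) (c - (a - b + c))))"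
  define kk :: "int \<times> int \<times> int \<Rightarrow> int" where "kk = (\<lambda>(a, b, c). a - b + c)"
  have PN: "Pi_op (TN N) w = (\<Sum>t\<in>I N. (co t * om t) * psi (kk t) w)" for N w
  proof -
    have m: "(\<lambda>w. co t * (case t of (a, b, c) \<Rightarrow> trip a b c w)) \<in> borel_measurable borel" for t
      by (cases t) (simp, measurable)
    have b: "cmod (co t * (case t of (a, b, c) \<Rightarrow> trip a b c w)) \<le> cmod (co t) * (nrm * nrm * nrm)" for t w
      by (cases t) (simp add: norm_mult mult_left_mono norm_trip_le[unfolded norm_mult])
    have "Pi_op (TN N) w = (\<Sum>t\<in>I N. Pi_op (\<lambda>w. co t * (case t of (a, b, c) \<Rightarrow> trip a b c w)) w)"
      unfolding TNs[abs_def] by (rule Pi_op_sum[OF fI m b])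
    also have "\<dots> = (\<Sum>t\<in>I N. (co t * om t) * psi (kk t) w)"
    proof (rule sum.cong[OF refl])
      fix t :: "int \<times> int \<times> int"
      obtain a b c where t: "t = (a, b, c)" by (cases t)
      show "Pi_op (\<lambda>w. co t * (case t of (a, b, c) \<Rightarrow> trip a b c w)) w = (co t * om t) * psi (kk t) w"
        unfolding t prod.case Pi_op_cmult[OF trip_measurable] Pi_op_trip by (simp add: om_def kk_def)
    qed
    finally show ?thesis .
  qed
  define g where "g = (\<lambda>(p, q). complex_of_real (omega p q) * (x (d + p) * cnj (y (d + p + q)) * z (d + q)))"
  \<comment> \<open>The pairs that remain when a - b + c = d is imposed on the truncated triples: a
    = d + p, c = d + q, b = d + p + q.\<close>
  define S where "S N = {(p, q). d + p \<in> ibox N \<and> d + q \<in> ibox N \<and> d + p + q \<in> ibox N}" for N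
  have fS: "finite (S N)" for N
  proof (rule finite_subset)
    show "S N \<subseteq> (\<lambda>k. k - d) ` ibox N \<times> (\<lambda>k. k - d) ` ibox N"
      by (force simp: S_def)
  qed simp
  have ipN: "L2ip (lebesgue_on (strip gam)) (Pi_op (TN N)) (psi d) = sum g (S N)" for N
  proof -
    have "L2ip (lebesgue_on (strip gam)) (Pi_op (TN N)) (psi d) = (\<Sum>t\<in>I N. if kk t = d then co t * om t else 0)"
      unfolding PN[abs_def]
      by (subst L2ip_sum) (auto simp: L2ip_cmult strip.e_ip intro!: sq_int_cmult strip.e_sq sum.cong)
    also have "\<dots> = (\<Sum>t\<in>{t \<in> I N. kk t = d}. co t * om t)"
      by (rule sum.inter_filter[symmetric, OF fI])
    also have "\<dots> = sum g (S N)"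
      by (rule sum.reindex_bij_witness[of _ "\<lambda>(p, q). (d + p, d + p + q, d + q)" "\<lambda>(a, b, c). (a - d, c - d)"])
         (auto simp: S_def I_def kk_def co_def om_def g_def mult_ac algebra_simps)
    finally show ?thesis .
  qed
  have "(\<lambda>N. sum g (S N)) \<longlonglongrightarrow> infsum g UNIV"
  proof (rule sum_tendsto_infsum[OF _ fS])
    have "cmod (x (d + p) * cnj (y (d + p + q)) * z (d + q)) \<le> B * B * B" for p q
    proof -
      have "0 \<le> B" using x[of 0] norm_ge_zero order_trans by blast
      then show ?thesis unfolding norm_mult complex_mod_cnj using x y z by (intro mult_mono) auto
    qed
    then show "g summable_on UNIV" unfolding g_def by (rule omega_summable)
    fix pq :: "int \<times> int"
    obtain p q where pq: "pq = (p, q)" by (cases pq)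
    show "\<forall>\<^sub>F N in sequentially. pq \<in> S N"
      using eventually_ibox[of "d + p"] eventually_ibox[of "d + q"] eventually_ibox[of "d + p + q"]
      by eventually_elim (simp add: S_def pq)
  qed
  note gl = this
  have PNm: "Pi_op (TN N) \<in> borel_measurable borel" for N unfolding PN[abs_def] by measurable
  have PTm: "Pi_op T \<in> borel_measurable borel" by (rule borel_measurable_LIMSEQ_metric[OF PNm Pl])
  have c: "(\<lambda>w. cnj (psi d w)) \<in> borel_measurable borel"
    by (rule measurable_compose[OF measurable_psi measurable_cnj])
  have Pcm: "(\<lambda>w. Pi_op T w * cnj (psi d w)) \<in> borel_measurable (lebesgue_on (strip gam))"
    by (rule measurable_lebesgue_on_borel[OF borel_measurable_times[OF PTm c]])
  have "integrable (lebesgue_on (strip gam)) (\<lambda>w. Pi_op T w * cnj (psi d w))"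
  proof (rule Bochner_Integration.integrable_bound[OF _ Pcm])
    show "integrable (lebesgue_on (strip gam)) (\<lambda>w. (2 * (C * C * C)) * cmod (psi d w))"
      by (intro integrable_mult_right psi_strip_integrable)
    have Tm: "T \<in> borel_measurable borel" by (rule borel_measurable_LIMSEQ_metric[OF TNm TNl])
    show "AE w in lebesgue_on (strip gam). norm (Pi_op T w * cnj (psi d w)) \<le> norm ((2 * (C * C * C)) * cmod (psi d w))"
      unfolding norm_mult complex_mod_cnj using Pi_op_bound[OF Tm Tb] C
      by (intro AE_I2) (auto intro!: mult_right_mono)
  qed
  then show "integrable (lebesgue_on (strip gam)) (\<lambda>w. Pi_op (\<lambda>w. synth x w * cnj (synth y w) * synth z w) w * cnj (psi d w))"
    by (simp add: T_def[abs_def])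
  have "(\<lambda>N. L2ip (lebesgue_on (strip gam)) (Pi_op (TN N)) (psi d)) \<longlonglongrightarrow> L2ip (lebesgue_on (strip gam)) (Pi_op T) (psi d)"
    unfolding L2ip_def
  proof (rule integral_dominated_convergence[OF Pcm])
    show "(\<lambda>w. Pi_op (TN N) w * cnj (psi d w)) \<in> borel_measurable (lebesgue_on (strip gam))" for N
      by (rule measurable_lebesgue_on_borel[OF borel_measurable_times[OF PNm c]])
    show "integrable (lebesgue_on (strip gam)) (\<lambda>w. (2 * (C * C * C)) * cmod (psi d w))"
      by (intro integrable_mult_right psi_strip_integrable)
    show "AE w in lebesgue_on (strip gam). (\<lambda>N. Pi_op (TN N) w * cnj (psi d w)) \<longlonglongrightarrow> Pi_op T w * cnj (psi d w)"
      by (intro AE_I2 tendsto_intros Pl)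
    show "AE w in lebesgue_on (strip gam). norm (Pi_op (TN N) w * cnj (psi d w)) \<le> (2 * (C * C * C)) * cmod (psi d w)" for N
      unfolding norm_mult complex_mod_cnj by (intro AE_I2 mult_right_mono Pi_op_bound[OF TNm TNb]) auto
  qed
  then have "L2ip (lebesgue_on (strip gam)) (Pi_op T) (psi d) = infsum g UNIV"
    unfolding ipN using gl by (rule LIMSEQ_unique)
  then show "L2ip (lebesgue_on (strip gam)) (Pi_op (\<lambda>w. synth x w * cnj (synth y w) * synth z w)) (psi d) =
    (\<Sum>\<^sub>\<infinity>(p, q). of_real (omega p q) * (x (d + p) * cnj (y (d + p + q)) * z (d + q)))"
    by (simp add: T_def[abs_def] g_def)
qed

section \<open>Fourier multipliers on the circle\<close>

lemma gauss_0: "gauss k 0 = nome ^ ((nat \<bar>k\<bar>)\<^sup>2)"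
proof -
  have "real ((nat \<bar>k\<bar>)\<^sup>2) = (of_int k)\<^sup>2" by simp
  then show ?thesis unfolding gauss_def nome_dlt exp_of_nat_mult[symmetric]
    by (simp add: power_mult_distrib)
qed

text \<open>The two-sided sum folds into a cosine series. The weight \<open>t0\<close> of k = 0 is
  kept apart, being 1 for \<open>ell_fun\<close> and 0 for \<open>h_fun\<close>, while the cosine
  series starts with a zero term.\<close>

lemma theta_partial:
  assumes "s 0 = 0"
  shows "(\<Sum>k\<in>ibox N. of_real ((if k = 0 then t0 else s (nat \<bar>k\<bar>)) * gauss k 0) * ee (- k) \<xi>) =
    complex_of_real (t0 + (\<Sum>k<Suc N. 2 * s k * nome ^ (k\<^sup>2) * cos (2 * pi * real k * \<xi>)))"
proof (induction N)
  case 0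
  then show ?case using assms by (simp add: ibox_def gauss_def ee_def)
next
  case (Suc N)
  have e: "ee (- int (Suc N)) \<xi> + ee (- (- int (Suc N))) \<xi> = of_real (2 * cos (2 * pi * real (Suc N) * \<xi>))"
  proof -
    have "ee (- j) \<xi> + ee (- (- j)) \<xi> = of_real (2 * cos (2 * pi * of_int j * \<xi>))" for j
      by (simp add: ee_def complex_eq_iff)
    from this[of "int (Suc N)"] show ?thesis by (simp only: of_int_of_nat_eq)
  qed
  have "(if int (Suc N) = 0 then t0 else s (nat \<bar>int (Suc N)\<bar>)) = s (Suc N)"
    "(if - int (Suc N) = 0 then t0 else s (nat \<bar>- int (Suc N)\<bar>)) = s (Suc N)"
    "gauss (int (Suc N)) 0 = nome ^ ((Suc N)\<^sup>2)" "gauss (- int (Suc N)) 0 = nome ^ ((Suc N)\<^sup>2)"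
    by (simp_all add: gauss_0 nat_add_distrib)
  then show ?case
    unfolding sum_ibox_Suc Suc sum.lessThan_Suc[of _ "Suc N"]
    using e by (simp only: distrib_left[symmetric]) (simp add: algebra_simps)
qed

lemma theta_partial_tendsto:
  assumes "s 0 = 0" "\<And>k. \<bar>s k\<bar> \<le> 1"
  shows "(\<lambda>N. \<Sum>k\<in>ibox N. of_real ((if k = 0 then t0 else s (nat \<bar>k\<bar>)) * gauss k 0) * ee (- k) \<xi>) \<longlonglongrightarrow>
    complex_of_real (t0 + theta s \<xi>)"
proof -
  have "summable (\<lambda>k. 2 * s k * nome ^ (k\<^sup>2) * cos (2 * pi * real k * \<xi>))"
    by (rule theta_summable) (rule assms)
  then have "(\<lambda>N. \<Sum>k<N. 2 * s k * nome ^ (k\<^sup>2) * cos (2 * pi * real k * \<xi>)) \<longlonglongrightarrow> theta s \<xi>"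
    unfolding theta_def by (rule summable_LIMSEQ)
  then have "(\<lambda>N. t0 + (\<Sum>k<Suc N. 2 * s k * nome ^ (k\<^sup>2) * cos (2 * pi * real k * \<xi>))) \<longlonglongrightarrow> t0 + theta s \<xi>"
    by (intro tendsto_intros LIMSEQ_Suc)
  then show ?thesis unfolding theta_partial[of s, OF assms(1)] by (rule tendsto_of_real)
qed

text \<open>Writing the sign as 1 - 2 [p odd] [q odd] splits \<open>omega\<close> into two products.
  Each factors into one-dimensional theta series: all indices give \<open>ell_fun\<close>, the odd
  ones \<open>h_fun\<close>.\<close>

lemma symbol_sum:
  "(\<Sum>\<^sub>\<infinity>(p, q). of_real (omega p q) * (ee (- p) \<xi> * ee (- q) \<eta>)) =
    complex_of_real (kap * (ell_fun \<xi> * ell_fun \<eta> - 2 * (h_fun \<xi> * h_fun \<eta>)))"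
proof -
  define E where "E N x = (\<Sum>k\<in>ibox N. of_real ((if k = 0 then 1 else ind_pos (nat \<bar>k\<bar>)) * gauss k 0) * ee (- k) x)" for N x
  define H where "H N x = (\<Sum>k\<in>ibox N. of_real ((if k = 0 then 0 else ind_odd (nat \<bar>k\<bar>)) * gauss k 0) * ee (- k) x)" for N x
  have E: "(\<lambda>N. E N x) \<longlonglongrightarrow> of_real (ell_fun x)" for x
    unfolding E_def ell_fun_theta by (rule theta_partial_tendsto) (rule ind_simps)+
  have H: "(\<lambda>N. H N x) \<longlonglongrightarrow> of_real (0 + h_fun x)" for x
    unfolding H_def h_fun_theta by (rule theta_partial_tendsto) (rule ind_simps)+
  have Ee: "E N x = (\<Sum>k\<in>ibox N. of_real (gauss k 0) * ee (- k) x)" for N x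
    unfolding E_def by (intro sum.cong) (auto simp: ind_pos_def)
  have He: "H N x = (\<Sum>k\<in>ibox N. of_real ((if odd k then 1 else 0) * gauss k 0) * ee (- k) x)" for N x
    unfolding H_def by (intro sum.cong) (auto simp: ind_odd_def even_nat_iff)
  let ?f = "\<lambda>(p, q). complex_of_real (omega p q) * (ee (- p) \<xi> * ee (- q) \<eta>)"
  have om: "omega p q = kap * (gauss p 0 * gauss q 0 - 2 * (((if odd p then 1 else 0) * gauss p 0) * ((if odd q then 1 else 0) * gauss q 0)))" for p q
    by (simp add: omega_def gauss_def exp_add[symmetric] power_mult_distrib algebra_simps)
  have box: "sum ?f (ibox N \<times> ibox N) = of_real kap * (E N \<xi> * E N \<eta> - 2 * (H N \<xi> * H N \<eta>))" for N
    unfolding Ee He sum_product sum.cartesian_product' om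
    unfolding sum_distrib_left sum_subtractf[symmetric]
    by (intro sum.cong refl) (auto simp: algebra_simps)
  have "?f summable_on UNIV"
    by (rule omega_summable[of _ 1]) (simp add: norm_mult)
  then have "(\<lambda>N. sum ?f (ibox N \<times> ibox N)) \<longlonglongrightarrow> infsum ?f UNIV"
  proof (rule sum_tendsto_infsum)
    fix pq :: "int \<times> int"
    obtain p q where "pq = (p, q)" by (cases pq)
    then show "\<forall>\<^sub>F N in sequentially. pq \<in> ibox N \<times> ibox N"
      using eventually_ibox[of p] eventually_ibox[of q] by (auto elim: eventually_elim2)
  qed simp
  moreover have "(\<lambda>N. sum ?f (ibox N \<times> ibox N)) \<longlonglongrightarrow>
      of_real kap * (of_real (ell_fun \<xi>) * of_real (ell_fun \<eta>) - 2 * (of_real (0 + h_fun \<xi>) * of_real (0 + h_fun \<eta>)))"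
    unfolding box by (intro tendsto_intros E H)
  ultimately show ?thesis by (simp add: LIMSEQ_unique)
qed

lemma b_symbol: "(\<Sum>\<^sub>\<infinity>(p, q). of_real (omega p q) * ee (- (p + q)) \<xi>) = of_real (b_fun \<xi>)"
proof -
  have e: "ee (- p) \<xi> * ee (- q) \<xi> = ee (- (p + q)) \<xi>" for p q unfolding ee_mult by simp
  have "b_fun \<xi> = kap * (ell_fun \<xi> * ell_fun \<xi> - 2 * (h_fun \<xi> * h_fun \<xi>))"
    by (simp add: b_fun_def kap_def power2_eq_square)
  then show ?thesis using symbol_sum[of \<xi> \<xi>] unfolding e by simp
qed

text \<open>Only q shifts the index here, so the sum over p is evaluated at 0. This is how
  \<open>ell_fun 0\<close> and \<open>h_fun 0\<close> enter the symbol a.\<close>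

lemma a_symbol: "(\<Sum>\<^sub>\<infinity>(p, q). of_real (omega p q) * ee (- q) \<xi>) = of_real ((a_fun \<xi> + lam) / 2)"
proof -
  have e: "ee (- p) 0 = 1" for p by (simp add: ee_def)
  have "a_fun \<xi> + lam = 2 * (kap * (ell_fun 0 * ell_fun \<xi> - 2 * (h_fun 0 * h_fun \<xi>)))"
    by (simp add: a_fun_def kap_def divide_inverse algebra_simps)
  then have "(a_fun \<xi> + lam) / 2 = kap * (ell_fun 0 * ell_fun \<xi> - 2 * (h_fun 0 * h_fun \<xi>))" by simp
  then show ?thesis using symbol_sum[of 0 \<xi>] unfolding e by simp
qed

lemma circle_shift_in_span:
  assumes "circle.in_span u"
  shows "circle.in_span (\<lambda>\<xi>. ee j \<xi> * u \<xi>)"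
proof (rule circle.in_span_limit)
  have u: "sq_int unit_interval u" using assms by (simp add: circle.in_span_def)
  show "sq_int unit_interval (\<lambda>\<xi>. ee j \<xi> * u \<xi>)"
    by (rule sq_int_mult_bounded[OF u measurable_ee, of _ 1]) simp
  fix \<epsilon> :: real assume "\<epsilon> > 0"
  then obtain N a where N: "L2n unit_interval (\<lambda>\<xi>. u \<xi> - (\<Sum>n\<in>ibox N. a n * ee n \<xi>)) < \<epsilon>"
    using assms unfolding circle.in_span_def by meson
  define b where "b n = (if n - j \<in> ibox N then a (n - j) else 0)" for n
  define N' where "N' = N + nat \<bar>j\<bar>"
  have "(\<Sum>n\<in>ibox N'. b n * ee n \<xi>) = (\<Sum>n\<in>(\<lambda>n. n + j) ` ibox N. b n * ee n \<xi>)" for \<xi>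
    by (rule sum.mono_neutral_right) (force simp: b_def N'_def ibox_def image_iff)+
  also have "(\<Sum>n\<in>(\<lambda>n. n + j) ` ibox N. b n * ee n \<xi>) = (\<Sum>n\<in>ibox N. a n * ee (n + j) \<xi>)" for \<xi>
    by (subst sum.reindex) (auto simp: inj_on_def b_def)
  finally have "(\<Sum>n\<in>ibox N'. b n * ee n \<xi>) = ee j \<xi> * (\<Sum>n\<in>ibox N. a n * ee n \<xi>)" for \<xi>
    by (simp add: sum_distrib_left ee_mult[symmetric] mult_ac)
  then have "L2n unit_interval (\<lambda>\<xi>. ee j \<xi> * u \<xi> - (\<Sum>n\<in>ibox N'. b n * ee n \<xi>)) =
     L2n unit_interval (\<lambda>\<xi>. u \<xi> - (\<Sum>n\<in>ibox N. a n * ee n \<xi>))"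
    unfolding L2n_def by (simp add: right_diff_distrib[symmetric] norm_mult)
  then show "\<exists>v. circle.in_span v \<and> L2n unit_interval (\<lambda>\<xi>. ee j \<xi> * u \<xi> - v \<xi>) < \<epsilon>"
    using N circle.in_span_comb[of b N'] by (intro exI[of _ "\<lambda>\<xi>. \<Sum>n\<in>ibox N'. b n * ee n \<xi>"]) simp
qed

lemma circle_in_span_zero: "circle.in_span (\<lambda>\<xi>. 0)"
  using circle.in_span_comb[of "\<lambda>_. 0" 0] by simp

lemma circle_in_span_sum: "(\<And>i. i \<in> I \<Longrightarrow> circle.in_span (u i)) \<Longrightarrow> circle.in_span (\<lambda>x. \<Sum>i\<in>I. u i x)"
  by (induction I rule: infinite_finite_induct) (auto intro: circle.in_span_add circle_in_span_zero)

text \<open>The multiplier is a uniform limit of trigonometric polynomials, the error being at most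
  the missing weight \<open>tl N\<close>, independent of \<xi>. Each polynomial only shifts
  coefficients; both conclusions survive the limit. The map \<sigma> is q for the symbol a and p + q
  for b.\<close>

lemma circle_multiplier:
  fixes \<sigma> :: "int \<Rightarrow> int \<Rightarrow> int"
  assumes u: "circle.in_span u" and m: "\<And>\<xi>. m \<xi> = (\<Sum>\<^sub>\<infinity>(p, q). of_real (omega p q) * ee (- \<sigma> p q) \<xi>)"
    and mc: "continuous_on UNIV m"
  shows "circle.in_span (\<lambda>\<xi>. m \<xi> * u \<xi>)"
    "L2ip unit_interval (\<lambda>\<xi>. m \<xi> * u \<xi>) (ee n) = (\<Sum>\<^sub>\<infinity>(p, q). of_real (omega p q) * L2ip unit_interval u (ee (n + \<sigma> p q)))"
proof -
  have us: "sq_int unit_interval u" using u by (simp add: circle.in_span_def)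
  define W where "W = (\<lambda>(p, q). kap * (gauss p 0 * gauss q 0))"
  have W: "W summable_on UNIV"
    using summable_on_cmult_right[OF gauss_mult_summable_pair, of kap] by (simp add: W_def case_prod_unfold)
  have Wn: "0 \<le> W pq" for pq using kap_pos by (simp add: W_def case_prod_unfold)
  define S where "S N = ibox N \<times> ibox N" for N
  have fS: "finite (S N)" for N by (simp add: S_def)
  have evS: "\<forall>\<^sub>F N in sequentially. pq \<in> S N" for pq
    using eventually_ibox[of "fst pq"] eventually_ibox[of "snd pq"] by eventually_elim (simp add: S_def mem_Times_iff)
  define tl where "tl N = infsum W UNIV - sum W (S N)" for N
  have tl0: "tl \<longlonglongrightarrow> 0"
    unfolding tl_def using tendsto_diff[OF tendsto_const[of "infsum W UNIV"] sum_tendsto_infsum[OF W fS evS]] by simp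
  have tln: "0 \<le> tl N" for N
    unfolding tl_def using finite_sum_le_infsum[OF W fS[of N]] Wn by simp
  let ?t = "\<lambda>\<xi> (p, q). complex_of_real (omega p q) * ee (- \<sigma> p q) \<xi>"
  define mN where "mN N \<xi> = sum (?t \<xi>) (S N)" for N \<xi>
  have ts: "?t \<xi> summable_on UNIV" for \<xi> by (rule omega_summable[of _ 1]) simp
  have tW: "norm (?t \<xi> pq) = W pq" for \<xi> pq
    by (cases pq) (simp add: W_def norm_mult norm_omega)
  have err: "cmod (m \<xi> - mN N \<xi>) \<le> tl N" for N \<xi>
  proof -
    have "m \<xi> - mN N \<xi> = infsum (?t \<xi>) (UNIV - S N)"
      unfolding m mN_def using infsum_Diff[OF ts[of \<xi>], of "S N"] fS by simp
    also have "norm \<dots> \<le> infsum W (UNIV - S N)"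
    proof (rule norm_infsum_le)
      show "(?t \<xi> has_sum infsum (?t \<xi>) (UNIV - S N)) (UNIV - S N)"
        by (rule has_sum_infsum) (rule summable_on_subset_banach[OF ts], simp)
      show "(W has_sum infsum W (UNIV - S N)) (UNIV - S N)"
        by (rule has_sum_infsum) (rule summable_on_subset_banach[OF W], simp)
      show "norm (?t \<xi> pq) \<le> W pq" for pq by (simp only: tW)
    qed
    also have "\<dots> = tl N" unfolding tl_def using infsum_Diff[OF W, of "S N"] fS by simp
    finally show ?thesis .
  qed
  have mNspan: "circle.in_span (\<lambda>\<xi>. mN N \<xi> * u \<xi>)" for N
  proof -
    have "circle.in_span (\<lambda>\<xi>. \<Sum>pq\<in>S N. (case pq of (p, q) \<Rightarrow> complex_of_real (omega p q)) * (ee (- (case pq of (p, q) \<Rightarrow> \<sigma> p q)) \<xi> * u \<xi>))"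
      by (intro circle_in_span_sum circle.in_span_cmult circle_shift_in_span u)
    then show ?thesis unfolding mN_def sum_distrib_right by (simp add: case_prod_unfold mult.assoc)
  qed
  have mm: "m \<in> borel_measurable unit_interval" by (rule continuous_measurable_unit[OF mc])
  have mNm: "mN N \<in> borel_measurable unit_interval" for N
    unfolding mN_def[abs_def] by (intro continuous_measurable_unit continuous_intros) (auto simp: case_prod_unfold intro!: continuous_intros continuous_ee)
  have dm: "(\<lambda>\<xi>. m \<xi> - mN N \<xi>) \<in> borel_measurable unit_interval" for N using mm mNm[of N] by measurable
  have close: "L2n unit_interval (\<lambda>\<xi>. m \<xi> * u \<xi> - mN N \<xi> * u \<xi>) \<le> tl N * L2n unit_interval u" for N
    unfolding left_diff_distrib[symmetric] by (rule L2n_mult_bounded[OF us dm]) (use err tln in auto)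
  have mus: "sq_int unit_interval (\<lambda>\<xi>. m \<xi> * u \<xi>)"
  proof -
    have "sq_int unit_interval (\<lambda>\<xi>. (m \<xi> - mN 0 \<xi>) * u \<xi> + mN 0 \<xi> * u \<xi>)"
      using mNspan[of 0] by (intro sq_int_add sq_int_mult_bounded[OF us dm, of _ "tl 0"]) (auto simp: err circle.in_span_def)
    then show ?thesis by (simp add: algebra_simps)
  qed
  have c0: "(\<lambda>N. tl N * L2n unit_interval u) \<longlonglongrightarrow> 0" using tendsto_mult_left_zero[OF tl0] .
  show "circle.in_span (\<lambda>\<xi>. m \<xi> * u \<xi>)"
  proof (rule circle.in_span_limit[OF mus])
    fix \<epsilon> :: real assume "\<epsilon> > 0"
    from order_tendstoD(2)[OF c0 this] obtain N where "tl N * L2n unit_interval u < \<epsilon>"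
      by (auto simp: eventually_sequentially)
    then show "\<exists>v. circle.in_span v \<and> L2n unit_interval (\<lambda>\<xi>. m \<xi> * u \<xi> - v \<xi>) < \<epsilon>"
      using close[of N] mNspan[of N] by (intro exI[of _ "\<lambda>\<xi>. mN N \<xi> * u \<xi>"]) auto
  qed
  let ?g = "\<lambda>(p, q). complex_of_real (omega p q) * L2ip unit_interval u (ee (n + \<sigma> p q))"
  have "?g summable_on UNIV"
    by (rule omega_summable[of _ "L2n unit_interval u"]) (rule circle.coeff_bound[OF us])
  from sum_tendsto_infsum[OF this fS evS] have l1: "(\<lambda>N. sum ?g (S N)) \<longlonglongrightarrow> infsum ?g UNIV" .
  have ipN: "L2ip unit_interval (\<lambda>\<xi>. mN N \<xi> * u \<xi>) (ee n) = sum ?g (S N)" for N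
  proof -
    have sh: "L2ip unit_interval (\<lambda>\<xi>. ee (- j) \<xi> * u \<xi>) (ee n) = L2ip unit_interval u (ee (n + j))" for j
    proof -
      have e: "ee (- (n + j)) \<xi> = ee (- j) \<xi> * ee (- n) \<xi>" for \<xi>
        unfolding ee_mult by (rule arg_cong[of _ _ "\<lambda>k. ee k \<xi>"]) simp
      have "ee (- j) \<xi> * u \<xi> * cnj (ee n \<xi>) = u \<xi> * cnj (ee (n + j) \<xi>)" for \<xi>
        unfolding ee_cnj e by (simp only: mult_ac)
      then show ?thesis unfolding L2ip_def by (simp only:)
    qed
    have "L2ip unit_interval (\<lambda>\<xi>. mN N \<xi> * u \<xi>) (ee n) =
      L2ip unit_interval (\<lambda>\<xi>. \<Sum>pq\<in>S N. (case pq of (p, q) \<Rightarrow> complex_of_real (omega p q)) * (ee (- (case pq of (p, q) \<Rightarrow> \<sigma> p q)) \<xi> * u \<xi>)) (ee n)"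
      unfolding mN_def sum_distrib_right by (simp add: case_prod_unfold mult.assoc)
    also have "\<dots> = (\<Sum>pq\<in>S N. (case pq of (p, q) \<Rightarrow> complex_of_real (omega p q)) * L2ip unit_interval u (ee (n + (case pq of (p, q) \<Rightarrow> \<sigma> p q))))"
      by (subst L2ip_sum) (auto simp: L2ip_cmult sh intro!: sq_int_cmult circle.e_sq sq_int_mult_bounded[OF us measurable_ee, of _ 1])
    finally show ?thesis by (simp add: case_prod_unfold)
  qed
  have "(\<lambda>N. L2ip unit_interval (\<lambda>\<xi>. m \<xi> * u \<xi>) (ee n) - sum ?g (S N)) \<longlonglongrightarrow> 0"
  proof (rule Lim_null_comparison[OF _ c0])
    show "\<forall>\<^sub>F N in sequentially. norm (L2ip unit_interval (\<lambda>\<xi>. m \<xi> * u \<xi>) (ee n) - sum ?g (S N)) \<le> tl N * L2n unit_interval u"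
    proof (rule always_eventually, rule allI)
      fix N
      have s: "sq_int unit_interval (\<lambda>\<xi>. mN N \<xi> * u \<xi>)" using mNspan[of N] by (simp add: circle.in_span_def)
      have "norm (L2ip unit_interval (\<lambda>\<xi>. m \<xi> * u \<xi>) (ee n) - sum ?g (S N)) =
        norm (L2ip unit_interval (\<lambda>\<xi>. m \<xi> * u \<xi> - mN N \<xi> * u \<xi>) (ee n))"
        unfolding ipN[symmetric] L2ip_diff[OF mus s circle.e_sq] ..
      also have "\<dots> \<le> L2n unit_interval (\<lambda>\<xi>. m \<xi> * u \<xi> - mN N \<xi> * u \<xi>)"
        by (rule circle.coeff_bound[OF sq_int_diff[OF mus s]])
      finally show "norm (L2ip unit_interval (\<lambda>\<xi>. m \<xi> * u \<xi>) (ee n) - sum ?g (S N)) \<le> tl N * L2n unit_interval u"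
        using close[of N] by simp
    qed
  qed
  from tendsto_diff[OF tendsto_const[of "L2ip unit_interval (\<lambda>\<xi>. m \<xi> * u \<xi>) (ee n)"] this]
  have "(\<lambda>N. sum ?g (S N)) \<longlonglongrightarrow> L2ip unit_interval (\<lambda>\<xi>. m \<xi> * u \<xi>) (ee n)" by simp
  with l1 show "L2ip unit_interval (\<lambda>\<xi>. m \<xi> * u \<xi>) (ee n) = infsum ?g UNIV" by (rule LIMSEQ_unique[rotated])
qed

section \<open>Reflection\<close>

lemma unit_reflection:
  fixes F :: "real \<Rightarrow> 'b::{banach,second_countable_topology}"
  assumes F: "F \<in> borel_measurable unit_interval"
  shows "(\<lambda>x. F (1 - x)) \<in> borel_measurable unit_interval"
    "integrable unit_interval F \<Longrightarrow> integrable unit_interval (\<lambda>x. F (1 - x))"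
    "integral\<^sup>L unit_interval (\<lambda>x. F (1 - x)) = integral\<^sup>L unit_interval F"
proof -
  have s: "{0..1} \<inter> space lebesgue \<in> sets (lebesgue :: real measure)" by simp
  define G where "G x = indicator {0..1} x *\<^sub>R F x" for x
  have G: "G \<in> borel_measurable lebesgue"
    using F unfolding G_def[abs_def] by (subst (asm) borel_measurable_restrict_space_iff[OF s])
  have aff: "(\<lambda>x::real. 1 + (-1) * x) \<in> lebesgue \<rightarrow>\<^sub>M lebesgue"
    using lebesgue_affine_measurable[where c = "\<lambda>x::real. -1" and t = 1] by simp
  have e: "indicator {0..1} x *\<^sub>R F (1 - x) = G (1 + (-1) * x)" for x :: real
    by (auto simp: G_def indicator_def)
  show "(\<lambda>x. F (1 - x)) \<in> borel_measurable unit_interval"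
    unfolding borel_measurable_restrict_space_iff[OF s] e by (rule measurable_compose[OF aff G])
  have "lebesgue = density (distr lebesgue lebesgue (\<lambda>x::real. 1 + (-1) * x)) (\<lambda>_. ennreal \<bar>-1\<bar>)"
    by (rule lebesgue_real_affine) simp
  then have d: "distr lebesgue lebesgue (\<lambda>x::real. 1 + (-1) * x) = lebesgue"
    by (simp add: density_1)
  show "integrable unit_interval (\<lambda>x. F (1 - x))" if "integrable unit_interval F"
    using that unfolding integrable_restrict_space[OF s] e G_def[symmetric]
    using integrable_distr_eq[OF aff G] d by simp
  show "integral\<^sup>L unit_interval (\<lambda>x. F (1 - x)) = integral\<^sup>L unit_interval F"
    unfolding integral_restrict_space[OF s] e G_def[symmetric]
    using integral_distr[OF aff G] d by simp
qed

text \<open>For a function of period 1 this is the conjugate of u (- \<xi>), as in the definition of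
  g. The argument 1 - \<xi> stays in [0, 1], where measurability and norms are taken.\<close>

definition reflect :: "(real \<Rightarrow> complex) \<Rightarrow> real \<Rightarrow> complex" where
  "reflect u \<xi> = cnj (u (1 - \<xi>))"

lemma refl_sq_int:
  assumes "sq_int unit_interval u"
  shows "sq_int unit_interval (reflect u)" "L2n unit_interval (reflect u) = L2n unit_interval u"
proof -
  have um: "u \<in> borel_measurable unit_interval" and ui: "integrable unit_interval (\<lambda>x. (cmod (u x))\<^sup>2)"
    using assms by (auto simp: sq_int_def)
  have m2: "(\<lambda>x. (cmod (u x))\<^sup>2) \<in> borel_measurable unit_interval" using um by measurable
  show "sq_int unit_interval (reflect u)"
    unfolding sq_int_def reflect_def[abs_def] complex_mod_cnj
    using measurable_compose[OF unit_reflection(1)[OF um] measurable_cnj] unit_reflection(2)[OF m2 ui] by simp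
  show "L2n unit_interval (reflect u) = L2n unit_interval u"
    unfolding L2n_def reflect_def complex_mod_cnj unit_reflection(3)[OF m2] ..
qed

lemma ee_reflect: "ee n (1 - \<xi>) = ee (- n) \<xi>"
proof -
  have "ee n (1 - \<xi>) = cis (2 * pi * of_int (- n)) * ee (- n) \<xi>"
    unfolding ee_def cis_mult by (rule arg_cong[of _ _ cis]) (simp add: algebra_simps)
  also have "cis (2 * pi * of_int (- n)) = 1" by (rule cis_multiple_2pi) simp
  finally show ?thesis by simp
qed

lemma refl_coeff:
  assumes "sq_int unit_interval u"
  shows "L2ip unit_interval (reflect u) (ee n) = cnj (L2ip unit_interval u (ee n))"
proof -
  have um: "u \<in> borel_measurable unit_interval" using assms by (auto simp: sq_int_def)
  define F where "F x = cnj (u x) * ee n x" for x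
  have F: "F \<in> borel_measurable unit_interval"
    unfolding F_def[abs_def] using measurable_compose[OF um measurable_cnj] by measurable
  have "reflect u \<xi> * cnj (ee n \<xi>) = F (1 - \<xi>)" for \<xi>
    by (simp add: reflect_def F_def ee_cnj ee_reflect)
  then have "L2ip unit_interval (reflect u) (ee n) = (\<integral>x. F x \<partial>unit_interval)"
    unfolding L2ip_def using unit_reflection(3)[OF F] by simp
  also have "\<dots> = (\<integral>x. cnj (u x * cnj (ee n x)) \<partial>unit_interval)"
    by (simp add: F_def)
  finally show ?thesis unfolding L2ip_def by (simp only: Bochner_Integration.integral_cnj)
qed

lemma refl_in_span:
  assumes "circle.in_span u"
  shows "circle.in_span (reflect u)"
proof (rule circle.in_span_limit)
  have u: "sq_int unit_interval u" using assms by (simp add: circle.in_span_def)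
  show "sq_int unit_interval (reflect u)" by (rule refl_sq_int(1)[OF u])
  fix \<epsilon> :: real assume "\<epsilon> > 0"
  then obtain N a where N: "L2n unit_interval (\<lambda>\<xi>. u \<xi> - (\<Sum>n\<in>ibox N. a n * ee n \<xi>)) < \<epsilon>"
    using assms unfolding circle.in_span_def by meson
  have "reflect (\<lambda>\<xi>. u \<xi> - (\<Sum>n\<in>ibox N. a n * ee n \<xi>)) = (\<lambda>\<xi>. reflect u \<xi> - (\<Sum>n\<in>ibox N. cnj (a n) * ee n \<xi>))"
    by (rule ext) (simp add: reflect_def ee_reflect ee_cnj)
  then have "L2n unit_interval (\<lambda>\<xi>. reflect u \<xi> - (\<Sum>n\<in>ibox N. cnj (a n) * ee n \<xi>)) < \<epsilon>"
    using refl_sq_int(2)[OF sq_int_diff[OF u circle.sq_int_comb], of a "ibox N"] N by simp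
  then show "\<exists>v. circle.in_span v \<and> L2n unit_interval (\<lambda>\<xi>. reflect u \<xi> - v \<xi>) < \<epsilon>"
    using circle.in_span_comb[of "\<lambda>n. cnj (a n)" N] by (intro exI[of _ "\<lambda>\<xi>. \<Sum>n\<in>ibox N. cnj (a n) * ee n \<xi>"]) simp
qed

section \<open>Elements of the phase space as lattice sums\<close>

lemma L2F_measurable: 
  assumes "u \<in> L2F gam"
  shows "u \<in> borel_measurable borel"
proof -
  from assms obtain F where F: "F holomorphic_on UNIV" "\<And>z. u z = complex_of_real (exp (- (cmod z)\<^sup>2 / 2)) * F z"
    unfolding L2F_def F_space_def Etilde_def by blast
  have "continuous_on UNIV u"
    unfolding F(2)[abs_def] by (intro continuous_intros holomorphic_on_imp_continuous_on F(1)) auto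
  then show ?thesis by (rule borel_measurable_continuous_onI)
qed

lemma L2F_sq_int: 
  assumes "u \<in> L2F gam"
  shows "sq_int (lebesgue_on (strip gam)) u"
  using assms L2_norm_finite_iff[OF measurable_lebesgue_on_borel[OF L2F_measurable[OF assms]]]
  by (simp add: L2F_def)

lemma psi_quasiperiodic: "exp ((complex_of_real gam * cnj z - cnj (complex_of_real gam) * z) / 2) * psi k (z + of_real gam) = psi k z"
proof -
  have g: "dlt * gam = pi" using gam_pos by (simp add: dlt_def)
  have "exp ((complex_of_real gam * cnj z - cnj (complex_of_real gam) * z) / 2) = cis (- (gam * Im z))"
    unfolding cis_conv_exp by (rule arg_cong[of _ _ exp]) (simp add: complex_eq_iff)
  moreover have "cis (- (gam * Im z)) * cis (2 * dlt * of_int k * Re (z + of_real gam) + Re (z + of_real gam) * Im (z + of_real gam) - pi * (of_int k)\<^sup>2 / 2)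
     = cis (2 * pi * of_int k) * cis (2 * dlt * of_int k * Re z + Re z * Im z - pi * (of_int k)\<^sup>2 / 2)"
    unfolding cis_mult using g by (intro arg_cong[of _ _ cis]) (simp add: algebra_simps flip: g)
  moreover have "cis (2 * pi * of_int k) = 1" by (rule cis_multiple_2pi) simp
  ultimately show ?thesis unfolding psi_eq by (simp add: mult_ac)
qed

lemma synth_quasiperiodic:
  "exp ((complex_of_real gam * cnj z - cnj (complex_of_real gam) * z) / 2) * synth c (z + of_real gam) = synth c z"
proof -
  let ?E = "exp ((complex_of_real gam * cnj z - cnj (complex_of_real gam) * z) / 2)"
  have "?E * synth c (z + of_real gam) = (\<Sum>\<^sub>\<infinity>k. ?E * (c k * psi k (z + of_real gam)))"
    unfolding synth_def by (rule infsum_cmult_right'[symmetric])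
  also have "\<dots> = (\<Sum>\<^sub>\<infinity>k. c k * psi k z)"
    by (intro infsum_cong) (simp only: psi_quasiperiodic mult.left_commute[of ?E])
  finally show ?thesis by (simp add: synth_def)
qed

text \<open>The exceptional set is covered by countably many horizontal translates of one null
  set.\<close>

lemma AE_of_AE_strip:
  assumes per: "\<And>z. P (z + of_real gam) \<longleftrightarrow> P z" and ae: "AE z in lebesgue_on (strip gam). P z"
  shows "AE z in lebesgue. P z"
proof -
  have "AE z in lebesgue. z \<in> strip gam \<longrightarrow> P z"
    using ae by (subst (asm) AE_restrict_space_iff) auto
  then obtain N where N: "N \<in> null_sets lebesgue" "{z. z \<in> strip gam \<and> \<not> P z} \<subseteq> N"
    by (auto simp: eventually_ae_filter)
  have perN: "P (z + of_real (real n * gam)) \<longleftrightarrow> P z" for n z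
  proof (induction n)
    case (Suc n)
    have "z + of_real (real (Suc n) * gam) = (z + of_real (real n * gam)) + of_real gam" by (simp add: algebra_simps)
    then show ?case unfolding per[of "z + of_real (real n * gam)", symmetric] Suc[symmetric] by (simp only: per)
  qed simp
  have perZ: "P (z + of_real (of_int n * gam)) \<longleftrightarrow> P z" for n :: int and z
  proof (cases "0 \<le> n")
    case True
    then show ?thesis using perN[of z "nat n"] by simp
  next
    case False
    then show ?thesis using perN[of "z + of_real (of_int n * gam)" "nat (- n)"] by (simp add: algebra_simps)
  qed
  have "{z. \<not> P z} \<subseteq> (\<Union>n::int. (+) (of_real (of_int n * gam)) ` N)"
  proof
    fix z assume "z \<in> {z. \<not> P z}"
    \<comment> \<open>The ceiling rather than the floor, since the strip is open on the left and
      closed on the right.\<close>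
    define n where "n = \<lceil>Re z / gam - 1 / 2\<rceil>"
    define w where "w = z - of_real (of_int n * gam)"
    have "of_int n - 1 < Re z / gam - 1 / 2" "Re z / gam - 1 / 2 \<le> of_int n" unfolding n_def by linarith+
    then have "w \<in> strip gam" using gam_pos by (simp add: strip_def w_def field_simps)
    moreover have "z = w + of_real (of_int n * gam)" by (simp add: w_def)
    then have "\<not> P w" using \<open>z \<in> {z. \<not> P z}\<close> perZ by simp
    ultimately have "w \<in> N" using N(2) by blast
    moreover have "z = of_real (of_int n * gam) + w" by (simp add: w_def)
    ultimately show "z \<in> (\<Union>n::int. (+) (of_real (of_int n * gam)) ` N)" by blast
  qed
  moreover have "negligible (\<Union>n::int. (+) (of_real (of_int n * gam)) ` N :: complex set)"
  proof (rule negligible_countable_Union)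
    have "negligible N" using N(1) by (simp only: negligible_iff_null_sets)
    then show "negligible S" if "S \<in> range (\<lambda>n::int. (+) (of_real (of_int n * gam)) ` N)" for S
      using that by (auto intro: negligible_translation simp del: of_real_mult)
  qed simp
  ultimately have "negligible {z. \<not> P z}" by (rule negligible_subset[rotated])
  then show ?thesis
    unfolding negligible_iff_null_sets by (rule AE_I') auto
qed

text \<open>Fatou's lemma for |u - S N|^2: the pointwise limit is |u - v|^2 and the integrals tend
  to 0. No subsequence has to be extracted.\<close>

lemma sums_in_L2_AE_limit:
  assumes u: "u \<in> borel_measurable M" and s: "\<And>N. S N \<in> borel_measurable M" "\<And>N. sq_int M (\<lambda>x. u x - S N x)"
    and l2: "(\<lambda>N. L2n M (\<lambda>x. u x - S N x)) \<longlonglongrightarrow> 0" and pw: "\<And>x. (\<lambda>N. S N x) \<longlonglongrightarrow> v x"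
  shows "AE x in M. u x = v x"
proof -
  let ?g = "\<lambda>N x. ennreal ((cmod (u x - S N x))\<^sup>2)"
  have m: "?g N \<in> borel_measurable M" for N using u s(1)[of N] by measurable
  have v: "v \<in> borel_measurable M" by (rule borel_measurable_LIMSEQ_metric[OF s(1) pw])
  have "(\<lambda>N. ?g N x) \<longlonglongrightarrow> ennreal ((cmod (u x - v x))\<^sup>2)" for x
    by (intro tendsto_ennrealI tendsto_intros pw)
  then have li: "liminf (\<lambda>N. ?g N x) = ennreal ((cmod (u x - v x))\<^sup>2)" for x
    by (intro lim_imp_Liminf) auto
  have i: "integral\<^sup>N M (?g N) = ennreal ((L2n M (\<lambda>x. u x - S N x))\<^sup>2)" for N
    unfolding L2n_sq by (rule nn_integral_eq_integral) (use s(2)[of N] in \<open>auto simp: sq_int_def\<close>)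
  have "(\<lambda>N. integral\<^sup>N M (?g N)) \<longlonglongrightarrow> ennreal (0\<^sup>2)"
    unfolding i by (intro tendsto_ennrealI tendsto_power l2)
  then have "liminf (\<lambda>N. integral\<^sup>N M (?g N)) = 0" by (simp add: lim_imp_Liminf)
  moreover have "(\<integral>\<^sup>+x. liminf (\<lambda>N. ?g N x) \<partial>M) \<le> liminf (\<lambda>N. integral\<^sup>N M (?g N))"
    by (rule nn_integral_liminf[OF m])
  ultimately have "(\<integral>\<^sup>+x. ennreal ((cmod (u x - v x))\<^sup>2) \<partial>M) = 0" unfolding li by simp
  then have "AE x in M. ennreal ((cmod (u x - v x))\<^sup>2) = 0"
    using u v by (subst (asm) nn_integral_0_iff_AE) measurable
  then show ?thesis by eventually_elim (simp add: ennreal_eq_0_iff)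
qed

text \<open>The coefficients are bounded, so the lattice sum converges at every point. It agrees
  with u almost everywhere on the strip and, both being quasi-periodic, in the whole plane; the
  plane is needed because the projection integrates over all of it.\<close>

lemma L2F_synth:
  assumes u: "u \<in> L2F gam" and s: "sums_in_L2 (lebesgue_on (strip gam)) (\<lambda>n z. c n * psi n z) u"
  shows "cmod (c n) \<le> L2n (lebesgue_on (strip gam)) u" "L2ip (lebesgue_on (strip gam)) u (psi n) = c n"
    "AE z in lebesgue. u z = synth c z"
proof -
  let ?M = "lebesgue_on (strip gam)"
  note D = strip.sums_in_L2_D[OF s]
  show cn: "L2ip ?M u (psi n) = c n" for n by (rule D(3))
  then show b: "cmod (c n) \<le> L2n ?M u" for n using strip.coeff_bound[OF D(1), of n] by simp
  have "AE z in ?M. u z = synth c z"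
  proof (rule sums_in_L2_AE_limit[OF _ _ _ D(2)])
    show "u \<in> borel_measurable ?M" using D(1) by (simp add: sq_int_def)
    show "(\<lambda>x. \<Sum>n\<in>ibox N. c n * psi n x) \<in> borel_measurable ?M" for N
      by (rule measurable_lebesgue_on_borel) measurable
    show "sq_int ?M (\<lambda>x. u x - (\<Sum>n\<in>ibox N. c n * psi n x))" for N
      by (rule sq_int_diff[OF D(1) strip.sq_int_comb])
    show "(\<lambda>N. \<Sum>n\<in>ibox N. c n * psi n x) \<longlonglongrightarrow> synth c x" for x by (rule synth_tendsto[OF b])
  qed
  moreover have "u (z + of_real gam) = synth c (z + of_real gam) \<longleftrightarrow> u z = synth c z" for z
  proof -
    let ?E = "exp ((complex_of_real gam * cnj z - cnj (complex_of_real gam) * z) / 2)"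
    have "R_op (complex_of_real gam) u = u" using u by (simp add: L2F_def F_space_def)
    then have "?E * u (z + of_real gam) = u z" by (metis R_op_def)
    then show ?thesis using synth_quasiperiodic[of z c] by (metis exp_not_eq_zero mult_cancel_left)
  qed
  ultimately show "AE z in lebesgue. u z = synth c z" by (intro AE_of_AE_strip)
qed

lemma Pi_op_cong_AE:
  assumes "u \<in> borel_measurable borel" "u' \<in> borel_measurable borel" "AE z in lebesgue. u z = u' z"
  shows "Pi_op u z = Pi_op u' z"
proof -
  have "(\<integral>w. kern z w * u w \<partial>lebesgue) = (\<integral>w. kern z w * u' w \<partial>lebesgue)"
  proof (rule integral_cong_AE)
    have "(\<lambda>w. kern z w * u w) \<in> borel_measurable lborel" "(\<lambda>w. kern z w * u' w) \<in> borel_measurable lborel"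
      using assms by measurable
    then show "(\<lambda>w. kern z w * u w) \<in> borel_measurable lebesgue" "(\<lambda>w. kern z w * u' w) \<in> borel_measurable lebesgue"
      by (simp_all add: measurable_completion)
    show "AE w in lebesgue. kern z w * u w = kern z w * u' w" using assms(3) by eventually_elim simp
  qed
  then show ?thesis by (simp add: Pi_op_def kern_def)
qed

section \<open>The equation for the coefficients\<close>

text \<open>\<open>conv_a\<close> and \<open>conv_b\<close> are the coefficients of the projections
  of |Psi0|^2 v and of Psi0^2 times the conjugate of v. The unknown sits in an unconjugated slot, at
  n + q, in the first and in the conjugated slot, at n + p + q, in the second.\<close>

definition conv_a :: "(int \<Rightarrow> complex) \<Rightarrow> int \<Rightarrow> complex" where
  "conv_a c n = (\<Sum>\<^sub>\<infinity>(p, q). of_real (omega p q) * c (n + q))"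

definition conv_b :: "(int \<Rightarrow> complex) \<Rightarrow> int \<Rightarrow> complex" where
  "conv_b c n = (\<Sum>\<^sub>\<infinity>(p, q). of_real (omega p q) * cnj (c (n + p + q)))"

text \<open>Both terms are trilinear pairings, with the coefficient sequences (1, 1, c) and (1, c,
  1).\<close>

lemma Pi_op_linearization_coeff:
  assumes v: "v \<in> borel_measurable borel" "AE z in lebesgue. v z = synth c z" and c: "\<And>n. cmod (c n) \<le> B"
  shows "L2ip (lebesgue_on (strip gam)) (Pi_op (\<lambda>y. 2 * complex_of_real ((cmod (Psi0 y))\<^sup>2) * v y + (Psi0 y)\<^sup>2 * cnj (v y))) (psi n) =
    2 * conv_a c n + conv_b c n"
proof -
  let ?M = "lebesgue_on (strip gam)"
  \<comment> \<open>The three slots share one bound, which must also cover the constant sequence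
    1.\<close>
  define B' where "B' = max B 1"
  have c': "cmod (c n) \<le> B'" and o: "cmod ((\<lambda>_. 1) n) \<le> B'" for n :: int using c[of n] by (auto simp: B'_def)
  define T1 where "T1 w = synth (\<lambda>_. 1) w * cnj (synth (\<lambda>_. 1) w) * synth c w" for w
  define T2 where "T2 w = synth (\<lambda>_. 1) w * cnj (synth c w) * synth (\<lambda>_. 1) w" for w
  have m1: "synth (\<lambda>_. 1) \<in> borel_measurable borel" and m2: "synth c \<in> borel_measurable borel"
    by (rule synth_measurable[OF o], rule synth_measurable[OF c'])
  note mc1 = measurable_compose[OF m1 measurable_cnj] and mc2 = measurable_compose[OF m2 measurable_cnj]
    and mcv = measurable_compose[OF v(1) measurable_cnj]
  have T: "T1 \<in> borel_measurable borel" "T2 \<in> borel_measurable borel"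
    unfolding T1_def[abs_def] T2_def[abs_def] by (intro borel_measurable_times m1 m2 mc1 mc2)+
  define K where "K = B' * nrm * Cg"
  have K: "cmod (synth (\<lambda>_. 1) w) \<le> K" "cmod (synth c w) \<le> K" for w
    unfolding K_def by (rule synth_bound[OF o], rule synth_bound[OF c'])
  then have "0 \<le> K" using norm_ge_zero order_trans by blast
  then have Tb: "cmod (T1 w) \<le> K * K * K" "cmod (T2 w) \<le> K * K * K" for w
    unfolding T1_def T2_def norm_mult complex_mod_cnj using K by (intro mult_mono; auto)+
  have "Pi_op (\<lambda>y. 2 * complex_of_real ((cmod (Psi0 y))\<^sup>2) * v y + (Psi0 y)\<^sup>2 * cnj (v y)) z = 2 * Pi_op T1 z + Pi_op T2 z" for z
  proof -
    have "Pi_op (\<lambda>y. 2 * complex_of_real ((cmod (Psi0 y))\<^sup>2) * v y + (Psi0 y)\<^sup>2 * cnj (v y)) z = Pi_op (\<lambda>w. 2 * T1 w + T2 w) z"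
    proof (rule Pi_op_cong_AE)
      show "(\<lambda>y. 2 * complex_of_real ((cmod (Psi0 y))\<^sup>2) * v y + (Psi0 y)\<^sup>2 * cnj (v y)) \<in> borel_measurable borel"
        unfolding Psi0_synth using m1 v(1) mcv by measurable
      show "(\<lambda>w. 2 * T1 w + T2 w) \<in> borel_measurable borel" using T by measurable
      show "AE y in lebesgue. 2 * complex_of_real ((cmod (Psi0 y))\<^sup>2) * v y + (Psi0 y)\<^sup>2 * cnj (v y) = 2 * T1 y + T2 y"
        using v(2)
      proof eventually_elim
        case (elim y)
        show ?case unfolding elim T1_def T2_def Psi0_synth complex_norm_square power2_eq_square[of "synth (\<lambda>_. 1) y"]
          by (simp only: mult_ac)
      qed
    qed
    also have "\<dots> = Pi_op (\<lambda>w. 2 * T1 w) z + Pi_op T2 z"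
      by (rule Pi_op_add[OF _ _ T(2) Tb(2), of _ "2 * (K * K * K)"]) (use T Tb in \<open>auto simp: norm_mult\<close>)
    finally show ?thesis by (simp only: Pi_op_cmult[OF T(1)])
  qed
  then have "L2ip ?M (Pi_op (\<lambda>y. 2 * complex_of_real ((cmod (Psi0 y))\<^sup>2) * v y + (Psi0 y)\<^sup>2 * cnj (v y))) (psi n) =
     (\<integral>w. 2 * (Pi_op T1 w * cnj (psi n w)) + Pi_op T2 w * cnj (psi n w) \<partial>?M)"
    unfolding L2ip_def by (simp add: distrib_right mult.assoc)
  also have "\<dots> = 2 * L2ip ?M (Pi_op T1) (psi n) + L2ip ?M (Pi_op T2) (psi n)"
  proof -
    have i1: "integrable ?M (\<lambda>w. Pi_op T1 w * cnj (psi n w))" unfolding T1_def[abs_def] by (rule trilinear_pairing(2)[OF o o c'])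
    have i2: "integrable ?M (\<lambda>w. Pi_op T2 w * cnj (psi n w))" unfolding T2_def[abs_def] by (rule trilinear_pairing(2)[OF o c' o])
    show ?thesis unfolding L2ip_def
      by (subst Bochner_Integration.integral_add) (auto intro: i1 i2)
  qed
  also have "L2ip ?M (Pi_op T1) (psi n) = conv_a c n"
    unfolding T1_def[abs_def] trilinear_pairing(1)[OF o o c'] conv_a_def by simp
  also have "L2ip ?M (Pi_op T2) (psi n) = conv_b c n"
    unfolding T2_def[abs_def] trilinear_pairing(1)[OF o c' o] conv_b_def by simp
  finally show ?thesis .
qed

lemma continuous_of_real_symbols: "continuous_on S (\<lambda>\<xi>. complex_of_real (a_fun \<xi>))" "continuous_on S (\<lambda>\<xi>. complex_of_real (b_fun \<xi>))"
  "continuous_on S mu" "continuous_on S a_fun" "continuous_on S b_fun"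
proof -
  show b: "continuous_on S (\<lambda>\<xi>. complex_of_real (b_fun \<xi>))" by (rule real_analytic_continuous[OF real_analytic_b])
  have "continuous_on S (\<lambda>\<xi>. complex_of_real (a_fun \<xi> + b_fun \<xi>) - complex_of_real (b_fun \<xi>))"
    by (intro continuous_on_diff b real_analytic_continuous[OF real_analytic_a_plus_b])
  then show a: "continuous_on S (\<lambda>\<xi>. complex_of_real (a_fun \<xi>))" by simp
  show "continuous_on S a_fun" "continuous_on S b_fun"
    using continuous_on_Re[OF a] continuous_on_Re[OF b] by simp_all
  show "continuous_on S mu" using DERIV_mu(1) by (meson DERIV_isCont continuous_at_imp_continuous_on)
qed

text \<open>The time derivative of f prescribed by the system i f' = a f + b g.\<close>

definition gen :: "(real \<Rightarrow> complex) \<Rightarrow> real \<Rightarrow> complex" where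
  "gen u \<xi> = - \<i> * (of_real (a_fun \<xi>) * u \<xi> + of_real (b_fun \<xi>) * reflect u \<xi>)"

lemma gen_in_span:
  assumes u: "circle.in_span u"
  shows "circle.in_span (gen u)"
    "L2ip unit_interval (gen u) (ee n) = - \<i> * (2 * conv_a (\<lambda>k. L2ip unit_interval u (ee k)) n
       + conv_b (\<lambda>k. L2ip unit_interval u (ee k)) n - of_real lam * L2ip unit_interval u (ee n))"
proof -
  have us: "sq_int unit_interval u" using u by (simp add: circle.in_span_def)
  define A where "A \<xi> = complex_of_real ((a_fun \<xi> + lam) / 2)" for \<xi>
  have cA: "continuous_on UNIV A" unfolding A_def[abs_def] by (intro continuous_intros continuous_of_real_symbols) simp
  note mA = circle_multiplier[OF u a_symbol[symmetric, folded A_def] cA]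
  note mB = circle_multiplier[OF refl_in_span[OF u] b_symbol[symmetric] continuous_of_real_symbols(2)]
  define P where "P \<xi> = 2 * (A \<xi> * u \<xi>) + (- of_real lam) * u \<xi>" for \<xi>
  have P: "circle.in_span P" unfolding P_def[abs_def] by (intro circle.in_span_add circle.in_span_cmult mA(1) u)
  have eq: "gen u = (\<lambda>\<xi>. - \<i> * (P \<xi> + of_real (b_fun \<xi>) * reflect u \<xi>))"
  proof (rule ext)
    fix \<xi>
    have "2 * (A \<xi> * u \<xi>) = of_real (a_fun \<xi>) * u \<xi> + of_real lam * u \<xi>"
      unfolding A_def by (simp add: field_simps)
    then show "gen u \<xi> = - \<i> * (P \<xi> + of_real (b_fun \<xi>) * reflect u \<xi>)"
      unfolding gen_def P_def by simp
  qed
  show "circle.in_span (gen u)" unfolding eq by (intro circle.in_span_cmult circle.in_span_add P mB(1))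
  have s: "sq_int unit_interval (\<lambda>\<xi>. A \<xi> * u \<xi>)" "sq_int unit_interval P" "sq_int unit_interval (\<lambda>\<xi>. of_real (b_fun \<xi>) * reflect u \<xi>)"
    using mA(1) P mB(1) by (auto simp: circle.in_span_def)
  have "L2ip unit_interval P (ee n) = 2 * L2ip unit_interval (\<lambda>\<xi>. A \<xi> * u \<xi>) (ee n) + (- of_real lam) * L2ip unit_interval u (ee n)"
    unfolding P_def[abs_def] by (subst L2ip_add) (auto simp only: L2ip_cmult intro!: sq_int_cmult s us circle.e_sq)
  then show "L2ip unit_interval (gen u) (ee n) = - \<i> * (2 * conv_a (\<lambda>k. L2ip unit_interval u (ee k)) n
       + conv_b (\<lambda>k. L2ip unit_interval u (ee k)) n - of_real lam * L2ip unit_interval u (ee n))"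
    unfolding eq L2ip_cmult L2ip_add[OF s(2,3) circle.e_sq] mA(2) mB(2) refl_coeff[OF us] conv_a_def conv_b_def
    by (simp add: add.assoc)
qed

text \<open>The data of one solution. The constants of the final estimates are parameters fixed
  outside, which makes those estimates uniform over all solutions.\<close>

locale lattice_flow =
  fixes v :: "real \<Rightarrow> complex \<Rightarrow> complex" and c :: "real \<Rightarrow> int \<Rightarrow> complex" and f :: "real \<Rightarrow> real \<Rightarrow> complex"
  assumes sol: "linearized_solution v" and lat: "lattice_expansion v c" and fou: "fourier_function c f"
begin

lemma v_L2F: "0 \<le> t \<Longrightarrow> v t \<in> L2F gam"
  using sol by (simp add: linearized_solution_def)

lemma v_synth:
  assumes "0 \<le> t"
  shows "cmod (c t n) \<le> L2n (lebesgue_on (strip gam)) (v t)" "L2ip (lebesgue_on (strip gam)) (v t) (psi n) = c t n"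
    "AE z in lebesgue. v t z = synth (c t) z"
  using L2F_synth[OF v_L2F[OF assms]] lat assms by (auto simp: lattice_expansion_def)

lemma f_circle:
  assumes "0 \<le> t"
  shows "circle.in_span (f t)" "L2ip unit_interval (f t) (ee n) = c t n" "sq_int unit_interval (f t)"
proof -
  have "sums_in_L2 unit_interval (\<lambda>n \<xi>. c t n * ee n \<xi>) (f t)"
    using fou assms unfolding fourier_function_def ee_exp by blast
  from circle.sums_in_L2_D[OF this]
  show "circle.in_span (f t)" "L2ip unit_interval (f t) (ee n) = c t n" "sq_int unit_interval (f t)" by auto
qed

text \<open>The equation holds at every point, so both sides can be paired with \<open>psi n\<close>
  over the strip; the resulting coefficients are those of \<open>gen (f t)\<close> on the
  circle.\<close>

lemma derivative_coeff:
  assumes t: "0 \<le> t"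
  obtains w where "w \<in> L2F gam" "has_L2_time_derivative v w t"
    "\<And>n. L2ip (lebesgue_on (strip gam)) w (psi n) = L2ip unit_interval (gen (f t)) (ee n)"
proof -
  let ?M = "lebesgue_on (strip gam)"
  from sol t obtain w where w: "w \<in> L2F gam" "has_L2_time_derivative v w t"
    and eq: "\<And>z. \<i> * w z + complex_of_real lam * v t z = Pi_op (\<lambda>y. 2 * complex_of_real ((cmod (Psi0 y))\<^sup>2) * v t y + (Psi0 y)\<^sup>2 * cnj (v t y)) z"
    unfolding linearized_solution_def by blast
  have sw: "sq_int ?M w" and sv: "sq_int ?M (v t)" using L2F_sq_int w(1) v_L2F[OF t] by auto
  have "L2ip ?M w (psi n) = L2ip unit_interval (gen (f t)) (ee n)" for n
  proof -
    have "\<i> * L2ip ?M w (psi n) + of_real lam * c t n = L2ip ?M (\<lambda>z. \<i> * w z + complex_of_real lam * v t z) (psi n)"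
      by (subst L2ip_add) (auto simp: L2ip_cmult v_synth(2)[OF t] intro!: sq_int_cmult sw sv strip.e_sq)
    also have "\<dots> = 2 * conv_a (c t) n + conv_b (c t) n"
      unfolding eq by (rule Pi_op_linearization_coeff[OF L2F_measurable[OF v_L2F[OF t]] v_synth(3)[OF t] v_synth(1)[OF t]])
    finally have "\<i> * L2ip ?M w (psi n) = 2 * conv_a (c t) n + conv_b (c t) n - of_real lam * c t n" by (simp add: algebra_simps)
    then have "- \<i> * (\<i> * L2ip ?M w (psi n)) = - \<i> * (2 * conv_a (c t) n + conv_b (c t) n - of_real lam * c t n)" by simp
    then show ?thesis unfolding gen_in_span(2)[OF f_circle(1)[OF t]] f_circle(2)[OF t] by simp
  qed
  then show ?thesis using that w by blast
qed

text \<open>Differentiability passes from the strip to the circle: Bessel's inequality bounds the coefficients of the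
  difference quotient of \<open>v\<close>, and the Fourier series of the difference quotient of \<open>f\<close> is complete.\<close>

lemma f_derivative:
  assumes t: "0 \<le> t"
  shows "((\<lambda>s. L2n unit_interval (\<lambda>\<xi>. (f s \<xi> - f t \<xi>) / of_real (s - t) - gen (f t) \<xi>)) \<longlongrightarrow> 0) (at t within {0..})"
proof -
  let ?M = "lebesgue_on (strip gam)"
  obtain w where w: "w \<in> L2F gam" "has_L2_time_derivative v w t"
    "\<And>n. L2ip ?M w (psi n) = L2ip unit_interval (gen (f t)) (ee n)"
    by (rule derivative_coeff[OF t]) blast
  define V where "V s z = (v s z - v t z) / complex_of_real (s - t) - w z" for s z
  define D where "D s \<xi> = (f s \<xi> - f t \<xi>) / of_real (s - t) - gen (f t) \<xi>" for s \<xi>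
  have Ve: "V s = (\<lambda>z. (of_real (1 / (s - t)) * v s z + of_real (- 1 / (s - t)) * v t z) + (-1) * w z)" for s
    unfolding V_def[abs_def] by (rule ext) (simp add: field_simps diff_divide_distrib)
  have De: "D s = (\<lambda>z. (of_real (1 / (s - t)) * f s z + of_real (- 1 / (s - t)) * f t z) + (-1) * gen (f t) z)" for s
    unfolding D_def[abs_def] by (rule ext) (simp add: field_simps diff_divide_distrib)
  note sw = L2F_sq_int[OF w(1)] and sv = L2F_sq_int[OF v_L2F]
  have sV: "sq_int ?M (V s)" if "0 \<le> s" for s
    unfolding Ve by (intro sq_int_add sq_int_cmult sv that t sw)
  have sD: "circle.in_span (D s)" if "0 \<le> s" for s
    unfolding De by (intro circle.in_span_add circle.in_span_cmult f_circle that t gen_in_span)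
  have le: "L2n unit_interval (D s) \<le> L2n ?M (V s)" if s: "0 \<le> s" for s
  proof (rule circle.in_span_norm_bound[OF sD[OF s] L2n_nonneg])
    fix N
    have g: "sq_int unit_interval (gen (f t))" using gen_in_span(1)[OF f_circle(1)[OF t]] by (simp add: circle.in_span_def)
    have cD: "L2ip unit_interval (D s) (ee n) = of_real (1 / (s - t)) * c s n + of_real (- 1 / (s - t)) * c t n + (-1) * L2ip unit_interval (gen (f t)) (ee n)" for n
      unfolding De
      by (simp only: L2ip_add sq_int_add sq_int_cmult f_circle s t g circle.e_sq L2ip_cmult)
    have cV: "L2ip ?M (V s) (psi n) = of_real (1 / (s - t)) * c s n + of_real (- 1 / (s - t)) * c t n + (-1) * L2ip ?M w (psi n)" for n
      unfolding Ve
      by (simp only: L2ip_add sq_int_add sq_int_cmult sv sw v_synth s t strip.e_sq L2ip_cmult)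
    have "L2ip unit_interval (D s) (ee n) = L2ip ?M (V s) (psi n)" for n
      unfolding cD cV w(3) ..
    then show "(\<Sum>n\<in>ibox N. (cmod (L2ip unit_interval (D s) (ee n)))\<^sup>2) \<le> (L2n ?M (V s))\<^sup>2"
      using strip.bessel[OF sV[OF s], of N] by simp
  qed
  have "((\<lambda>s. ennreal (L2n ?M (V s))) \<longlongrightarrow> ennreal 0) (at t within {0..})"
  proof (rule Lim_transform_eventually)
    show "((\<lambda>s. L2_norm ?M (V s)) \<longlongrightarrow> ennreal 0) (at t within {0..})"
      using w(2) by (simp add: has_L2_time_derivative_def V_def[abs_def])
    show "\<forall>\<^sub>F s in at t within {0..}. L2_norm ?M (V s) = ennreal (L2n ?M (V s))"
      unfolding eventually_at_filter by (intro always_eventually) (auto simp: L2_norm_eq[OF sV])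
  qed
  then have V0: "((\<lambda>s. L2n ?M (V s)) \<longlongrightarrow> 0) (at t within {0..})"
    by (subst (asm) tendsto_ennreal_iff) auto
  show ?thesis
    unfolding D_def[abs_def, symmetric]
  proof (rule Lim_null_comparison[OF _ V0])
    show "\<forall>\<^sub>F s in at t within {0..}. norm (L2n unit_interval (\<lambda>\<xi>. (f s \<xi> - f t \<xi>) / of_real (s - t) - gen (f t) \<xi>)) \<le> L2n ?M (V s)"
      unfolding eventually_at_filter by (intro always_eventually) (auto simp: le[unfolded D_def[abs_def]] simp del: of_real_diff)
  qed
qed

end

section \<open>Solving the linear system pointwise\<close>

lemma unit_L1_le_L2:
  assumes "sq_int unit_interval u"
  shows "integrable unit_interval u" "(\<integral>x. cmod (u x) \<partial>unit_interval) \<le> L2n unit_interval u"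
proof -
  show "integrable unit_interval u" by (rule sq_int_imp_integrable[OF finite_unit_interval assms])
  have "L2n unit_interval (ee 0) = 1" by simp
  then show "(\<integral>x. cmod (u x) \<partial>unit_interval) \<le> L2n unit_interval u"
    using L2_cauchy_schwarz_norm[OF assms circle.e_sq[of 0]] by simp
qed

lemma unit_integral_bound:
  assumes u: "sq_int unit_interval u" and m: "m \<in> borel_measurable unit_interval" "\<And>x. cmod (m x) \<le> B"
  shows "cmod (\<integral>x. m x * u x \<partial>unit_interval) \<le> B * L2n unit_interval u"
proof -
  have B: "0 \<le> B" using m(2)[of 0] norm_ge_zero order_trans by blast
  have s: "sq_int unit_interval (\<lambda>x. m x * u x)"
    by (rule sq_int_mult_bounded[OF u m(1)]) (use m(2) in auto)
  have "cmod (\<integral>x. m x * u x \<partial>unit_interval) \<le> (\<integral>x. cmod (m x * u x) \<partial>unit_interval)" by (rule integral_norm_bound)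
  also have "\<dots> \<le> L2n unit_interval (\<lambda>x. m x * u x)" by (rule unit_L1_le_L2(2)[OF s])
  also have "\<dots> \<le> B * L2n unit_interval u" by (rule L2n_mult_bounded[OF u m(1) _ B]) (use m(2) in auto)
  finally show ?thesis .
qed

text \<open>f is differentiable at t only in the L2 norm, while \<phi> has a quadratic remainder
  uniform in x; the pairing of the two still obeys the product rule.\<close>

lemma L2_product_rule:
  fixes f :: "real \<Rightarrow> real \<Rightarrow> complex" and \<phi> :: "real \<Rightarrow> real \<Rightarrow> complex"
  assumes f: "\<And>s. 0 \<le> s \<Longrightarrow> sq_int unit_interval (f s)" and f': "sq_int unit_interval f'"
    and d: "((\<lambda>s. L2n unit_interval (\<lambda>\<xi>. (f s \<xi> - f t \<xi>) / of_real (s - t) - f' \<xi>)) \<longlongrightarrow> 0) (at t within {0..})"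
    and \<phi>m: "\<And>s. \<phi> s \<in> borel_measurable unit_interval" "\<phi>' \<in> borel_measurable unit_interval"
    and \<phi>b: "\<And>s x. s \<in> {0..T} \<Longrightarrow> cmod (\<phi> s x) \<le> C" "\<And>x. cmod (\<phi>' x) \<le> C"
    and tay: "\<And>s x. s \<in> {0..T} \<Longrightarrow> cmod (\<phi> s x - \<phi> t x - of_real (s - t) * \<phi>' x) \<le> C * (s - t)\<^sup>2"
    and t: "t \<in> {0..T}"
  shows "((\<lambda>s. ((\<integral>x. \<phi> s x * f s x \<partial>unit_interval) - (\<integral>x. \<phi> t x * f t x \<partial>unit_interval)) / of_real (s - t))
     \<longlongrightarrow> (\<integral>x. \<phi>' x * f t x + \<phi> t x * f' x \<partial>unit_interval)) (at t within {0..T})"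
proof -
  let ?M = unit_interval
  have C: "0 \<le> C" using \<phi>b(2)[of 0] norm_ge_zero order_trans by blast
  have ft: "sq_int ?M (f t)" using f t by simp
  define Q where "Q s \<xi> = (f s \<xi> - f t \<xi>) / of_real (s - t) - f' \<xi>" for s \<xi>
  define E where "E s = C * L2n ?M (Q s) + \<bar>s - t\<bar> * (C * (1 + T) * L2n ?M f') + \<bar>s - t\<bar> * (C * L2n ?M (f t))" for s
  have bnd: "cmod (((\<integral>x. \<phi> s x * f s x \<partial>?M) - (\<integral>x. \<phi> t x * f t x \<partial>?M)) / of_real (s - t) - (\<integral>x. \<phi>' x * f t x + \<phi> t x * f' x \<partial>?M)) \<le> E s"
    if s: "s \<in> {0..T}" "s \<noteq> t" for s
  proof -
    have fs: "sq_int ?M (f s)" using f s by simp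
    have ne: "complex_of_real (s - t) \<noteq> 0" using s by simp
    have Qs: "sq_int ?M (Q s)"
    proof -
      have "Q s = (\<lambda>\<xi>. of_real (1 / (s - t)) * (f s \<xi> - f t \<xi>) - f' \<xi>)" by (rule ext) (simp add: Q_def)
      then show ?thesis by (simp only:) (intro sq_int_diff sq_int_cmult fs ft f')
    qed
    define \<alpha> where "\<alpha> x = (\<phi> s x - \<phi> t x) / of_real (s - t) - \<phi>' x" for x
    have \<alpha>m: "\<alpha> \<in> borel_measurable ?M" "(\<lambda>x. \<phi> s x - \<phi> t x) \<in> borel_measurable ?M"
      unfolding \<alpha>_def[abs_def] using \<phi>m by measurable
    have \<alpha>b: "cmod (\<alpha> x) \<le> C * \<bar>s - t\<bar>" for x
    proof -
      have "\<alpha> x = (\<phi> s x - \<phi> t x - of_real (s - t) * \<phi>' x) / of_real (s - t)"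
        unfolding \<alpha>_def diff_divide_distrib using ne by simp
      then have "cmod (\<alpha> x) = cmod (\<phi> s x - \<phi> t x - of_real (s - t) * \<phi>' x) / \<bar>s - t\<bar>"
        by (simp add: norm_divide del: of_real_diff)
      also have "\<dots> \<le> (C * (s - t)\<^sup>2) / \<bar>s - t\<bar>" using tay[OF s(1)] by (rule divide_right_mono) simp
      also have "\<dots> = C * \<bar>s - t\<bar>" using s(2) by (simp add: power2_eq_square abs_if field_simps)
      finally show ?thesis .
    qed
    have db: "cmod (\<phi> s x - \<phi> t x) \<le> \<bar>s - t\<bar> * (C * (1 + T))" for x
    proof -
      have "\<phi> s x - \<phi> t x = of_real (s - t) * (\<alpha> x + \<phi>' x)" unfolding \<alpha>_def using ne by simp
      then have "cmod (\<phi> s x - \<phi> t x) = \<bar>s - t\<bar> * cmod (\<alpha> x + \<phi>' x)" by (simp add: norm_mult del: of_real_diff)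
      also have "\<dots> \<le> \<bar>s - t\<bar> * (C * \<bar>s - t\<bar> + C)"
        by (intro mult_left_mono order_trans[OF norm_triangle_ineq] add_mono \<alpha>b \<phi>b) auto
      also have "\<dots> \<le> \<bar>s - t\<bar> * (C * (1 + T))"
      proof (rule mult_left_mono)
        have "C * \<bar>s - t\<bar> \<le> C * T" using s t C by (intro mult_left_mono) auto
        then show "C * \<bar>s - t\<bar> + C \<le> C * (1 + T)" by (simp add: algebra_simps)
      qed simp
      finally show ?thesis .
    qed
    have \<phi>sm: "\<phi> s \<in> borel_measurable ?M" "\<phi> t \<in> borel_measurable ?M" by (rule \<phi>m)+
    have i: "integrable ?M (\<lambda>x. m x * u x)" if "sq_int ?M u" "m \<in> borel_measurable ?M" "\<And>x. cmod (m x) \<le> B" for m u B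
      by (rule unit_L1_le_L2(1)[OF sq_int_mult_bounded[OF that(1,2)]]) (use that(3) in auto)
    note ints = i[OF fs \<phi>sm(1) \<phi>b(1)[OF s(1)]] and intt = i[OF ft \<phi>sm(2) \<phi>b(1)[OF t]]
      and i1 = i[OF ft \<phi>m(2) \<phi>b(2)] and i2 = i[OF f' \<phi>sm(2) \<phi>b(1)[OF t]]
      and j1 = i[OF Qs \<phi>sm(1) \<phi>b(1)[OF s(1)]] and j2 = i[OF f' \<alpha>m(2) db] and j3 = i[OF ft \<alpha>m(1) \<alpha>b]
    have "((\<integral>x. \<phi> s x * f s x \<partial>?M) - (\<integral>x. \<phi> t x * f t x \<partial>?M)) / of_real (s - t) - (\<integral>x. \<phi>' x * f t x + \<phi> t x * f' x \<partial>?M)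
       = (\<integral>x. (\<phi> s x * f s x - \<phi> t x * f t x) / of_real (s - t) - (\<phi>' x * f t x + \<phi> t x * f' x) \<partial>?M)"
      by (subst Bochner_Integration.integral_diff)
         (auto simp: Bochner_Integration.integral_diff[OF ints intt] simp del: of_real_diff
           intro!: Bochner_Integration.integrable_divide_zero Bochner_Integration.integrable_diff ints intt i1 i2)
    \<comment> \<open>The error splits into the L2 error of the difference quotient of f, the
      increment of \<phi> against f', and the Taylor error of \<phi> against f t. These are the
      three terms of \<open>E\<close>.\<close>
    also have "\<dots> = (\<integral>x. (\<phi> s x * Q s x + (\<phi> s x - \<phi> t x) * f' x) + \<alpha> x * f t x \<partial>?M)"
    proof (rule Bochner_Integration.integral_cong[OF refl])
      fix x
      have e1: "\<phi> s x * f s x - \<phi> t x * f t x = \<phi> s x * (f s x - f t x) + (\<phi> s x - \<phi> t x) * f t x" by (simp add: algebra_simps)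
      show "(\<phi> s x * f s x - \<phi> t x * f t x) / of_real (s - t) - (\<phi>' x * f t x + \<phi> t x * f' x) =
        (\<phi> s x * Q s x + (\<phi> s x - \<phi> t x) * f' x) + \<alpha> x * f t x"
        unfolding e1 add_divide_distrib Q_def \<alpha>_def by (simp add: algebra_simps del: of_real_diff)
    qed
    also have "\<dots> = (\<integral>x. \<phi> s x * Q s x \<partial>?M) + (\<integral>x. (\<phi> s x - \<phi> t x) * f' x \<partial>?M) + (\<integral>x. \<alpha> x * f t x \<partial>?M)"
      using j1 j2 j3 by simp
    finally have eq: "((\<integral>x. \<phi> s x * f s x \<partial>?M) - (\<integral>x. \<phi> t x * f t x \<partial>?M)) / of_real (s - t) - (\<integral>x. \<phi>' x * f t x + \<phi> t x * f' x \<partial>?M)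
       = (\<integral>x. \<phi> s x * Q s x \<partial>?M) + (\<integral>x. (\<phi> s x - \<phi> t x) * f' x \<partial>?M) + (\<integral>x. \<alpha> x * f t x \<partial>?M)" .
    have b1: "cmod (\<integral>x. \<phi> s x * Q s x \<partial>?M) \<le> C * L2n ?M (Q s)"
      by (rule unit_integral_bound[OF Qs \<phi>sm(1) \<phi>b(1)[OF s(1)]])
    have b2: "cmod (\<integral>x. (\<phi> s x - \<phi> t x) * f' x \<partial>?M) \<le> (\<bar>s - t\<bar> * (C * (1 + T))) * L2n ?M f'"
      by (rule unit_integral_bound[OF f' \<alpha>m(2) db])
    have b3: "cmod (\<integral>x. \<alpha> x * f t x \<partial>?M) \<le> (C * \<bar>s - t\<bar>) * L2n ?M (f t)"
      by (rule unit_integral_bound[OF ft \<alpha>m(1) \<alpha>b])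
    show ?thesis
      unfolding eq E_def
      by (rule order_trans[OF norm_triangle_ineq], rule add_mono, rule order_trans[OF norm_triangle_ineq], rule add_mono)
         (use b1 b2 b3 in \<open>simp_all add: mult_ac\<close>)
  qed
  have d': "((\<lambda>s. L2n ?M (Q s)) \<longlongrightarrow> 0) (at t within {0..T})"
    unfolding Q_def[abs_def] by (rule tendsto_within_subset[OF d]) auto
  have "(E \<longlongrightarrow> C * 0 + \<bar>t - t\<bar> * (C * (1 + T) * L2n ?M f') + \<bar>t - t\<bar> * (C * L2n ?M (f t))) (at t within {0..T})"
    unfolding E_def[abs_def] by (intro tendsto_intros d')
  then have E0: "(E \<longlongrightarrow> 0) (at t within {0..T})" by simp
  show ?thesis
    by (rule Lim_transform2[OF tendsto_const], rule Lim_null_comparison[OF _ E0])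
       (use bnd in \<open>auto simp: eventually_at_filter norm_minus_commute\<close>)
qed

text \<open>The mean value bound is applied to F x - x F' t, whose derivative is at most K |s - t|
  between s and t. This gives K instead of the sharp K / 2, which is immaterial here.\<close>

lemma second_order_taylor:
  fixes F :: "real \<Rightarrow> real"
  assumes d0: "\<And>x. (F has_real_derivative F' x) (at x)" and d1: "\<And>x. (F' has_real_derivative F'' x) (at x)"
    and K: "\<And>x. \<bar>F'' x\<bar> \<le> K"
  shows "\<bar>F s - F t - (s - t) * F' t\<bar> \<le> K * (s - t)\<^sup>2"
proof -
  have lip: "\<bar>F' x - F' y\<bar> \<le> K * \<bar>x - y\<bar>" for x y
    using field_differentiable_bound[of UNIV F' F'' K x y] d1 K by simp
  let ?S = "{min s t..max s t}"
  have K0: "0 \<le> K" using K[of 0] by linarith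
  have "norm ((F s - s * F' t) - (F t - t * F' t)) \<le> (K * \<bar>s - t\<bar>) * norm (s - t)"
  proof (rule field_differentiable_bound[of ?S _ "\<lambda>x. F' x - F' t"])
    fix z assume z: "z \<in> ?S"
    show "((\<lambda>x. F x - x * F' t) has_real_derivative F' z - F' t) (at z within ?S)"
      by (auto intro!: derivative_eq_intros has_field_derivative_at_within[OF d0])
    have "\<bar>z - t\<bar> \<le> \<bar>s - t\<bar>" using z by (auto simp: min_def max_def split: if_splits)
    then have "K * \<bar>z - t\<bar> \<le> K * \<bar>s - t\<bar>" using K0 by (rule mult_left_mono)
    then show "norm (F' z - F' t) \<le> K * \<bar>s - t\<bar>" using lip[of z t] by simp
  qed auto
  then show ?thesis by (simp add: power2_eq_square algebra_simps)
qed

text \<open>\<open>sin (\<mu> s) / \<mu>\<close>, extended by its limit \<open>s\<close> at \<open>\<mu> = 0\<close>.\<close>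

definition sinc :: "real \<Rightarrow> real \<Rightarrow> real" where
  "sinc m s = (if m = 0 then s else sin (m * s) / m)"

lemma mult_sinc: "m * sinc m s = sin (m * s)"
  by (simp add: sinc_def)

lemma DERIV_sinc: "(sinc m has_real_derivative cos (m * s)) (at s)"
  unfolding sinc_def[abs_def] by (cases "m = 0") (auto intro!: derivative_eq_intros)

lemma sinc_0 [simp]: "sinc m 0 = 0"
  by (simp add: sinc_def)

lemma abs_sinc_le: "\<bar>sinc m s\<bar> \<le> \<bar>s\<bar>"
proof -
  have "\<bar>sinc m s - sinc m 0\<bar> \<le> 1 * \<bar>s - 0\<bar>"
    using field_differentiable_bound[of UNIV "sinc m" "\<lambda>s. cos (m * s)" 1 s 0] DERIV_sinc by simp
  then show ?thesis by simp
qed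

text \<open>The two scalar functions of which the propagator from time s to T is made. The constants
  m^2 and m stay bounded when \<mu> is inserted for m.\<close>

lemma prop_taylor:
  assumes "0 \<le> m"
  shows "\<bar>cos (m * (T - s)) - cos (m * (T - t)) - (s - t) * (m * sin (m * (T - t)))\<bar> \<le> m\<^sup>2 * (s - t)\<^sup>2"
    "\<bar>sinc m (T - s) - sinc m (T - t) - (s - t) * (- cos (m * (T - t)))\<bar> \<le> m * (s - t)\<^sup>2"
proof -
  show "\<bar>cos (m * (T - s)) - cos (m * (T - t)) - (s - t) * (m * sin (m * (T - t)))\<bar> \<le> m\<^sup>2 * (s - t)\<^sup>2"
    by (rule second_order_taylor[where F'' = "\<lambda>x. - (m * (m * cos (m * (T - x))))"])
       (auto intro!: derivative_eq_intros mult_left_mono simp: abs_mult power2_eq_square mult_left_le assms)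
  have "((\<lambda>x. sinc m (T - x)) has_real_derivative cos (m * (T - x)) * (- 1)) (at x)" for x
    by (rule DERIV_chain2[OF DERIV_sinc]) (auto intro!: derivative_eq_intros)
  then show "\<bar>sinc m (T - s) - sinc m (T - t) - (s - t) * (- cos (m * (T - t)))\<bar> \<le> m * (s - t)\<^sup>2"
    by (intro second_order_taylor[where F'' = "\<lambda>x. - (m * sin (m * (T - x)))"])
       (auto intro!: derivative_eq_intros simp: abs_mult mult_left_le assms)
qed

lemma periodic_bounded:
  fixes g :: "real \<Rightarrow> real"
  assumes "continuous_on UNIV g" "\<And>x. g (x + 1) = g x"
  shows "\<exists>K. \<forall>x. \<bar>g x\<bar> \<le> K"
proof -
  have "bounded (g ` {0..1})"
    by (intro compact_imp_bounded compact_continuous_image continuous_on_subset[OF assms(1)]) auto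
  then obtain K where "\<forall>y\<in>g ` {0..1}. norm y \<le> K" by (meson bounded_iff)
  then have K: "\<And>x. x \<in> {0..1} \<Longrightarrow> \<bar>g x\<bar> \<le> K" by simp
  have perN: "g (x + real n) = g x" for x n
  proof (induction n)
    case (Suc n)
    then show ?case using assms(2)[of "x + real n"] by (simp add: ac_simps)
  qed simp
  have "\<bar>g x\<bar> \<le> K" for x
  proof -
    have "g x = g (frac x)"
    proof (cases "0 \<le> \<lfloor>x\<rfloor>")
      case True
      then show ?thesis using perN[of "frac x" "nat \<lfloor>x\<rfloor>"] by (simp add: frac_def)
    next
      case False
      then show ?thesis using perN[of x "nat (- \<lfloor>x\<rfloor>)"] by (simp add: frac_def)
    qed
    moreover have "frac x \<in> {0..1}" using frac_ge_0[of x] frac_lt_1[of x] by auto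
    ultimately show ?thesis using K by simp
  qed
  then show ?thesis by blast
qed

lemma symbols_bounded: "\<exists>K>0. \<forall>x. \<bar>a_fun x\<bar> \<le> K \<and> \<bar>b_fun x\<bar> \<le> K \<and> \<bar>mu x\<bar> \<le> K"
proof -
  obtain K1 K2 K3 where "\<And>x. \<bar>a_fun x\<bar> \<le> K1" "\<And>x. \<bar>b_fun x\<bar> \<le> K2" "\<And>x. \<bar>mu x\<bar> \<le> K3"
    using periodic_bounded[OF continuous_of_real_symbols(4) symbols_periodic(1)]
      periodic_bounded[OF continuous_of_real_symbols(5) symbols_periodic(2)]
      periodic_bounded[OF continuous_of_real_symbols(3) symbols_periodic(3)] by metis
  then have "\<forall>x. \<bar>a_fun x\<bar> \<le> max 1 (max K1 (max K2 K3)) \<and> \<bar>b_fun x\<bar> \<le> max 1 (max K1 (max K2 K3)) \<and> \<bar>mu x\<bar> \<le> max 1 (max K1 (max K2 K3))"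
    by (simp add: le_max_iff_disj)
  then show ?thesis by (intro exI[of _ "max 1 (max K1 (max K2 K3))"]) auto
qed

lemma measurable_symbols:
  "a_fun \<in> borel_measurable unit_interval" "b_fun \<in> borel_measurable unit_interval" "mu \<in> borel_measurable unit_interval"
  by (rule continuous_measurable_unit, rule continuous_of_real_symbols)+

lemma measurable_sinc_mu: "(\<lambda>x. sinc (mu x) s) \<in> borel_measurable unit_interval"
  unfolding sinc_def using measurable_symbols(3) by measurable

lemma reflect_gen: "reflect (gen u) \<xi> = \<i> * (of_real (a_fun \<xi>) * reflect u \<xi> + of_real (b_fun \<xi>) * u \<xi>)"
proof -
  have "a_fun (1 - \<xi>) = a_fun \<xi>" "b_fun (1 - \<xi>) = b_fun \<xi>"
    using symbols_periodic(1,2)[of "- \<xi>"] symbols_even(1,2)[of \<xi>] by (simp_all add: add.commute)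
  then show ?thesis by (simp add: gen_def reflect_def)
qed

text \<open>Tested against its own conjugate phase, h contributes the integral of |h|.\<close>

lemma AE_zero_of_integrals:
  assumes h: "integrable unit_interval h"
    and z: "\<And>\<zeta>. \<zeta> \<in> borel_measurable unit_interval \<Longrightarrow> (\<And>x. cmod (\<zeta> x) \<le> 1) \<Longrightarrow> (\<integral>x. \<zeta> x * h x \<partial>unit_interval) = 0"
  shows "AE x in unit_interval. h x = 0"
proof -
  have hm: "h \<in> borel_measurable unit_interval" using h by simp
  have cm: "(\<lambda>x. cnj (h x)) \<in> borel_measurable unit_interval" by (rule measurable_compose[OF hm measurable_cnj])
  define \<zeta> where "\<zeta> x = (if h x = 0 then 0 else cnj (h x) / of_real (cmod (h x)))" for x
  have "\<zeta> \<in> borel_measurable unit_interval" unfolding \<zeta>_def[abs_def] using hm cm by measurable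
  moreover have "cmod (\<zeta> x) \<le> 1" for x by (simp add: \<zeta>_def norm_divide)
  ultimately have "(\<integral>x. \<zeta> x * h x \<partial>unit_interval) = 0" by (rule z)
  moreover have "\<zeta> x * h x = of_real (cmod (h x))" for x
    using complex_norm_square[of "h x"] by (auto simp: \<zeta>_def field_simps power2_eq_square)
  ultimately have "complex_of_real (\<integral>x. cmod (h x) \<partial>unit_interval) = 0"
    by (simp only: integral_complex_of_real)
  then have "(\<integral>x. cmod (h x) \<partial>unit_interval) = 0" by (simp only: of_real_eq_0_iff)
  then have "AE x in unit_interval. cmod (h x) = 0"
    using integral_nonneg_eq_0_iff_AE[OF integrable_norm[OF h]] by simp
  then show ?thesis by simp
qed

context lattice_flow
begin

lemma g_sq: "0 \<le> s \<Longrightarrow> sq_int unit_interval (reflect (f s))"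
  by (rule refl_sq_int(1)[OF f_circle(3)])

lemma gen_sq: "0 \<le> s \<Longrightarrow> sq_int unit_interval (gen (f s))"
  using gen_in_span(1)[OF f_circle(1)] by (simp add: circle.in_span_def)

lemma g_derivative:
  assumes t: "0 \<le> t"
  shows "((\<lambda>s. L2n unit_interval (\<lambda>\<xi>. (reflect (f s) \<xi> - reflect (f t) \<xi>) / of_real (s - t) - reflect (gen (f t)) \<xi>)) \<longlongrightarrow> 0) (at t within {0..})"
proof -
  have eq: "L2n unit_interval (\<lambda>\<xi>. (reflect (f s) \<xi> - reflect (f t) \<xi>) / of_real (s - t) - reflect (gen (f t)) \<xi>) =
     L2n unit_interval (\<lambda>\<xi>. (f s \<xi> - f t \<xi>) / of_real (s - t) - gen (f t) \<xi>)" if s: "0 \<le> s" for s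
  proof -
    have "(\<lambda>\<xi>. (f s \<xi> - f t \<xi>) / of_real (s - t) - gen (f t) \<xi>) = (\<lambda>\<xi>. of_real (1 / (s - t)) * (f s \<xi> - f t \<xi>) - gen (f t) \<xi>)"
      by (rule ext) simp
    then have sq: "sq_int unit_interval (\<lambda>\<xi>. (f s \<xi> - f t \<xi>) / of_real (s - t) - gen (f t) \<xi>)"
      by (simp only:) (intro sq_int_diff sq_int_cmult f_circle(3) gen_sq s t)
    have "(\<lambda>\<xi>. (reflect (f s) \<xi> - reflect (f t) \<xi>) / of_real (s - t) - reflect (gen (f t)) \<xi>) = reflect (\<lambda>\<xi>. (f s \<xi> - f t \<xi>) / of_real (s - t) - gen (f t) \<xi>)"
      by (rule ext) (simp add: reflect_def)
    then show ?thesis using refl_sq_int(2)[OF sq] by simp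
  qed
  show ?thesis
    by (rule Lim_transform_eventually[OF f_derivative[OF t]])
      (unfold eventually_at_filter, intro always_eventually, auto simp: eq simp del: of_real_diff)
qed

text \<open>Duality: \<open>\<phi>1 s\<close> and \<open>\<phi>2 s\<close> are \<zeta> times the
  first row of the propagator from time s to T, so \<open>G s\<close> pairs \<zeta> with the state
  reached at T when starting from f s and its reflection. It does not depend on s; comparing s = T
  with s = 0 gives the formula.\<close>

lemma pairing_constant:
  assumes T: "0 \<le> T" and \<zeta>: "\<zeta> \<in> borel_measurable unit_interval" "\<And>x. cmod (\<zeta> x) \<le> 1"
  shows "(\<integral>x. \<zeta> x * f T x \<partial>unit_interval) =
    (\<integral>x. \<zeta> x * (of_real (cos (mu x * T)) * f 0 x - \<i> * of_real (sinc (mu x) T) * (of_real (a_fun x) * f 0 x + of_real (b_fun x) * reflect (f 0) x)) \<partial>unit_interval)"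
proof -
  let ?M = unit_interval
  obtain K where K: "0 < K" "\<And>x. \<bar>a_fun x\<bar> \<le> K" "\<And>x. \<bar>b_fun x\<bar> \<le> K" "\<And>x. \<bar>mu x\<bar> \<le> K"
    using symbols_bounded by blast
  define \<phi>1 where "\<phi>1 s x = \<zeta> x * (of_real (cos (mu x * (T - s))) - \<i> * of_real (a_fun x * sinc (mu x) (T - s)))" for s x
  define \<phi>2 where "\<phi>2 s x = \<zeta> x * (- \<i> * of_real (b_fun x * sinc (mu x) (T - s)))" for s x
  \<comment> \<open>\<open>\<psi>1\<close> and \<open>\<psi>2\<close> are the derivatives of
    \<open>\<phi>1\<close> and \<open>\<phi>2\<close> in the starting time, which enters as T -
    s.\<close>
  define \<psi>1 where "\<psi>1 t x = \<zeta> x * (of_real (mu x * sin (mu x * (T - t))) - \<i> * of_real (a_fun x * (- cos (mu x * (T - t)))))" for t x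
  define \<psi>2 where "\<psi>2 t x = \<zeta> x * (- \<i> * of_real (b_fun x * (- cos (mu x * (T - t)))))" for t x
  \<comment> \<open>One constant for the sizes of all four functions on [0, T] and for the Taylor
    remainders. The part 1 + K + K^2 also covers K + K.\<close>
  define C where "C = 1 + K * T + K + K\<^sup>2 + K * K"
  note ms = measurable_symbols
  have smeas: "(\<lambda>x. sinc (mu x) s) \<in> borel_measurable ?M" for s by (rule measurable_sinc_mu)
  have meas: "\<phi>1 s \<in> borel_measurable ?M" "\<phi>2 s \<in> borel_measurable ?M" "\<psi>1 s \<in> borel_measurable ?M" "\<psi>2 s \<in> borel_measurable ?M" for s
    unfolding \<phi>1_def[abs_def] \<phi>2_def[abs_def] \<psi>1_def[abs_def] \<psi>2_def[abs_def] using \<zeta>(1) ms smeas[of "T - s"] by measurable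
  have zle: "cmod (\<zeta> x * y) \<le> B" if "cmod y \<le> B" for x y B
    unfolding norm_mult using mult_mono[OF \<zeta>(2) that, of x] by simp
  have ile: "cmod (\<i> * of_real r) \<le> B" if "\<bar>r\<bar> \<le> B" for r B using that by (simp add: norm_mult)
  have nile: "cmod (- \<i> * of_real r) \<le> B" if "\<bar>r\<bar> \<le> B" for r B using that by (simp add: norm_mult)
  have rle: "cmod (of_real r) \<le> B" if "\<bar>r\<bar> \<le> B" for r B using that by simp
  have sb: "\<bar>sinc (mu x) (T - s)\<bar> \<le> T" if "s \<in> {0..T}" for s x
    using abs_sinc_le[of "mu x" "T - s"] that by auto
  have KT: "0 \<le> K * T" "0 \<le> K\<^sup>2" "0 \<le> K * K" using K T by auto
  have b1: "cmod (\<phi>1 s x) \<le> C" "cmod (\<phi>2 s x) \<le> C" if s: "s \<in> {0..T}" for s x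
  proof -
    have as: "\<bar>a_fun x * sinc (mu x) (T - s)\<bar> \<le> K * T" and bs: "\<bar>b_fun x * sinc (mu x) (T - s)\<bar> \<le> K * T"
      by (rule abs_mult_le[OF K(2) sb[OF s]], rule abs_mult_le[OF K(3) sb[OF s]])
    then have "cmod (\<phi>1 s x) \<le> 1 + K * T" "cmod (\<phi>2 s x) \<le> K * T"
      unfolding \<phi>1_def \<phi>2_def
      by (intro zle order_trans[OF norm_triangle_ineq4] add_mono ile rle; simp del: of_real_mult)
         (rule zle[OF nile[OF bs]])
    then show "cmod (\<phi>1 s x) \<le> C" "cmod (\<phi>2 s x) \<le> C" using KT K(1) unfolding C_def by linarith+
  qed
  have b2: "cmod (\<psi>1 t x) \<le> C" "cmod (\<psi>2 t x) \<le> C" for t x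
  proof -
    have ms: "\<bar>mu x * sin (mu x * (T - t))\<bar> \<le> K * 1" and as: "\<bar>a_fun x * (- cos (mu x * (T - t)))\<bar> \<le> K * 1"
      and bs: "\<bar>b_fun x * (- cos (mu x * (T - t)))\<bar> \<le> K * 1"
      by (intro abs_mult_le K; simp)+
    have "cmod (\<psi>1 t x) \<le> K * 1 + K * 1" "cmod (\<psi>2 t x) \<le> K * 1"
      unfolding \<psi>1_def \<psi>2_def
      by (rule zle[OF order_trans[OF norm_triangle_ineq4 add_mono[OF rle[OF ms] ile[OF as]]]])
         (rule zle[OF nile[OF bs]])
    moreover have "K + K \<le> C"
    proof -
      have "0 \<le> (K - 1)\<^sup>2" by simp
      then have "K \<le> 1 + K\<^sup>2" using K(1) by (simp add: power2_eq_square algebra_simps)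
      then show ?thesis unfolding C_def using KT by linarith
    qed
    ultimately show "cmod (\<psi>1 t x) \<le> C" "cmod (\<psi>2 t x) \<le> C" using K(1) by linarith+
  qed
  have m0: "0 \<le> mu x" "mu x \<le> K" "(mu x)\<^sup>2 \<le> K\<^sup>2" for x
    using mu_nonneg[of x] K(4)[of x] by (auto intro!: power_mono)
  have tay: "cmod (\<phi>1 s x - \<phi>1 t x - of_real (s - t) * \<psi>1 t x) \<le> C * (s - t)\<^sup>2"
    "cmod (\<phi>2 s x - \<phi>2 t x - of_real (s - t) * \<psi>2 t x) \<le> C * (s - t)\<^sup>2" for s t x
  proof -
    define R1 where "R1 = cos (mu x * (T - s)) - cos (mu x * (T - t)) - (s - t) * (mu x * sin (mu x * (T - t)))"
    define R2 where "R2 = sinc (mu x) (T - s) - sinc (mu x) (T - t) - (s - t) * (- cos (mu x * (T - t)))"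
    have R: "\<bar>R1\<bar> \<le> K\<^sup>2 * (s - t)\<^sup>2" "\<bar>R2\<bar> \<le> K * (s - t)\<^sup>2"
      unfolding R1_def R2_def
      by (rule order_trans[OF prop_taylor(1)[OF mu_nonneg] mult_right_mono[OF m0(3)]], simp)
         (rule order_trans[OF prop_taylor(2)[OF mu_nonneg] mult_right_mono[OF m0(2)]], simp)
    have as: "\<bar>a_fun x * R2\<bar> \<le> K * (K * (s - t)\<^sup>2)" and bs: "\<bar>b_fun x * R2\<bar> \<le> K * (K * (s - t)\<^sup>2)"
      by (intro abs_mult_le K R)+
    have e1: "\<phi>1 s x - \<phi>1 t x - of_real (s - t) * \<psi>1 t x = \<zeta> x * (of_real R1 - \<i> * of_real (a_fun x * R2))"
      and e2: "\<phi>2 s x - \<phi>2 t x - of_real (s - t) * \<psi>2 t x = \<zeta> x * (- \<i> * of_real (b_fun x * R2))"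
      unfolding \<phi>1_def \<phi>2_def \<psi>1_def \<psi>2_def R1_def R2_def by (simp_all add: algebra_simps)
    have "cmod (\<phi>1 s x - \<phi>1 t x - of_real (s - t) * \<psi>1 t x) \<le> K\<^sup>2 * (s - t)\<^sup>2 + K * (K * (s - t)\<^sup>2)"
      "cmod (\<phi>2 s x - \<phi>2 t x - of_real (s - t) * \<psi>2 t x) \<le> K * (K * (s - t)\<^sup>2)"
      
      by (simp only: e1, rule zle[OF order_trans[OF norm_triangle_ineq4 add_mono[OF rle[OF R(1)] ile[OF as]]]])
         (simp only: e2, rule zle[OF nile[OF bs]])
    moreover have "K\<^sup>2 * (s - t)\<^sup>2 + K * (K * (s - t)\<^sup>2) \<le> C * (s - t)\<^sup>2" "K * (K * (s - t)\<^sup>2) \<le> C * (s - t)\<^sup>2"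
      unfolding mult.assoc[symmetric] distrib_right[symmetric] C_def using KT K(1) by (intro mult_right_mono; simp)+
    ultimately show "cmod (\<phi>1 s x - \<phi>1 t x - of_real (s - t) * \<psi>1 t x) \<le> C * (s - t)\<^sup>2"
      "cmod (\<phi>2 s x - \<phi>2 t x - of_real (s - t) * \<psi>2 t x) \<le> C * (s - t)\<^sup>2" by linarith+
  qed
  define G where "G s = (\<integral>x. \<phi>1 s x * f s x \<partial>?M) + (\<integral>x. \<phi>2 s x * reflect (f s) x \<partial>?M)" for s
  have i: "integrable ?M (\<lambda>x. m x * u x)" if "sq_int ?M u" "m \<in> borel_measurable ?M" "\<And>x. cmod (m x) \<le> B" for m u B
    by (rule unit_L1_le_L2(1)[OF sq_int_mult_bounded[OF that(1,2)]]) (use that(3) in auto)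
  have lim: "((\<lambda>s. (G s - G t) / of_real (s - t)) \<longlongrightarrow> 0) (at t within {0..T})" if t: "t \<in> {0..T}" for t
  proof -
    have t0: "0 \<le> t" using t by simp
    note sq = f_circle(3)[OF t0] g_sq[OF t0] gen_sq[OF t0] refl_sq_int(1)[OF gen_sq[OF t0]]
    note l1 = L2_product_rule[OF f_circle(3) sq(3) f_derivative[OF t0] meas(1,3) b1(1) b2(1) tay(1) t]
    note l2 = L2_product_rule[OF g_sq sq(4) g_derivative[OF t0] meas(2,4) b1(2) b2(2) tay(2) t]
    have "(\<integral>x. \<psi>1 t x * f t x + \<phi>1 t x * gen (f t) x \<partial>?M) + (\<integral>x. \<psi>2 t x * reflect (f t) x + \<phi>2 t x * reflect (gen (f t)) x \<partial>?M) =
      (\<integral>x. (\<psi>1 t x * f t x + \<phi>1 t x * gen (f t) x) + (\<psi>2 t x * reflect (f t) x + \<phi>2 t x * reflect (gen (f t)) x) \<partial>?M)"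
      by (rule Bochner_Integration.integral_add[symmetric];
          intro Bochner_Integration.integrable_add i[OF sq(1) meas(3) b2(1)] i[OF sq(3) meas(1) b1(1)[OF t]] i[OF sq(2) meas(4) b2(2)] i[OF sq(4) meas(2) b1(2)[OF t]])
    also have "\<dots> = (\<integral>x. 0 \<partial>?M)"
    proof (rule Bochner_Integration.integral_cong[OF refl])
      fix x
      define S where "S = sinc (mu x) (T - t)"
      define Co where "Co = cos (mu x * (T - t))"
      \<comment> \<open>In this form \<mu> enters only through its square a^2 - b^2, so the
        integrand cancels by pure algebra, also where \<mu> vanishes.\<close>
      have sn: "mu x * sin (mu x * (T - t)) = (a_fun x * a_fun x - b_fun x * b_fun x) * S"
      proof -
        have "mu x * sin (mu x * (T - t)) = (mu x)\<^sup>2 * S" unfolding S_def mult_sinc[symmetric] by (simp add: power2_eq_square)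
        then show ?thesis unfolding mu_square by (simp add: algebra_simps)
      qed
      show "(\<psi>1 t x * f t x + \<phi>1 t x * gen (f t) x) + (\<psi>2 t x * reflect (f t) x + \<phi>2 t x * reflect (gen (f t)) x) = 0"
        unfolding \<phi>1_def \<phi>2_def \<psi>1_def \<psi>2_def reflect_gen sn gen_def S_def[symmetric] Co_def[symmetric]
        by (simp add: algebra_simps)
    qed
    finally have z: "(\<integral>x. \<psi>1 t x * f t x + \<phi>1 t x * gen (f t) x \<partial>?M) + (\<integral>x. \<psi>2 t x * reflect (f t) x + \<phi>2 t x * reflect (gen (f t)) x \<partial>?M) = 0" by simp
    have "(\<lambda>s. (G s - G t) / of_real (s - t)) = (\<lambda>s. ((\<integral>x. \<phi>1 s x * f s x \<partial>?M) - (\<integral>x. \<phi>1 t x * f t x \<partial>?M)) / of_real (s - t)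
        + ((\<integral>x. \<phi>2 s x * reflect (f s) x \<partial>?M) - (\<integral>x. \<phi>2 t x * reflect (f t) x \<partial>?M)) / of_real (s - t))"
      unfolding G_def by (rule ext) (simp add: add_divide_distrib diff_divide_distrib del: of_real_diff)
    then show ?thesis using tendsto_add[OF l1 l2] unfolding z by simp
  qed
  have dRe: "((\<lambda>s. Re (G s)) has_real_derivative 0) (at t within {0..T})" and dIm: "((\<lambda>s. Im (G s)) has_real_derivative 0) (at t within {0..T})"
    if "t \<in> {0..T}" for t
    using tendsto_Re[OF lim[OF that]] tendsto_Im[OF lim[OF that]] unfolding has_field_derivative_iff
    by (simp_all add: Re_divide_of_real Im_divide_of_real del: of_real_diff)
  obtain r1 where r1: "\<And>s. s \<in> {0..T} \<Longrightarrow> Re (G s) = r1"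
    using has_field_derivative_zero_constant[of "{0..T}" "\<lambda>s. Re (G s)"] dRe by auto
  obtain r2 where r2: "\<And>s. s \<in> {0..T} \<Longrightarrow> Im (G s) = r2"
    using has_field_derivative_zero_constant[of "{0..T}" "\<lambda>s. Im (G s)"] dIm by auto
  have "G T = G 0" using r1[of 0] r1[of T] r2[of 0] r2[of T] T by (simp add: complex_eq_iff)
  moreover have "G T = (\<integral>x. \<zeta> x * f T x \<partial>?M)" unfolding G_def \<phi>1_def \<phi>2_def by simp
  moreover have "G 0 = (\<integral>x. \<phi>1 0 x * f 0 x + \<phi>2 0 x * reflect (f 0) x \<partial>?M)"
    unfolding G_def using T
    by (intro Bochner_Integration.integral_add[symmetric] i[OF f_circle(3) meas(1) b1(1)] i[OF g_sq meas(2) b1(2)]) auto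
  moreover have "\<phi>1 0 x * f 0 x + \<phi>2 0 x * reflect (f 0) x = \<zeta> x * (of_real (cos (mu x * T)) * f 0 x - \<i> * of_real (sinc (mu x) T) * (of_real (a_fun x) * f 0 x + of_real (b_fun x) * reflect (f 0) x))" for x
    unfolding \<phi>1_def \<phi>2_def by (simp add: algebra_simps)
  ultimately show ?thesis by simp
qed

lemma explicit_solution:
  assumes T: "0 \<le> T"
  shows "AE x in unit_interval. f T x = of_real (cos (mu x * T)) * f 0 x -
    \<i> * of_real (sinc (mu x) T) * (of_real (a_fun x) * f 0 x + of_real (b_fun x) * reflect (f 0) x)"
proof -
  let ?M = unit_interval
  define R where "R x = of_real (cos (mu x * T)) * f 0 x - \<i> * of_real (sinc (mu x) T) * (of_real (a_fun x) * f 0 x + of_real (b_fun x) * reflect (f 0) x)" for x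
  obtain K where K: "\<And>x. \<bar>a_fun x\<bar> \<le> K" "\<And>x. \<bar>b_fun x\<bar> \<le> K" using symbols_bounded by blast
  have sa: "sq_int ?M (\<lambda>x. of_real (a_fun x) * f 0 x)" "sq_int ?M (\<lambda>x. of_real (b_fun x) * reflect (f 0) x)"
    by (rule sq_int_mult_bounded[OF f_circle(3), of _ _ K], simp, use measurable_symbols K in \<open>auto\<close>)
       (rule sq_int_mult_bounded[OF g_sq, of _ _ K], simp, use measurable_symbols K in \<open>auto\<close>)
  have "sq_int ?M (\<lambda>x. of_real (sinc (mu x) T) * (of_real (a_fun x) * f 0 x + of_real (b_fun x) * reflect (f 0) x))"
    using measurable_sinc_mu[of T] abs_sinc_le[of _ T] by (intro sq_int_mult_bounded[OF sq_int_add[OF sa], of _ "\<bar>T\<bar>"]) auto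
  moreover have "sq_int ?M (\<lambda>x. of_real (cos (mu x * T)) * f 0 x)"
    using measurable_symbols(3) by (intro sq_int_mult_bounded[OF f_circle(3), of _ _ 1]) auto
  ultimately have R: "sq_int ?M R"
    unfolding R_def[abs_def] mult.assoc by (intro sq_int_diff sq_int_cmult)
  have fT: "sq_int ?M (f T)" by (rule f_circle(3)[OF T])
  have "AE x in ?M. f T x - R x = 0"
  proof (rule AE_zero_of_integrals)
    show "integrable ?M (\<lambda>x. f T x - R x)" by (rule unit_L1_le_L2(1)[OF sq_int_diff[OF fT R]])
    fix \<zeta> :: "real \<Rightarrow> complex" assume z: "\<zeta> \<in> borel_measurable ?M" "\<And>x. cmod (\<zeta> x) \<le> 1"
    have i: "integrable ?M (\<lambda>x. \<zeta> x * u x)" if "sq_int ?M u" for u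
      by (rule unit_L1_le_L2(1)[OF sq_int_mult_bounded[OF that z(1), of 1]]) (use z(2) in auto)
    have "(\<integral>x. \<zeta> x * (f T x - R x) \<partial>?M) = (\<integral>x. \<zeta> x * f T x \<partial>?M) - (\<integral>x. \<zeta> x * R x \<partial>?M)"
      unfolding right_diff_distrib by (rule Bochner_Integration.integral_diff[OF i[OF fT] i[OF R]])
    then show "(\<integral>x. \<zeta> x * (f T x - R x) \<partial>?M) = 0"
      using pairing_constant[OF T z] by (simp add: R_def)
  qed
  then show ?thesis unfolding R_def by eventually_elim simp
qed

end

section \<open>Smooth functions\<close>

lemma smooth_coinduct:
  assumes "P \<phi>" "\<And>\<phi>. P \<phi> \<Longrightarrow> (\<forall>x. \<phi> differentiable (at x)) \<and> P (deriv \<phi>)"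
  shows "smooth \<phi>"
proof -
  have "P ((deriv ^^ n) \<phi>)" for n by (induction n) (use assms in auto)
  then show ?thesis using assms(2) by (auto simp: smooth_def)
qed

lemma smooth_DERIV: "smooth \<phi> \<Longrightarrow> (\<phi> has_real_derivative deriv \<phi> x) (at x)"
proof -
  assume "smooth \<phi>"
  then have "(deriv ^^ 0) \<phi> differentiable (at x)" unfolding smooth_def by blast
  then show ?thesis by (auto simp: real_differentiable_def dest: DERIV_imp_deriv)
qed

lemma smooth_deriv: "smooth \<phi> \<Longrightarrow> smooth (deriv \<phi>)"
  unfolding smooth_def by (metis funpow_Suc_right o_apply)

lemma smooth_isCont: "smooth \<phi> \<Longrightarrow> isCont \<phi> x"
  by (rule DERIV_isCont[OF smooth_DERIV])

lemma smooth_continuous: "smooth \<phi> \<Longrightarrow> continuous_on S \<phi>"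
  by (intro continuous_at_imp_continuous_on ballI smooth_isCont)

lemma smoothI_DERIV:
  assumes "\<And>x. (\<phi> has_real_derivative \<phi>' x) (at x)" "smooth \<phi>'"
  shows "smooth \<phi>"
proof -
  have "deriv \<phi> = \<phi>'" using assms(1) by (intro ext DERIV_imp_deriv)
  then show ?thesis
    by (intro smooth_coinduct[where P = "\<lambda>\<psi>. \<psi> = \<phi> \<or> smooth \<psi>"])
       (use assms smooth_DERIV smooth_deriv in \<open>auto simp: real_differentiable_def\<close>)
qed

text \<open>A version of finite order that allows induction for products: the derivative of a
  product is a sum of products of functions of one order less.\<close>

primrec times_differentiable :: "nat \<Rightarrow> (real \<Rightarrow> real) \<Rightarrow> bool" where
  "times_differentiable 0 \<phi> \<longleftrightarrow> (\<forall>x. \<phi> differentiable (at x))"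
| "times_differentiable (Suc n) \<phi> \<longleftrightarrow> (\<forall>x. \<phi> differentiable (at x)) \<and> times_differentiable n (deriv \<phi>)"

lemma times_differentiable_Suc_D: "times_differentiable (Suc n) \<phi> \<Longrightarrow> times_differentiable n \<phi>"
  by (induction n arbitrary: \<phi>) auto

lemma times_differentiable_D: "times_differentiable n \<phi> \<Longrightarrow> (\<phi> has_real_derivative deriv \<phi> x) (at x)"
  by (cases n) (auto simp: real_differentiable_def dest: DERIV_imp_deriv)

lemma smooth_iff_times_differentiable: "smooth \<phi> \<longleftrightarrow> (\<forall>n. times_differentiable n \<phi>)"
proof
  assume "smooth \<phi>"
  moreover have "smooth \<phi> \<Longrightarrow> times_differentiable n \<phi>" for n
    by (induction n arbitrary: \<phi>) (auto simp: real_differentiable_def intro: smooth_deriv smooth_DERIV)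
  ultimately show "\<forall>n. times_differentiable n \<phi>" by blast
next
  assume "\<forall>n. times_differentiable n \<phi>"
  then show "smooth \<phi>"
    by (rule smooth_coinduct[where P = "\<lambda>\<psi>. \<forall>n. times_differentiable n \<psi>"])
       (metis times_differentiable.simps)
qed

lemma times_differentiable_add:
  "times_differentiable n \<phi> \<Longrightarrow> times_differentiable n \<psi> \<Longrightarrow> times_differentiable n (\<lambda>x. \<phi> x + \<psi> x)"
proof (induction n arbitrary: \<phi> \<psi>)
  case (Suc n)
  have "deriv (\<lambda>x. \<phi> x + \<psi> x) = (\<lambda>x. deriv \<phi> x + deriv \<psi> x)"
    by (intro ext DERIV_imp_deriv DERIV_add times_differentiable_D[OF Suc.prems(1)] times_differentiable_D[OF Suc.prems(2)])
  with Suc show ?case by (auto intro: differentiable_add)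
qed (auto intro: differentiable_add)

lemma times_differentiable_mult:
  "times_differentiable n \<phi> \<Longrightarrow> times_differentiable n \<psi> \<Longrightarrow> times_differentiable n (\<lambda>x. \<phi> x * \<psi> x)"
proof (induction n arbitrary: \<phi> \<psi>)
  case (Suc n)
  have "deriv (\<lambda>x. \<phi> x * \<psi> x) = (\<lambda>x. deriv \<phi> x * \<psi> x + deriv \<psi> x * \<phi> x)"
    by (intro ext DERIV_imp_deriv DERIV_mult times_differentiable_D[OF Suc.prems(1)] times_differentiable_D[OF Suc.prems(2)])
  moreover have "times_differentiable n (\<lambda>x. deriv \<phi> x * \<psi> x + deriv \<psi> x * \<phi> x)"
    using Suc.prems by (intro times_differentiable_add Suc.IH) (auto intro: times_differentiable_Suc_D)
  ultimately show ?case using Suc.prems by (auto intro: differentiable_mult)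
qed (auto intro: differentiable_mult)

lemma smooth_add: "smooth \<phi> \<Longrightarrow> smooth \<psi> \<Longrightarrow> smooth (\<lambda>x. \<phi> x + \<psi> x)"
  by (simp add: smooth_iff_times_differentiable times_differentiable_add)

lemma smooth_mult: "smooth \<phi> \<Longrightarrow> smooth \<psi> \<Longrightarrow> smooth (\<lambda>x. \<phi> x * \<psi> x)"
  by (simp add: smooth_iff_times_differentiable times_differentiable_mult)

lemma smooth_affine: "smooth (\<lambda>x. p * x + q)"
  using smooth_Re[OF real_analytic_add[OF real_analytic_mult[OF real_analytic_const[of "of_real p"] real_analytic_of_real] real_analytic_const[of "of_real q"]]]
  by simp

lemma smooth_compose_affine:
  assumes "smooth \<phi>"
  shows "smooth (\<lambda>x. \<phi> (p * x + q))"
\<comment> \<open>The scalar k belongs to the invariant because every derivative contributes a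
  factor p.\<close>
proof (rule smooth_coinduct[where P = "\<lambda>\<psi>. \<exists>k \<eta>. smooth \<eta> \<and> \<psi> = (\<lambda>x. k * \<eta> (p * x + q))"])
  show "\<exists>k \<eta>. smooth \<eta> \<and> (\<lambda>x. \<phi> (p * x + q)) = (\<lambda>x. k * \<eta> (p * x + q))"
    using assms by (intro exI[of _ 1] exI[of _ \<phi>]) simp
  fix \<psi> assume "\<exists>k \<eta>. smooth \<eta> \<and> \<psi> = (\<lambda>x. k * \<eta> (p * x + q))"
  then obtain k \<eta> where \<eta>: "smooth \<eta>" "\<psi> = (\<lambda>x. k * \<eta> (p * x + q))" by blast
  have d: "(\<psi> has_real_derivative (k * p) * deriv \<eta> (p * x + q)) (at x)" for x
  proof -
    have "((\<lambda>x. \<eta> (p * x + q)) has_real_derivative deriv \<eta> (p * x + q) * p) (at x)"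
      by (rule DERIV_chain2[OF smooth_DERIV[OF \<eta>(1)]]) (auto intro!: derivative_eq_intros)
    then show ?thesis unfolding \<eta>(2) using DERIV_cmult by (metis mult.commute mult.left_commute)
  qed
  then have "deriv \<psi> = (\<lambda>x. (k * p) * deriv \<eta> (p * x + q))" by (intro ext DERIV_imp_deriv)
  then show "(\<forall>x. \<psi> differentiable (at x)) \<and> (\<exists>k \<eta>. smooth \<eta> \<and> deriv \<psi> = (\<lambda>x. k * \<eta> (p * x + q)))"
    using d smooth_deriv[OF \<eta>(1)] by (auto simp: real_differentiable_def)
qed

lemma smooth_antiderivative:
  assumes "smooth \<phi>"
  obtains \<Phi> where "smooth \<Phi>" "\<And>x. (\<Phi> has_real_derivative \<phi> x) (at x)"
proof -
  have "\<exists>F. \<forall>x :: real. - \<infinity> < ereal x \<longrightarrow> ereal x < \<infinity> \<longrightarrow> (F has_vector_derivative \<phi> x) (at x)"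
    by (rule einterval_antiderivative) (auto intro: smooth_isCont[OF assms])
  then obtain \<Phi> where "\<And>x. (\<Phi> has_real_derivative \<phi> x) (at x)"
    by (auto simp: has_real_derivative_iff_has_vector_derivative)
  then show ?thesis using that smoothI_DERIV[OF _ assms] by blast
qed

text \<open>The classical family of functions flat at 0. It is closed under differentiation, the
  polynomial p becoming y^2 (p - p') in the variable y = 1 / x, so smoothness follows by
  coinduction.\<close>

definition flat_fun :: "real poly \<Rightarrow> real \<Rightarrow> real" where
  "flat_fun p x = (if 0 < x then poly p (1 / x) * exp (- (1 / x)) else 0)"

lemma poly_exp_tendsto_0: "((\<lambda>y::real. poly p y * exp (- y)) \<longlongrightarrow> 0) at_top"
proof -
  have eq: "(\<lambda>y::real. poly p y * exp (- y)) = (\<lambda>y. \<Sum>i\<le>degree p. coeff p i * (y ^ i / exp y))"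
    by (rule ext) (simp add: poly_altdef sum_distrib_right exp_minus field_simps sum_divide_distrib)
  have "((\<lambda>y. \<Sum>i\<le>degree p. coeff p i * (y ^ i / exp y)) \<longlongrightarrow> (\<Sum>i\<le>degree p. coeff p i * 0)) at_top"
    by (intro tendsto_sum tendsto_mult tendsto_const tendsto_power_div_exp_0)
  then show ?thesis unfolding eq by simp
qed

lemma DERIV_flat_fun:
  "(flat_fun p has_real_derivative flat_fun ([:0, 0, 1:] * (p - pderiv p)) x) (at x)"
proof -
  consider "0 < x" | "x < 0" | "x = 0" by linarith
  then show ?thesis
  proof cases
    case 1
    have "((\<lambda>x. poly p (1 / x) * exp (- (1 / x))) has_real_derivative flat_fun ([:0, 0, 1:] * (p - pderiv p)) x) (at x)"
      using 1 by (auto intro!: derivative_eq_intros DERIV_chain2[OF poly_DERIV] simp: flat_fun_def field_simps power2_eq_square)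
    then show ?thesis
      by (rule has_field_derivative_transform_within_open[of _ _ _ "{0<..}"]) (use 1 in \<open>auto simp: flat_fun_def\<close>)
  next
    case 2
    have "((\<lambda>x. 0) has_real_derivative flat_fun ([:0, 0, 1:] * (p - pderiv p)) x) (at x)"
      using 2 by (simp add: flat_fun_def)
    then show ?thesis
      by (rule has_field_derivative_transform_within_open[of _ _ _ "{..<0}"]) (use 2 in \<open>auto simp: flat_fun_def\<close>)
  next
    case 3
    have "((\<lambda>x. poly ([:0, 1:] * p) (inverse x) * exp (- inverse x)) \<longlongrightarrow> 0) (at_right 0)"
      by (rule filterlim_compose[OF poly_exp_tendsto_0 filterlim_inverse_at_top_right])
    then have r: "((\<lambda>x. flat_fun p x / x) \<longlongrightarrow> 0) (at_right 0)"
      by (rule Lim_transform_eventually)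
         (auto simp: eventually_at_filter flat_fun_def field_simps)
    have l: "((\<lambda>x. flat_fun p x / x) \<longlongrightarrow> 0) (at_left 0)"
      by (rule Lim_transform_eventually[OF tendsto_const])
         (auto simp: eventually_at_filter flat_fun_def)
    have "((\<lambda>x. flat_fun p x / x) \<longlongrightarrow> 0) (at 0)"
      using filterlim_split_at[OF l r] .
    then show ?thesis using 3 by (simp add: has_field_derivative_iff flat_fun_def)
  qed
qed

lemma smooth_flat_fun: "smooth (flat_fun p)"
proof (rule smooth_coinduct[where P = "\<lambda>\<phi>. \<exists>p. \<phi> = flat_fun p"])
  fix \<phi> assume "\<exists>p. \<phi> = flat_fun p"
  then obtain p where p: "\<phi> = flat_fun p" by blast
  have "deriv \<phi> = flat_fun ([:0, 0, 1:] * (p - pderiv p))" unfolding p by (intro ext DERIV_imp_deriv DERIV_flat_fun)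
  then show "(\<forall>x. \<phi> differentiable (at x)) \<and> (\<exists>p. deriv \<phi> = flat_fun p)"
    using DERIV_flat_fun[of p] unfolding p real_differentiable_def by blast
qed blast

text \<open>The normalized primitive of a bump made of two flat functions. The transition lies in
  [1, 2] rather than [0, 1], so that a rescaled step vanishes on a whole neighbourhood of the
  endpoint.\<close>

lemma smooth_step_exists:
  obtains s M where "smooth s" "\<And>x. x \<le> 1 \<Longrightarrow> s x = 0" "\<And>x. 2 \<le> x \<Longrightarrow> s x = 1"
    "\<And>x. 0 \<le> s x" "\<And>x. s x \<le> 1" "\<And>x. \<bar>deriv s x\<bar> \<le> M" "\<And>x. 2 \<le> x \<Longrightarrow> deriv s x = 0"
proof -
  define b where "b x = flat_fun 1 (1 * x + (- 1)) * flat_fun 1 ((- 1) * x + 2)" for x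
  have bs: "smooth b" unfolding b_def[abs_def] by (intro smooth_mult smooth_compose_affine smooth_flat_fun)
  have f01: "0 \<le> flat_fun 1 x" "flat_fun 1 x \<le> 1" for x by (auto simp: flat_fun_def)
  have b0: "0 \<le> b x" "b x \<le> 1" for x
    unfolding b_def using f01 mult_mono[OF f01(2) f01(2)] by (auto intro: mult_nonneg_nonneg)
  have bz: "b x = 0" if "x \<le> 1 \<or> 2 \<le> x" for x using that by (auto simp: b_def flat_fun_def)
  have bp: "0 < b x" if "1 < x" "x < 2" for x using that by (auto simp: b_def flat_fun_def)
  obtain B where B: "smooth B" "\<And>x. (B has_real_derivative b x) (at x)" by (rule smooth_antiderivative[OF bs]) blast
  have "B 1 < B 2"
    by (rule DERIV_pos_imp_increasing_open[of 1 2 B]) (use B(2) bp in \<open>auto intro!: smooth_continuous[OF B(1)]\<close>)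
  define s where "s x = (1 / (B 2 - B 1)) * B x + (- B 1 / (B 2 - B 1))" for x
  have mono: "B x \<le> B y" if "x \<le> y" for x y
    by (rule DERIV_nonneg_imp_nondecreasing[OF that]) (use B(2) b0 in blast)
  have const: "B x = B y" if "x \<le> y" "\<And>z. x < z \<Longrightarrow> z < y \<Longrightarrow> b z = 0" for x y
  proof (cases "x = y")
    case False
    then have "x < y" using that(1) by simp
    then obtain z where "x < z" "z < y" "B y - B x = (y - x) * b z"
      using MVT2[of x y B b] B(2) by auto
    then show ?thesis using that(2) by simp
  qed simp
  have lo: "B x = B 1" if "x \<le> 1" for x by (rule const[OF that]) (use bz in auto)
  have hi: "B x = B 2" if "2 \<le> x" for x by (rule const[OF that, symmetric]) (use bz in auto)
  have ds: "deriv s x = b x / (B 2 - B 1)" for x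
    unfolding s_def[abs_def] 
    by (rule DERIV_imp_deriv) (use \<open>B 1 < B 2\<close> in \<open>auto intro!: derivative_eq_intros B(2)\<close>)
  have s_eq: "s x = (B x - B 1) / (B 2 - B 1)" for x by (simp add: s_def diff_divide_distrib)
  show ?thesis
  proof (rule that[of s "1 / (B 2 - B 1)"])
    show "smooth s" unfolding s_def[abs_def]
      using smooth_add[OF smooth_mult[OF smooth_affine[of 0 "1 / (B 2 - B 1)"] B(1)] smooth_affine[of 0 "- B 1 / (B 2 - B 1)"]] by simp
    show "s x = 0" if "x \<le> 1" for x using lo[OF that] by (simp add: s_def)
    show "s x = 1" if "2 \<le> x" for x
      
      using \<open>B 1 < B 2\<close> unfolding s_eq hi[OF that] by simp
    have B12: "B 1 \<le> B x" "B x \<le> B 2" for x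
      using mono[of 1 x] lo[of x] mono[of x 2] hi[of x] by (cases "x \<le> 1"; force)+
    show "0 \<le> s x" "s x \<le> 1" for x unfolding s_eq using B12[of x] \<open>B 1 < B 2\<close> by auto
    show "\<bar>deriv s x\<bar> \<le> 1 / (B 2 - B 1)" for x
      unfolding ds using b0[of x] \<open>B 1 < B 2\<close> by (auto simp: abs_div_pos intro!: divide_right_mono)
    show "deriv s x = 0" if "2 \<le> x" for x using bz that by (simp add: ds)
  qed
qed

section \<open>Integration by parts against weak derivatives\<close>

lemma AE_unit_interior: "AE x in unit_interval. 0 < x \<and> x < 1"
proof -
  have "AE x in lebesgue. x \<notin> {0, 1::real}"
    by (intro AE_not_in) (simp add: null_sets_completionI finite_imp_null_set_lborel)
  then have "AE x in lebesgue. x \<in> {0..1} \<longrightarrow> 0 < x \<and> x < (1::real)" by eventually_elim auto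
  then show ?thesis by (subst AE_restrict_space_iff) auto
qed

text \<open>The function \<Phi> vanishes at the ends but is not supported inside (0, 1), so it is
  multiplied by cutoffs. Their derivatives are of size N on layers of width 2 / N, where |\<Phi>| is
  at most 2 L / N; the extra terms stay bounded and vanish pointwise in the limit.\<close>

lemma weak_ibp:
  fixes \<Phi> :: "real \<Rightarrow> real"
  assumes w: "weak_deriv u w" and u2: "sq_int unit_interval u" and w2: "sq_int unit_interval w"
    and \<Phi>: "smooth \<Phi>" "\<Phi> 0 = 0" "\<Phi> 1 = 0"
  shows "(\<integral>x. deriv \<Phi> x *\<^sub>R u x \<partial>unit_interval) = - (\<integral>x. \<Phi> x *\<^sub>R w x \<partial>unit_interval)"
proof -
  let ?M = unit_interval
  obtain s M where s: "smooth s" "\<And>x. x \<le> 1 \<Longrightarrow> s x = 0" "\<And>x. 2 \<le> x \<Longrightarrow> s x = 1"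
    "\<And>x. 0 \<le> s x" "\<And>x. s x \<le> 1" "\<And>x. \<bar>deriv s x\<bar> \<le> M" "\<And>x. 2 \<le> x \<Longrightarrow> deriv s x = 0"
    by (rule smooth_step_exists) blast
  have M0: "0 \<le> M" using s(6)[of 0] by linarith
  have "bounded (deriv \<Phi> ` {0..1})"
    by (intro compact_imp_bounded compact_continuous_image smooth_continuous[OF smooth_deriv[OF \<Phi>(1)]]) simp
  then obtain L where "\<forall>y\<in>deriv \<Phi> ` {0..1}. norm y \<le> L" by (meson bounded_iff)
  then have L: "\<bar>deriv \<Phi> x\<bar> \<le> L" if "x \<in> {0..1}" for x using that by simp
  have L0: "0 \<le> L" using L[of 0] by simp
  have lip: "\<bar>\<Phi> x - \<Phi> y\<bar> \<le> L * \<bar>x - y\<bar>" if "x \<in> {0..1}" "y \<in> {0..1}" for x y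
    using field_differentiable_bound[of "{0..1}" \<Phi> "deriv \<Phi>" L y x] that L
      has_field_derivative_at_within[OF smooth_DERIV[OF \<Phi>(1)]] by (auto simp: abs_minus_commute)
  have \<Phi>L: "\<bar>\<Phi> x\<bar> \<le> L * x" "\<bar>\<Phi> x\<bar> \<le> L * (1 - x)" if "x \<in> {0..1}" for x
    using lip[OF that, of 0] lip[OF that, of 1] \<Phi> that by auto
  define N where "N n = real n + 1" for n
  have N1: "1 \<le> N n" for n by (simp add: N_def)
  \<comment> \<open>Cutoffs at the two ends: \<open>l n\<close> is 0 for N n x <= 1 and 1 for N n x
    >= 2, and \<open>r n\<close> does the same in 1 - x. The summand 0 only fits the affine form of
    \<open>smooth_compose_affine\<close>.\<close>
  define l r where "l n x = s (N n * x + 0)" and "r n x = s (- N n * x + N n)" for n x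
  define dl dr where "dl n x = deriv s (N n * x + 0) * N n" and "dr n x = deriv s (- N n * x + N n) * - N n" for n x
  define \<phi> where "\<phi> n x = (l n x * r n x) * \<Phi> x" for n x
  have lr_smooth: "smooth (l n)" "smooth (r n)" for n
    unfolding l_def[abs_def] r_def[abs_def] by (rule smooth_compose_affine[OF s(1)])+
  have \<phi>_smooth: "smooth (\<phi> n)" for n
    unfolding \<phi>_def[abs_def] by (intro smooth_mult lr_smooth \<Phi>)
  have dlr: "(l n has_real_derivative dl n x) (at x)" "(r n has_real_derivative dr n x) (at x)" for n x
    unfolding l_def[abs_def] r_def[abs_def] dl_def dr_def
    by (rule DERIV_chain2[OF smooth_DERIV[OF s(1)]]; auto intro!: derivative_eq_intros)+
  have d\<phi>: "deriv (\<phi> n) x = (dl n x * r n x + dr n x * l n x) * \<Phi> x + deriv \<Phi> x * (l n x * r n x)" for n x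
    unfolding \<phi>_def[abs_def] by (intro DERIV_imp_deriv DERIV_mult dlr smooth_DERIV \<Phi>)
  have lr01: "0 \<le> l n x" "l n x \<le> 1" "0 \<le> r n x" "r n x \<le> 1" for n x
    unfolding l_def r_def by (rule s)+
  have test: "test_function (\<phi> n)" for n
    unfolding test_function_def
  proof (intro conjI \<phi>_smooth exI allI impI)
    show "0 < 1 / N n" "1 - 1 / N n < 1" using N1[of n] by auto
    fix x assume x: "x \<notin> {1 / N n..1 - 1 / N n}"
    have Np: "0 < N n" using N1[of n] by linarith
    have "N n * x \<le> 1 \<or> N n * (1 - x) \<le> 1" using x Np by (auto simp: field_simps)
    then have "l n x = 0 \<or> r n x = 0" unfolding l_def r_def using s(2) by (auto simp: algebra_simps)
    then show "\<phi> n x = 0" by (auto simp: \<phi>_def)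
  qed
  have lim: "(\<lambda>n. deriv (\<phi> n) x) \<longlonglongrightarrow> deriv \<Phi> x" "(\<lambda>n. \<phi> n x) \<longlonglongrightarrow> \<Phi> x" if x: "0 < x" "x < 1" for x
  proof -
    have "\<forall>\<^sub>F n in sequentially. 2 / x \<le> real n" "\<forall>\<^sub>F n in sequentially. 2 / (1 - x) \<le> real n"
      by real_asymp+
    then have ev: "\<forall>\<^sub>F n in sequentially. 2 \<le> N n * x \<and> 2 \<le> N n * (1 - x)"
    proof eventually_elim
      case (elim n)
      then show ?case using x by (simp add: N_def field_simps)
    qed
    have "\<forall>\<^sub>F n in sequentially. deriv \<Phi> x = deriv (\<phi> n) x \<and> \<Phi> x = \<phi> n x"
      using ev
    proof eventually_elim
      case (elim n)
      then have "2 \<le> N n * x + 0" "2 \<le> - N n * x + N n" by (simp_all add: algebra_simps)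
      then have "l n x = 1" "r n x = 1" "dl n x = 0" "dr n x = 0"
        unfolding l_def r_def dl_def dr_def using s(3,7) by auto
      then show ?case by (simp add: d\<phi> \<phi>_def)
    qed
    then have c1: "\<forall>\<^sub>F n in sequentially. deriv \<Phi> x = deriv (\<phi> n) x" and c2: "\<forall>\<^sub>F n in sequentially. \<Phi> x = \<phi> n x"
      by (auto elim: eventually_mono)
    show "(\<lambda>n. deriv (\<phi> n) x) \<longlonglongrightarrow> deriv \<Phi> x" "(\<lambda>n. \<phi> n x) \<longlonglongrightarrow> \<Phi> x"
      by (rule Lim_transform_eventually[OF tendsto_const c1], rule Lim_transform_eventually[OF tendsto_const c2])
  qed
  have dlb: "\<bar>dl n x * \<Phi> x\<bar> \<le> 2 * M * L" "\<bar>dr n x * \<Phi> x\<bar> \<le> 2 * M * L" if x: "x \<in> {0..1}" for n x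
  proof -
    have Np: "0 \<le> N n" using N1[of n] by linarith
    have key: "\<bar>deriv s (N n * y) * N n * \<Phi> x\<bar> \<le> 2 * M * L" if y: "0 \<le> y" "\<bar>\<Phi> x\<bar> \<le> L * y" for y
    proof (cases "2 \<le> N n * y")
      case True
      then show ?thesis using s(7) M0 L0 by simp
    next
      case False
      have "\<bar>deriv s (N n * y) * N n * \<Phi> x\<bar> = \<bar>deriv s (N n * y)\<bar> * (N n * \<bar>\<Phi> x\<bar>)" using Np by (simp add: abs_mult)
      also have "\<dots> \<le> M * (N n * (L * y))"
        by (intro mult_mono s(6) order_refl y(2) mult_nonneg_nonneg Np M0) auto
      also have "\<dots> = M * L * (N n * y)" by (simp add: mult_ac)
      also have "\<dots> \<le> M * L * 2" using False by (intro mult_left_mono mult_nonneg_nonneg M0 L0) auto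
      finally show ?thesis by (simp add: mult_ac)
    qed
    show "\<bar>dl n x * \<Phi> x\<bar> \<le> 2 * M * L" using key[of x] \<Phi>L(1)[OF x] x by (simp add: dl_def)
    have "- N n * x + N n = N n * (1 - x)" by (simp add: algebra_simps)
    then show "\<bar>dr n x * \<Phi> x\<bar> \<le> 2 * M * L" using key[of "1 - x"] \<Phi>L(2)[OF x] x by (simp add: dr_def abs_minus_cancel)
  qed
  define D where "D = 2 * M * L + 2 * M * L + L"
  have bd: "\<bar>deriv (\<phi> n) x\<bar> \<le> D" "\<bar>\<phi> n x\<bar> \<le> L" if x: "x \<in> {0..1}" for n x
  proof -
    have "\<bar>deriv (\<phi> n) x\<bar> \<le> \<bar>(dl n x * \<Phi> x) * r n x\<bar> + \<bar>(dr n x * \<Phi> x) * l n x\<bar> + \<bar>deriv \<Phi> x * (l n x * r n x)\<bar>"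
      unfolding d\<phi> by (simp add: algebra_simps)
    also have "\<dots> \<le> (2 * M * L) * 1 + (2 * M * L) * 1 + L * (1 * 1)"
      unfolding abs_mult[of _ "r n x"] abs_mult[of _ "l n x"] abs_mult[of _ "l n x * r n x"]
      using lr01 by (intro add_mono mult_mono dlb x L) (auto intro!: mult_mono mult_nonneg_nonneg M0 L0 simp: abs_mult mult_le_one)
    finally show "\<bar>deriv (\<phi> n) x\<bar> \<le> D" by (simp add: D_def)
    have "\<bar>\<phi> n x\<bar> \<le> (1 * 1) * (L * x)"
      unfolding \<phi>_def abs_mult using lr01 \<Phi>L(1)[OF x] by (intro mult_mono) (auto intro: mult_nonneg_nonneg)
    also have "\<dots> \<le> L" using x L0 by (simp add: mult_left_le)
    finally show "\<bar>\<phi> n x\<bar> \<le> L" by simp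
  qed
  have ui: "integrable ?M (\<lambda>x. cmod (u x))" "integrable ?M (\<lambda>x. cmod (w x))"
    using unit_L1_le_L2(1)[OF u2] unit_L1_le_L2(1)[OF w2] by auto
  have um: "u \<in> borel_measurable ?M" "w \<in> borel_measurable ?M" using w by (auto simp: weak_deriv_def)
  have sm: "\<eta> \<in> borel_measurable ?M" if "smooth \<eta>" for \<eta>
    by (rule measurable_lebesgue_on_borel[OF borel_measurable_continuous_onI[OF smooth_continuous[OF that]]])
  note ae = AE_unit_interior
  have ae01: "AE x in ?M. x \<in> {0..1}" using ae by eventually_elim auto
  have l1: "(\<lambda>n. \<integral>x. deriv (\<phi> n) x *\<^sub>R u x \<partial>?M) \<longlonglongrightarrow> (\<integral>x. deriv \<Phi> x *\<^sub>R u x \<partial>?M)"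
  proof (rule integral_dominated_convergence[where w = "\<lambda>x. D * cmod (u x)"])
    show "(\<lambda>x. deriv \<Phi> x *\<^sub>R u x) \<in> borel_measurable ?M" "(\<lambda>x. deriv (\<phi> n) x *\<^sub>R u x) \<in> borel_measurable ?M" for n
      using sm[OF smooth_deriv[OF \<Phi>(1)]] sm[OF smooth_deriv[OF \<phi>_smooth[of n]]] um by measurable
    show "integrable ?M (\<lambda>x. D * cmod (u x))" using ui by simp
    show "AE x in ?M. (\<lambda>n. deriv (\<phi> n) x *\<^sub>R u x) \<longlonglongrightarrow> deriv \<Phi> x *\<^sub>R u x"
      using ae by eventually_elim (intro tendsto_scaleR tendsto_const lim; simp)
    show "AE x in ?M. norm (deriv (\<phi> n) x *\<^sub>R u x) \<le> D * cmod (u x)" for n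
      using ae01 by eventually_elim (simp only: norm_scaleR, rule mult_right_mono[OF bd(1)], auto)
  qed
  have l2: "(\<lambda>n. \<integral>x. \<phi> n x *\<^sub>R w x \<partial>?M) \<longlonglongrightarrow> (\<integral>x. \<Phi> x *\<^sub>R w x \<partial>?M)"
  proof (rule integral_dominated_convergence[where w = "\<lambda>x. L * cmod (w x)"])
    show "(\<lambda>x. \<Phi> x *\<^sub>R w x) \<in> borel_measurable ?M" "(\<lambda>x. \<phi> n x *\<^sub>R w x) \<in> borel_measurable ?M" for n
      using sm[OF \<Phi>(1)] sm[OF \<phi>_smooth[of n]] um by measurable
    show "integrable ?M (\<lambda>x. L * cmod (w x))" using ui by simp
    show "AE x in ?M. (\<lambda>n. \<phi> n x *\<^sub>R w x) \<longlonglongrightarrow> \<Phi> x *\<^sub>R w x"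
      using ae by eventually_elim (intro tendsto_scaleR tendsto_const lim; simp)
    show "AE x in ?M. norm (\<phi> n x *\<^sub>R w x) \<le> L * cmod (w x)" for n
      using ae01 by eventually_elim (simp only: norm_scaleR, rule mult_right_mono[OF bd(2)], auto)
  qed
  have "(\<integral>x. deriv (\<phi> n) x *\<^sub>R u x \<partial>?M) = - (\<integral>x. \<phi> n x *\<^sub>R w x \<partial>?M)" for n
    using w test by (simp add: weak_deriv_def)
  then show ?thesis using l1 tendsto_minus[OF l2] by (simp add: LIMSEQ_unique)
qed

text \<open>The primitive of G need not vanish at 1, so its linear interpolant is subtracted: \<Phi>
  = P - P 0 - k x vanishes at both ends and has derivative G - k. The constant k is itself a value
  of the primitive, hence at most B, and its term is paid by the L1 norm of u.\<close>

lemma weak_deriv_integral_bound_real: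
  fixes G :: "real \<Rightarrow> real"
  assumes w: "weak_deriv u w" and u2: "sq_int unit_interval u" and w2: "sq_int unit_interval w"
    and G: "smooth G" "\<And>y. y \<in> {0..1} \<Longrightarrow> \<bar>integral {0..y} G\<bar> \<le> B"
  shows "cmod (\<integral>x. of_real (G x) * u x \<partial>unit_interval) \<le> 2 * B * (L2n unit_interval u + L2n unit_interval w)"
proof -
  let ?M = unit_interval
  have B0: "0 \<le> B" using G(2)[of 0] by simp
  obtain P where P: "smooth P" "\<And>x. (P has_real_derivative G x) (at x)" by (rule smooth_antiderivative[OF G(1)]) blast
  have PB: "\<bar>P y - P 0\<bar> \<le> B" if "y \<in> {0..1}" for y
  proof -
    have "(G has_integral P y - P 0) {0..y}"
      using that P(2) by (intro fundamental_theorem_of_calculus)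
        (auto simp: has_real_derivative_iff_has_vector_derivative[symmetric] intro: has_field_derivative_at_within)
    then show ?thesis using G(2)[OF that] by (simp add: integral_unique)
  qed
  define k where "k = P 1 - P 0"
  define \<Phi> where "\<Phi> x = P x + ((- k) * x + (- P 0))" for x
  have k: "\<bar>k\<bar> \<le> B" using PB[of 1] by (simp add: k_def)
  have \<Phi>: "smooth \<Phi>" unfolding \<Phi>_def[abs_def] by (intro smooth_add P(1) smooth_affine)
  have d\<Phi>: "deriv \<Phi> x = G x - k" for x
    unfolding \<Phi>_def[abs_def] by (rule DERIV_imp_deriv) (auto intro!: derivative_eq_intros P(2))
  have \<Phi>B: "\<bar>\<Phi> x\<bar> \<le> 2 * B" if "x \<in> {0..1}" for x
  proof -
    have "\<bar>k * x\<bar> \<le> B * 1" unfolding abs_mult using k that B0 by (intro mult_mono) auto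
    then show ?thesis using PB[OF that] by (simp add: \<Phi>_def)
  qed
  have sm: "\<eta> \<in> borel_measurable ?M" if "smooth \<eta>" for \<eta>
    by (rule measurable_lebesgue_on_borel[OF borel_measurable_continuous_onI[OF smooth_continuous[OF that]]])
  \<comment> \<open>Extension by 0 outside [0, 1], because \<open>unit_integral_bound\<close> asks
    for a bound at every real point.\<close>
  define \<Psi> where "\<Psi> x = (if x \<in> {0..1} then of_real (\<Phi> x) else (0::complex))" for x
  have \<Psi>: "\<Psi> \<in> borel_measurable ?M" "cmod (\<Psi> x) \<le> 2 * B" for x
  proof -
    have "(\<lambda>x. complex_of_real (\<Phi> x)) \<in> borel_measurable ?M" using sm[OF \<Phi>] by measurable
    then show "\<Psi> \<in> borel_measurable ?M"
      by (subst measurable_cong[where g = "\<lambda>x. complex_of_real (\<Phi> x)"]) (auto simp: \<Psi>_def)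
    show "cmod (\<Psi> x) \<le> 2 * B" using \<Phi>B[of x] B0 by (auto simp: \<Psi>_def)
  qed
  have ui: "integrable ?M u" by (rule unit_L1_le_L2(1)[OF u2])
  have "bounded ((\<lambda>x. complex_of_real (G x)) ` {0..1})"
    by (intro compact_imp_bounded compact_continuous_image continuous_intros smooth_continuous[OF G(1)]) simp
  then obtain L where "\<forall>y\<in>(\<lambda>x. complex_of_real (G x)) ` {0..1}. norm y \<le> L" by (meson bounded_iff)
  then have L: "cmod (complex_of_real (G x)) \<le> L" if "x \<in> {0..1}" for x using that by simp
  have Gm: "(\<lambda>x. complex_of_real (G x)) \<in> borel_measurable ?M" using sm[OF G(1)] by measurable
  have Gi: "integrable ?M (\<lambda>x. of_real (G x) * u x)"
    by (rule unit_L1_le_L2(1)[OF sq_int_mult_bounded[OF u2 Gm, of L]]) (use L in auto)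
  have "(\<integral>x. of_real (G x) * u x \<partial>?M) = (\<integral>x. of_real (deriv \<Phi> x) * u x + of_real k * u x \<partial>?M)"
    by (simp add: d\<Phi> algebra_simps)
  also have "\<dots> = (\<integral>x. of_real (deriv \<Phi> x) * u x \<partial>?M) + (\<integral>x. of_real k * u x \<partial>?M)"
  proof (rule Bochner_Integration.integral_add)
    have "(\<lambda>x. of_real (deriv \<Phi> x) * u x) = (\<lambda>x. of_real (G x) * u x - of_real k * u x)"
      by (simp add: d\<Phi> algebra_simps)
    then show "integrable ?M (\<lambda>x. of_real (deriv \<Phi> x) * u x)" using Gi ui by simp
  qed (use ui in simp)
  also have "(\<integral>x. of_real (deriv \<Phi> x) * u x \<partial>?M) = - (\<integral>x. of_real (\<Phi> x) * w x \<partial>?M)"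
    using weak_ibp[OF w u2 w2 \<Phi>] by (simp add: \<Phi>_def k_def scaleR_conv_of_real)
  also have "(\<integral>x. of_real (\<Phi> x) * w x \<partial>?M) = (\<integral>x. \<Psi> x * w x \<partial>?M)"
    by (rule Bochner_Integration.integral_cong) (auto simp: \<Psi>_def)
  also have "(\<integral>x. of_real k * u x \<partial>?M) = of_real k * (\<integral>x. u x \<partial>?M)" by simp
  finally have "cmod (\<integral>x. of_real (G x) * u x \<partial>?M) \<le> cmod (\<integral>x. \<Psi> x * w x \<partial>?M) + \<bar>k\<bar> * cmod (\<integral>x. u x \<partial>?M)"
    using norm_triangle_ineq[of "- (\<integral>x. \<Psi> x * w x \<partial>?M)" "of_real k * (\<integral>x. u x \<partial>?M)"] by (simp add: norm_mult)
  also have "\<dots> \<le> 2 * B * L2n ?M w + B * L2n ?M u"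
    using unit_integral_bound[OF w2 \<Psi>] order_trans[OF integral_norm_bound unit_L1_le_L2(2)[OF u2]]
    by (intro add_mono mult_mono k B0) auto
  also have "\<dots> \<le> 2 * B * (L2n ?M u + L2n ?M w)" using mult_nonneg_nonneg[OF B0 L2n_nonneg[of ?M u]] by (simp add: algebra_simps)
  finally show ?thesis .
qed

text \<open>Real and imaginary part of G are treated separately, which doubles the constant.\<close>

lemma weak_deriv_integral_bound:
  assumes w: "weak_deriv u w" and u2: "sq_int unit_interval u" and w2: "sq_int unit_interval w"
    and G: "real_analytic G" "\<And>y. y \<in> {0..1} \<Longrightarrow> cmod (integral {0..y} G) \<le> B"
  shows "cmod (\<integral>x. G x * u x \<partial>unit_interval) \<le> 4 * B * (L2n unit_interval u + L2n unit_interval w)"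
proof -
  let ?M = unit_interval
  have Gi: "G integrable_on {0..y}" for y
    by (rule integrable_continuous_interval[OF real_analytic_continuous[OF G(1)]])
  have R: "\<bar>integral {0..y} (\<lambda>x. Re (G x))\<bar> \<le> B" "\<bar>integral {0..y} (\<lambda>x. Im (G x))\<bar> \<le> B" if "y \<in> {0..1}" for y
    using G(2)[OF that] abs_Re_le_cmod[of "integral {0..y} G"] abs_Im_le_cmod[of "integral {0..y} G"]
      integral_linear[OF Gi bounded_linear_Re, of y] integral_linear[OF Gi bounded_linear_Im, of y]
    by (simp_all add: o_def)
  note b1 = weak_deriv_integral_bound_real[OF w u2 w2 smooth_Re[OF G(1)] R(1)]
  note b2 = weak_deriv_integral_bound_real[OF w u2 w2 smooth_Im[OF G(1)] R(2)]
  have int: "integrable ?M (\<lambda>x. of_real (H x) * u x)" if "continuous_on UNIV H" for H :: "real \<Rightarrow> real"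
  proof -
    have c: "continuous_on UNIV (\<lambda>x. complex_of_real (H x))" using that by (intro continuous_intros)
    then have "bounded ((\<lambda>x. complex_of_real (H x)) ` {0..1})" 
      by (intro compact_imp_bounded compact_continuous_image continuous_on_subset[OF c]) auto
    then obtain L where "\<forall>y\<in>(\<lambda>x. complex_of_real (H x)) ` {0..1}. norm y \<le> L" by (meson bounded_iff)
    then show ?thesis
      by (intro unit_L1_le_L2(1)[OF sq_int_mult_bounded[OF u2 continuous_measurable_unit[OF c], of L]]) auto
  qed
  have cG: "continuous_on UNIV (\<lambda>x. Re (G x))" "continuous_on UNIV (\<lambda>x. Im (G x))"
    by (intro continuous_intros real_analytic_continuous[OF G(1)])+
  have "G x * u x = of_real (Re (G x)) * u x + \<i> * (of_real (Im (G x)) * u x)" for x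
    by (subst complex_eq[of "G x"]) (simp add: algebra_simps)
  then have "(\<integral>x. G x * u x \<partial>?M) = (\<integral>x. of_real (Re (G x)) * u x \<partial>?M) + \<i> * (\<integral>x. of_real (Im (G x)) * u x \<partial>?M)"
    using int[OF cG(1)] int[OF cG(2)] by simp
  then show ?thesis
    using norm_triangle_ineq[of "\<integral>x. of_real (Re (G x)) * u x \<partial>?M" "\<i> * (\<integral>x. of_real (Im (G x)) * u x \<partial>?M)"] b1 b2
    by (simp add: norm_mult algebra_simps)
qed

section \<open>The two estimates\<close>

text \<open>At the two endpoints \<mu> vanishes and division by 0 returns 0; they form a null
  set.\<close>

definition weight_quot :: "(real \<Rightarrow> complex) \<Rightarrow> real \<Rightarrow> complex" where
  "weight_quot u \<xi> = (u \<xi> + reflect u \<xi>) / of_real (mu \<xi>)"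

definition mu_ratio :: "real \<Rightarrow> real" where
  "mu_ratio \<xi> = mu \<xi> / (a_fun \<xi> + b_fun \<xi>)"

text \<open>Serves to pass to the infimum in two H1 norms one after the other. Infinite
  \<open>c\<close> is treated apart, since subtracting infinity cannot be undone.\<close>

lemma le_INF_add_const_ennreal:
  fixes y c :: ennreal
  assumes "\<And>i. i \<in> I \<Longrightarrow> y \<le> f i + c"
  shows "y \<le> (INF i\<in>I. f i) + c"
proof (cases "c = top")
  case False
  then have "y - c \<le> (INF i\<in>I. f i)"
    using assms by (intro INF_greatest) (simp add: ennreal_minus_le_iff add.commute)
  then show ?thesis using False by (simp add: ennreal_minus_le_iff add.commute)
qed simp

lemma AE_reflect_zero:
  assumes h: "h \<in> borel_measurable unit_interval" and z: "AE x in unit_interval. h x = (0::complex)"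
  shows "AE x in unit_interval. h (1 - x) = 0"
proof -
  let ?F = "\<lambda>x. cmod (h x)"
  have Fm: "?F \<in> borel_measurable unit_interval" using h by measurable
  have z': "AE x in unit_interval. ?F x = 0" using z by eventually_elim simp
  have Fi: "integrable unit_interval ?F"
    by (rule integrable_cong_AE_imp[of _ "\<lambda>x. 0"]) (use z' in \<open>auto simp: Fm elim: eventually_mono\<close>)
  have "(\<integral>x. ?F x \<partial>unit_interval) = 0" by (rule integral_eq_zero_AE[OF z'])
  then have "(\<integral>x. ?F (1 - x) \<partial>unit_interval) = 0" by (simp only: unit_reflection(3)[OF Fm])
  then have "AE x in unit_interval. ?F (1 - x) = 0"
    using integral_nonneg_eq_0_iff_AE[OF unit_reflection(2)[OF Fm Fi]] by simp
  then show ?thesis by simp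
qed

lemma multipliers_bounded:
  "\<exists>K\<ge>0. \<forall>x. \<bar>mu_ratio x\<bar> \<le> K \<and> \<bar>b_fun x\<bar> \<le> K \<and> \<bar>1 / (a_fun x + b_fun x)\<bar> \<le> K"
proof -
  have c: "continuous_on UNIV (\<lambda>x. 1 / (a_fun x + b_fun x))" "continuous_on UNIV mu_ratio"
    unfolding mu_ratio_def[abs_def]
    using a_plus_b_pos by (auto intro!: continuous_intros continuous_of_real_symbols simp: less_imp_neq[symmetric])
  have p: "1 / (a_fun (x + 1) + b_fun (x + 1)) = 1 / (a_fun x + b_fun x)" "mu_ratio (x + 1) = mu_ratio x" for x
    by (simp_all add: symbols_periodic mu_ratio_def)
  obtain K1 where K1: "\<And>x. \<bar>1 / (a_fun x + b_fun x)\<bar> \<le> K1" using periodic_bounded[OF c(1) p(1)] by blast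
  obtain K2 where K2: "\<And>x. \<bar>mu_ratio x\<bar> \<le> K2" using periodic_bounded[OF c(2) p(2)] by blast
  obtain K3 where K3: "\<And>x. \<bar>b_fun x\<bar> \<le> K3" using symbols_bounded by blast
  have "0 \<le> max K1 (max K2 K3)" using K1[of 0] by linarith
  then show ?thesis using K1 K2 K3 by (intro exI[of _ "max K1 (max K2 K3)"]) (auto simp: le_max_iff_disj)
qed

lemma measurable_multipliers:
  "(\<lambda>x. complex_of_real (mu_ratio x)) \<in> borel_measurable unit_interval"
  "(\<lambda>x. complex_of_real (b_fun x)) \<in> borel_measurable unit_interval"
  "(\<lambda>x. complex_of_real (1 / (a_fun x + b_fun x))) \<in> borel_measurable unit_interval"
  "(\<lambda>x. complex_of_real (cos (mu x * T))) \<in> borel_measurable unit_interval"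
  "(\<lambda>x. complex_of_real (sin (mu x * T))) \<in> borel_measurable unit_interval"
  unfolding mu_ratio_def using measurable_symbols by measurable

lemma measurable_reflect: "u \<in> borel_measurable unit_interval \<Longrightarrow> reflect u \<in> borel_measurable unit_interval"
  unfolding reflect_def[abs_def] by (rule measurable_compose[OF unit_reflection(1) measurable_cnj])

lemma weight_quot_measurable:
  assumes "u \<in> borel_measurable unit_interval"
  shows "weight_quot u \<in> borel_measurable unit_interval"
  unfolding weight_quot_def[abs_def] using assms measurable_reflect[OF assms] measurable_symbols(3) by measurable

text \<open>The primitive of the oscillating factor is of size |\<tau>|^(-1/3), uniformly in \<nu>;
  integration by parts against the weak derivative of u turns this into a bound of the integral
  itself.\<close>

lemma oscillatory_multiplier_bound:
  assumes m: "real_analytic m"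
  shows "\<exists>C\<ge>0. \<forall>u w \<tau> \<nu>. weak_deriv u w \<and> sq_int unit_interval u \<and> sq_int unit_interval w \<and> \<tau> \<noteq> 0 \<longrightarrow>
    cmod (\<integral>x. m x * cis (\<tau> * mu x + \<nu> * x) * u x \<partial>unit_interval)
      \<le> C * \<bar>\<tau>\<bar> powr (-1/3) * (L2n unit_interval u + L2n unit_interval w)"
proof -
  obtain B where B: "0 \<le> B" "\<And>t \<nu> b. t \<noteq> 0 \<Longrightarrow> 0 \<le> b \<Longrightarrow> b \<le> 1 \<Longrightarrow>
      norm (integral {0..b} (\<lambda>x. cis (t * mu x + \<nu> * x))) \<le> B * \<bar>t\<bar> powr (-1/3)"
    using mu_oscillatory_decay by blast
  obtain m' where m': "\<And>x. (m has_vector_derivative m' x) (at x)" "real_analytic m'"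
    using real_analytic_vector_derivative[OF m] by blast
  obtain C where C: "0 \<le> C" "\<And>t \<nu> b. t \<noteq> 0 \<Longrightarrow> 0 \<le> b \<Longrightarrow> b \<le> 1 \<Longrightarrow>
      norm (integral {0..b} (\<lambda>x. m x * cis (t * mu x + \<nu> * x))) \<le> C * \<bar>t\<bar> powr (-1/3)"
    using oscillatory_decay_amplitude[OF B(2,1) continuous_of_real_symbols(3) m'(1) real_analytic_continuous[OF m'(2)]]
    by blast
  have ra: "real_analytic (\<lambda>x. m x * cis (t * mu x + \<nu> * x))" for t \<nu>
  proof -
    have "real_analytic (\<lambda>x. m x * exp (\<i> * (of_real t * of_real (mu x) + of_real \<nu> * of_real x)))"
      by (intro real_analytic_mult real_analytic_exp real_analytic_add real_analytic_const real_analytic_mu real_analytic_of_real m)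
    then show ?thesis by (simp add: cis_conv_exp)
  qed
  have "cmod (\<integral>x. m x * cis (\<tau> * mu x + \<nu> * x) * u x \<partial>unit_interval)
      \<le> 4 * (C * \<bar>\<tau>\<bar> powr (-1/3)) * (L2n unit_interval u + L2n unit_interval w)"
    if "weak_deriv u w" "sq_int unit_interval u" "sq_int unit_interval w" "\<tau> \<noteq> 0" for u w \<tau> \<nu>
    by (rule weak_deriv_integral_bound[OF that(1-3) ra]) (use C(2)[OF that(4)] in auto)
  then show ?thesis using C(1) by (intro exI[of _ "4 * C"]) (auto simp: mult.assoc)
qed

context lattice_flow
begin

abbreviation X where "X t \<equiv> weight_quot (f t)"

text \<open>For X = (f + g) / \<mu> one substitutes g = \<mu> X - f, so that a f + b g = (a - b) f +
  b \<mu> X. The factor sin (\<mu> T) / \<mu> then always meets \<mu> or a - b = \<mu>^2 / (a + b),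
  and all coefficients are bounded uniformly in T.\<close>

lemma explicit_solution_weighted:
  assumes T: "0 \<le> T"
  shows "AE x in unit_interval. f T x = of_real (cos (mu x * T)) * f 0 x
      + (- \<i> * of_real (sin (mu x * T))) * (of_real (mu_ratio x) * f 0 x + of_real (b_fun x) * X 0 x)"
    "AE x in unit_interval. X T x = of_real (cos (mu x * T)) * X 0 x
      + of_real (sin (mu x * T)) * (\<i> * (of_real (mu_ratio x) * X 0 x) + (- 2 * \<i>) * (of_real (1 / (a_fun x + b_fun x)) * f 0 x))"
proof -
  let ?M = unit_interval
  let ?R = "\<lambda>x. of_real (cos (mu x * T)) * f 0 x - \<i> * of_real (sinc (mu x) T) * (of_real (a_fun x) * f 0 x + of_real (b_fun x) * reflect (f 0) x)"
  have fm: "f t \<in> borel_measurable ?M" "reflect (f t) \<in> borel_measurable ?M" if "0 \<le> t" for t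
    using f_circle(3)[OF that] g_sq[OF that] by (auto simp: sq_int_def)
  have sol: "AE x in ?M. f T x = ?R x" by (rule explicit_solution[OF T])
  have "AE x in ?M. f T (1 - x) - ?R (1 - x) = 0"
  proof (rule AE_reflect_zero)
    show "(\<lambda>x. f T x - ?R x) \<in> borel_measurable ?M"
      using fm[OF T] fm[of 0] measurable_symbols measurable_sinc_mu[of T] by measurable
    show "AE x in ?M. f T x - ?R x = 0" using sol by eventually_elim simp
  qed
  then have sol': "AE x in ?M. reflect (f T) x = of_real (cos (mu x * T)) * reflect (f 0) x
      + \<i> * of_real (sinc (mu x) T) * (of_real (a_fun x) * reflect (f 0) x + of_real (b_fun x) * f 0 x)"
  proof eventually_elim
    case (elim x)
    have s: "a_fun (1 - x) = a_fun x" "b_fun (1 - x) = b_fun x" "mu (1 - x) = mu x"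
      using symbols_periodic[of "- x"] symbols_even[of x] by (simp_all add: add.commute)
    from elim have "f T (1 - x) = ?R (1 - x)" by simp
    then have "reflect (f T) x = cnj (?R (1 - x))" by (simp only: reflect_def)
    then show ?case unfolding s by (simp add: reflect_def)
  qed
  have alg: "of_real (sinc (mu x) T) * of_real (a_fun x - b_fun x) = complex_of_real (sin (mu x * T) * mu_ratio x)"
    and nz: "complex_of_real (mu x) \<noteq> 0" "complex_of_real (a_fun x + b_fun x) \<noteq> 0" if "0 < x \<and> x < 1" for x
  proof -
    have m: "0 < mu x" "0 < a_fun x + b_fun x" using mu_pos that a_plus_b_pos by auto
    then show "complex_of_real (mu x) \<noteq> 0" "complex_of_real (a_fun x + b_fun x) \<noteq> 0" by (simp_all del: of_real_add)
    have "mu x * mu x = (a_fun x - b_fun x) * (a_fun x + b_fun x)" using mu_square[of x] by (simp add: power2_eq_square)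
    then have "a_fun x - b_fun x = mu x * mu x / (a_fun x + b_fun x)" using m by (simp add: field_simps)
    then have "sinc (mu x) T * (a_fun x - b_fun x) = sin (mu x * T) * mu_ratio x"
      unfolding mult_sinc[symmetric] mu_ratio_def by simp
    then show "of_real (sinc (mu x) T) * of_real (a_fun x - b_fun x) = complex_of_real (sin (mu x * T) * mu_ratio x)"
      by (metis of_real_mult)
  qed
  have rearrange: "p * (m * y) - \<i> * (q * (m * r)) * (2 * u - m * y) = m * (p * y + q * (\<i> * (m * r * y) + (- 2 * \<i>) * (r * u)))"
    for p q m r y u :: complex by (simp add: algebra_simps)
  have X0: "reflect (f 0) x = of_real (mu x) * X 0 x - f 0 x" if "0 < x \<and> x < 1" for x
    using nz(1)[OF that] by (simp add: weight_quot_def)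
  show "AE x in ?M. f T x = of_real (cos (mu x * T)) * f 0 x
      + (- \<i> * of_real (sin (mu x * T))) * (of_real (mu_ratio x) * f 0 x + of_real (b_fun x) * X 0 x)"
    using sol AE_unit_interior
  proof eventually_elim
    case (elim x)
    have "of_real (sinc (mu x) T) * (of_real (a_fun x) * f 0 x + of_real (b_fun x) * reflect (f 0) x)
      = of_real (sinc (mu x) T) * of_real (a_fun x - b_fun x) * f 0 x + of_real (mu x * sinc (mu x) T) * (of_real (b_fun x) * X 0 x)"
      unfolding X0[OF elim(2)] by (simp add: algebra_simps)
    also have "\<dots> = of_real (sin (mu x * T)) * (of_real (mu_ratio x) * f 0 x + of_real (b_fun x) * X 0 x)"
      unfolding alg[OF elim(2)] mult_sinc by (simp add: algebra_simps)
    finally show ?case using elim(1) by (simp add: mult.assoc)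
  qed
  show "AE x in ?M. X T x = of_real (cos (mu x * T)) * X 0 x
      + of_real (sin (mu x * T)) * (\<i> * (of_real (mu_ratio x) * X 0 x) + (- 2 * \<i>) * (of_real (1 / (a_fun x + b_fun x)) * f 0 x))"
    using sol sol' AE_unit_interior
  proof eventually_elim
    case (elim x)
    have r: "of_real (mu_ratio x) = complex_of_real (mu x) * of_real (1 / (a_fun x + b_fun x))" by (simp add: mu_ratio_def)
    have "f T x + reflect (f T) x = of_real (cos (mu x * T)) * (f 0 x + reflect (f 0) x)
       - \<i> * (of_real (sinc (mu x) T) * of_real (a_fun x - b_fun x)) * (f 0 x - reflect (f 0) x)"
      unfolding elim(1,2) by (simp add: algebra_simps)
    moreover have sub: "f 0 x + reflect (f 0) x = of_real (mu x) * X 0 x" "f 0 x - reflect (f 0) x = 2 * f 0 x - of_real (mu x) * X 0 x"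
      unfolding X0[OF elim(3)] by simp_all
    moreover have "of_real (cos (mu x * T)) * (of_real (mu x) * X 0 x)
       - \<i> * (of_real (sinc (mu x) T) * of_real (a_fun x - b_fun x)) * (2 * f 0 x - of_real (mu x) * X 0 x)
       = of_real (mu x) * (of_real (cos (mu x * T)) * X 0 x
      + of_real (sin (mu x * T)) * (\<i> * (of_real (mu_ratio x) * X 0 x) + (- 2 * \<i>) * (of_real (1 / (a_fun x + b_fun x)) * f 0 x)))"
      unfolding alg[OF elim(3)] of_real_mult r by (rule rearrange)
    ultimately have "f T x + reflect (f T) x = of_real (mu x) * (of_real (cos (mu x * T)) * X 0 x
      + of_real (sin (mu x * T)) * (\<i> * (of_real (mu_ratio x) * X 0 x) + (- 2 * \<i>) * (of_real (1 / (a_fun x + b_fun x)) * f 0 x)))"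
      by (simp only:)
    then show ?case using nz(1)[OF elim(3)] unfolding weight_quot_def[of "f T"] by simp
  qed
qed

lemma stability:
  assumes K: "0 \<le> K" "\<And>x. \<bar>mu_ratio x\<bar> \<le> K" "\<And>x. \<bar>b_fun x\<bar> \<le> K" "\<And>x. \<bar>1 / (a_fun x + b_fun x)\<bar> \<le> K"
    and T: "0 \<le> T"
  shows "L2_norm unit_interval (X T) + L2_norm unit_interval (f T)
    \<le> ennreal (2 + 4 * K) * (L2_norm unit_interval (X 0) + L2_norm unit_interval (f 0))"
proof (cases "sq_int unit_interval (X 0)")
  \<comment> \<open>With X 0 outside L2 the right-hand side is infinite.\<close>
  case False
  have f0: "f 0 \<in> borel_measurable unit_interval" using f_circle(3)[of 0] by (simp add: sq_int_def)
  have "L2_norm unit_interval (X 0) = \<infinity>"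
    using L2_norm_finite_iff[OF weight_quot_measurable[OF f0]] False by (auto simp: not_less top_unique)
  then show ?thesis using K(1) by (simp add: ennreal_mult_top)
next
  case True
  let ?M = unit_interval and ?N = "L2n unit_interval"
  note X0 = True and f0 = f_circle(3)[of 0, simplified]
  note mm = measurable_multipliers
  have sq: "sq_int ?M (\<lambda>x. of_real (m x) * u x)" and le: "?N (\<lambda>x. of_real (m x) * u x) \<le> B * ?N u"
    if "sq_int ?M u" "(\<lambda>x. complex_of_real (m x)) \<in> borel_measurable ?M" "\<And>x. \<bar>m x\<bar> \<le> B" for m u B
  proof -
    have "0 \<le> B" using that(3)[of 0] by linarith
    then show "sq_int ?M (\<lambda>x. of_real (m x) * u x)" "?N (\<lambda>x. of_real (m x) * u x) \<le> B * ?N u"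
      using sq_int_mult_bounded[OF that(1,2), of B] L2n_mult_bounded[OF that(1,2), of B] that(3) by auto
  qed
  have tri: "?N (\<lambda>x. u x + v x) \<le> p + q" if "sq_int ?M u" "sq_int ?M v" "?N u \<le> p" "?N v \<le> q" for u v p q
    using L2n_triangle[OF that(1,2)] that(3,4) by linarith
  note f0r = sq[OF f0 mm(1) K(2)] le[OF f0 mm(1) K(2)]
  note X0b = sq[OF X0 mm(2) K(3)] le[OF X0 mm(2) K(3)]
  note X0r = sq[OF X0 mm(1) K(2)] le[OF X0 mm(1) K(2)]
  note f0a = sq[OF f0 mm(3) K(4)] le[OF f0 mm(3) K(4)]
  have c1: "\<bar>cos (mu x * T)\<bar> \<le> 1" "\<bar>sin (mu x * T)\<bar> \<le> 1" for x by auto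
  note f0c = sq[OF f0 mm(4) c1(1)] le[OF f0 mm(4) c1(1)]
  note X0c = sq[OF X0 mm(4) c1(1)] le[OF X0 mm(4) c1(1)]
  define F where "F x = of_real (cos (mu x * T)) * f 0 x
      + (- \<i>) * (of_real (sin (mu x * T)) * (of_real (mu_ratio x) * f 0 x + of_real (b_fun x) * X 0 x))" for x
  define Y where "Y x = of_real (cos (mu x * T)) * X 0 x
      + of_real (sin (mu x * T)) * (\<i> * (of_real (mu_ratio x) * X 0 x) + (- 2 * \<i>) * (of_real (1 / (a_fun x + b_fun x)) * f 0 x))" for x
  have i1: "sq_int ?M (\<lambda>x. of_real (mu_ratio x) * f 0 x + of_real (b_fun x) * X 0 x)"
    "?N (\<lambda>x. of_real (mu_ratio x) * f 0 x + of_real (b_fun x) * X 0 x) \<le> K * ?N (f 0) + K * ?N (X 0)"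
    by (rule sq_int_add[OF f0r(1) X0b(1)], rule tri[OF f0r(1) X0b(1) f0r(2) X0b(2)])
  have i2: "sq_int ?M (\<lambda>x. \<i> * (of_real (mu_ratio x) * X 0 x) + (- 2 * \<i>) * (of_real (1 / (a_fun x + b_fun x)) * f 0 x))"
    "?N (\<lambda>x. \<i> * (of_real (mu_ratio x) * X 0 x) + (- 2 * \<i>) * (of_real (1 / (a_fun x + b_fun x)) * f 0 x)) \<le> K * ?N (X 0) + 2 * (K * ?N (f 0))"
    using X0r(2) f0a(2)
    by (intro sq_int_add sq_int_cmult X0r f0a tri; simp only: L2n_cmult; simp add: norm_mult)+
  note j1 = sq[OF i1(1) mm(5) c1(2)] le[OF i1(1) mm(5) c1(2)] and j2 = sq[OF i2(1) mm(5) c1(2)] le[OF i2(1) mm(5) c1(2)]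
  have F: "sq_int ?M F" "?N F \<le> 1 * ?N (f 0) + 1 * (K * ?N (f 0) + K * ?N (X 0))"
    unfolding F_def[abs_def]
    by (rule sq_int_add[OF f0c(1) sq_int_cmult[OF j1(1)]], rule tri[OF f0c(1) sq_int_cmult[OF j1(1)] f0c(2)])
       (use j1(2) i1(2) in \<open>simp only: L2n_cmult, simp\<close>)
  have Y: "sq_int ?M Y" "?N Y \<le> 1 * ?N (X 0) + 1 * (K * ?N (X 0) + 2 * (K * ?N (f 0)))"
    unfolding Y_def[abs_def]
    by (rule sq_int_add[OF X0c(1) j2(1)], rule tri[OF X0c(1) j2(1) X0c(2)])
       (use j2(2) i2(2) in simp)
  have fT: "sq_int ?M (f T)" by (rule f_circle(3)[OF T])
  have XT: "X T \<in> borel_measurable ?M" by (rule weight_quot_measurable) (use fT in \<open>simp add: sq_int_def\<close>)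
  have eF: "L2_norm ?M (f T) = ennreal (?N F)"
  proof -
    have "AE x in ?M. f T x = F x" using explicit_solution_weighted(1)[OF T] by (simp add: F_def mult.assoc)
    then have "AE x in ?M. ennreal ((cmod (f T x))\<^sup>2) = ennreal ((cmod (F x))\<^sup>2)" by eventually_elim simp
    then have "L2_norm ?M (f T) = L2_norm ?M F" unfolding L2_norm_def by (simp only: cong: nn_integral_cong_AE)
    then show ?thesis by (simp add: L2_norm_eq[OF F(1)])
  qed
  have eY: "L2_norm ?M (X T) = ennreal (?N Y)"
  proof -
    have "AE x in ?M. X T x = Y x" using explicit_solution_weighted(2)[OF T] by (simp add: Y_def)
    then have "AE x in ?M. ennreal ((cmod (X T x))\<^sup>2) = ennreal ((cmod (Y x))\<^sup>2)" by eventually_elim simp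
    then have "L2_norm ?M (X T) = L2_norm ?M Y" unfolding L2_norm_def by (simp only: cong: nn_integral_cong_AE)
    then show ?thesis by (simp add: L2_norm_eq[OF Y(1)])
  qed
  have r: "(2 + 4 * K) * (?N (X 0) + ?N (f 0)) = 2 * ?N (X 0) + 2 * ?N (f 0) + 4 * (K * ?N (X 0)) + 4 * (K * ?N (f 0))"
    by (simp add: algebra_simps)
  have "?N F \<le> ?N (f 0) + (K * ?N (f 0) + K * ?N (X 0))" "?N Y \<le> ?N (X 0) + (K * ?N (X 0) + 2 * (K * ?N (f 0)))"
    using F(2) Y(2) by simp_all
  moreover have "0 \<le> K * ?N (f 0)" "0 \<le> K * ?N (X 0)" "0 \<le> ?N (f 0)" "0 \<le> ?N (X 0)" using K(1) by simp_all
  \<comment> \<open>The two bounds add up to the factors 1 + 3 K for f 0 and 1 + 2 K for X 0; 2 + 4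
    K dominates both.\<close>
  ultimately have "?N Y + ?N F \<le> (2 + 4 * K) * (?N (X 0) + ?N (f 0))" unfolding r by argo
  then show ?thesis
    unfolding eF eY L2_norm_eq[OF X0] L2_norm_eq[OF f0] using K(1)
    by (simp add: ennreal_plus[symmetric] ennreal_mult[symmetric] del: ennreal_plus)
qed

text \<open>Cosine and sine are split into cis (T \<mu>) and cis (- T \<mu>), and the Fourier factor
  becomes the linear phase with \<nu> = 2 pi n. Six oscillatory integrals result, four with data f 0
  and two with data X 0.\<close>

lemma coefficient_decay:
  assumes D: "0 \<le> D" and T: "0 < T"
    and osc: "\<And>m u w \<tau> \<nu>. m \<in> {\<lambda>x. 1, \<lambda>x. of_real (mu_ratio x), \<lambda>x. of_real (b_fun x)} \<Longrightarrow>
      weak_deriv u w \<Longrightarrow> sq_int unit_interval u \<Longrightarrow> sq_int unit_interval w \<Longrightarrow> \<tau> \<noteq> 0 \<Longrightarrow>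
      cmod (\<integral>x. m x * cis (\<tau> * mu x + \<nu> * x) * u x \<partial>unit_interval)
        \<le> D * \<bar>\<tau>\<bar> powr (-1/3) * (L2n unit_interval u + L2n unit_interval w)"
    and K: "\<And>x. \<bar>mu_ratio x\<bar> \<le> K" "\<And>x. \<bar>b_fun x\<bar> \<le> K"
    and w: "weak_deriv (f 0) w" "sq_int unit_interval w"
    and y: "weak_deriv (X 0) y" "sq_int unit_interval y" "sq_int unit_interval (X 0)"
  shows "cmod (c T n) \<le> 2 * D * T powr (-1/3) *
    ((L2n unit_interval (f 0) + L2n unit_interval w) + (L2n unit_interval (X 0) + L2n unit_interval y))"
proof -
  let ?M = unit_interval
  note f0 = f_circle(3)[of 0, simplified]
  define \<nu> where "\<nu> = 2 * pi * of_int n"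
  define J where "J m \<tau> u = (\<integral>x. m x * cis (\<tau> * mu x + \<nu> * x) * u x \<partial>?M)" for m \<tau> and u :: "real \<Rightarrow> complex"
  define r where "r x = complex_of_real (mu_ratio x)" for x
  define bb where "bb x = complex_of_real (b_fun x)" for x
  define N1 where "N1 = D * T powr (-1/3) * (L2n ?M (f 0) + L2n ?M w)"
  define N2 where "N2 = D * T powr (-1/3) * (L2n ?M (X 0) + L2n ?M y)"
  have cism: "(\<lambda>x. cis (\<tau> * mu x + \<nu> * x)) \<in> borel_measurable ?M" for \<tau>
  proof (rule continuous_measurable_unit)
    show "continuous_on UNIV (\<lambda>x. cis (\<tau> * mu x + \<nu> * x))"
      by (intro continuous_intros continuous_on_cis continuous_of_real_symbols)
  qed
  have int: "integrable ?M (\<lambda>x. m x * cis (\<tau> * mu x + \<nu> * x) * u x)"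
    if "sq_int ?M u" "m \<in> borel_measurable ?M" "\<And>x. cmod (m x) \<le> B" for m u \<tau> B
  proof (rule unit_L1_le_L2(1)[OF sq_int_mult_bounded[OF that(1), of _ B]])
    show "(\<lambda>x. m x * cis (\<tau> * mu x + \<nu> * x)) \<in> borel_measurable ?M" using cism[of \<tau>] that(2) by measurable
    show "AE x in ?M. cmod (m x * cis (\<tau> * mu x + \<nu> * x)) \<le> B" using that(3) by (simp add: norm_mult)
  qed
  have i1: "integrable ?M (\<lambda>x. 1 * cis (\<tau> * mu x + \<nu> * x) * f 0 x)"
    and i2: "integrable ?M (\<lambda>x. r x * cis (\<tau> * mu x + \<nu> * x) * f 0 x)"
    and i3: "integrable ?M (\<lambda>x. bb x * cis (\<tau> * mu x + \<nu> * x) * X 0 x)" for \<tau>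
    using int[OF f0, of "\<lambda>_. 1" 1 \<tau>] int[OF f0, of r K \<tau>] int[OF y(3), of bb K \<tau>] K measurable_multipliers(1,2)
    by (simp_all add: r_def[abs_def] bb_def[abs_def])
  have ptw: "(of_real (cos (mu x * T)) * f 0 x + (- \<i> * of_real (sin (mu x * T))) * (r x * f 0 x + bb x * X 0 x)) * cis (\<nu> * x)
     = (1 / 2) * ((1 * cis (T * mu x + \<nu> * x) * f 0 x + 1 * cis (- T * mu x + \<nu> * x) * f 0 x)
        - (r x * cis (T * mu x + \<nu> * x) * f 0 x - r x * cis (- T * mu x + \<nu> * x) * f 0 x)
        - (bb x * cis (T * mu x + \<nu> * x) * X 0 x - bb x * cis (- T * mu x + \<nu> * x) * X 0 x))" for x
  proof -
    define e where "e = cis (\<nu> * x)"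
    define p q where "p = cis (T * mu x)" and "q = cis (- T * mu x)"
    have pq: "cis (T * mu x + \<nu> * x) = p * e" "cis (- T * mu x + \<nu> * x) = q * e" by (simp_all add: e_def p_def q_def cis_mult)
    have cs: "complex_of_real (cos (mu x * T)) = (p + q) / 2" "- \<i> * complex_of_real (sin (mu x * T)) = (q - p) / 2"
      by (simp_all add: p_def q_def complex_eq_iff mult.commute)
    show ?thesis unfolding pq e_def[symmetric] cs by (simp add: field_simps)
  qed
  have "c T n = L2ip ?M (f T) (ee n)" using f_circle(2)[of T n] T by simp
  also have "\<dots> = (\<integral>x. f T x * cis (\<nu> * x) \<partial>?M)" by (simp add: L2ip_def ee_def cis_cnj \<nu>_def)
  also have "\<dots> = (\<integral>x. (of_real (cos (mu x * T)) * f 0 x + (- \<i> * of_real (sin (mu x * T))) * (r x * f 0 x + bb x * X 0 x)) * cis (\<nu> * x) \<partial>?M)"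
  proof (rule integral_cong_AE)
    have cn: "(\<lambda>x. cis (\<nu> * x)) \<in> borel_measurable ?M" using cism[of 0] by simp
    show "(\<lambda>x. f T x * cis (\<nu> * x)) \<in> borel_measurable ?M"
      using cn f_circle(3)[of T] T by (intro borel_measurable_times) (auto simp: sq_int_def)
    show "(\<lambda>x. (of_real (cos (mu x * T)) * f 0 x + (- \<i> * of_real (sin (mu x * T))) * (r x * f 0 x + bb x * X 0 x)) * cis (\<nu> * x)) \<in> borel_measurable ?M"
      using cn f0 y(3) measurable_multipliers unfolding r_def bb_def sq_int_def
      by (intro borel_measurable_times borel_measurable_add borel_measurable_const) auto
    show "AE x in ?M. f T x * cis (\<nu> * x) = (of_real (cos (mu x * T)) * f 0 x + (- \<i> * of_real (sin (mu x * T))) * (r x * f 0 x + bb x * X 0 x)) * cis (\<nu> * x)"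
      using explicit_solution_weighted(1)[of T] T unfolding r_def bb_def by (auto elim: eventually_mono)
  qed
  also have "\<dots> = (1 / 2) * ((J (\<lambda>_. 1) T (f 0) + J (\<lambda>_. 1) (- T) (f 0)) - (J r T (f 0) - J r (- T) (f 0)) - (J bb T (X 0) - J bb (- T) (X 0)))"
    unfolding ptw J_def integral_mult_right_zero
    by (simp only: Bochner_Integration.integral_add Bochner_Integration.integral_diff i1 i2 i3
        Bochner_Integration.integrable_add Bochner_Integration.integrable_diff)
  finally have cJ: "c T n = (1 / 2) * ((J (\<lambda>_. 1) T (f 0) + J (\<lambda>_. 1) (- T) (f 0)) - (J r T (f 0) - J r (- T) (f 0)) - (J bb T (X 0) - J bb (- T) (X 0)))" .
  have bnd: "cmod (J m \<tau> (f 0)) \<le> N1" "cmod (J m' \<tau> (X 0)) \<le> N2"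
    if "m \<in> {\<lambda>x. 1, \<lambda>x. of_real (mu_ratio x), \<lambda>x. of_real (b_fun x)}" "m' \<in> {\<lambda>x. 1, \<lambda>x. of_real (mu_ratio x), \<lambda>x. of_real (b_fun x)}" "\<tau> \<noteq> 0" "\<bar>\<tau>\<bar> = T" for m m' \<tau>
    unfolding J_def N1_def N2_def that(4)[symmetric]
    by (rule osc[OF that(1) w(1) f0 w(2) that(3)], rule osc[OF that(2) y(1,3,2) that(3)])
  have b: "cmod (J (\<lambda>_. 1) T (f 0)) \<le> N1" "cmod (J (\<lambda>_. 1) (- T) (f 0)) \<le> N1" "cmod (J r T (f 0)) \<le> N1" "cmod (J r (- T) (f 0)) \<le> N1"
    "cmod (J bb T (X 0)) \<le> N2" "cmod (J bb (- T) (X 0)) \<le> N2"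
    using T by (auto intro!: bnd simp: r_def[abs_def] bb_def[abs_def])
  have "cmod ((A + B) - (C - E) - (G - H)) \<le> cmod A + cmod B + cmod C + cmod E + cmod G + cmod H" for A B C E G H
    using norm_triangle_ineq4[of "(A + B) - (C - E)" "G - H"] norm_triangle_ineq4[of "A + B" "C - E"]
      norm_triangle_ineq[of A B] norm_triangle_ineq4[of C E] norm_triangle_ineq4[of G H] by linarith
  from this[of "J (\<lambda>_. 1) T (f 0)" "J (\<lambda>_. 1) (- T) (f 0)" "J r T (f 0)" "J r (- T) (f 0)" "J bb T (X 0)" "J bb (- T) (X 0)"]
  have "cmod (c T n) \<le> (1 / 2) * (4 * N1 + 2 * N2)" unfolding cJ norm_mult using b by simp
  also have "\<dots> \<le> 2 * (N1 + N2)" using D by (simp add: N2_def)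
  finally show ?thesis by (simp add: N1_def N2_def algebra_simps)
qed

text \<open>Each pair of weak derivatives gives a coefficient bound and, through
  \<open>synth_bound\<close>, a sup-norm bound; the infimum over the pairs produces the H1 norms. If
  some function of a pair is not in L2, the corresponding right-hand side is infinite.\<close>

lemma sup_norm_decay:
  assumes D: "0 \<le> D" and T: "0 < T"
    and osc: "\<And>m u w \<tau> \<nu>. m \<in> {\<lambda>x. 1, \<lambda>x. of_real (mu_ratio x), \<lambda>x. of_real (b_fun x)} \<Longrightarrow>
      weak_deriv u w \<Longrightarrow> sq_int unit_interval u \<Longrightarrow> sq_int unit_interval w \<Longrightarrow> \<tau> \<noteq> 0 \<Longrightarrow>
      cmod (\<integral>x. m x * cis (\<tau> * mu x + \<nu> * x) * u x \<partial>unit_interval)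
        \<le> D * \<bar>\<tau>\<bar> powr (-1/3) * (L2n unit_interval u + L2n unit_interval w)"
    and K: "\<And>x. \<bar>mu_ratio x\<bar> \<le> K" "\<And>x. \<bar>b_fun x\<bar> \<le> K"
    and C: "4 * D * nrm * Cg \<le> C" "0 < C"
  shows "Linf_norm lebesgue (v T) \<le> ennreal (C * (1 / T powr (1/3))) * (H1_norm (X 0) + H1_norm (f 0))"
proof -
  let ?M = unit_interval and ?C = "C * (1 / T powr (1/3))"
  define E where "E u w = ennsqrt ((L2_norm ?M u)\<^sup>2 + (L2_norm ?M w)\<^sup>2)" for u w
  have Cp: "0 < ?C" using C(2) T by simp
  have Einf: "E u w = \<infinity>" if "u \<in> borel_measurable ?M" "w \<in> borel_measurable ?M" "\<not> (sq_int ?M u \<and> sq_int ?M w)" for u w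
  proof -
    have "L2_norm ?M u = \<infinity> \<or> L2_norm ?M w = \<infinity>"
      using that L2_norm_finite_iff[of u ?M] L2_norm_finite_iff[of w ?M] by (auto simp: not_less top_unique)
    then show ?thesis unfolding E_def ennsqrt_def by (auto simp: power2_eq_square ennreal_top_mult)
  qed
  \<comment> \<open>p + q <= 2 sqrt (p^2 + q^2) compares the sum of two L2 norms used so far with
    the form of the H1 norm.\<close>
  have Efin: "ennreal (L2n ?M u + L2n ?M w) \<le> 2 * E u w" if "sq_int ?M u" "sq_int ?M w" for u w
  proof -
    have "L2n ?M u \<le> sqrt ((L2n ?M u)\<^sup>2 + (L2n ?M w)\<^sup>2)" "L2n ?M w \<le> sqrt ((L2n ?M u)\<^sup>2 + (L2n ?M w)\<^sup>2)"
      by (simp_all add: real_le_rsqrt)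
    then have "L2n ?M u + L2n ?M w \<le> 2 * sqrt ((L2n ?M u)\<^sup>2 + (L2n ?M w)\<^sup>2)" by linarith
    moreover have "E u w = ennreal (sqrt ((L2n ?M u)\<^sup>2 + (L2n ?M w)\<^sup>2))"
      unfolding E_def L2_norm_eq[OF that(1)] L2_norm_eq[OF that(2)]
      by (simp add: ennreal_power ennreal_plus[symmetric] ennsqrt_ennreal del: ennreal_plus)
    ultimately show ?thesis by (metis ennreal_leI ennreal_mult' ennreal_numeral zero_le_numeral)
  qed
  have bound: "Linf_norm lebesgue (v T) \<le> ennreal ?C * (E (X 0) y + E (f 0) w)"
    if wy: "weak_deriv (X 0) y" "weak_deriv (f 0) w" for y w
  proof (cases "sq_int ?M (X 0) \<and> sq_int ?M y \<and> sq_int ?M (f 0) \<and> sq_int ?M w")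
    case False
    then have "E (X 0) y = \<infinity> \<or> E (f 0) w = \<infinity>" using Einf[of "X 0" y] Einf[of "f 0" w] wy unfolding weak_deriv_def by blast
    then show ?thesis using Cp by (auto simp: ennreal_mult_top)
  next
    case True
    define N where "N = (L2n ?M (f 0) + L2n ?M w) + (L2n ?M (X 0) + L2n ?M y)"
    have N0: "0 \<le> N" by (simp add: N_def)
    have cb: "cmod (c T n) \<le> 2 * D * T powr (-1/3) * N" for n
      unfolding N_def by (rule coefficient_decay[OF D T osc K]) (use wy True in auto)
    have "Linf_norm lebesgue (v T) \<le> ennreal (2 * D * T powr (-1/3) * N * nrm * Cg)"
      unfolding Linf_norm_def
    proof (rule esssup_I)
      have "v T \<in> borel_measurable borel" using L2F_measurable[OF v_L2F[of T]] T by simp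
      then have "v T \<in> borel_measurable lebesgue" by (simp add: measurable_completion)
      then show "(\<lambda>x. ennreal (cmod (v T x))) \<in> borel_measurable lebesgue" by measurable
      show "AE x in lebesgue. ennreal (cmod (v T x)) \<le> ennreal (2 * D * T powr (-1/3) * N * nrm * Cg)"
        using v_synth(3)[OF less_imp_le[OF T]]
      proof eventually_elim
        case (elim x)
        show ?case unfolding elim by (rule ennreal_leI[OF synth_bound[OF cb]])
      qed
    qed
    also have "\<dots> \<le> ennreal (?C / 2 * N)"
    proof (rule ennreal_leI)
      have "2 * D * T powr (-1/3) * N * nrm * Cg = (4 * D * nrm * Cg) * (T powr (-1/3) / 2 * N)" by simp
      also have "\<dots> \<le> C * (T powr (-1/3) / 2 * N)" by (rule mult_right_mono[OF C(1)]) (simp add: N0)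
      also have "\<dots> = ?C / 2 * N" using powr_minus[of T "1/3"] by (simp add: field_simps)
      finally show "2 * D * T powr (-1/3) * N * nrm * Cg \<le> ?C / 2 * N" .
    qed
    also have "\<dots> = ennreal (?C / 2) * (ennreal (L2n ?M (X 0) + L2n ?M y) + ennreal (L2n ?M (f 0) + L2n ?M w))"
      using Cp N0 by (subst ennreal_mult) (auto simp: N_def ennreal_plus[symmetric] add_ac simp del: ennreal_plus)
    also have "\<dots> \<le> ennreal (?C / 2) * (2 * E (X 0) y + 2 * E (f 0) w)"
      using True by (intro mult_left_mono add_mono Efin) auto
    also have "\<dots> = ennreal ?C * (E (X 0) y + E (f 0) w)"
    proof -
      have "ennreal (?C / 2) * 2 = ennreal ?C"
        using Cp by (subst ennreal_numeral[symmetric], subst ennreal_mult'[symmetric]) auto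
      then show ?thesis by (simp only: distrib_left[symmetric] mult.assoc[symmetric])
    qed
    finally show ?thesis .
  qed
  \<comment> \<open>The finite positive factor moves to the left, so that each infimum stands next
    to a mere additive constant.\<close>
  let ?L = "ennreal (1 / ?C) * Linf_norm lebesgue (v T)"
  have "ennreal (1 / r) * ennreal r = 1" if "0 < r" for r using that by (simp add: ennreal_mult'[symmetric])
  note inv = this[OF Cp]
  have "?L \<le> E (X 0) y + E (f 0) w" if "weak_deriv (X 0) y" "weak_deriv (f 0) w" for y w
    using mult_left_mono[OF bound[OF that], of "ennreal (1 / ?C)"] by (simp only: mult.assoc[symmetric] inv mult_1_left) simp
  then have "?L \<le> H1_norm (f 0) + E (X 0) y" if "weak_deriv (X 0) y" for y
    unfolding H1_norm_def E_def[symmetric] using that by (intro le_INF_add_const_ennreal) (auto simp: add.commute)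
  then have "?L \<le> H1_norm (X 0) + H1_norm (f 0)"
    unfolding H1_norm_def[of "X 0"] E_def[symmetric] by (intro le_INF_add_const_ennreal) (auto simp: add.commute)
  then have "ennreal ?C * ?L \<le> ennreal ?C * (H1_norm (X 0) + H1_norm (f 0))" by (rule mult_left_mono) simp
  then show ?thesis using inv by (simp only: mult.assoc[symmetric] mult.commute[of "ennreal ?C" "ennreal (1 / ?C)"] mult_1_left)
qed

end

theorem theorem1p2:
  shows "smooth mu \<and> periodic1 mu \<and>
    (\<exists>\<kappa>. \<kappa> \<noteq> 0 \<and> mu \<sim>[at 0] (\<lambda>\<xi>. \<kappa> * \<xi>\<^sup>2)) \<and>
    (\<exists>C>0. \<forall>(v :: real \<Rightarrow> complex \<Rightarrow> complex) (c :: real \<Rightarrow> int \<Rightarrow> complex)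
             (f :: real \<Rightarrow> real \<Rightarrow> complex) (g :: real \<Rightarrow> real \<Rightarrow> complex).
       linearized_solution v \<and> lattice_expansion v c \<and> fourier_function c f \<and>
       (\<forall>t \<xi>. g t \<xi> = cnj (f t (- \<xi>))) \<longrightarrow>
       (\<forall>t\<ge>0.
          L2_norm unit_interval (\<lambda>\<xi>. (f t \<xi> + g t \<xi>) / complex_of_real (mu \<xi>))
            + L2_norm unit_interval (f t)
          \<le> ennreal C *
             (L2_norm unit_interval (\<lambda>\<xi>. (f 0 \<xi> + g 0 \<xi>) / complex_of_real (mu \<xi>))
              + L2_norm unit_interval (f 0))) \<and>
       (\<forall>t>0.
          Linf_norm lebesgue (v t)
          \<le> ennreal (C * (1 / t powr (1/3))) *
             (H1_norm (\<lambda>\<xi>. (f 0 \<xi> + g 0 \<xi>) / complex_of_real (mu \<xi>))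
              + H1_norm (f 0))))"
proof (intro conjI)
  show "smooth mu" by (rule mu_smooth)
  show "periodic1 mu" by (simp add: periodic1_def symbols_periodic)
  show "\<exists>\<kappa>. \<kappa> \<noteq> 0 \<and> mu \<sim>[at 0] (\<lambda>\<xi>. \<kappa> * \<xi>\<^sup>2)" by (rule mu_asymp)
  obtain K where K: "0 \<le> K" "\<And>x. \<bar>mu_ratio x\<bar> \<le> K" "\<And>x. \<bar>b_fun x\<bar> \<le> K" "\<And>x. \<bar>1 / (a_fun x + b_fun x)\<bar> \<le> K"
    using multipliers_bounded by blast
  let ?B = "\<lambda>m D. \<forall>u w \<tau> \<nu>. weak_deriv u w \<and> sq_int unit_interval u \<and> sq_int unit_interval w \<and> \<tau> \<noteq> 0 \<longrightarrow>
    cmod (\<integral>x. m x * cis (\<tau> * mu x + \<nu> * x) * u x \<partial>unit_interval)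
      \<le> D * \<bar>\<tau>\<bar> powr (-1/3) * (L2n unit_interval u + L2n unit_interval w)"
  obtain D1 where D1: "0 \<le> D1" "?B (\<lambda>x. 1) D1"
    using oscillatory_multiplier_bound[OF real_analytic_const[of 1]] by blast
  obtain D2 where D2: "0 \<le> D2" "?B (\<lambda>x. of_real (mu_ratio x)) D2"
    using oscillatory_multiplier_bound[OF real_analytic_mu_ratio, folded mu_ratio_def] by blast
  obtain D3 where D3: "0 \<le> D3" "?B (\<lambda>x. of_real (b_fun x)) D3"
    using oscillatory_multiplier_bound[OF real_analytic_b] by blast
  \<comment> \<open>One constant for the three amplitudes 1, \<open>mu_ratio\<close> and
    \<open>b_fun\<close>.\<close>
  define D where "D = max D1 (max D2 D3)"
  have D0: "0 \<le> D" using D1(1) by (simp add: D_def)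
  have Bm: "?B m D" if "?B m D'" "D' \<le> D" for m D'
  proof (intro allI impI)
    fix u w \<tau> \<nu> assume "weak_deriv u w \<and> sq_int unit_interval u \<and> sq_int unit_interval w \<and> \<tau> \<noteq> (0::real)"
    then have "cmod (\<integral>x. m x * cis (\<tau> * mu x + \<nu> * x) * u x \<partial>unit_interval)
      \<le> D' * \<bar>\<tau>\<bar> powr (-1/3) * (L2n unit_interval u + L2n unit_interval w)" using that(1) by blast
    also have "\<dots> \<le> D * \<bar>\<tau>\<bar> powr (-1/3) * (L2n unit_interval u + L2n unit_interval w)"
      using that(2) by (intro mult_right_mono) auto
    finally show "cmod (\<integral>x. m x * cis (\<tau> * mu x + \<nu> * x) * u x \<partial>unit_interval)
      \<le> D * \<bar>\<tau>\<bar> powr (-1/3) * (L2n unit_interval u + L2n unit_interval w)" .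
  qed
  have osc: "?B m D" if m: "m \<in> {\<lambda>x. 1, \<lambda>x. of_real (mu_ratio x), \<lambda>x. of_real (b_fun x)}" for m
  proof -
    consider "m = (\<lambda>x. 1)" | "m = (\<lambda>x. of_real (mu_ratio x))" | "m = (\<lambda>x. of_real (b_fun x))" using m by blast
    then show ?thesis
    proof cases
      case 1 then show ?thesis by (simp only:) (rule Bm[OF D1(2)], simp add: D_def)
    next
      case 2 then show ?thesis by (simp only:) (rule Bm[OF D2(2)], simp add: D_def)
    next
      case 3 then show ?thesis by (simp only:) (rule Bm[OF D3(2)], simp add: D_def)
    qed
  qed
  \<comment> \<open>Fixed before any solution is introduced, hence independent of the solution and
    of t.\<close>
  define C where "C = max (2 + 4 * K) (4 * D * nrm * Cg)"
  have C: "2 + 4 * K \<le> C" "4 * D * nrm * Cg \<le> C" unfolding C_def by auto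
  then have C0: "0 < C" using K(1) by linarith
  show "\<exists>C>0. \<forall>(v :: real \<Rightarrow> complex \<Rightarrow> complex) (c :: real \<Rightarrow> int \<Rightarrow> complex)
             (f :: real \<Rightarrow> real \<Rightarrow> complex) (g :: real \<Rightarrow> real \<Rightarrow> complex).
       linearized_solution v \<and> lattice_expansion v c \<and> fourier_function c f \<and>
       (\<forall>t \<xi>. g t \<xi> = cnj (f t (- \<xi>))) \<longrightarrow>
       (\<forall>t\<ge>0.
          L2_norm unit_interval (\<lambda>\<xi>. (f t \<xi> + g t \<xi>) / complex_of_real (mu \<xi>))
            + L2_norm unit_interval (f t)
          \<le> ennreal C *
             (L2_norm unit_interval (\<lambda>\<xi>. (f 0 \<xi> + g 0 \<xi>) / complex_of_real (mu \<xi>))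
              + L2_norm unit_interval (f 0))) \<and>
       (\<forall>t>0.
          Linf_norm lebesgue (v t)
          \<le> ennreal (C * (1 / t powr (1/3))) *
             (H1_norm (\<lambda>\<xi>. (f 0 \<xi> + g 0 \<xi>) / complex_of_real (mu \<xi>))
              + H1_norm (f 0)))"
  proof (intro exI[of _ C] conjI C0 allI impI; elim conjE)
    fix v c f and g :: "real \<Rightarrow> real \<Rightarrow> complex"
    assume "linearized_solution v" "lattice_expansion v c" "fourier_function c f" and g: "\<forall>t \<xi>. g t \<xi> = cnj (f t (- \<xi>))"
    then interpret lattice_flow v c f by unfold_locales
    \<comment> \<open>By periodicity f (- \<xi>) = f (1 - \<xi>), so g is the reflection of
      f.\<close>
    have X: "(\<lambda>\<xi>. (f t \<xi> + g t \<xi>) / complex_of_real (mu \<xi>)) = weight_quot (f t)" if "0 \<le> t" for t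
    proof
      fix \<xi>
      have "f t (- \<xi> + 1) = f t (- \<xi>)" using fou that unfolding fourier_function_def periodic1_def by blast
      then show "(f t \<xi> + g t \<xi>) / complex_of_real (mu \<xi>) = weight_quot (f t) \<xi>"
        by (simp add: weight_quot_def reflect_def g add.commute)
    qed
    {
      fix t :: real assume t: "0 \<le> t"
      show "L2_norm unit_interval (\<lambda>\<xi>. (f t \<xi> + g t \<xi>) / complex_of_real (mu \<xi>)) + L2_norm unit_interval (f t)
          \<le> ennreal C * (L2_norm unit_interval (\<lambda>\<xi>. (f 0 \<xi> + g 0 \<xi>) / complex_of_real (mu \<xi>)) + L2_norm unit_interval (f 0))"
        unfolding X[OF t] X[OF order_refl]
        by (rule order_trans[OF stability[OF K t] mult_right_mono[OF ennreal_leI[OF C(1)]]]) simp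
    }
    fix t :: real assume t: "0 < t"
    show "Linf_norm lebesgue (v t) \<le> ennreal (C * (1 / t powr (1/3))) *
        (H1_norm (\<lambda>\<xi>. (f 0 \<xi> + g 0 \<xi>) / complex_of_real (mu \<xi>)) + H1_norm (f 0))"
      unfolding X[OF order_refl]
      by (rule sup_norm_decay[OF D0 t _ K(2,3) C(2) C0]) (use osc in blast)
  qed
qed

end
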